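(* Let $1<B<2$, $0<\kappa<\min\left(\frac{B^2}{4},\frac12\right)$, $B_c:=\sqrt2$ and $\nu:=\frac{\log2}{\log(2/B)}$. Let $h_c^{\mathrm a}=h_c^{\mathrm a}(\beta)$ be the annealed critical point. (1) If $B>B_c$, there exists $\beta_0>0$ such that for $0<\beta\le\beta_0$ and for every $\eta\in(0,1)$ one can find $\varepsilon>0$ such that for all $u\in(0,\varepsilon)$ $$\mathtt F(\beta,h_c^{\mathrm a}+u)\ge(1-\eta)\,\mathtt F^{\mathrm a}(\beta,h_c^{\mathrm a}+u).$$ (2) If $B<B_c$, then for every $\eta\in(0,1)$ one can find constants $c,\beta_0,\varepsilon>0$ such that if $0<\beta\le\beta_0$, for all $u\in(c\,\beta^{\frac{2}{2-\nu}},\varepsilon)$ $$\mathtt F(\beta,h_c^{\mathrm a}+u)\ge(1-\eta)\,\mathtt F^{\mathrm a}(\beta,h_c^{\mathrm a}+u).$$ (3) If $B=B_c$, then for every $\eta\in(0,1)$ one can find $\beta_0>0$ and a constant $c>0$ such that if $0<\beta\le\beta_0$, for all $u\in\left(c\exp(-c\,\beta^{-2/3}),1\right)$ $$\mathtt F(\beta,h_c^{\mathrm a}+u)\ge(1-\eta)\,\mathtt F^{\mathrm a}(\beta,h_c^{\mathrm a}+u).$$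
   Context: For $i,j\in\mathbb N=\{1,2,\dots\}$, the hierarchical distance $d(i,j)$ is the smallest $p\ge0$ such that $i$ and $j$ lie in a common block $\{(k-1)2^p+1,\dots,k2^p\}$, $k\in\mathbb N$. Let $\omega=(\omega_i)_{i\in\mathbb N}$ be a centered Gaussian family, with law $\mathbb P$ and expectation $\mathbb E$, with $\mathbb E[\omega_i\omega_j]=\kappa^{d(i,j)}$ (so variance $1$). For $\beta\ge0$ and $h\in\mathbb R$, set $Z_0^{(i)}=e^{\beta\omega_i+h}$ for $i\in\mathbb N$ and, for $n\ge0$, $$Z_{n+1}^{(i)}=\frac{Z_n^{(2i-1)}Z_n^{(2i)}+B-1}{B}.$$ Write $Z^\omega_{n,h}:=Z_n^{(1)}$. The quenched free energy is $\mathtt F(\beta,h)=\lim_{n\to\infty}2^{-n}\log Z^\omega_{n,h}$ (the limit exists $\mathbb P$-a.s. and in $L^1$, is a.s. constant and non-negative). The annealed free energy is $\mathtt F^{\mathrm a}(\beta,h)=\lim_{n\to\infty}2^{-n}\log\mathbb E[Z^\omega_{n,h}]$ (the limit exists, is finite and non-negative). The annealed critical point is $h_c^{\mathrm a}(\beta)=\sup\{h:\mathtt F^{\mathrm a}(\beta,h)=0\}$, which is finite. *)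

theory Defs
  imports "HOL-Probability.Probability"
begin

text \<open>The index set of the paper, the positive integers, is rendered as \<open>{1..} :: nat set\<close>;
  the values of an environment at index \<open>0\<close> are never used.\<close>

definition hier_dist :: "nat \<Rightarrow> nat \<Rightarrow> nat" where
  "hier_dist i j =
     (LEAST p. \<exists>k\<ge>1. i \<in> {(k - 1) * 2 ^ p + 1 .. k * 2 ^ p} \<and> j \<in> {(k - 1) * 2 ^ p + 1 .. k * 2 ^ p})"

text \<open>A family is centered Gaussian if each finite linear combination has a law \<open>N(0, \<sigma>\<^sup>2)\<close>, written
  as the law of \<open>\<sigma>\<close> times a standard normal variable so that the degenerate case \<open>\<sigma> = 0\<close> is
  covered as well.\<close>

definition centered_gaussian_family :: "'a measure \<Rightarrow> 'i set \<Rightarrow> ('i \<Rightarrow> 'a \<Rightarrow> real) \<Rightarrow> bool" where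
  "centered_gaussian_family M I X \<longleftrightarrow>
     (\<forall>i\<in>I. X i \<in> borel_measurable M) \<and>
     (\<forall>J a. finite J \<and> J \<subseteq> I \<longrightarrow>
        (\<exists>\<sigma>\<ge>0. distr M borel (\<lambda>x. \<Sum>i\<in>J. a i * X i x) =
                 distr std_normal_distribution borel (\<lambda>y. \<sigma> * y)))"

text \<open>\<open>Z B \<beta> h w n i\<close> is the partition function of the \<open>i\<close>-th block of generation \<open>n\<close> for the
  fixed realisation \<open>w\<close> of the environment.\<close>

primrec Z :: "real \<Rightarrow> real \<Rightarrow> real \<Rightarrow> (nat \<Rightarrow> real) \<Rightarrow> nat \<Rightarrow> nat \<Rightarrow> real" where
  "Z B \<beta> h w 0 i = exp (\<beta> * w i + h)"
| "Z B \<beta> h w (Suc n) i = (Z B \<beta> h w n (2 * i - 1) * Z B \<beta> h w n (2 * i) + B - 1) / B"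

text \<open>The quenched free energy is the constant to which the normalised logarithm of the partition
  function converges almost surely.\<close>

definition quenched_free_energy ::
    "'a measure \<Rightarrow> (nat \<Rightarrow> 'a \<Rightarrow> real) \<Rightarrow> real \<Rightarrow> real \<Rightarrow> real \<Rightarrow> real" where
  "quenched_free_energy M \<omega> B \<beta> h =
     (THE F. AE x in M. (\<lambda>n. ln (Z B \<beta> h (\<lambda>i. \<omega> i x) n 1) / 2 ^ n) \<longlonglongrightarrow> F)"

definition annealed_free_energy ::
    "'a measure \<Rightarrow> (nat \<Rightarrow> 'a \<Rightarrow> real) \<Rightarrow> real \<Rightarrow> real \<Rightarrow> real \<Rightarrow> real" where
  "annealed_free_energy M \<omega> B \<beta> h =
     lim (\<lambda>n. ln (\<integral>x. Z B \<beta> h (\<lambda>i. \<omega> i x) n 1 \<partial>M) / 2 ^ n)"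

definition annealed_critical_point ::
    "'a measure \<Rightarrow> (nat \<Rightarrow> 'a \<Rightarrow> real) \<Rightarrow> real \<Rightarrow> real \<Rightarrow> real" where
  "annealed_critical_point M \<omega> B \<beta> = Sup {h. annealed_free_energy M \<omega> B \<beta> h = 0}"

definition B_crit :: real where
  "B_crit = sqrt 2"

definition \<nu> :: "real \<Rightarrow> real" where
  "\<nu> B = ln 2 / ln (2 / B)"

end

theory Submission
  imports Defs
begin

text \<open>The Gaussian field on a block of generation \<open>n + 1\<close> is, apart from a variable common to the whole
  block, a variable of variance of order \<open>\<kappa>\<^sup>n\<close> glued with two independent copies of the field of
  generation \<open>n\<close>. Hence the moments of the partition function obey one-step recursions in which every
  step is followed by a convolution in \<open>h\<close> with a narrow Gaussian. Since \<open>\<kappa> < 1 / 2\<close> and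
  \<open>\<kappa> < B\<^sup>2 / 4\<close>, these convolutions are negligible against the growth of the first two derivatives of
  the logarithm of the homogeneous recursion, and the annealed recursion follows the homogeneous one
  as long as \<open>u = h - h\<^sub>c\<close> is of order \<open>(B / 2)\<^sup>n\<close>. At the scale \<open>n\<close> at which \<open>(2 / B)\<^sup>n u\<close> is a large
  constant, the annealed free energy is \<open>1 / 2\<^sup>n\<close> times the logarithm of the first moment, up to a
  bounded correction of that logarithm.

  The relative variance is multiplied by about \<open>2 / B\<^sup>2\<close> in each step, with a summable source
  proportional to \<open>\<beta>\<^sup>2\<close>. It is small at scale \<open>n\<close> for small \<open>\<beta>\<close> if \<open>B > \<surd>2\<close>, and under the given
  relations between \<open>u\<close> and \<open>\<beta>\<close> if \<open>B \<le> \<surd>2\<close>. The second moment method at scale \<open>n\<close>, together with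
  \<open>Z\<^sub>n\<^sub>+\<^sub>1 \<ge> Z\<^sub>n Z\<^sub>n' / B\<close>, where \<open>Z\<^sub>n\<close> and \<open>Z\<^sub>n'\<close> belong to the two halves of the block, bounds the
  quenched free energy from below.\<close>

text \<open>As functions of h all moments are polynomials in exp h with non-negative coefficients,
  and convolution with a centred Gaussian only multiplies each coefficient by a number at least 1.
  It therefore increases every moment and every increment in h. The critical point, however, is not
  explicit: at h_c one only knows that the first moments do not exceed 1. A matching lower bound
  comes from a shrinking region: a first moment of generation n at most 1 - C (\<beta> \<rho>^n)^2
  stays below the corresponding thresholds for ever, and h_c lies on the border of that region. In
  the comparison with the homogeneous recursion u gets multiplied by a constant that must stay
  bounded over all generations, so every step may lose only a summable relative amount. The constant
  b lies between max 2 ((2 / B)^2) and 1 / \<kappa>. Then \<rho>^2 = b \<kappa> weighs the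
  convolutions against the curvature up to the correlation length, and \<tau>^2 = 2 \<kappa> weighs
  them against the number of sites beyond it.\<close>

abbreviation N01 :: "real measure" where
  "N01 \<equiv> std_normal_distribution"

section \<open>Exponential moments of the standard normal law\<close>

lemma prob_space_N01: "prob_space N01"
  using real_dist_normal_dist by (simp add: real_distribution_def)

lemma std_normal_exp:
  fixes t :: real
  shows "integrable N01 (\<lambda>g. exp (t * g))" and "(\<integral>g. exp (t * g) \<partial>N01) = exp (t\<^sup>2 / 2)"
proof -
  have eq: "std_normal_density x * exp (t * x) = exp (t\<^sup>2 / 2) * normal_density t 1 x" for x
    unfolding normal_density_def
    by (simp add: exp_add[symmetric] power2_eq_square field_simps)
  have i: "integrable lborel (\<lambda>x. std_normal_density x * exp (t * x))"
    unfolding eq by simp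
  have v: "(\<integral>x. std_normal_density x * exp (t * x) \<partial>lborel) = exp (t\<^sup>2 / 2)"
    unfolding eq by simp
  show "integrable N01 (\<lambda>g. exp (t * g))"
    using i by (subst integrable_density) auto
  show "(\<integral>g. exp (t * g) \<partial>N01) = exp (t\<^sup>2 / 2)"
    using v by (subst integral_density) auto
qed

text \<open>Multiplied by exp (x^2 / 4), the standard density becomes sqrt 2 times the density of
  variance 2. This one exponent yields all smaller ones by interpolation.\<close>

lemma std_normal_exp_square:
  shows "integrable N01 (\<lambda>g. exp (g\<^sup>2 / 4))" and "(\<integral>g. exp (g\<^sup>2 / 4) \<partial>N01) = sqrt 2"
proof -
  have eq: "std_normal_density x * exp (x\<^sup>2 / 4) = sqrt 2 * normal_density 0 (sqrt 2) x" for x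
    unfolding normal_density_def
    by (simp add: exp_add[symmetric] field_simps real_sqrt_mult)
  have i: "integrable lborel (\<lambda>x. std_normal_density x * exp (x\<^sup>2 / 4))"
    unfolding eq by simp
  have v: "(\<integral>x. std_normal_density x * exp (x\<^sup>2 / 4) \<partial>lborel) = sqrt 2"
    unfolding eq by simp
  show "integrable N01 (\<lambda>g. exp (g\<^sup>2 / 4))"
    using i by (subst integrable_density) auto
  show "(\<integral>g. exp (g\<^sup>2 / 4) \<partial>N01) = sqrt 2"
    using v by (subst integral_density) auto
qed

lemma std_normal_moments:
  shows "integrable N01 (\<lambda>g. g)" "integrable N01 (\<lambda>g. g\<^sup>2)"
    "(\<integral>g. g \<partial>N01) = 0" "(\<integral>g. g\<^sup>2 \<partial>N01) = 1"
proof -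
  show "integrable N01 (\<lambda>g. g)"
    using integrable_std_normal_moment[of 1] by (subst integrable_density) auto
  show "integrable N01 (\<lambda>g. g\<^sup>2)"
    using integrable_std_normal_moment[of 2] by (subst integrable_density) auto
  show "(\<integral>g. g \<partial>N01) = 0"
    using integral_std_normal_moment_odd[of 0] by (subst integral_density) auto
  show "(\<integral>g. g\<^sup>2 \<partial>N01) = 1"
    using integral_std_normal_moment_even[of 1] by (subst integral_density) auto
qed

text \<open>The chord of exp over the segment from 0 to y. It turns a single finite exponential
  moment into bounds that tend to 1 linearly in the parameter, which is what a summation of errors
  over all generations requires.\<close>

lemma convex_exp_interpolate:
  fixes s y :: real
  assumes "0 \<le> s" "s \<le> 1"
  shows "exp (s * y) \<le> 1 + s * (exp y - 1)"
proof -
  have "convex_on UNIV (exp :: real \<Rightarrow> real)"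
    by (rule exp_convex)
  then have "exp ((1 - s) *\<^sub>R 0 + s *\<^sub>R y) \<le> (1 - s) * exp 0 + s * exp y"
    using assms by (intro convex_onD) auto
  then show ?thesis by (simp add: algebra_simps)
qed

lemma exp_half_le: "exp (1/2 :: real) \<le> 5/3"
proof -
  have "exp (1::real) \<le> (5/3)^2"
    using exp_le e_less_272 by (simp add: power2_eq_square)
  then have "(exp (1/2::real))^2 \<le> (5/3)^2"
    by (simp add: exp_double[symmetric])
  then show ?thesis by (rule power2_le_imp_le) simp
qed

text \<open>For x at most 1 the chord between 0 and 1 gives at most 1 + 3 x + x^2; for larger x the
  crude factor 2 is at most exp 1 and disappears in 3 x. The exponent has no constant term, so small
  x costs little.\<close>

lemma std_normal_exp_abs:
  fixes x :: real
  assumes "0 \<le> x"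
  shows "integrable N01 (\<lambda>g. exp (x * \<bar>g\<bar>))" and "(\<integral>g. exp (x * \<bar>g\<bar>) \<partial>N01) \<le> exp (3 * x + x\<^sup>2)"
proof -
  have b: "exp (x * \<bar>g\<bar>) \<le> exp (x * g) + exp (- x * g)" if "0 \<le> x" for x g :: real
    by (cases "0 \<le> g") (simp_all add: add_increasing add_increasing2)
  have int: "integrable N01 (\<lambda>g. exp (x * \<bar>g\<bar>))" if "0 \<le> x" for x :: real
    by (rule Bochner_Integration.integrable_bound
          [OF Bochner_Integration.integrable_add[OF std_normal_exp(1)[of x] std_normal_exp(1)[of "-x"]]])
      (use b[OF that] in auto)
  then show "integrable N01 (\<lambda>g. exp (x * \<bar>g\<bar>))"
    using assms by blast
  have two: "(\<integral>g. exp (x * \<bar>g\<bar>) \<partial>N01) \<le> 2 * exp (x\<^sup>2 / 2)" if "0 \<le> x" for x :: real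
  proof -
    have "(\<integral>g. exp (x * \<bar>g\<bar>) \<partial>N01) \<le> (\<integral>g. exp (x * g) + exp (- x * g) \<partial>N01)"
      by (rule integral_mono[OF int[OF that] Bochner_Integration.integrable_add[OF std_normal_exp(1) std_normal_exp(1)]])
        (use b[OF that] in auto)
    also have "\<dots> = 2 * exp (x\<^sup>2 / 2)"
      using std_normal_exp[of x] std_normal_exp[of "-x"] by simp
    finally show ?thesis .
  qed
  show "(\<integral>g. exp (x * \<bar>g\<bar>) \<partial>N01) \<le> exp (3 * x + x\<^sup>2)"
  proof (cases "x \<le> 1")
    case True
    interpret prob_space N01 by (rule prob_space_N01)
    have "(\<integral>g. exp (x * \<bar>g\<bar>) \<partial>N01) \<le> (\<integral>g. 1 + x * (exp (1 * \<bar>g\<bar>) - 1) \<partial>N01)"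
      by (rule integral_mono[OF int[OF assms]])
        (use convex_exp_interpolate[OF assms True] int[of 1] in \<open>auto intro!: Bochner_Integration.integrable_add integrable_mult_right Bochner_Integration.integrable_diff\<close>)
    also have "\<dots> = 1 + x * ((\<integral>g. exp (1 * \<bar>g\<bar>) \<partial>N01) - 1)"
      using int[of 1] by (simp add: prob_space[simplified])
    also have "\<dots> \<le> 1 + x * (2 * exp (1\<^sup>2/2) - 1)"
      using two[of 1] assms by (intro add_left_mono mult_left_mono) auto
    also have "\<dots> \<le> 1 + (3 * x + x\<^sup>2)"
    proof -
      have "x * (2 * exp (1\<^sup>2/2) - 1) \<le> x * 3"
        using exp_half_le assms by (intro mult_left_mono) auto
      then show ?thesis using zero_le_power2[of x] by linarith
    qed
    also have "\<dots> \<le> exp (3 * x + x\<^sup>2)" by (rule exp_ge_add_one_self)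
    finally show ?thesis .
  next
    case False
    have "(2::real) \<le> exp 1" using exp_ge_add_one_self[of 1] by simp
    then have "2 * exp (x\<^sup>2/2) \<le> exp 1 * exp (x\<^sup>2/2)" by simp
    also have "\<dots> = exp (1 + x\<^sup>2/2)" by (simp add: exp_add)
    also have "\<dots> \<le> exp (3 * x + x\<^sup>2)" 
    proof -
      have "1 + x\<^sup>2/2 \<le> 3 * x + x\<^sup>2" using False zero_le_power2[of x] by linarith
      then show ?thesis by simp
    qed
    finally show ?thesis using two[OF assms] by linarith
  qed
qed

lemma std_normal_exp_small_square:
  fixes s :: real
  assumes "0 \<le> s" "s \<le> 1/4"
  shows "integrable N01 (\<lambda>g. exp (s * g\<^sup>2))" and "(\<integral>g. exp (s * g\<^sup>2) \<partial>N01) \<le> exp (2 * s)"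
proof -
  interpret prob_space N01 by (rule prob_space_N01)
  have b: "exp (s * g\<^sup>2) \<le> 1 + 4 * s * (exp (g\<^sup>2 / 4) - 1)" for g
    using convex_exp_interpolate[of "4 * s" "g\<^sup>2/4"] assms by simp
  have ib: "integrable N01 (\<lambda>g. 1 + 4 * s * (exp (g\<^sup>2 / 4) - 1))"
    using std_normal_exp_square(1)
    by (intro Bochner_Integration.integrable_add integrable_mult_right Bochner_Integration.integrable_diff) auto
  show i: "integrable N01 (\<lambda>g. exp (s * g\<^sup>2))"
    by (rule Bochner_Integration.integrable_bound[OF ib])
      (use b in \<open>auto intro!: order_trans[OF _ abs_ge_self]\<close>)
  have "(\<integral>g. exp (s * g\<^sup>2) \<partial>N01) \<le> (\<integral>g. 1 + 4 * s * (exp (g\<^sup>2 / 4) - 1) \<partial>N01)"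
    by (rule integral_mono[OF i ib b])
  also have "\<dots> = 1 + 4 * s * (sqrt 2 - 1)"
    using std_normal_exp_square by (simp add: prob_space[simplified])
  also have "\<dots> \<le> 1 + 2 * s"
  proof -
    have "sqrt 2 \<le> 3/2" by (rule real_le_lsqrt) (auto simp: power2_eq_square)
    then have "s * (sqrt 2 - 1) \<le> s * (1/2)" using assms by (intro mult_left_mono) auto
    then show ?thesis by simp
  qed
  also have "\<dots> \<le> exp (2 * s)" by (rule exp_ge_add_one_self)
  finally show "(\<integral>g. exp (s * g\<^sup>2) \<partial>N01) \<le> exp (2 * s)" .
qed

lemma exp_add_le_average: "exp (x + y) \<le> (exp (2 * x) + exp (2 * y)) / (2::real)"
proof -
  have "0 \<le> (exp x - exp y)\<^sup>2" by simp
  also have "\<dots> = exp (2*x) + exp (2*y) - 2 * exp (x + y)"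
    by (simp add: power2_diff exp_double exp_add)
  finally show ?thesis by simp
qed

text \<open>The linear and the quadratic exponent are separated by the inequality between arithmetic
  and geometric mean. This doubles both, whence the bound 1/8 on s where the purely quadratic case
  allows 1/4.\<close>

lemma std_normal_exp_quadratic:
  fixes \<alpha> s :: real
  assumes "0 \<le> \<alpha>" "0 \<le> s" "s \<le> 1/8"
  shows "integrable N01 (\<lambda>g. exp (\<alpha> * \<bar>g\<bar> + s * g\<^sup>2))"
    and "(\<integral>g. exp (\<alpha> * \<bar>g\<bar> + s * g\<^sup>2) \<partial>N01) \<le> exp (6 * \<alpha> + 4 * \<alpha>\<^sup>2 + 4 * s)"
proof -
  let ?F = "\<lambda>g. (exp (2*\<alpha> * \<bar>g\<bar>) + exp (2 * s * g\<^sup>2)) / 2"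
  have b: "exp (\<alpha> * \<bar>g\<bar> + s * g\<^sup>2) \<le> ?F g" for g
    using exp_add_le_average[of "\<alpha> * \<bar>g\<bar>" "s * g\<^sup>2"] by (simp add: mult.assoc)
  have i1: "integrable N01 (\<lambda>g. exp (2*\<alpha> * \<bar>g\<bar>))" "integrable N01 (\<lambda>g. exp (2 * s * g\<^sup>2))"
    using std_normal_exp_abs(1)[of "2*\<alpha>"] std_normal_exp_small_square(1)[of "2 * s"] assms by auto
  then have ib: "integrable N01 ?F" by auto
  show i: "integrable N01 (\<lambda>g. exp (\<alpha> * \<bar>g\<bar> + s * g\<^sup>2))"
    by (rule Bochner_Integration.integrable_bound[OF ib])
      (use b in \<open>auto intro!: order_trans[OF _ abs_ge_self]\<close>)
  have "(\<integral>g. exp (\<alpha> * \<bar>g\<bar> + s * g\<^sup>2) \<partial>N01) \<le> (\<integral>g. ?F g \<partial>N01)"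
    by (rule integral_mono[OF i ib b])
  also have "\<dots> = ((\<integral>g. exp (2*\<alpha> * \<bar>g\<bar>) \<partial>N01) + (\<integral>g. exp (2 * s * g\<^sup>2) \<partial>N01)) / 2"
    using i1 by simp
  also have "\<dots> \<le> (exp (3 * (2 * \<alpha>) + (2 * \<alpha>)\<^sup>2) + exp (2*(2 * s))) / 2"
    using std_normal_exp_abs(2)[of "2*\<alpha>"] std_normal_exp_small_square(2)[of "2 * s"] assms
    by (intro divide_right_mono add_mono) auto
  also have "\<dots> \<le> (exp (6 * \<alpha> + 4 * \<alpha>\<^sup>2 + 4 * s) + exp (6 * \<alpha> + 4 * \<alpha>\<^sup>2 + 4 * s)) / 2"
    using assms by (intro divide_right_mono add_mono) (auto simp: power_mult_distrib)
  finally show "(\<integral>g. exp (\<alpha> * \<bar>g\<bar> + s * g\<^sup>2) \<partial>N01) \<le> exp (6 * \<alpha> + 4 * \<alpha>\<^sup>2 + 4 * s)" by simp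
qed

section \<open>Exponential polynomials and Gaussian smoothing in h\<close>

definition heat :: "real \<Rightarrow> (real \<Rightarrow> real) \<Rightarrow> real \<Rightarrow> real" where
  "heat s G h = (\<integral>g. G (h + s * g) \<partial>N01)"

text \<open>The class that contains all moments as functions of h. On exp (k h) the operator
  \<open>heat s\<close> is multiplication by exp ((k s)^2 / 2), so monotonicity, convexity and the
  effect of smoothing can be read off coefficient by coefficient.\<close>

definition expoly :: "(real \<Rightarrow> real) \<Rightarrow> bool" where
  "expoly G \<longleftrightarrow> (\<exists>p. (\<forall>k. 0 \<le> coeff p k) \<and> (\<forall>h. G h = poly p (exp h)))"

lemma expolyE:
  assumes "expoly G"
  obtains N c where "\<And>k::nat. 0 \<le> c k" "\<And>h. G h = (\<Sum>k\<le>N. c k * exp (real k * h))"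
proof -
  obtain p where p: "\<forall>k. 0 \<le> coeff p k" "\<forall>h. G h = poly p (exp h)"
    using assms unfolding expoly_def by blast
  have "G h = (\<Sum>k\<le>degree p. coeff p k * exp (real k * h))" for h
    using p by (simp add: poly_altdef exp_of_nat_mult)
  then show ?thesis using that p(1) by blast
qed

lemma expolyI:
  assumes "\<And>k::nat. 0 \<le> c k" "\<And>h. G h = (\<Sum>k\<le>N. c k * exp (real k * h))"
  shows "expoly G"
proof -
  let ?p = "\<Sum>k\<le>N. monom (c k) k"
  have "0 \<le> coeff ?p j" for j
    using assms(1) by (auto simp: coeff_sum intro!: sum_nonneg)
  moreover have "G h = poly ?p (exp h)" for h
    by (simp add: assms(2) poly_sum poly_monom exp_of_nat_mult)
  ultimately show ?thesis unfolding expoly_def by blast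
qed

lemma expoly_const [intro]: "0 \<le> c \<Longrightarrow> expoly (\<lambda>_. c)"
  by (rule expolyI[of "\<lambda>k. c" _ 0]) auto

lemma expoly_exp: "expoly (\<lambda>h. exp (real m * h + c))"
  by (rule expolyI[of "\<lambda>k. if k = m then exp c else 0" _ m])
    (auto simp: exp_add if_distrib[of "\<lambda>z. z * _"] cong: if_cong)

lemma expoly_add [intro]:
  assumes "expoly G" "expoly H" shows "expoly (\<lambda>h. G h + H h)"
proof -
  obtain p q where "\<forall>k. 0 \<le> coeff p k" "\<forall>h. G h = poly p (exp h)"
     "\<forall>k. 0 \<le> coeff q k" "\<forall>h. H h = poly q (exp h)"
    using assms unfolding expoly_def by blast
  then show ?thesis unfolding expoly_def by (intro exI[of _ "p + q"]) auto
qed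

lemma expoly_mult [intro]:
  assumes "expoly G" "expoly H" shows "expoly (\<lambda>h. G h * H h)"
proof -
  obtain p q where "\<forall>k. 0 \<le> coeff p k" "\<forall>h. G h = poly p (exp h)"
     "\<forall>k. 0 \<le> coeff q k" "\<forall>h. H h = poly q (exp h)"
    using assms unfolding expoly_def by blast
  then show ?thesis unfolding expoly_def
    by (intro exI[of _ "p * q"]) (auto simp: coeff_mult intro!: sum_nonneg)
qed

lemma expoly_power [intro]: "expoly G \<Longrightarrow> expoly (\<lambda>h. G h ^ k)"
  by (induction k) auto

lemma expoly_divide [intro]: "expoly G \<Longrightarrow> 0 \<le> c \<Longrightarrow> expoly (\<lambda>h. G h / c)"
  using expoly_mult[of G "\<lambda>_. inverse c"] expoly_const[of "inverse c"] by (simp add: divide_inverse)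

lemma expoly_nonneg: "expoly G \<Longrightarrow> 0 \<le> G h"
  by (erule expolyE) (auto intro!: sum_nonneg)

lemma expoly_mono:
  assumes "expoly G" "x \<le> y" shows "G x \<le> G y"
  using assms(1) by (rule expolyE) (auto intro!: sum_mono mult_left_mono assms(2))

lemma expoly_continuous: "expoly G \<Longrightarrow> continuous_on A G"
  by (erule expolyE) (auto intro!: continuous_intros simp: fun_eq_iff[symmetric] cong: continuous_on_cong)

lemma le_mult_ge_1: "0 \<le> c \<Longrightarrow> 1 \<le> x \<Longrightarrow> c \<le> c * (x::real)"
  using mult_left_mono[of 1 x c] by simp

text \<open>Closure under increments is what makes smoothing raise differences and not only values:
  \<open>heat_ge\<close> applies to the increment as well.\<close>

lemma expoly_increment:
  assumes "expoly G" "0 \<le> u" shows "expoly (\<lambda>h. G (h + u) - G h)"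
proof -
  obtain N c where c: "\<And>k::nat. 0 \<le> c k" "\<And>h. G h = (\<Sum>k\<le>N. c k * exp (real k * h))"
    using assms(1) by (rule expolyE) blast
  show ?thesis
    by (rule expolyI[of "\<lambda>k. c k * (exp (real k * u) - 1)" _ N])
      (use c assms(2) in \<open>auto simp: sum_subtractf[symmetric] algebra_simps exp_add intro!: sum.cong le_mult_ge_1\<close>)
qed

lemma heat_expoly_eq:
  assumes "\<And>h. G h = (\<Sum>k\<le>N. c k * exp (real k * h))"
  shows "integrable N01 (\<lambda>g. G (h + s * g))"
    and "heat s G h = (\<Sum>k\<le>N. (c k * exp ((real k * s)\<^sup>2 / 2)) * exp (real k * h))"
proof -
  have eq: "G (h + s * g) = (\<Sum>k\<le>N. (c k * exp (real k * h)) * exp ((real k * s) * g))" for g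
    by (simp add: assms exp_add algebra_simps)
  have i: "integrable N01 (\<lambda>g. (c k * exp (real k * h)) * exp ((real k * s) * g))" for k
    by (intro integrable_mult_right std_normal_exp)
  show "integrable N01 (\<lambda>g. G (h + s * g))"
    unfolding eq using i by (intro Bochner_Integration.integrable_sum) auto
  have "heat s G h = (\<Sum>k\<le>N. (c k * exp (real k * h)) * exp ((real k * s)\<^sup>2 / 2))"
    unfolding heat_def eq
    by (subst Bochner_Integration.integral_sum, rule i) (simp add: std_normal_exp)
  then show "heat s G h = (\<Sum>k\<le>N. (c k * exp ((real k * s)\<^sup>2 / 2)) * exp (real k * h))"
    by (simp add: mult_ac)
qed

lemma expoly_integrable:
  assumes "expoly G" shows "integrable N01 (\<lambda>g. G (h + s * g))"
  using assms by (rule expolyE) (rule heat_expoly_eq(1))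

lemma expoly_heat [intro]:
  assumes "expoly G" shows "expoly (heat s G)"
proof -
  obtain N c where c: "\<And>k::nat. 0 \<le> c k" "\<And>h. G h = (\<Sum>k\<le>N. c k * exp (real k * h))"
    using assms by (rule expolyE) blast
  show ?thesis
    by (rule expolyI[OF _ heat_expoly_eq(2)[OF c(2)]]) (use c(1) in auto)
qed

lemma heat_ge:
  assumes "expoly G" shows "G h \<le> heat s G h"
proof -
  obtain N c where c: "\<And>k::nat. 0 \<le> c k" "\<And>h. G h = (\<Sum>k\<le>N. c k * exp (real k * h))"
    using assms by (rule expolyE) blast
  show ?thesis
    unfolding heat_expoly_eq(2)[OF c(2)] c(2)
    by (intro sum_mono mult_right_mono le_mult_ge_1) (use c(1) in auto)
qed

lemma square_half_le_exp: "0 \<le> x \<Longrightarrow> x\<^sup>2 / 2 \<le> exp (x::real)"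
  using exp_lower_Taylor_quadratic[of x] by simp

text \<open>The increment is of second order in \<open>s\<close>, because the Gaussian is centred.\<close>

lemma heat_increment_le:
  assumes "expoly G" "0 < \<sigma>"
  shows "heat s G h - G h \<le> (s / \<sigma>)\<^sup>2 * heat s G (h + \<sigma>)"
proof -
  obtain N c where c: "\<And>k::nat. 0 \<le> c k" "\<And>h. G h = (\<Sum>k\<le>N. c k * exp (real k * h))"
    using assms(1) by (rule expolyE) blast
  have "heat s G h - G h = (\<Sum>k\<le>N. c k * exp (real k * h) * (exp ((real k * s)\<^sup>2 / 2) - 1))"
    unfolding heat_expoly_eq(2)[OF c(2)] c(2) by (simp add: sum_subtractf algebra_simps)
  also have "\<dots> \<le> (\<Sum>k\<le>N. c k * exp (real k * h) * ((s / \<sigma>)\<^sup>2 * exp (real k * \<sigma>) * exp ((real k * s)\<^sup>2 / 2)))"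
  proof (intro sum_mono mult_left_mono)
    fix k :: nat
    have e: "exp x - 1 \<le> x * exp x" if "0 \<le> x" for x :: real
    proof -
      have "exp x * (1 - x) \<le> exp x * exp (- x)"
        using exp_ge_add_one_self[of "-x"] by (intro mult_left_mono) auto
      then show ?thesis by (simp add: exp_minus algebra_simps)
    qed
    have "exp ((real k * s)\<^sup>2 / 2) - 1 \<le> (real k * s)\<^sup>2 / 2 * exp ((real k * s)\<^sup>2 / 2)"
      by (rule e) simp
    \<comment> \<open>The factor k^2 is traded for exp (k \<sigma>), that is, for a shift of h by
      \<sigma>. The free parameter \<sigma> will be 1 / a^n, the scale on which the moments of
      generation n vary.\<close>
    also have "(real k * s)\<^sup>2 / 2 * exp ((real k * s)\<^sup>2 / 2) = (s / \<sigma>)\<^sup>2 * ((real k * \<sigma>)\<^sup>2 / 2) * exp ((real k * s)\<^sup>2 / 2)"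
      using assms(2) by (simp add: power2_eq_square)
    also have "(s / \<sigma>)\<^sup>2 * ((real k * \<sigma>)\<^sup>2 / 2) * exp ((real k * s)\<^sup>2 / 2)
        \<le> (s / \<sigma>)\<^sup>2 * exp (real k * \<sigma>) * exp ((real k * s)\<^sup>2 / 2)"
      using assms(2) by (intro mult_right_mono mult_left_mono square_half_le_exp) auto
    finally show "exp ((real k * s)\<^sup>2 / 2) - 1 \<le> (s / \<sigma>)\<^sup>2 * exp (real k * \<sigma>) * exp ((real k * s)\<^sup>2 / 2)" .
  qed (use c(1) in auto)
  also have "\<dots> = (s / \<sigma>)\<^sup>2 * heat s G (h + \<sigma>)"
    unfolding heat_expoly_eq(2)[OF c(2)]
    by (simp add: sum_distrib_left exp_add algebra_simps)
  finally show ?thesis .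
qed

text \<open>The chord inequality holds for each exponential, and the coefficients are non-negative.
  It is used to interpolate between a point where a moment is known and a point at the distance
  where the growth bound is sharp.\<close>

lemma expoly_convex:
  assumes "expoly G" "0 \<le> t" "t \<le> 1"
  shows "G (h + t * w) \<le> (1 - t) * G h + t * G (h + w)"
proof -
  obtain N c where c: "\<And>k::nat. 0 \<le> c k" "\<And>h. G h = (\<Sum>k\<le>N. c k * exp (real k * h))"
    using assms(1) by (rule expolyE) blast
  have "G (h + t * w) = (\<Sum>k\<le>N. (c k * exp (real k * h)) * exp (t * (real k * w)))"
    by (simp add: c(2) algebra_simps exp_add)
  also have "\<dots> \<le> (\<Sum>k\<le>N. (c k * exp (real k * h)) * (1 + t * (exp (real k * w) - 1)))"
    using c(1) assms by (intro sum_mono mult_left_mono convex_exp_interpolate) auto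
  also have "\<dots> = (1 - t) * G h + t * G (h + w)"
    unfolding c(2) sum_distrib_left sum.distrib[symmetric]
    by (intro sum.cong) (auto simp: algebra_simps exp_add)
  finally show ?thesis .
qed

lemma heat_mono:
  assumes "expoly G" "expoly H" "\<And>h. G h \<le> H h" shows "heat s G h \<le> heat s H h"
  unfolding heat_def using assms expoly_integrable by (intro integral_mono) auto

text \<open>Monotonicity allows g to be replaced by its absolute value. Hence bounds that are known
  only to the right of a base point are enough to control the smoothed function.\<close>

lemma heat_abs_le:
  assumes "expoly G" "0 \<le> s" "\<And>g. G (h + s * \<bar>g\<bar>) \<le> F g" "integrable N01 F"
  shows "heat s G h \<le> (\<integral>g. F g \<partial>N01)"
  unfolding heat_def
proof (rule integral_mono[OF expoly_integrable[OF assms(1)] assms(4)])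
  fix g :: real
  have "G (h + s * g) \<le> G (h + s * \<bar>g\<bar>)"
    using assms(2) by (intro expoly_mono[OF assms(1)] add_left_mono mult_left_mono) auto
  with assms(3)[of g] show "G (h + s * g) \<le> F g" by linarith
qed

lemma heat_add:
  assumes "expoly G" "expoly H" shows "heat s (\<lambda>h. G h + H h) h = heat s G h + heat s H h"
  unfolding heat_def using expoly_integrable[OF assms(1)] expoly_integrable[OF assms(2)] by simp

lemma heat_cmult: "heat s (\<lambda>h. c * G h) h = c * heat s G h"
  unfolding heat_def by simp

lemma heat_square_le:
  assumes "expoly G" shows "(heat s G h)\<^sup>2 \<le> heat s (\<lambda>h. (G h)\<^sup>2) h"
proof -
  interpret prob_space N01 by (rule prob_space_N01)
  have "0 \<le> (\<integral>g. (G (h + s * g) - heat s G h)\<^sup>2 \<partial>N01)" by simp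
  also have "\<dots> = (\<integral>g. (G (h + s * g))\<^sup>2 - 2 * heat s G h * G (h + s * g) + (heat s G h)\<^sup>2 \<partial>N01)"
    by (simp add: power2_diff algebra_simps)
  also have "\<dots> = heat s (\<lambda>h. (G h)\<^sup>2) h - (heat s G h)\<^sup>2"
    using expoly_integrable[OF assms] expoly_integrable[OF expoly_power[OF assms, of 2]]
    by (simp add: heat_def prob_space[simplified] power2_eq_square)
  finally show ?thesis by simp
qed

section \<open>The homogeneous recursion\<close>

text \<open>The second derivative of the logarithm of the homogeneous partition function grows at most
  like \<open>b\<^sup>n\<close>, whereas the variance added at generation \<open>n\<close> decays like \<open>\<kappa>\<^sup>n\<close>.\<close>

locale hier_pinning =
  fixes B \<kappa> b :: real
  assumes B_gt: "1 < B" and B_lt: "B < 2" and \<kappa>_pos: "0 < \<kappa>"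
    and b_gt: "2 < b" "(2 / B)\<^sup>2 < b" and b_\<kappa>: "b * \<kappa> < 1"
begin

text \<open>The derivative of \<open>ff\<close> at its fixed point 1. A small excess over 1 grows
  like a^n, so a^n u is the size that u has at generation n.\<close>

definition a :: real where "a = 2 / B"

definition ff :: "real \<Rightarrow> real" where "ff y = (y\<^sup>2 + B - 1) / B"

lemma a_gt: "1 < a" and a_lt: "a < 2" and a_b: "a\<^sup>2 < b"
  using B_gt B_lt b_gt by (auto simp: a_def field_simps)

lemma a_pos [simp]: "0 < a" "0 \<le> a" "0 < a ^ n" "0 \<le> a ^ n" "a \<noteq> 0"
  using a_gt by auto

lemma b_pos [simp]: "0 < b" "0 \<le> b" "0 < b ^ n" "0 \<le> b ^ n"
  using b_gt by auto

lemma one_le_a_pow: "1 \<le> a ^ n"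
  using a_gt by (simp add: one_le_power)

lemma a_pow_b_pow: "(a ^ n)\<^sup>2 \<le> b ^ n"
  using a_b by (metis less_imp_le power_mono power_mult power2_eq_square mult.commute zero_le_power2)

lemma ff_mono: "0 \<le> x \<Longrightarrow> x \<le> y \<Longrightarrow> ff x \<le> ff y"
  using B_gt by (auto simp: ff_def intro!: divide_right_mono power_mono)

lemma den_pos: "0 < y\<^sup>2 + B - 1"
  using B_gt zero_le_power2[of y] by linarith

lemma ff_pos: "0 < ff y"
  using B_gt den_pos[of y] by (simp add: ff_def)

lemma ff_ge: "(B - 1) / B \<le> ff y"
  using B_gt by (auto simp: ff_def intro!: divide_right_mono)

lemma ff_ge_1: "1 \<le> y \<Longrightarrow> 1 \<le> ff y"
  using B_gt one_le_power[of y 2] by (simp add: ff_def)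

lemma ff_le_square: "1 \<le> y \<Longrightarrow> ff y \<le> y\<^sup>2"
proof -
  assume "1 \<le> y"
  then have "(B - 1) * 1 \<le> (B - 1) * y\<^sup>2"
    using B_gt by (intro mult_left_mono) auto
  then show ?thesis using B_gt by (simp add: ff_def field_simps)
qed

lemma ff_ge_square: "y\<^sup>2 / B \<le> ff y"
  using B_gt by (auto simp: ff_def intro!: divide_right_mono)

lemma ff_add: "ff (1 + e) = 1 + a * e + e\<^sup>2 / B"
  using B_gt by (simp add: ff_def a_def power2_eq_square field_simps)

text \<open>Convexity of exp with weights 1 / B and 1 - 1 / B. Iterated, it yields the lower bound
  exp (a^m t) for \<open>hom\<close>, which is sharp to first order near the critical point.\<close>

lemma ff_ge_exp: "exp (a * t) \<le> ff (exp t)"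
proof -
  have "exp ((1 / B) * (2 * t)) \<le> 1 + 1 / B * (exp (2 * t) - 1)"
    using B_gt by (intro convex_exp_interpolate) auto
  also have "\<dots> = ff (exp t)"
    using B_gt unfolding exp_double ff_def by (simp add: field_simps)
  finally show ?thesis by (simp add: a_def)
qed

lemma ff_ge_linear: "1 \<le> y \<Longrightarrow> 1 + a * (y - 1) \<le> ff y"
  using ff_add[of "y - 1"] B_gt by simp

text \<open>The model without disorder at h = t, with critical point t = 0. The disordered moments
  will be compared with this function at a slightly enlarged argument.\<close>

primrec hom :: "nat \<Rightarrow> real \<Rightarrow> real" where
  "hom 0 t = exp t"
| "hom (Suc m) t = ff (hom m t)"

lemma hom_pos: "0 < hom m t"
  by (cases m) (auto simp: ff_pos)

lemma hom_ge_1: "0 \<le> t \<Longrightarrow> 1 \<le> hom m t"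
  by (induction m) (auto simp: ff_ge_1)

lemma hom_mono: "s \<le> t \<Longrightarrow> hom m s \<le> hom m t"
  by (induction m) (auto simp: less_imp_le[OF hom_pos] intro!: ff_mono)

lemma hom_0 [simp]: "hom m 0 = 1"
  using B_gt by (induction m) (auto simp: ff_def)

lemma hom_ge_exp: "0 \<le> t \<Longrightarrow> exp (a ^ m * t) \<le> hom m t"
proof (induction m)
  case (Suc m)
  have "exp (a ^ Suc m * t) \<le> ff (exp (a ^ m * t))"
    using ff_ge_exp[of "a ^ m * t"] by (simp add: mult_ac)
  also have "\<dots> \<le> hom (Suc m) t"
    using Suc by (auto intro!: ff_mono)
  finally show ?case .
qed simp

lemma hom_le_power: "0 \<le> t \<Longrightarrow> hom (m + k) t \<le> hom m t ^ (2 ^ k)"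
proof (induction k)
  case (Suc k)
  have "hom (m + Suc k) t \<le> (hom (m + k) t)\<^sup>2"
    using ff_le_square[OF hom_ge_1[OF Suc.prems]] by simp
  also have "\<dots> \<le> (hom m t ^ (2 ^ k))\<^sup>2"
    using Suc less_imp_le[OF hom_pos] by (intro power_mono) auto
  also have "\<dots> = hom m t ^ (2 ^ Suc k)"
    by (simp add: power_mult[symmetric] mult.commute)
  finally show ?case .
qed simp

subsection \<open>Logarithmic derivatives of the homogeneous partition function\<close>

text \<open>With \<open>p2\<close>, the first two derivatives of \<open>ell m\<close>, the logarithm
  of \<open>hom m\<close>, given by the recursions that result from differentiating ln of
  \<open>ff\<close>; \<open>ell_deriv\<close> and \<open>p1_deriv\<close> confirm this.\<close>

primrec p1 :: "nat \<Rightarrow> real \<Rightarrow> real" where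
  "p1 0 t = 1"
| "p1 (Suc m) t = 2 * (hom m t)\<^sup>2 / ((hom m t)\<^sup>2 + B - 1) * p1 m t"

primrec p2 :: "nat \<Rightarrow> real \<Rightarrow> real" where
  "p2 0 t = 0"
| "p2 (Suc m) t = 2 * (hom m t)\<^sup>2 / ((hom m t)\<^sup>2 + B - 1) * p2 m t
     + 4 * (hom m t)\<^sup>2 * (B - 1) / ((hom m t)\<^sup>2 + B - 1)\<^sup>2 * (p1 m t)\<^sup>2"

definition ell :: "nat \<Rightarrow> real \<Rightarrow> real" where "ell m t = ln (hom m t)"

lemma hom_deriv: "(hom m has_real_derivative hom m t * p1 m t) (at t)"
proof (induction m)
  case 0
  have "hom 0 = exp" by (rule ext) simp
  then show ?case by (auto intro!: derivative_eq_intros)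
next
  case (Suc m)
  have eq: "hom (Suc m) = (\<lambda>t. ((hom m t)\<^sup>2 + B - 1) / B)"
    by (rule ext) (simp add: ff_def)
  have h: "(hom (Suc m) has_real_derivative 2 * hom m t * (hom m t * p1 m t) / B) (at t)"
    unfolding eq using B_gt by (auto intro!: derivative_eq_intros Suc)
  have e: "2 * hom m t * (hom m t * p1 m t) / B = hom (Suc m) t * p1 (Suc m) t"
    using den_pos[of "hom m t"] B_gt by (simp add: ff_def power2_eq_square)
  show ?case by (rule h[unfolded e])
qed

lemma ell_deriv: "(ell m has_real_derivative p1 m t) (at t)"
  unfolding ell_def using hom_pos[of m t]
  by (auto intro!: derivative_eq_intros hom_deriv)

lemma p1_deriv: "(p1 m has_real_derivative p2 m t) (at t)"
proof (induction m)
  case 0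
  have "p1 0 = (\<lambda>_. 1)" by (rule ext) simp
  then show ?case by simp
next
  case (Suc m)
  have eq: "p1 (Suc m) = (\<lambda>t. 2 * (hom m t)\<^sup>2 / ((hom m t)\<^sup>2 + B - 1) * p1 m t)"
    by (rule ext) simp
  let ?y = "hom m t"
  have d: "?y\<^sup>2 + B - 1 \<noteq> 0" using den_pos[of ?y] by simp
  have "((\<lambda>t. 2 * (hom m t)\<^sup>2 / ((hom m t)\<^sup>2 + B - 1)) has_real_derivative
      4 * ?y\<^sup>2 * (B - 1) / (?y\<^sup>2 + B - 1)\<^sup>2 * p1 m t) (at t)"
    by (rule derivative_eq_intros hom_deriv refl d | simp)+
      (use d in \<open>simp add: field_simps power2_eq_square\<close>)
  from DERIV_mult[OF this Suc] show ?case
    unfolding eq by (simp add: power2_eq_square algebra_simps)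
qed

lemma p1_pos: "0 < p1 m t"
proof (induction m)
  case (Suc m)
  then show ?case using den_pos[of "hom m t"] hom_pos[of m t] by simp
qed simp

lemma p2_nonneg: "0 \<le> p2 m t"
  by (induction m)
    (use B_gt den_pos in \<open>auto intro!: mult_nonneg_nonneg divide_nonneg_nonneg add_nonneg_nonneg less_imp_le[OF den_pos]\<close>)

lemma p1_0: "p1 m 0 = a ^ m"
  by (induction m) (auto simp: a_def)

lemma p1_mono: "s \<le> t \<Longrightarrow> p1 m s \<le> p1 m t"
  by (rule DERIV_nonneg_imp_nondecreasing[of s t]) (use p1_deriv p2_nonneg in blast)+

lemma p1_ge: "0 \<le> t \<Longrightarrow> a ^ m \<le> p1 m t"
  using p1_mono[of 0 t m] p1_0 by simp

lemma p1_Suc: "p1 (Suc m) t = a * (hom m t)\<^sup>2 / hom (Suc m) t * p1 m t"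
  using B_gt by (simp add: ff_def a_def)

text \<open>A bound with one power of \<open>hom\<close> is wanted, because the source in the
  recursion of \<open>p2\<close> divides the square of \<open>p1\<close> by the square of
  \<open>hom\<close>. A cruder bound with the power q is proved beforehand. It settles the values y
  below B^2, where y^q is a constant; for larger y the inequality y^3 \<le> z^2 for the next value z
  closes the induction.\<close>

lemma p1_le_hom:
  "\<exists>D\<ge>1. \<forall>m t. 0 \<le> t \<longrightarrow> p1 m t \<le> D * a ^ m * hom m t"
proof -
  \<comment> \<open>Since a > 1, a large q satisfies q + 2 \<le> a (q + 1); this makes y^(q+2) \<le>
    (ff y)^(q+1), which is the induction step for the crude bound.\<close>
  obtain q :: nat where q: "1 / (a - 1) \<le> real q"
    using real_arch_simple by blast
  have qa: "real q + 2 \<le> a * (real q + 1)"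
    using q a_gt by (simp add: field_simps)
  have yq: "y ^ (q + 2) \<le> ff y ^ (q + 1)" if "1 \<le> y" for y
  proof -
    define t where "t = ln y"
    have t: "y = exp t" "0 \<le> t"
      using that by (auto simp: t_def)
    have "y ^ (q + 2) = exp ((real q + 2) * t)"
      using exp_of_nat_mult[of "q + 2" t] by (simp add: t(1) algebra_simps)
    also have "\<dots> \<le> exp (a * (real q + 1) * t)"
      using qa t(2) by (auto intro!: mult_right_mono)
    also have "\<dots> = exp (a * t) ^ (q + 1)"
      using exp_of_nat_mult[of "q + 1" "a * t"] by (simp add: algebra_simps)
    also have "\<dots> \<le> ff y ^ (q + 1)"
      unfolding t(1) by (intro power_mono ff_ge_exp) auto
    finally show ?thesis .
  qed
  have A: "p1 m t \<le> a ^ m * hom m t ^ q" if "0 \<le> t" for m t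
  proof (induction m)
    case 0
    then show ?case using that by simp
  next
    case (Suc m)
    let ?y = "hom m t" and ?z = "hom (Suc m) t"
    have "p1 (Suc m) t \<le> a * ?y\<^sup>2 / ?z * (a ^ m * ?y ^ q)"
      unfolding p1_Suc using Suc hom_pos[of "Suc m" t] by (intro mult_left_mono) (auto simp: ff_pos less_imp_le)
    also have "\<dots> = a ^ Suc m * (?y ^ (q + 2) / ?z)" by (simp add: power_add power2_eq_square)
    also have "\<dots> \<le> a ^ Suc m * (?z ^ (q + 1) / ?z)"
      using yq[OF hom_ge_1[OF that, of m]] hom_pos[of "Suc m" t]
      by (intro mult_left_mono divide_right_mono) (auto simp: ff_pos less_imp_le)
    also have "\<dots> = a ^ Suc m * ?z ^ q" using hom_pos[of "Suc m" t] by simp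
    finally show ?case .
  qed
  define D where "D = B ^ (2 * q + 1)"
  have D1: "1 \<le> D" unfolding D_def using B_gt by (intro one_le_power) auto
  have "p1 m t \<le> D * a ^ m * hom m t" if "0 \<le> t" for m t
  proof (induction m)
    case 0
    have "1 * 1 \<le> D * exp t" using D1 that by (intro mult_mono) auto
    then show ?case by simp
  next
    case (Suc m)
    let ?y = "hom m t" and ?z = "hom (Suc m) t"
    have y1: "1 \<le> ?y" and z1: "1 \<le> ?z" using hom_ge_1[OF that] by blast+
    have zy: "?y\<^sup>2 \<le> B * ?z" using ff_ge_square[of ?y] B_gt by (simp add: field_simps)
    show ?case
    proof (cases "B\<^sup>2 \<le> ?y")
      case True
      have "B\<^sup>2 * ?y ^ 3 \<le> ?y * ?y ^ 3" using True y1 by (intro mult_right_mono) auto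
      also have "\<dots> = (?y\<^sup>2)\<^sup>2" by (simp add: power2_eq_square power3_eq_cube)
      also have "\<dots> \<le> (B * ?z)\<^sup>2" using zy by (intro power_mono) auto
      finally have k: "?y ^ 3 \<le> ?z\<^sup>2" using B_gt by (simp add: power_mult_distrib)
      have "p1 (Suc m) t \<le> a * ?y\<^sup>2 / ?z * (D * a ^ m * ?y)"
        unfolding p1_Suc using Suc z1 by (intro mult_left_mono) auto
      also have "\<dots> = D * a ^ Suc m * (?y ^ 3 / ?z)" by (simp add: power2_eq_square power3_eq_cube)
      also have "\<dots> \<le> D * a ^ Suc m * (?z\<^sup>2 / ?z)"
        using k z1 D1 by (intro mult_left_mono divide_right_mono) auto
      also have "\<dots> = D * a ^ Suc m * ?z" using z1 by (simp add: power2_eq_square)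
      finally show ?thesis .
    next
      case False
      have "p1 (Suc m) t \<le> a * ?y\<^sup>2 / ?z * (a ^ m * ?y ^ q)"
        unfolding p1_Suc using A[OF that, of m] z1 by (intro mult_left_mono) auto
      also have "\<dots> \<le> a * B * (a ^ m * (B\<^sup>2) ^ q)"
        using zy z1 False y1 B_gt
        by (intro mult_mono power_mono) (auto simp: field_simps)
      also have "\<dots> = D * a ^ Suc m * 1"
      proof -
        have "D = B * (B\<^sup>2) ^ q" by (simp add: D_def power_mult)
        then show ?thesis by (metis mult.assoc mult.commute mult.right_neutral power_Suc)
      qed
      also have "\<dots> \<le> D * a ^ Suc m * ?z" using z1 D1 by (intro mult_left_mono) auto
      finally show ?thesis .
    qed
  qed
  then show ?thesis using D1 by blast
qed

text \<open>By \<open>p1_le_hom\<close> the source of generation m is at most 4 D^2 a^(2m), hence of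
  order b^m, while the linear part at most doubles. As b > 2, the constant C with 4 D^2 \<le> C (b -
  2) is preserved by the recursion.\<close>

lemma p2_le: "\<exists>C\<ge>1. \<forall>m t. 0 \<le> t \<longrightarrow> p2 m t \<le> C * b ^ m"
proof -
  obtain D where D: "1 \<le> D" "\<And>m t. 0 \<le> t \<Longrightarrow> p1 m t \<le> D * a ^ m * hom m t"
    using p1_le_hom by blast
  define C where "C = 1 + 4 * D\<^sup>2 / (b - 2)"
  have C1: "1 \<le> C" using b_gt D by (simp add: C_def)
  have Cb: "4 * D\<^sup>2 \<le> C * (b - 2)" using b_gt by (simp add: C_def distrib_right)
  have "p2 m t \<le> C * b ^ m" if "0 \<le> t" for m t
  proof (induction m)
    case 0
    then show ?case using C1 by simp
  next
    case (Suc m)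
    let ?y = "hom m t"
    have y1: "1 \<le> ?y" using hom_ge_1[OF that] by blast
    have d: "0 < ?y\<^sup>2 + B - 1" "?y\<^sup>2 \<le> ?y\<^sup>2 + B - 1" using den_pos B_gt by auto
    have "2 * ?y\<^sup>2 / (?y\<^sup>2 + B - 1) * p2 m t \<le> 2 * p2 m t"
      using d by (intro mult_right_mono p2_nonneg) (auto simp: field_simps)
    also have "\<dots> \<le> 2 * (C * b ^ m)" using Suc by simp
    finally have 1: "2 * ?y\<^sup>2 / (?y\<^sup>2 + B - 1) * p2 m t \<le> 2 * (C * b ^ m)" .
    have "4 * ?y\<^sup>2 * (B - 1) / (?y\<^sup>2 + B - 1)\<^sup>2 * (p1 m t)\<^sup>2
        \<le> 4 * ?y\<^sup>2 * 1 / (?y\<^sup>2)\<^sup>2 * (D * a ^ m * ?y)\<^sup>2"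
      using d D(2)[OF that, of m] B_lt B_gt y1 less_imp_le[OF p1_pos, of m t]
      by (intro mult_mono frac_le power_mono) auto
    also have "\<dots> = 4 * D\<^sup>2 * (a ^ m)\<^sup>2"
      using y1 by (simp add: power2_eq_square)
    also have "\<dots> \<le> C * (b - 2) * b ^ m"
      using Cb C1 b_gt by (intro mult_mono[OF Cb a_pow_b_pow[of m]]) auto
    finally show ?case using 1 by (simp add: algebra_simps)
  qed
  then show ?thesis using C1 by blast
qed

text \<open>The mean value theorem for \<open>ell\<close> and for \<open>p1\<close>. Convexity of
  \<open>ell\<close> gives the lower bound, the bound on its curvature the upper one.\<close>

lemma ell_taylor:
  "\<exists>C\<ge>1. \<forall>m t. 0 \<le> t \<longrightarrow> p1 m t \<le> a ^ m + C * b ^ m * t \<and>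
     (\<forall>w\<ge>0. ell m t + p1 m t * w \<le> ell m (t + w) \<and>
            ell m (t + w) \<le> ell m t + p1 m t * w + C * b ^ m * w\<^sup>2)"
proof -
  obtain C where C: "1 \<le> C" "\<And>m t. 0 \<le> t \<Longrightarrow> p2 m t \<le> C * b ^ m"
    using p2_le by blast
  have L: "p1 m (t + w) \<le> p1 m t + C * b ^ m * w" if "0 \<le> t" "0 \<le> w" for m t w
  proof (cases "w = 0")
    case False
    then have "t < t + w" using that by simp
    from MVT2[OF this p1_deriv[of m]] obtain z
      where z: "t < z" "z < t + w" "p1 m (t + w) - p1 m t = (t + w - t) * p2 m z" by blast
    have "w * p2 m z \<le> w * (C * b ^ m)" using z that C(2)[of z m] by (intro mult_left_mono) auto
    then show ?thesis using z(3) by (simp add: mult_ac)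
  qed simp
  have T: "ell m t + p1 m t * w \<le> ell m (t + w) \<and>
      ell m (t + w) \<le> ell m t + p1 m t * w + C * b ^ m * w\<^sup>2" if "0 \<le> t" "0 \<le> w" for m t w
  proof (cases "w = 0")
    case False
    then have "t < t + w" using that by simp
    from MVT2[OF this ell_deriv[of m]] obtain z
      where z: "t < z" "z < t + w" "ell m (t + w) - ell m t = (t + w - t) * p1 m z" by blast
    have "p1 m z \<le> p1 m t + C * b ^ m * w"
      using p1_mono[of z "t + w" m] z L[OF that, of m] by linarith
    then have "w * p1 m z \<le> w * (p1 m t + C * b ^ m * w)" using that by (intro mult_left_mono) auto
    moreover have "w * p1 m t \<le> w * p1 m z" using z that by (intro mult_left_mono p1_mono) auto
    ultimately show ?thesis using z(3) by (simp add: algebra_simps power2_eq_square)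
  qed simp
  have "p1 m t \<le> a ^ m + C * b ^ m * t" if "0 \<le> t" for m t
    using L[of 0 t m] that p1_0[of m] by simp
  with C(1) T show ?thesis by blast
qed

subsection \<open>The critical window\<close>

text \<open>One step maps the excess e to a e + e^2 / B. The quadratic coefficient has to be
  multiplied by a^2 while the linear part offers only a; the gap a^2 - a pays for the new term e^2
  \<le> 4 (a^m v)^2.\<close>

lemma hom_window_small:
  "\<exists>C\<ge>1. \<forall>m v. 0 \<le> v \<longrightarrow> a ^ m * v \<le> 1 / C \<longrightarrow> hom m v \<le> 1 + a ^ m * v + C * (a ^ m * v)\<^sup>2"
proof -
  define D where "D = a\<^sup>2 - a"
  define C where "C = 1 + 4 / D"
  have D0: "0 < D" using a_gt by (simp add: D_def power2_eq_square)
  have C1: "1 \<le> C" using D0 by (simp add: C_def)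
  have Ca: "4 \<le> C * D" using D0 by (simp add: C_def distrib_right)
  have "hom m v \<le> 1 + a ^ m * v + C * (a ^ m * v)\<^sup>2" if "0 \<le> v" "a ^ m * v \<le> 1 / C" for m v
    using that(2)
  proof (induction m)
    case 0
    have "1 / C \<le> 1" using C1 by simp
    then have "v \<le> 1" using 0 by simp
    then have "exp v \<le> 1 + v + v\<^sup>2" using exp_bound[OF that(1)] by simp
    also have "\<dots> \<le> 1 + v + C * v\<^sup>2" using C1 mult_right_mono[of 1 C "v\<^sup>2"] by simp
    finally show ?case by simp
  next
    case (Suc m)
    let ?z = "a ^ m * v"
    have z0: "0 \<le> ?z" using that by simp
    have "1 * ?z \<le> a * ?z" using a_gt z0 by (intro mult_right_mono) auto
    then have zC: "?z \<le> 1 / C" using Suc.prems unfolding power_Suc mult.assoc by linarith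
    then have Cz: "C * ?z \<le> 1" using C1 by (simp add: field_simps)
    define e where "e = ?z + C * ?z\<^sup>2"
    have e0: "0 \<le> e" using z0 C1 by (simp add: e_def)
    have "C * ?z\<^sup>2 \<le> ?z"
      using mult_right_mono[OF Cz z0] by (simp add: power2_eq_square mult_ac)
    then have e2: "e \<le> 2 * ?z" unfolding e_def by linarith
    have "hom (Suc m) v \<le> ff (1 + e)"
      using Suc.IH[OF zC] less_imp_le[OF hom_pos[of m v]] by (auto simp: e_def intro!: ff_mono)
    also have "\<dots> = 1 + a * e + e\<^sup>2 / B" by (rule ff_add)
    also have "e\<^sup>2 / B \<le> (2 * ?z)\<^sup>2 / 1" using e0 e2 B_gt by (intro frac_le power_mono) auto
    also have "1 + a * e + (2 * ?z)\<^sup>2 / 1 = 1 + a * ?z + (a * C + 4) * ?z\<^sup>2"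
      by (simp add: e_def power2_eq_square algebra_simps)
    also have "\<dots> \<le> 1 + a * ?z + (C * a\<^sup>2) * ?z\<^sup>2"
      using Ca by (intro add_left_mono mult_right_mono) (simp_all add: D_def algebra_simps)
    also have "\<dots> = 1 + a ^ Suc m * v + C * (a ^ Suc m * v)\<^sup>2"
      by (simp add: power2_eq_square mult_ac)
    finally show ?case by simp
  qed
  then show ?thesis using C1 by blast
qed

text \<open>For a window of arbitrary size X one goes back a fixed number k of generations to the
  small window, and k squarings produce no more than a constant E. Where a^m v is not small, E is at
  most E C a^m v, so the bound can be stated linearly everywhere.\<close>

lemma hom_window:
  "\<exists>C\<ge>1. \<forall>m v. 0 \<le> v \<longrightarrow> a ^ m * v \<le> X \<longrightarrow> hom m v \<le> 1 + C * (a ^ m * v)"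
proof -
  obtain C where C: "1 \<le> C"
    "\<And>m v. 0 \<le> v \<Longrightarrow> a ^ m * v \<le> 1 / C \<Longrightarrow> hom m v \<le> 1 + a ^ m * v + C * (a ^ m * v)\<^sup>2"
    using hom_window_small by blast
  have small: "hom m v \<le> 1 + 2 * (a ^ m * v)" if "0 \<le> v" "a ^ m * v \<le> 1 / C" for m v
  proof -
    let ?z = "a ^ m * v"
    have "C * ?z\<^sup>2 \<le> 1 * ?z" unfolding power2_eq_square mult.assoc[symmetric]
      using that C(1) by (intro mult_right_mono) (auto simp: field_simps)
    then show ?thesis using C(2)[OF that] by simp
  qed
  obtain k where k: "C * max X 0 < a ^ k"
    using real_arch_pow[OF a_gt] by blast
  define E where "E = max (3 ^ (2 ^ k)) (exp (2 ^ k * max X 0))"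
  have E1: "1 \<le> E" unfolding E_def by (rule max.coboundedI1) simp
  have big: "hom m v \<le> E" if "0 \<le> v" "a ^ m * v \<le> X" for m v
  proof (cases "k \<le> m")
    case True
    have "a ^ (m - k) * v * a ^ k = a ^ m * v" using True by (simp add: power_add[symmetric])
    then have "a ^ (m - k) * v * (C * max X 0) \<le> X" using k that
      by (smt (verit, best) a_pos(4) mult_left_mono mult_nonneg_nonneg)
    have "a ^ (m - k) * v \<le> 1 / C"
    proof (cases "X \<le> 0")
      case True
      then have "a ^ m * v = 0" using that by (smt (verit) a_pos(4) mult_nonneg_nonneg)
      then show ?thesis using C(1) by simp
    next
      case False
      then have "a ^ (m - k) * v * (C * X) \<le> 1 * X" using \<open>a ^ (m - k) * v * (C * max X 0) \<le> X\<close> by simp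
      then have "a ^ (m - k) * v * C \<le> 1" using False
        by (metis mult.assoc mult_le_cancel_right_pos not_le)
      then show ?thesis using C(1) by (simp add: field_simps)
    qed
    then have "hom (m - k) v \<le> 3" using small[OF that(1), of "m - k"] C(1)
      by (smt (verit) divide_le_eq_1_pos)
    then have "hom (m - k) v ^ (2 ^ k) \<le> 3 ^ (2 ^ k)"
      using less_imp_le[OF hom_pos] by (intro power_mono) auto
    then show ?thesis using hom_le_power[OF that(1), of "m - k" k] True
      unfolding E_def by (simp add: le_max_iff_disj)
  next
    case False
    have "v \<le> a ^ m * v" using that one_le_a_pow[of m] mult_right_mono[of 1 "a ^ m" v] by simp
    then have vX: "v \<le> max X 0" using that by simp
    have "hom m v \<le> exp v ^ 2 ^ m" using hom_le_power[OF that(1), of 0 m] by simp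
    also have "\<dots> = exp (2 ^ m * v)" using exp_of_nat_mult[of "2 ^ m" v] by simp
    also have "\<dots> \<le> exp (2 ^ k * max X 0)"
      using vX False that by (auto intro!: mult_mono power_increasing)
    finally show ?thesis unfolding E_def by simp
  qed
  have "hom m v \<le> 1 + (2 + E * C) * (a ^ m * v)" if "0 \<le> v" "a ^ m * v \<le> X" for m v
  proof (cases "a ^ m * v \<le> 1 / C")
    case True
    have "0 \<le> E * C * (a ^ m * v)" using E1 C(1) that by (intro mult_nonneg_nonneg) auto
    then show ?thesis using small[OF that(1) True] by (simp add: algebra_simps)
  next
    case False
    then have "1 \<le> C * (a ^ m * v)" using C(1) by (simp add: field_simps)
    then have "E * 1 \<le> E * (C * (a ^ m * v))" using E1 by (intro mult_left_mono) auto
    moreover have "0 \<le> a ^ m * v" using that by simp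
    ultimately show ?thesis using big[OF that] by (simp add: algebra_simps)
  qed
  moreover have "1 \<le> 2 + E * C" using E1 C(1) by (smt (verit) mult_nonneg_nonneg)
  ultimately show ?thesis by blast
qed

end

lemma expoly_shift:
  assumes "expoly G" shows "expoly (\<lambda>h. G (h + w))"
proof -
  obtain N c where c: "\<And>k::nat. 0 \<le> c k" "\<And>h. G h = (\<Sum>k\<le>N. c k * exp (real k * h))"
    using assms by (rule expolyE) blast
  show ?thesis
    by (rule expolyI[of "\<lambda>k. c k * exp (real k * w)" _ N])
      (use c in \<open>auto simp: algebra_simps exp_add\<close>)
qed

lemma heat_shift: "heat s (\<lambda>h. G (h + w)) h = heat s G (h + w)"
  unfolding heat_def by (simp add: algebra_simps)

context hier_pinning
begin

section \<open>Decay rates of the smoothing\<close>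

lemma \<kappa>_half: "2 * \<kappa> < 1"
proof -
  have "2 * \<kappa> < b * \<kappa>" using b_gt \<kappa>_pos by (intro mult_strict_right_mono) auto
  then show ?thesis using b_\<kappa> by simp
qed

text \<open>The rate at which smoothing decays relative to the derivatives of \<open>ell\<close>:
  both s_n a^n and the square root of (s_n)^2 b^n are at most \<beta> \<rho>^n. Similarly \<tau>
  serves for 2^n, the largest possible logarithmic derivative of a partition function of generation
  n.\<close>

definition \<rho> :: real where "\<rho> = sqrt (b * \<kappa>)"

definition \<tau> :: real where "\<tau> = sqrt (2 * \<kappa>)"

lemma \<rho>_gt: "0 < \<rho>" and \<rho>_lt: "\<rho> < 1"
proof -
  have "0 < b * \<kappa>" using \<kappa>_pos by (intro mult_pos_pos) auto
  then show "0 < \<rho>" "\<rho> < 1" unfolding \<rho>_def using b_\<kappa> by (auto simp only: real_sqrt_gt_0_iff real_sqrt_lt_1_iff)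
qed

lemma \<tau>_gt: "0 < \<tau>" and \<tau>_lt: "\<tau> < 1"
  unfolding \<tau>_def using \<kappa>_half \<kappa>_pos by (auto simp only: real_sqrt_gt_0_iff real_sqrt_lt_1_iff)

lemma \<rho>_\<tau>_pos [simp]: "0 \<le> \<rho>" "0 < \<rho> ^ n" "0 \<le> \<rho> ^ n" "0 \<le> \<tau>" "0 < \<tau> ^ n" "0 \<le> \<tau> ^ n"
  using \<rho>_gt \<tau>_gt by simp_all

lemma \<rho>_pow_le_1: "\<rho> ^ n \<le> 1" and \<tau>_pow_le_1: "\<tau> ^ n \<le> 1"
  using \<rho>_lt \<tau>_lt by (simp_all add: power_le_one)

lemma \<rho>_sq: "(\<rho> ^ n)\<^sup>2 = (b * \<kappa>) ^ n" and \<tau>_sq: "(\<tau> ^ n)\<^sup>2 = (2 * \<kappa>) ^ n"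
proof -
  have sw: "(x ^ n)\<^sup>2 = (x\<^sup>2) ^ n" for x :: real
    by (metis power_mult mult.commute)
  have "0 \<le> b * \<kappa>" "0 \<le> 2 * \<kappa>" using \<kappa>_pos by simp_all
  then have "\<rho>\<^sup>2 = b * \<kappa>" "\<tau>\<^sup>2 = 2 * \<kappa>"
    by (simp_all only: \<rho>_def \<tau>_def real_sqrt_pow2)
  then show "(\<rho> ^ n)\<^sup>2 = (b * \<kappa>) ^ n" "(\<tau> ^ n)\<^sup>2 = (2 * \<kappa>) ^ n"
    by (simp_all only: sw)
qed

text \<open>Here \<kappa>^(n+1) (1 - \<kappa>) = \<kappa>^(n+1) - \<kappa>^(n+2). The first power is
  the covariance between the two halves of a block of generation n + 1, the second is the part of it
  that this block shares with its surroundings.\<close>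

definition s :: "real \<Rightarrow> nat \<Rightarrow> real" where
  "s \<beta> n = \<beta> * sqrt (\<kappa> ^ Suc n * (1 - \<kappa>))"

lemma s_nonneg: "0 \<le> \<beta> \<Longrightarrow> 0 \<le> s \<beta> n"
  using \<kappa>_half \<kappa>_pos by (auto simp: s_def)

lemma s_sq: "(s \<beta> n)\<^sup>2 = \<beta>\<^sup>2 * (\<kappa> ^ Suc n * (1 - \<kappa>))"
  using \<kappa>_half \<kappa>_pos by (auto simp: s_def power_mult_distrib)

lemma s_sq_le: "(s \<beta> n)\<^sup>2 \<le> \<beta>\<^sup>2 * \<kappa> ^ n"
proof -
  have "\<kappa> ^ Suc n * (1 - \<kappa>) \<le> \<kappa> ^ n * 1"
    using \<kappa>_half \<kappa>_pos by (intro mult_mono power_decreasing) auto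
  then show ?thesis unfolding s_sq by (intro mult_left_mono) auto
qed

lemma s_sq_b: "(s \<beta> n)\<^sup>2 * b ^ n \<le> (\<beta> * \<rho> ^ n)\<^sup>2"
  using mult_right_mono[OF s_sq_le[of \<beta> n], of "b ^ n"]
  by (simp add: power_mult_distrib \<rho>_sq mult_ac)

lemma s_a:
  assumes "0 \<le> \<beta>" shows "s \<beta> n * a ^ n \<le> \<beta> * \<rho> ^ n"
proof -
  have "(s \<beta> n * a ^ n)\<^sup>2 \<le> (s \<beta> n)\<^sup>2 * b ^ n"
    unfolding power_mult_distrib using a_pow_b_pow[of n] by (intro mult_left_mono) auto
  also have "\<dots> \<le> (\<beta> * \<rho> ^ n)\<^sup>2" by (rule s_sq_b)
  finally show ?thesis by (rule power2_le_imp_le) (use assms in auto)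
qed

lemma s_\<tau>: "2 ^ n * (s \<beta> n)\<^sup>2 \<le> \<beta>\<^sup>2 * (\<tau> ^ n)\<^sup>2"
  using mult_left_mono[OF s_sq_le[of \<beta> n], of "2 ^ n"]
  by (simp add: \<tau>_sq power_mult_distrib mult_ac)

lemma s_le_\<tau>:
  assumes "0 \<le> \<beta>" shows "s \<beta> n \<le> \<beta> * \<tau> ^ n"
proof -
  have "1 * (s \<beta> n)\<^sup>2 \<le> 2 ^ n * (s \<beta> n)\<^sup>2" by (rule mult_right_mono) auto
  also have "\<dots> \<le> (\<beta> * \<tau> ^ n)\<^sup>2" using s_\<tau>[of n \<beta>] by (simp add: power_mult_distrib)
  finally have "(s \<beta> n)\<^sup>2 \<le> (\<beta> * \<tau> ^ n)\<^sup>2" by simp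
  then show ?thesis by (rule power2_le_imp_le) (use assms in auto)
qed

subsection \<open>The annealed recursions\<close>

text \<open>As functions of \<open>h\<close>, the first and second moments of the partition function of generation
  \<open>n\<close> in the field \<open>inner n\<close> constructed below.\<close>

primrec AA :: "real \<Rightarrow> nat \<Rightarrow> real \<Rightarrow> real" where
  "AA \<beta> 0 = (\<lambda>h. exp (h + \<beta>\<^sup>2 * (1 - \<kappa>) / 2))"
| "AA \<beta> (Suc n) = heat (s \<beta> n) (\<lambda>h. ff (AA \<beta> n h))"

primrec DD :: "real \<Rightarrow> nat \<Rightarrow> real \<Rightarrow> real" where
  "DD \<beta> 0 = (\<lambda>h. exp (2 * h + 2 * \<beta>\<^sup>2 * (1 - \<kappa>)))"
| "DD \<beta> (Suc n) = heat (s \<beta> n) (\<lambda>h. ((DD \<beta> n h)\<^sup>2 + 2 * (B - 1) * (AA \<beta> n h)\<^sup>2 + (B - 1)\<^sup>2) / B\<^sup>2)"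

lemma expoly_ff [intro]: "expoly G \<Longrightarrow> expoly (\<lambda>h. ff (G h))"
proof -
  assume "expoly G"
  then have "expoly (\<lambda>h. ((G h)\<^sup>2 + (B - 1)) / B)"
    using B_gt by (intro expoly_divide expoly_add expoly_power expoly_const) auto
  then show ?thesis by (simp add: ff_def add_diff_eq)
qed

lemma expoly_AA [intro]: "expoly (AA \<beta> n)"
proof (induction n)
  case 0
  show ?case using expoly_exp[of 1 "\<beta>\<^sup>2 * (1 - \<kappa>) / 2"] by simp
qed auto

lemma expoly_DD_step:
  assumes "expoly D" "expoly A"
  shows "expoly (\<lambda>h. ((D h)\<^sup>2 + 2 * (B - 1) * (A h)\<^sup>2 + (B - 1)\<^sup>2) / B\<^sup>2)"
proof -
  have "expoly (\<lambda>h. 2 * (B - 1) * (A h)\<^sup>2)"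
    using B_gt assms by (intro expoly_mult expoly_const expoly_power) auto
  then show ?thesis using assms B_gt by (intro expoly_divide expoly_add expoly_const expoly_power) auto
qed

lemma expoly_DD [intro]: "expoly (DD \<beta> n)"
proof (induction n)
  case 0
  show ?case using expoly_exp[of 2 "2 * \<beta>\<^sup>2 * (1 - \<kappa>)"] by simp
next
  case (Suc n)
  show ?case unfolding DD.simps by (intro expoly_heat expoly_DD_step Suc) auto
qed

lemma AA_nonneg [simp]: "0 \<le> AA \<beta> n h"
  by (intro expoly_nonneg) auto

lemma AA_Suc_ge: "ff (AA \<beta> n h) \<le> AA \<beta> (Suc n) h"
  using heat_ge[OF expoly_ff[OF expoly_AA[of \<beta> n]], of h "s \<beta> n"] by simp

lemma AA_Suc_ge_const: "(B - 1) / B \<le> AA \<beta> (Suc n) h"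
  using AA_Suc_ge[of \<beta> n h] ff_ge[of "AA \<beta> n h"] by linarith

lemma AA_pos [simp]: "0 < AA \<beta> n h"
proof (cases n)
  case (Suc m)
  have "0 < (B - 1) / B" using B_gt by simp
  then show ?thesis unfolding Suc using AA_Suc_ge_const[of \<beta> m h] by linarith
qed simp

lemma AA_mono: "x \<le> y \<Longrightarrow> AA \<beta> n x \<le> AA \<beta> n y"
  by (rule expoly_mono) auto

lemma ff_square: "(ff y)\<^sup>2 = (y ^ 4 + 2 * (B - 1) * y\<^sup>2 + (B - 1)\<^sup>2) / B\<^sup>2"
proof -
  have "(y\<^sup>2 + B - 1)\<^sup>2 = y ^ 4 + 2 * (B - 1) * y\<^sup>2 + (B - 1)\<^sup>2"
    by algebra
  then show ?thesis by (simp only: ff_def power_divide)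
qed

text \<open>The variance is non-negative. This follows from the recursions by Jensen's inequality
  for \<open>heat\<close>, before their probabilistic meaning is available.\<close>

lemma AA_DD: "(AA \<beta> n h)\<^sup>2 \<le> DD \<beta> n h"
proof (induction n arbitrary: h)
  case 0
  have "\<beta>\<^sup>2 * (1 - \<kappa>) \<ge> 0" using \<kappa>_half \<kappa>_pos by simp
  moreover have "2 * (h + x / 2) \<le> 2 * h + 2 * x" if "0 \<le> x" for x :: real using that by simp
  ultimately have "2 * (h + \<beta>\<^sup>2 * (1 - \<kappa>) / 2) \<le> 2 * h + 2 * \<beta>\<^sup>2 * (1 - \<kappa>)" by (metis mult.assoc)
  then show ?case by (simp only: AA.simps DD.simps exp_double[symmetric] exp_le_cancel_iff)
next
  case (Suc n)
  have "(AA \<beta> (Suc n) h)\<^sup>2 \<le> heat (s \<beta> n) (\<lambda>h. (ff (AA \<beta> n h))\<^sup>2) h"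
    unfolding AA.simps by (intro heat_square_le) auto
  also have "\<dots> \<le> DD \<beta> (Suc n) h"
    unfolding DD.simps
  proof (intro heat_mono expoly_DD_step expoly_power)
    fix h
    have "(AA \<beta> n h) ^ 4 = ((AA \<beta> n h)\<^sup>2)\<^sup>2" by simp
    also have "\<dots> \<le> (DD \<beta> n h)\<^sup>2" using Suc by (intro power_mono) auto
    finally show "(ff (AA \<beta> n h))\<^sup>2 \<le> ((DD \<beta> n h)\<^sup>2 + 2 * (B - 1) * (AA \<beta> n h)\<^sup>2 + (B - 1)\<^sup>2) / B\<^sup>2"
      unfolding ff_square by (intro divide_right_mono) auto
  qed auto
  finally show ?case .
qed

lemma DD_nonneg [simp]: "0 \<le> DD \<beta> n h"
  by (intro expoly_nonneg) auto

text \<open>The logarithmic derivative in h cannot exceed the number 2^n of sites. The constant B -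
  1 in the recursion can only lower it.\<close>

lemma AA_growth: "0 \<le> w \<Longrightarrow> AA \<beta> n (h + w) \<le> exp (2 ^ n * w) * AA \<beta> n h"
proof (induction n arbitrary: h)
  case 0
  show ?case by (simp add: exp_add mult_ac)
next
  case (Suc n)
  have "AA \<beta> (Suc n) (h + w) = heat (s \<beta> n) (\<lambda>h. ff (AA \<beta> n (h + w))) h"
    by (simp add: heat_shift[of _ "\<lambda>h. ff (AA \<beta> n h)"])
  also have "\<dots> \<le> heat (s \<beta> n) (\<lambda>h. exp (2 ^ Suc n * w) * ff (AA \<beta> n h)) h"
  proof (intro heat_mono expoly_mult expoly_const expoly_ff expoly_shift[OF expoly_AA])
    fix h
    have "ff (AA \<beta> n (h + w)) \<le> ff (exp (2 ^ n * w) * AA \<beta> n h)"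
      using Suc by (intro ff_mono) auto
    also have "\<dots> = (exp (2 ^ Suc n * w) * (AA \<beta> n h)\<^sup>2 + (B - 1)) / B"
      unfolding ff_def by (simp add: power_mult_distrib exp_double[symmetric] mult_ac)
    also have "\<dots> \<le> (exp (2 ^ Suc n * w) * (AA \<beta> n h)\<^sup>2 + exp (2 ^ Suc n * w) * (B - 1)) / B"
      using B_gt Suc.prems mult_right_mono[of 1 "exp (2 ^ Suc n * w)" "B - 1"]
      by (intro divide_right_mono add_left_mono) auto
    also have "\<dots> = exp (2 ^ Suc n * w) * ff (AA \<beta> n h)"
      unfolding ff_def by (simp add: algebra_simps)
    finally show "ff (AA \<beta> n (h + w)) \<le> exp (2 ^ Suc n * w) * ff (AA \<beta> n h)" .
  qed auto
  also have "\<dots> = exp (2 ^ Suc n * w) * AA \<beta> (Suc n) h"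
    by (simp add: heat_cmult)
  finally show ?case .
qed

lemma sum_geometric_le:
  assumes "0 \<le> q" "q < (1::real)" shows "(\<Sum>j<n. q ^ j) \<le> 1 / (1 - q)"
proof -
  have "(\<Sum>j<n. q ^ j) \<le> (\<Sum>j. q ^ j)"
    using assms by (intro sum_le_suminf summable_geometric) auto
  then show ?thesis using assms by (simp add: suminf_geometric)
qed

text \<open>For h \<ge> 0 the recursion is dominated by plain squaring. Per site, the smoothing of
  generation n adds at most 3 s_n + 2^(n+1) (s_n)^2, which is summable because \<tau> < 1.\<close>

lemma AA_upper:
  assumes "0 \<le> \<beta>"
  shows "0 \<le> h \<Longrightarrow> AA \<beta> n h \<le> exp (2 ^ n * (h + (\<beta>\<^sup>2 + (\<Sum>j<n. (3 * \<beta> + 2 * \<beta>\<^sup>2) * \<tau> ^ j))))"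
proof (induction n arbitrary: h)
  case 0
  have "\<beta>\<^sup>2 * (1 - \<kappa>) / 2 \<le> \<beta>\<^sup>2 * 1 / 1" using \<kappa>_pos \<kappa>_half by (intro frac_le mult_left_mono) auto
  then show ?case by simp
next
  case (Suc n)
  define c where "c = \<beta>\<^sup>2 + (\<Sum>j<n. (3 * \<beta> + 2 * \<beta>\<^sup>2) * \<tau> ^ j)"
  have c0: "0 \<le> c" unfolding c_def using assms by (intro add_nonneg_nonneg sum_nonneg) auto
  define x where "x = 2 ^ Suc n * s \<beta> n"
  have x0: "0 \<le> x" using s_nonneg[OF assms] by (simp add: x_def)
  have "AA \<beta> (Suc n) h \<le> (\<integral>g. exp (2 ^ Suc n * (h + c)) * exp (x * \<bar>g\<bar>) \<partial>N01)"
    unfolding AA.simps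
  proof (rule heat_abs_le[OF expoly_ff[OF expoly_AA] s_nonneg[OF assms]])
    fix g :: real
    let ?h = "h + s \<beta> n * \<bar>g\<bar>"
    have h0: "0 \<le> ?h" using Suc.prems s_nonneg[OF assms] by simp
    let ?E = "exp (2 ^ n * (?h + c))"
    have E1: "1 \<le> ?E" using h0 c0 by simp
    have "ff (AA \<beta> n ?h) \<le> ff ?E" using Suc.IH[OF h0] by (intro ff_mono) (auto simp: c_def)
    also have "\<dots> \<le> ?E\<^sup>2" by (rule ff_le_square[OF E1])
    also have "\<dots> = exp (2 ^ Suc n * (h + c)) * exp (x * \<bar>g\<bar>)"
      unfolding exp_double[symmetric] x_def exp_add[symmetric] by (simp add: algebra_simps)
    finally show "ff (AA \<beta> n ?h) \<le> exp (2 ^ Suc n * (h + c)) * exp (x * \<bar>g\<bar>)" .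
  qed (intro integrable_mult_right std_normal_exp_abs x0)
  also have "\<dots> \<le> exp (2 ^ Suc n * (h + c)) * exp (3 * x + x\<^sup>2)"
    using std_normal_exp_abs(2)[OF x0] by simp
  also have "\<dots> = exp (2 ^ Suc n * (h + c + (3 * s \<beta> n + 2 ^ Suc n * (s \<beta> n)\<^sup>2)))"
    unfolding exp_add[symmetric] x_def by (simp add: algebra_simps power2_eq_square)
  also have "\<dots> \<le> exp (2 ^ Suc n * (h + c + (3 * \<beta> + 2 * \<beta>\<^sup>2) * \<tau> ^ n))"
  proof -
    have "2 ^ Suc n * (s \<beta> n)\<^sup>2 \<le> 2 * (\<beta>\<^sup>2 * (\<tau> ^ n)\<^sup>2)" using s_\<tau>[of n \<beta>] by simp
    also have "\<dots> \<le> 2 * (\<beta>\<^sup>2 * \<tau> ^ n)"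
      using \<tau>_pow_le_1[of n] mult_left_mono[of "\<tau> ^ n" 1 "\<tau> ^ n"]
      by (intro mult_left_mono) (auto simp: power2_eq_square)
    finally have "3 * s \<beta> n + 2 ^ Suc n * (s \<beta> n)\<^sup>2 \<le> (3 * \<beta> + 2 * \<beta>\<^sup>2) * \<tau> ^ n"
      using s_le_\<tau>[OF assms, of n] by (simp add: algebra_simps)
    then show ?thesis by simp
  qed
  finally show ?case by (simp add: c_def add_ac)
qed

text \<open>The annealed free energy computed from \<open>AA\<close>, hence without the variable
  common to the whole block. By \<open>annealed_eq_fa\<close> that variable does not change the
  limit.\<close>

definition fa :: "real \<Rightarrow> real \<Rightarrow> real" where
  "fa \<beta> h = lim (\<lambda>n. ln (AA \<beta> n h) / 2 ^ n)"

lemma ln_AA_Suc: "2 * ln (AA \<beta> n h) - ln B \<le> ln (AA \<beta> (Suc n) h)"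
proof -
  have "2 * ln (AA \<beta> n h) - ln B = ln ((AA \<beta> n h)\<^sup>2 / B)"
    using B_gt AA_pos[of \<beta> n h] by (simp add: ln_div ln_realpow del: AA_pos)
  also have "\<dots> \<le> ln (AA \<beta> (Suc n) h)"
    using ff_ge_square[of "AA \<beta> n h"] AA_Suc_ge[of \<beta> n h] B_gt AA_pos[of \<beta> n h]
    by (intro ln_mono) (auto simp del: AA.simps AA_pos)
  finally show ?thesis .
qed

text \<open>Since \<open>ff y\<close> is at least y^2 / B and smoothing only increases, the numbers
  (ln A_n - ln B) / 2^n are non-decreasing, so each of them is a lower bound for the limit.
  \<open>AA_upper\<close> keeps them bounded.\<close>

lemma fa_lim_and_ge:
  assumes "0 \<le> \<beta>"
  shows "(\<lambda>n. ln (AA \<beta> n h) / 2 ^ n) \<longlonglongrightarrow> fa \<beta> h" and "(ln (AA \<beta> n h) - ln B) / 2 ^ n \<le> fa \<beta> h"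
proof -
  let ?L = "\<lambda>n. (ln (AA \<beta> n h) - ln B) / 2 ^ n"
  have lnB: "0 < ln B" using B_gt by simp
  have inc: "incseq ?L"
  proof (rule incseq_SucI)
    fix n
    have "?L n = (2 * ln (AA \<beta> n h) - ln B - ln B) / 2 ^ Suc n" by (simp add: field_simps)
    also have "\<dots> \<le> ?L (Suc n)" using ln_AA_Suc[of \<beta> n h] by (intro divide_right_mono) auto
    finally show "?L n \<le> ?L (Suc n)" .
  qed
  define C where "C = \<bar>h\<bar> + (\<beta>\<^sup>2 + (3 * \<beta> + 2 * \<beta>\<^sup>2) * (1 / (1 - \<tau>)))"
  have ub: "?L n \<le> C" for n
  proof -
    have "ln (AA \<beta> n h) \<le> ln (AA \<beta> n \<bar>h\<bar>)" by (intro ln_mono AA_mono) auto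
    also have "\<dots> \<le> 2 ^ n * (\<bar>h\<bar> + (\<beta>\<^sup>2 + (\<Sum>j<n. (3 * \<beta> + 2 * \<beta>\<^sup>2) * \<tau> ^ j)))"
      using ln_mono[OF AA_upper[OF assms, of "\<bar>h\<bar>" n]] by simp
    also have "\<dots> \<le> 2 ^ n * C"
      unfolding C_def sum_distrib_left[symmetric] using sum_geometric_le[of \<tau> n] \<tau>_lt assms
      by (intro mult_left_mono add_left_mono) auto
    finally show ?thesis using lnB by (simp add: field_simps)
  qed
  have "\<forall>i. ?L i \<le> C" using ub by blast
  from incseq_convergent[OF inc this] obtain L where L: "?L \<longlonglongrightarrow> L" "\<forall>i. ?L i \<le> L" .
  have "(\<lambda>n. ?L n + ln B * (1 / 2) ^ n) \<longlonglongrightarrow> L + ln B * 0"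
    by (intro tendsto_intros L LIMSEQ_power_zero) auto
  moreover have "(\<lambda>n. ?L n + ln B * (1 / 2) ^ n) = (\<lambda>n. ln (AA \<beta> n h) / 2 ^ n)"
    by (intro ext) (simp add: field_simps power_one_over)
  ultimately have lim: "(\<lambda>n. ln (AA \<beta> n h) / 2 ^ n) \<longlonglongrightarrow> L" by simp
  then have "fa \<beta> h = L" unfolding fa_def by (rule limI)
  then show "(\<lambda>n. ln (AA \<beta> n h) / 2 ^ n) \<longlonglongrightarrow> fa \<beta> h" "(ln (AA \<beta> n h) - ln B) / 2 ^ n \<le> fa \<beta> h"
    using lim L(2) by auto
qed

text \<open>The fixed point 1 is unstable with multiplier a > 1. A first moment above 1 therefore
  exceeds B at a later generation, and from there the monotone lower bound for \<open>fa\<close> is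
  positive.\<close>

lemma fa_pos:
  assumes "0 \<le> \<beta>" "1 < AA \<beta> n h" shows "0 < fa \<beta> h"
proof -
  have "1 + a ^ k * (AA \<beta> n h - 1) \<le> AA \<beta> (n + k) h" for k
  proof (induction k)
    case (Suc k)
    have "0 \<le> a ^ k * (AA \<beta> n h - 1)" using assms by (intro mult_nonneg_nonneg) auto
    then have "1 \<le> AA \<beta> (n + k) h" using Suc by linarith
    then have "1 + a * (AA \<beta> (n + k) h - 1) \<le> AA \<beta> (n + Suc k) h"
      using ff_ge_linear AA_Suc_ge[of \<beta> "n + k" h] by (metis add_Suc_right order_trans)
    moreover have "a * (a ^ k * (AA \<beta> n h - 1)) \<le> a * (AA \<beta> (n + k) h - 1)"
      using Suc by (intro mult_left_mono) auto
    ultimately show ?case unfolding power_Suc mult.assoc by linarith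
  qed simp
  moreover obtain k where "B / (AA \<beta> n h - 1) < a ^ k" using real_arch_pow[OF a_gt] by blast
  then have "B < a ^ k * (AA \<beta> n h - 1)" using assms(2) by (simp add: pos_divide_less_eq)
  ultimately have "1 + a ^ k * (AA \<beta> n h - 1) \<le> AA \<beta> (n + k) h" "B < a ^ k * (AA \<beta> n h - 1)" by blast+
  then have "B < AA \<beta> (n + k) h" by linarith
  then have "0 < (ln (AA \<beta> (n + k) h) - ln B) / 2 ^ (n + k)" using B_gt by simp
  then show ?thesis using fa_lim_and_ge(2)[OF assms(1), of "n + k" h] by linarith
qed

lemma fa_zero:
  assumes "0 \<le> \<beta>" "\<And>n. AA \<beta> n h \<le> 1" shows "fa \<beta> h = 0"
proof -
  let ?c = "ln ((B - 1) / B)"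
  have "(\<lambda>n. ?c * (1 / 2) ^ n) \<longlonglongrightarrow> ?c * 0"
    by (intro tendsto_intros LIMSEQ_power_zero) auto
  then have l: "(\<lambda>n. ?c * (1 / 2) ^ n) \<longlonglongrightarrow> 0" by simp
  have B0: "0 < (B - 1) / B" using B_gt by simp
  have "(\<lambda>n. ln (AA \<beta> n h) / 2 ^ n) \<longlonglongrightarrow> 0"
  proof (rule tendsto_sandwich[OF _ _ l tendsto_const])
    show "\<forall>\<^sub>F n in sequentially. ?c * (1 / 2) ^ n \<le> ln (AA \<beta> n h) / 2 ^ n"
    proof (intro eventually_sequentiallyI[of 1])
      fix n :: nat assume "1 \<le> n"
      then obtain m where n: "n = Suc m" by (cases n) auto
      have "?c \<le> ln (AA \<beta> n h)"
        unfolding n using AA_Suc_ge_const[of \<beta> m h] B0 by (rule ln_mono)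
      then have "?c / 2 ^ n \<le> ln (AA \<beta> n h) / 2 ^ n" by (rule divide_right_mono) simp
      moreover have "?c * (1 / 2) ^ n = ?c / 2 ^ n" by (simp add: power_one_over)
      ultimately show "?c * (1 / 2) ^ n \<le> ln (AA \<beta> n h) / 2 ^ n" by (simp only:)
    qed
    show "\<forall>\<^sub>F n in sequentially. ln (AA \<beta> n h) / 2 ^ n \<le> 0"
      using assms(2) by (intro always_eventually allI divide_nonpos_pos) auto
  qed
  with fa_lim_and_ge(1)[OF assms(1)] show ?thesis by (rule LIMSEQ_unique)
qed

section \<open>Stability of the homogeneous bound under smoothing\<close>

text \<open>On the logarithmic scale the Taylor bound is quadratic in g, so its Gaussian integral is
  explicit. The resulting exponent is compared with the tangent of \<open>ell\<close> at t, along
  which moving by \<eta> (t + 1 / a^m) gains at least p \<eta> (t + 1 / a^m). The summand 1 / a^m is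
  needed because t may vanish. Powers up to 4 are required by the second moments.\<close>

lemma hom_heat:
  "\<exists>C\<ge>1. \<forall>m t \<epsilon> \<eta>. \<forall>q\<le>4::nat. 0 \<le> t \<longrightarrow> 0 \<le> \<epsilon> \<longrightarrow> \<eta> \<le> 1 \<longrightarrow> C * (\<epsilon> * a ^ m) \<le> \<eta> \<longrightarrow> C * (b ^ m * \<epsilon>\<^sup>2) \<le> \<eta> \<longrightarrow>
     integrable N01 (\<lambda>g. hom m (t + \<epsilon> * \<bar>g\<bar>) ^ q) \<and>
     (\<integral>g. hom m (t + \<epsilon> * \<bar>g\<bar>) ^ q \<partial>N01) \<le> hom m (t + \<eta> * (t + 1 / a ^ m)) ^ q"
proof -
  obtain K where K: "1 \<le> K"
    "\<And>m t. 0 \<le> t \<Longrightarrow> p1 m t \<le> a ^ m + K * b ^ m * t"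
    "\<And>m t w. 0 \<le> t \<Longrightarrow> 0 \<le> w \<Longrightarrow> ell m t + p1 m t * w \<le> ell m (t + w)"
    "\<And>m t w. 0 \<le> t \<Longrightarrow> 0 \<le> w \<Longrightarrow> ell m (t + w) \<le> ell m t + p1 m t * w + K * b ^ m * w\<^sup>2"
    using ell_taylor by blast
  \<comment> \<open>Three error terms arise, from \<alpha>, from the square of \<alpha> and from
    \<sigma>. The factor 48 lets each take at most a third of the available gain, and keeps \<sigma>
    below 1/8 for q up to 4.\<close>
  define C where "C = 48 * K"
  have "integrable N01 (\<lambda>g. hom m (t + \<epsilon> * \<bar>g\<bar>) ^ q) \<and>
     (\<integral>g. hom m (t + \<epsilon> * \<bar>g\<bar>) ^ q \<partial>N01) \<le> hom m (t + \<eta> * (t + 1 / a ^ m)) ^ q"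
    if t: "0 \<le> t" and \<epsilon>: "0 \<le> \<epsilon>" and \<eta>1: "\<eta> \<le> 1" and c1: "C * (\<epsilon> * a ^ m) \<le> \<eta>" and c2: "C * (b ^ m * \<epsilon>\<^sup>2) \<le> \<eta>"
      and q: "q \<le> 4" for m t \<epsilon> \<eta> and q :: nat
  proof -
    define p where "p = p1 m t"
    define r where "r = t + 1 / a ^ m"
    define Q where "Q = K * b ^ m"
    have Q0: "0 < Q" using K(1) by (simp add: Q_def)
    have r0: "0 < r" using t by (simp add: r_def add_nonneg_pos)
    have pa: "a ^ m \<le> p" unfolding p_def by (rule p1_ge[OF t])
    have p0: "0 < p" using pa a_pos(3)[of m] by linarith
    have "a ^ m * a ^ m \<le> K * b ^ m"
    proof -
      have "1 * (a ^ m)\<^sup>2 \<le> K * b ^ m" using K(1) by (intro mult_mono a_pow_b_pow) auto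
      then show ?thesis by (simp add: power2_eq_square)
    qed
    then have "a ^ m \<le> Q * (1 / a ^ m)" by (simp add: Q_def field_simps)
    \<comment> \<open>The slope p is at most a^m + Q t, and a^m is at most Q / a^m because a^2 < b;
      thus the curvature bound Q controls the slope on the length r.\<close>
    then have pQ: "p \<le> Q * r" using K(2)[OF t, of m] by (simp add: p_def Q_def r_def algebra_simps)
    have e1: "48 * (\<epsilon> * a ^ m) \<le> \<eta>"
      using c1 mult_right_mono[of 48 C "\<epsilon> * a ^ m"] K(1) \<epsilon> by (simp add: C_def)
    have e2: "48 * (Q * \<epsilon>\<^sup>2) \<le> \<eta>" using c2 by (simp add: C_def Q_def mult_ac)
    have \<eta>0: "0 \<le> \<eta>" using e2 Q0 by (smt (verit) mult_nonneg_nonneg zero_le_power2)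
    define \<alpha> where "\<alpha> = real q * (p * \<epsilon>)"
    define \<sigma> where "\<sigma> = real q * (Q * \<epsilon>\<^sup>2)"
    have \<alpha>0: "0 \<le> \<alpha>" and \<sigma>0: "0 \<le> \<sigma>" using p0 \<epsilon> Q0 by (auto simp: \<alpha>_def \<sigma>_def)
    have q4: "real q \<le> 4" using q by simp
    have "\<sigma> \<le> 4 * (Q * \<epsilon>\<^sup>2)" unfolding \<sigma>_def using q4 Q0 by (intro mult_right_mono) auto
    then have \<sigma>8: "\<sigma> \<le> 1 / 8" using e2 \<eta>1 by simp
    have homexp: "hom m x = exp (ell m x)" for x using hom_pos by (simp add: ell_def)
    have pt: "hom m (t + \<epsilon> * \<bar>g\<bar>) ^ q \<le> exp (real q * ell m t) * exp (\<alpha> * \<bar>g\<bar> + \<sigma> * g\<^sup>2)" for g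
    proof -
      have "ell m (t + \<epsilon> * \<bar>g\<bar>) \<le> ell m t + p * (\<epsilon> * \<bar>g\<bar>) + Q * (\<epsilon> * \<bar>g\<bar>)\<^sup>2"
        using K(4)[OF t, of "\<epsilon> * \<bar>g\<bar>" m] \<epsilon> by (simp add: p_def Q_def)
      then have "real q * ell m (t + \<epsilon> * \<bar>g\<bar>) \<le> real q * (ell m t + p * (\<epsilon> * \<bar>g\<bar>) + Q * (\<epsilon> * \<bar>g\<bar>)\<^sup>2)"
        by (intro mult_left_mono) auto
      also have "\<dots> = real q * ell m t + (\<alpha> * \<bar>g\<bar> + \<sigma> * g\<^sup>2)"
        by (simp add: \<alpha>_def \<sigma>_def power_mult_distrib algebra_simps)
      finally show ?thesis unfolding homexp exp_of_nat_mult[symmetric] exp_add[symmetric] by simp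
    qed
    have ib: "integrable N01 (\<lambda>g. exp (real q * ell m t) * exp (\<alpha> * \<bar>g\<bar> + \<sigma> * g\<^sup>2))"
      by (intro integrable_mult_right std_normal_exp_quadratic \<alpha>0 \<sigma>0 \<sigma>8)
    have meas: "(\<lambda>g. hom m (t + \<epsilon> * \<bar>g\<bar>) ^ q) \<in> borel_measurable N01"
    proof -
      have "continuous_on UNIV (hom m)"
        by (intro continuous_at_imp_continuous_on ballI DERIV_isCont[OF hom_deriv])
      then have [measurable]: "hom m \<in> borel_measurable borel" by (rule borel_measurable_continuous_onI)
      show ?thesis by measurable
    qed
    have i: "integrable N01 (\<lambda>g. hom m (t + \<epsilon> * \<bar>g\<bar>) ^ q)"
      by (rule Bochner_Integration.integrable_bound[OF ib meas])
        (use pt in \<open>auto simp: abs_of_pos[OF zero_less_power[OF hom_pos]] power_abs[symmetric]\<close>)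
    have "(\<integral>g. hom m (t + \<epsilon> * \<bar>g\<bar>) ^ q \<partial>N01) \<le> (\<integral>g. exp (real q * ell m t) * exp (\<alpha> * \<bar>g\<bar> + \<sigma> * g\<^sup>2) \<partial>N01)"
      by (rule integral_mono[OF i ib pt])
    also have "\<dots> \<le> exp (real q * ell m t) * exp (6 * \<alpha> + 4 * \<alpha>\<^sup>2 + 4 * \<sigma>)"
      using std_normal_exp_quadratic(2)[OF \<alpha>0 \<sigma>0 \<sigma>8] by simp
    also have "\<dots> \<le> exp (real q * ell m t) * exp (real q * (p * (\<eta> * r)))"
    proof -
      have ar: "1 \<le> a ^ m * r" using t by (simp add: r_def distrib_left)
      have pr: "1 \<le> p * r" using ar mult_right_mono[OF pa, of r] r0 by linarith
      have 1: "18 * (p * \<epsilon>) \<le> p * (\<eta> * r)"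
      proof -
        have "18 * \<epsilon> * 1 \<le> 18 * \<epsilon> * (a ^ m * r)" using ar \<epsilon> by (intro mult_left_mono) auto
        also have "\<dots> = 18 * (\<epsilon> * a ^ m) * r" by simp
        also have "\<dots> \<le> \<eta> * r" using e1 r0 mult_nonneg_nonneg[OF \<epsilon> a_pos(4), of m] by (intro mult_right_mono) auto
        finally have "p * (18 * \<epsilon>) \<le> p * (\<eta> * r)" using p0 by (intro mult_left_mono) auto
        then show ?thesis by simp
      qed
      have 2: "48 * (p * \<epsilon>)\<^sup>2 \<le> p * (\<eta> * r)"
      proof -
        have "48 * (p * \<epsilon>\<^sup>2) \<le> 48 * (Q * r * \<epsilon>\<^sup>2)" using pQ by (intro mult_left_mono mult_right_mono) auto
        also have "\<dots> = 48 * (Q * \<epsilon>\<^sup>2) * r" by simp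
        also have "\<dots> \<le> \<eta> * r" using e2 r0 by (intro mult_right_mono) auto
        finally have "p * (48 * (p * \<epsilon>\<^sup>2)) \<le> p * (\<eta> * r)" using p0 by (intro mult_left_mono) auto
        then show ?thesis by (simp add: power2_eq_square mult_ac)
      qed
      have 3: "12 * (Q * \<epsilon>\<^sup>2) \<le> p * (\<eta> * r)"
      proof -
        have "\<eta> * 1 \<le> \<eta> * (p * r)" using pr \<eta>0 by (intro mult_left_mono) auto
        moreover have "0 \<le> Q * \<epsilon>\<^sup>2" using Q0 by simp
        ultimately show ?thesis using e2 by (simp add: mult_ac)
      qed
      have 4: "4 * \<alpha>\<^sup>2 \<le> real q * (16 * (p * \<epsilon>)\<^sup>2)"
      proof -
        have "real q * real q \<le> real q * 4" using q4 by (intro mult_left_mono) auto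
        then have "(real q * real q) * (4 * (p * \<epsilon>)\<^sup>2) \<le> (real q * 4) * (4 * (p * \<epsilon>)\<^sup>2)"
          by (intro mult_right_mono) auto
        moreover have "4 * \<alpha>\<^sup>2 = (real q * real q) * (4 * (p * \<epsilon>)\<^sup>2)"
          by (simp add: \<alpha>_def power2_eq_square)
        ultimately show ?thesis by linarith
      qed
      have "6 * \<alpha> + 4 * \<alpha>\<^sup>2 + 4 * \<sigma> \<le> real q * (6 * (p * \<epsilon>) + 16 * (p * \<epsilon>)\<^sup>2 + 4 * (Q * \<epsilon>\<^sup>2))"
        using 4 by (simp add: \<alpha>_def \<sigma>_def algebra_simps)
      also have "\<dots> \<le> real q * (p * (\<eta> * r))"
        using 1 2 3 by (intro mult_left_mono) auto
      finally show ?thesis by simp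
    qed
    also have "\<dots> = exp (real q * (ell m t + p * (\<eta> * r)))" by (simp add: exp_add algebra_simps)
    also have "\<dots> \<le> exp (real q * ell m (t + \<eta> * r))"
      using K(3)[OF t, of "\<eta> * r" m] \<eta>0 r0 by (auto simp: p_def intro!: mult_left_mono)
    also have "\<dots> = hom m (t + \<eta> * r) ^ q" unfolding homexp exp_of_nat_mult by simp
    finally show ?thesis using i by (simp add: r_def)
  qed
  moreover have "1 \<le> C" using K(1) by (simp add: C_def)
  ultimately show ?thesis by (intro exI[of _ C]) blast
qed

text \<open>The growth bound degrades by a shift of order \<open>1 / a ^ n\<close>. Near \<open>h0\<close> this loss is regained by
  interpolating with the value at \<open>h0\<close>, which is known independently.\<close>

lemma growth_step:
  obtains C where "1 \<le> C" and "\<And>\<beta> n y y' h0 c \<xi> \<xi>' \<zeta> v. \<lbrakk>0 \<le> \<beta>; \<beta> \<le> 1; \<And>h. 0 \<le> y h; \<And>h. 0 \<le> y' h;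
     expoly (\<lambda>h. (ff (y h))\<^sup>2); expoly (\<lambda>h. (y' h)\<^sup>2);
     \<And>h. (y' h)\<^sup>2 \<le> heat (s \<beta> n) (\<lambda>h. (ff (y h))\<^sup>2) h;
     \<And>v. 0 \<le> v \<Longrightarrow> y (h0 + v) \<le> hom n (c * (v + \<xi> / a ^ n));
     1 \<le> c; c \<le> 2; 0 \<le> \<xi>; 0 \<le> \<xi>'; y' h0 \<le> 1 + \<xi>'; 0 < \<zeta>; C * \<zeta> \<le> 1;
     C * (\<beta> * \<rho> ^ n) \<le> \<zeta>\<^sup>2; \<xi> \<le> \<zeta>\<^sup>2; 0 \<le> v\<rbrakk> \<Longrightarrow>
     y' (h0 + v) \<le> hom (Suc n) (c * (1 + C * \<zeta>) * (v + \<xi>' / a ^ Suc n))"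
proof -
  \<comment> \<open>The functions y and y' are abstract because the step serves twice: for
    \<open>AA\<close>, and for the square root of \<open>DD\<close>. The one-step inequality is
    therefore stated for squares, which suits both.\<close>
  obtain C0 where C0: "1 \<le> C0"
    "\<And>m t \<epsilon> \<eta> q. q \<le> (4::nat) \<Longrightarrow> 0 \<le> t \<Longrightarrow> 0 \<le> \<epsilon> \<Longrightarrow> \<eta> \<le> 1 \<Longrightarrow> C0 * (\<epsilon> * a ^ m) \<le> \<eta> \<Longrightarrow> C0 * (b ^ m * \<epsilon>\<^sup>2) \<le> \<eta> \<Longrightarrow>
     integrable N01 (\<lambda>g. hom m (t + \<epsilon> * \<bar>g\<bar>) ^ q) \<and>
     (\<integral>g. hom m (t + \<epsilon> * \<bar>g\<bar>) ^ q \<partial>N01) \<le> hom m (t + \<eta> * (t + 1 / a ^ m)) ^ q"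
    using hom_heat by metis
  obtain K where K: "1 \<le> K"
    "\<And>m v. 0 \<le> v \<Longrightarrow> a ^ m * v \<le> 1 / K \<Longrightarrow> hom m v \<le> 1 + a ^ m * v + K * (a ^ m * v)\<^sup>2"
    using hom_window_small by blast
  define D where "D = 14 * (K + 2)"
  define C where "C = 6 + 7 * D + 4 * (C0 * b)"
  have D0: "42 \<le> D" "14 * K \<le> D" using K(1) by (auto simp: D_def)
  have "1 * 2 \<le> C0 * b" using C0(1) b_gt by (intro mult_mono) auto
  then have C1: "1 \<le> C" "4 * (C0 * b) \<le> C" "6 + 7 * D \<le> C" "14 * K \<le> C"
    using D0 by (auto simp: C_def)
  have "y' (h0 + v) \<le> hom (Suc n) (c * (1 + C * \<zeta>) * (v + \<xi>' / a ^ Suc n))"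
    if \<beta>: "0 \<le> \<beta>" "\<beta> \<le> 1" and y0: "\<And>h. 0 \<le> y h" and y'0: "\<And>h. 0 \<le> y' h"
      and ey: "expoly (\<lambda>h. (ff (y h))\<^sup>2)" and ey': "expoly (\<lambda>h. (y' h)\<^sup>2)"
      and step: "\<And>h. (y' h)\<^sup>2 \<le> heat (s \<beta> n) (\<lambda>h. (ff (y h))\<^sup>2) h"
      and bd: "\<And>v. 0 \<le> v \<Longrightarrow> y (h0 + v) \<le> hom n (c * (v + \<xi> / a ^ n))"
      and c: "1 \<le> c" "c \<le> 2" and \<xi>: "0 \<le> \<xi>" and \<xi>': "0 \<le> \<xi>'" and y'1: "y' h0 \<le> 1 + \<xi>'"
      and \<zeta>: "0 < \<zeta>" "C * \<zeta> \<le> 1" and \<zeta>\<rho>: "C * (\<beta> * \<rho> ^ n) \<le> \<zeta>\<^sup>2" and \<xi>\<zeta>: "\<xi> \<le> \<zeta>\<^sup>2" and v: "0 \<le> v"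
    for \<beta> n y y' h0 c \<xi> \<xi>' \<zeta> v
  proof -
    let ?m = "Suc n"
    define r where "r = 1 / a ^ ?m"
    have r0: "0 < r" by (simp add: r_def)
    have ar: "a ^ ?m * r = 1" by (simp add: r_def)
    have rn: "1 / a ^ n = a * r" by (simp add: r_def)
    have \<zeta>1: "\<zeta> \<le> 1" using \<zeta> C1(1) mult_right_mono[of 1 C \<zeta>] by linarith
    have \<zeta>2: "\<zeta>\<^sup>2 \<le> \<zeta>" using \<zeta> \<zeta>1 mult_left_mono[of \<zeta> 1 \<zeta>] by (simp add: power2_eq_square)
    define \<epsilon> where "\<epsilon> = c * s \<beta> n"
    have s0: "0 \<le> s \<beta> n" by (rule s_nonneg[OF \<beta>(1)])
    have \<epsilon>0: "0 \<le> \<epsilon>" using s0 c by (simp add: \<epsilon>_def)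
    have \<epsilon>2: "\<epsilon> \<le> 2 * s \<beta> n" unfolding \<epsilon>_def using c s0 by (intro mult_right_mono) auto
    have \<beta>\<rho>: "0 \<le> \<beta> * \<rho> ^ n" "\<beta> * \<rho> ^ n \<le> 1" using \<beta> \<rho>_pow_le_1[of n] mult_mono[of \<beta> 1 "\<rho> ^ n" 1] by auto
    have 4: "4 * (C0 * b) * (\<beta> * \<rho> ^ n) \<le> \<zeta>\<^sup>2"
      using mult_right_mono[OF C1(2) \<beta>\<rho>(1)] \<zeta>\<rho> by linarith
    have k1: "C0 * (\<epsilon> * a ^ ?m) \<le> \<zeta>\<^sup>2"
    proof -
      have "\<epsilon> * a ^ ?m \<le> 2 * s \<beta> n * a ^ ?m" using \<epsilon>2 by (intro mult_right_mono) auto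
      also have "\<dots> = 2 * a * (s \<beta> n * a ^ n)" by simp
      also have "\<dots> \<le> 2 * b * (\<beta> * \<rho> ^ n)"
        using a_lt b_gt s0 by (intro mult_mono[OF _ s_a[OF \<beta>(1)]]) auto
      finally have "C0 * (\<epsilon> * a ^ ?m) \<le> C0 * (2 * b * (\<beta> * \<rho> ^ n))" using C0(1) by (intro mult_left_mono) auto
      also have "\<dots> \<le> 4 * (C0 * b) * (\<beta> * \<rho> ^ n)"
      proof -
        have "0 \<le> (C0 * b) * (\<beta> * \<rho> ^ n)" using C0(1) by (intro mult_nonneg_nonneg[OF _ \<beta>\<rho>(1)]) auto
        moreover have "C0 * (2 * b * (\<beta> * \<rho> ^ n)) = 2 * ((C0 * b) * (\<beta> * \<rho> ^ n))" by simp
        ultimately show ?thesis by linarith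
      qed
      finally show ?thesis using 4 by linarith
    qed
    have k2: "C0 * (b ^ ?m * \<epsilon>\<^sup>2) \<le> \<zeta>\<^sup>2"
    proof -
      have "\<epsilon>\<^sup>2 \<le> (2 * s \<beta> n)\<^sup>2" using \<epsilon>2 \<epsilon>0 by (intro power_mono) auto
      then have "b ^ ?m * \<epsilon>\<^sup>2 \<le> b ^ ?m * (2 * s \<beta> n)\<^sup>2" by (intro mult_left_mono) auto
      also have "\<dots> = 4 * b * ((s \<beta> n)\<^sup>2 * b ^ n)" by (simp add: power_mult_distrib)
      also have "\<dots> \<le> 4 * b * (\<beta> * \<rho> ^ n)\<^sup>2" using s_sq_b[of \<beta> n] by (intro mult_left_mono) auto
      also have "\<dots> \<le> 4 * b * (\<beta> * \<rho> ^ n)"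
        using \<beta>\<rho> mult_left_mono[OF \<beta>\<rho>(2) \<beta>\<rho>(1)] by (intro mult_left_mono) (auto simp: power2_eq_square)
      finally have "C0 * (b ^ ?m * \<epsilon>\<^sup>2) \<le> C0 * (4 * b * (\<beta> * \<rho> ^ n))" using C0(1) by (intro mult_left_mono) auto
      then show ?thesis using 4 by (simp add: mult_ac)
    qed
    have \<zeta>sq1: "\<zeta>\<^sup>2 \<le> 1" using \<zeta>1 \<zeta>2 by linarith
    \<comment> \<open>Smoothing alone: with \<eta> = \<zeta>^2 in the stability lemma, the argument
      grows by the relative amount \<zeta>^2 and by a shift 5 \<zeta>^2 r. Summing such shifts over
      the generations would be too costly close to h0.\<close>
    have S1: "y' (h0 + v) \<le> hom ?m (c * ((1 + \<zeta>\<^sup>2) * v + 5 * \<zeta>\<^sup>2 * r))" if v: "0 \<le> v" for v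
    proof -
      define t where "t = c * (v + \<xi> / a ^ n)"
      have t0: "0 \<le> t" using c v \<xi> by (simp add: t_def)
      note kl = C0(2)[of 2 t \<epsilon> "\<zeta>\<^sup>2" ?m, OF _ t0 \<epsilon>0 \<zeta>sq1 k1 k2, simplified]
      have "(y' (h0 + v))\<^sup>2 \<le> heat (s \<beta> n) (\<lambda>h. (ff (y h))\<^sup>2) (h0 + v)" by (rule step)
      also have "\<dots> \<le> (\<integral>g. hom ?m (t + \<epsilon> * \<bar>g\<bar>) ^ 2 \<partial>N01)"
      proof (rule heat_abs_le[OF ey s0])
        show "integrable N01 (\<lambda>g. hom ?m (t + \<epsilon> * \<bar>g\<bar>) ^ 2)" using kl by simp
        fix g :: real
        have "y (h0 + (v + s \<beta> n * \<bar>g\<bar>)) \<le> hom n (c * (v + s \<beta> n * \<bar>g\<bar> + \<xi> / a ^ n))"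
          using v s0 by (intro bd) auto
        also have "c * (v + s \<beta> n * \<bar>g\<bar> + \<xi> / a ^ n) = t + \<epsilon> * \<bar>g\<bar>" by (simp add: t_def \<epsilon>_def algebra_simps)
        finally have "ff (y (h0 + v + s \<beta> n * \<bar>g\<bar>)) \<le> hom ?m (t + \<epsilon> * \<bar>g\<bar>)"
          using y0 by (auto simp: add.assoc intro!: ff_mono)
        then show "(ff (y (h0 + v + s \<beta> n * \<bar>g\<bar>)))\<^sup>2 \<le> (hom ?m (t + \<epsilon> * \<bar>g\<bar>))\<^sup>2"
          using ff_pos by (intro power_mono) (auto intro: less_imp_le)
      qed
      also have "\<dots> \<le> hom ?m (t + \<zeta>\<^sup>2 * (t + r)) ^ 2" using kl by (simp add: r_def)
      finally have "y' (h0 + v) \<le> hom ?m (t + \<zeta>\<^sup>2 * (t + r))"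
        by (rule power2_le_imp_le) (rule less_imp_le[OF hom_pos])
      also have "\<dots> \<le> hom ?m (c * ((1 + \<zeta>\<^sup>2) * v + 5 * \<zeta>\<^sup>2 * r))"
      proof (rule hom_mono)
        have "\<xi> / a ^ n = \<xi> * (a * r)" unfolding rn[symmetric] by simp
        also have "\<dots> \<le> \<zeta>\<^sup>2 * (2 * r)" using \<xi>\<zeta> a_lt r0 \<xi> by (intro mult_mono) auto
        finally have "t \<le> c * (v + \<zeta>\<^sup>2 * (2 * r))" unfolding t_def using c by (intro mult_left_mono) auto
        then have "(1 + \<zeta>\<^sup>2) * t \<le> (1 + \<zeta>\<^sup>2) * (c * (v + \<zeta>\<^sup>2 * (2 * r)))" by (intro mult_left_mono) auto
        also have "\<dots> = c * ((1 + \<zeta>\<^sup>2) * v + (1 + \<zeta>\<^sup>2) * (\<zeta>\<^sup>2 * (2 * r)))" by (simp add: algebra_simps)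
        also have "\<dots> \<le> c * ((1 + \<zeta>\<^sup>2) * v + 2 * (\<zeta>\<^sup>2 * (2 * r)))"
          using \<zeta>sq1 r0 c by (intro mult_left_mono add_left_mono mult_right_mono) auto
        finally have "(1 + \<zeta>\<^sup>2) * t \<le> c * ((1 + \<zeta>\<^sup>2) * v + 2 * (\<zeta>\<^sup>2 * (2 * r)))" .
        moreover have "1 * (\<zeta>\<^sup>2 * r) \<le> c * (\<zeta>\<^sup>2 * r)" using c r0 by (intro mult_right_mono) auto
        ultimately show "t + \<zeta>\<^sup>2 * (t + r) \<le> c * ((1 + \<zeta>\<^sup>2) * v + 5 * \<zeta>\<^sup>2 * r)"
          by (simp add: algebra_simps)
      qed
      finally show ?thesis .
    qed
    \<comment> \<open>The crossover. For v \<ge> \<zeta> r the shift of order \<zeta>^2 r is at most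
      of order \<zeta> v, so it becomes a relative error of order \<zeta>. The square root of the
      smoothing error thus determines \<zeta>.\<close>
    define v1 where "v1 = \<zeta> * r"
    have v10: "0 < v1" using \<zeta> r0 by (simp add: v1_def)
    have S2: "y' (h0 + v) \<le> hom ?m (c * (1 + 6 * \<zeta>) * v)" if v: "v1 \<le> v" for v
    proof -
      have "\<zeta>\<^sup>2 * r \<le> \<zeta> * v" using v \<zeta> by (simp add: v1_def power2_eq_square mult.assoc)
      moreover have "\<zeta>\<^sup>2 * v \<le> \<zeta> * v" using \<zeta>2 v v10 by (intro mult_right_mono) auto
      ultimately have "(1 + \<zeta>\<^sup>2) * v + 5 * \<zeta>\<^sup>2 * r \<le> (1 + 6 * \<zeta>) * v" by (simp add: algebra_simps)
      then have "c * ((1 + \<zeta>\<^sup>2) * v + 5 * \<zeta>\<^sup>2 * r) \<le> c * (1 + 6 * \<zeta>) * v"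
        using c mult_left_mono[of _ _ c] by (simp add: mult.assoc)
      then show ?thesis using S1[of v] hom_mono v v10 by (meson less_imp_le order_trans)
    qed
    show ?thesis
    proof (cases "v1 \<le> v")
      case True
      have "c * (1 + 6 * \<zeta>) * v \<le> c * (1 + C * \<zeta>) * (v + \<xi>' / a ^ ?m)"
        using c \<zeta> C1(3) D0 v \<xi>' by (intro mult_mono add_mono mult_right_mono) auto
      then show ?thesis using S2[OF True] hom_mono by (meson order_trans)
    next
      case False
      \<comment> \<open>Below the crossover the square of y' is interpolated by convexity between
        h0, where it is at most (1 + \<xi>')^2, and h0 + v1, where the bound just proved is sharp to
        first order. The excess over the value at h0 is then linear in v.\<close>
      define l where "l = v / v1"
      have l: "0 \<le> l" "l \<le> 1" "v = l * v1" using v v10 False by (auto simp: l_def)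
      define x where "x = c * (1 + 6 * \<zeta>) * \<zeta>"
      have "c * (1 + 6 * \<zeta>) \<le> 2 * 7" using c \<zeta> \<zeta>1 by (intro mult_mono) auto
      then have x14: "x \<le> 14 * \<zeta>" unfolding x_def using \<zeta> by (intro mult_right_mono) auto
      have x0: "0 < x" using c \<zeta> by (simp add: x_def)
      have "K * x \<le> K * (14 * \<zeta>)" using K(1) x14 by (intro mult_left_mono) auto
      also have "\<dots> \<le> C * \<zeta>" using mult_right_mono[OF C1(4), of \<zeta>] \<zeta> by simp
      finally have Kx: "K * x \<le> 1" using \<zeta> by linarith
      have xv: "a ^ ?m * (c * (1 + 6 * \<zeta>) * v1) = x"
        using ar by (simp add: x_def v1_def mult_ac)
      define z where "z = x + K * x\<^sup>2"
      have z0: "0 < z" using x0 K(1) by (simp add: z_def add_pos_nonneg)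
      have z2: "z \<le> 2 * x" using mult_right_mono[OF Kx, of x] x0 by (simp add: z_def power2_eq_square mult_ac)
      have "hom ?m (c * (1 + 6 * \<zeta>) * v1) \<le> 1 + z"
        using K(2)[of "c * (1 + 6 * \<zeta>) * v1" ?m] Kx K(1) c \<zeta> v10 unfolding xv z_def
        by (simp add: field_simps)
      then have y1: "y' (h0 + v1) \<le> 1 + z" using S2[of v1] by simp
      have "(y' (h0 + v))\<^sup>2 \<le> (1 - l) * (y' h0)\<^sup>2 + l * (y' (h0 + v1))\<^sup>2"
        using expoly_convex[OF ey' l(1,2), of h0 v1] l(3) by simp
      also have "\<dots> \<le> (1 - l) * (1 + \<xi>')\<^sup>2 + l * (1 + z)\<^sup>2"
        using l y'1 y1 y'0 by (intro add_mono mult_left_mono power_mono) auto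
      also have "\<dots> \<le> (1 - l) * (1 + \<xi>')\<^sup>2 + l * ((1 + z)\<^sup>2 * (1 + \<xi>')\<^sup>2)"
        using l \<xi>' by (intro add_left_mono mult_left_mono le_mult_ge_1) (auto intro!: one_le_power)
      also have "\<dots> = (1 + \<xi>')\<^sup>2 * (1 + l * (2 * z + z\<^sup>2))"
        by (simp add: power2_eq_square algebra_simps)
      also have "\<dots> \<le> (1 + \<xi>')\<^sup>2 * (1 + l * (z + z\<^sup>2 / 2))\<^sup>2"
      proof (intro mult_left_mono)
        have sq: "1 + 2 * y \<le> (1 + y)\<^sup>2" for y :: real by (simp add: power2_sum)
        have "l * (2 * z + z\<^sup>2) = 2 * (l * (z + z\<^sup>2 / 2))" by (simp add: algebra_simps)
        then show "1 + l * (2 * z + z\<^sup>2) \<le> (1 + l * (z + z\<^sup>2 / 2))\<^sup>2" using sq by metis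
      qed simp
      also have "\<dots> = ((1 + \<xi>') * (1 + l * (z + z\<^sup>2 / 2)))\<^sup>2" by (simp add: power_mult_distrib)
      finally have "y' (h0 + v) \<le> (1 + \<xi>') * (1 + l * (z + z\<^sup>2 / 2))"
        by (rule power2_le_imp_le) (use \<xi>' l z0 in \<open>auto intro!: mult_nonneg_nonneg add_nonneg_nonneg\<close>)
      also have "\<dots> \<le> exp \<xi>' * exp (l * (z + z\<^sup>2 / 2))"
        using l z0 by (intro mult_mono exp_ge_add_one_self) (auto intro!: add_nonneg_nonneg mult_nonneg_nonneg)
      also have "\<dots> = exp (\<xi>' + l * (z + z\<^sup>2 / 2))" by (simp add: exp_add)
      also have "\<dots> \<le> exp (a ^ ?m * (c * (1 + C * \<zeta>) * (v + \<xi>' / a ^ ?m)))"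
      proof -
        have "z\<^sup>2 \<le> (2 * x)\<^sup>2" using z0 z2 by (intro power_mono) auto
        then have "z + z\<^sup>2 / 2 \<le> x + (K + 2) * x\<^sup>2" by (simp add: z_def power_mult_distrib algebra_simps)
        also have "\<dots> = x * (1 + (K + 2) * x)" by (simp add: power2_eq_square algebra_simps)
        also have "\<dots> \<le> x * (1 + (K + 2) * (14 * \<zeta>))"
          using x14 x0 K(1) by (intro mult_left_mono add_left_mono) auto
        finally have "l * (z + z\<^sup>2 / 2) \<le> l * (x * (1 + D * \<zeta>))"
          using l by (intro mult_left_mono) (auto simp: D_def algebra_simps)
        also have "l * (x * (1 + D * \<zeta>)) = a ^ ?m * c * v * ((1 + 6 * \<zeta>) * (1 + D * \<zeta>))"
          unfolding l(3) xv[symmetric] by (simp add: mult_ac)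
        also have "\<dots> \<le> a ^ ?m * c * v * (1 + C * \<zeta>)"
        proof (intro mult_left_mono)
          have "\<zeta> * \<zeta> \<le> \<zeta>" using \<zeta>2 by (simp add: power2_eq_square)
          then have "D * (\<zeta> * \<zeta>) \<le> D * \<zeta>" using D0 by (intro mult_left_mono) auto
          then have "(1 + 6 * \<zeta>) * (1 + D * \<zeta>) \<le> 1 + (6 + 7 * D) * \<zeta>" by (simp add: algebra_simps)
          also have "\<dots> \<le> 1 + C * \<zeta>" using C1(3) \<zeta> by (intro add_left_mono mult_right_mono) auto
          finally show "(1 + 6 * \<zeta>) * (1 + D * \<zeta>) \<le> 1 + C * \<zeta>" .
        qed (use c v in auto)
        finally have A: "l * (z + z\<^sup>2 / 2) \<le> a ^ ?m * c * v * (1 + C * \<zeta>)" .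
        have "1 * 1 \<le> c * (1 + C * \<zeta>)" using c C1(1) \<zeta> by (intro mult_mono) auto
        then have "1 * \<xi>' \<le> c * (1 + C * \<zeta>) * \<xi>'" using \<xi>' by (intro mult_right_mono) auto
        with A have "\<xi>' + l * (z + z\<^sup>2 / 2) \<le> a ^ ?m * c * v * (1 + C * \<zeta>) + c * (1 + C * \<zeta>) * \<xi>'" by linarith
        also have "\<dots> = a ^ ?m * (c * (1 + C * \<zeta>) * (v + \<xi>' / a ^ ?m))"
        proof -
          have "A * (d * (v + X)) = A * c * v * k + d * (A * X)" if "d = c * k" for A d X k :: real
            using that by (simp add: algebra_simps)
          from this[OF refl, of "a ^ ?m" "1 + C * \<zeta>" "\<xi>' / a ^ ?m"] show ?thesis
            by (simp del: power_Suc)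
        qed
        finally show ?thesis by simp
      qed
      \<comment> \<open>The interpolated bound has been brought to the form exp (a^m t), which
        \<open>hom m t\<close> dominates.\<close>
      also have "\<dots> \<le> hom ?m (c * (1 + C * \<zeta>) * (v + \<xi>' / a ^ ?m))"
        using c C1(1) \<zeta> v \<xi>' by (intro hom_ge_exp mult_nonneg_nonneg add_nonneg_nonneg) auto
      finally show ?thesis .
    qed
  qed
  with C1(1) show ?thesis by (rule that)
qed

text \<open>The second-order increment bound with \<sigma> = 1 / a^n: the ratio s_n a^n is at most
  \<beta> \<rho>^n, and the smoothed value at the shifted point is bounded as long as a^n u is. The
  fourth power of \<open>hom\<close> covers ff A, (ff A)^2 and D^2 alike. The threshold \<delta>
  does not depend on the window X.\<close>

lemma heat_window:
  "\<exists>\<delta>>0. \<forall>X. \<exists>C\<ge>1. \<forall>\<beta> n G h0 \<xi> u. 0 \<le> \<beta> \<longrightarrow> \<beta> \<le> \<delta> \<longrightarrow> expoly G \<longrightarrow> 0 \<le> \<xi> \<longrightarrow> \<xi> \<le> 1 \<longrightarrow>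
     (\<forall>v\<ge>0. G (h0 + v) \<le> hom n (2 * (v + \<xi> / a ^ n)) ^ 4) \<longrightarrow> 0 \<le> u \<longrightarrow> a ^ n * u \<le> X \<longrightarrow>
     heat (s \<beta> n) G (h0 + u) - G (h0 + u) \<le> C * (\<beta> * \<rho> ^ n)\<^sup>2"
proof -
  obtain C0 where C0: "1 \<le> C0"
    "\<And>m t \<epsilon> \<eta> q. q \<le> (4::nat) \<Longrightarrow> 0 \<le> t \<Longrightarrow> 0 \<le> \<epsilon> \<Longrightarrow> \<eta> \<le> 1 \<Longrightarrow> C0 * (\<epsilon> * a ^ m) \<le> \<eta> \<Longrightarrow> C0 * (b ^ m * \<epsilon>\<^sup>2) \<le> \<eta> \<Longrightarrow>
     integrable N01 (\<lambda>g. hom m (t + \<epsilon> * \<bar>g\<bar>) ^ q) \<and>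
     (\<integral>g. hom m (t + \<epsilon> * \<bar>g\<bar>) ^ q \<partial>N01) \<le> hom m (t + \<eta> * (t + 1 / a ^ m)) ^ q"
    using hom_heat by metis
  define \<delta> where "\<delta> = 1 / (4 * C0)"
  have \<delta>: "0 < \<delta>" "\<delta> \<le> 1" "4 * C0 * \<delta> = 1" using C0(1) by (auto simp: \<delta>_def)
  have "\<exists>C\<ge>1. \<forall>\<beta> n G h0 \<xi> u. 0 \<le> \<beta> \<longrightarrow> \<beta> \<le> \<delta> \<longrightarrow> expoly G \<longrightarrow> 0 \<le> \<xi> \<longrightarrow> \<xi> \<le> 1 \<longrightarrow>
     (\<forall>v\<ge>0. G (h0 + v) \<le> hom n (2 * (v + \<xi> / a ^ n)) ^ 4) \<longrightarrow> 0 \<le> u \<longrightarrow> a ^ n * u \<le> X \<longrightarrow>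
     heat (s \<beta> n) G (h0 + u) - G (h0 + u) \<le> C * (\<beta> * \<rho> ^ n)\<^sup>2" for X
  proof -
    obtain W where W: "1 \<le> W" "\<And>m v. 0 \<le> v \<Longrightarrow> a ^ m * v \<le> 4 * X + 9 \<Longrightarrow> hom m v \<le> 1 + W * (a ^ m * v)"
      using hom_window[of "4 * X + 9"] by blast
    define E where "E = 1 + W * max 0 (4 * X + 9)"
    have E1: "1 \<le> E" using W(1) by (simp add: E_def)
    have "heat (s \<beta> n) G (h0 + u) - G (h0 + u) \<le> E ^ 4 * (\<beta> * \<rho> ^ n)\<^sup>2"
      if \<beta>: "0 \<le> \<beta>" "\<beta> \<le> \<delta>" and G: "expoly G" and \<xi>: "0 \<le> \<xi>" "\<xi> \<le> 1"
        and bd: "\<And>v. 0 \<le> v \<Longrightarrow> G (h0 + v) \<le> hom n (2 * (v + \<xi> / a ^ n)) ^ 4"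
        and u: "0 \<le> u" "a ^ n * u \<le> X" for \<beta> n G h0 \<xi> u
    proof -
      define r where "r = 1 / a ^ n"
      have r0: "0 < r" and ar: "a ^ n * r = 1" by (auto simp: r_def)
      have s0: "0 \<le> s \<beta> n" by (rule s_nonneg[OF \<beta>(1)])
      define t where "t = 2 * (u + r + \<xi> * r)"
      have t0: "0 \<le> t" using u r0 \<xi> by (simp add: t_def)
      have \<beta>\<rho>: "0 \<le> \<beta> * \<rho> ^ n" "\<beta> * \<rho> ^ n \<le> \<delta>"
        using \<beta> \<rho>_pow_le_1[of n] mult_mono[of \<beta> \<delta> "\<rho> ^ n" 1] by auto
      have k1: "C0 * ((2 * s \<beta> n) * a ^ n) \<le> 1"
      proof -
        have "C0 * ((2 * s \<beta> n) * a ^ n) = 2 * C0 * (s \<beta> n * a ^ n)" by simp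
        also have "\<dots> \<le> 4 * C0 * \<delta>"
          using s_a[OF \<beta>(1), of n] \<beta>\<rho> C0(1) s0 by (intro mult_mono) auto
        finally show ?thesis using \<delta> by simp
      qed
      have k2: "C0 * (b ^ n * (2 * s \<beta> n)\<^sup>2) \<le> 1"
      proof -
        have "C0 * (b ^ n * (2 * s \<beta> n)\<^sup>2) = 4 * C0 * ((s \<beta> n)\<^sup>2 * b ^ n)" by (simp add: power_mult_distrib)
        also have "\<dots> \<le> 4 * C0 * (\<delta> * 1)"
        proof (intro mult_left_mono)
          have "(\<beta> * \<rho> ^ n) * (\<beta> * \<rho> ^ n) \<le> \<delta> * 1" using \<beta>\<rho> \<delta> by (intro mult_mono) auto
          then show "(s \<beta> n)\<^sup>2 * b ^ n \<le> \<delta> * 1" using s_sq_b[of \<beta> n] by (simp add: power2_eq_square)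
        qed (use C0(1) in auto)
        finally show ?thesis using \<delta> by simp
      qed
      note kl = C0(2)[of 4 t "2 * s \<beta> n" 1 n, OF _ t0 _ _ k1 k2, simplified]
      have "heat (s \<beta> n) G (h0 + u) - G (h0 + u) \<le> (s \<beta> n / r)\<^sup>2 * heat (s \<beta> n) G (h0 + u + r)"
        by (rule heat_increment_le[OF G r0])
      also have "\<dots> \<le> (\<beta> * \<rho> ^ n)\<^sup>2 * E ^ 4"
      proof (intro mult_mono)
        show "(s \<beta> n / r)\<^sup>2 \<le> (\<beta> * \<rho> ^ n)\<^sup>2"
          using s_a[OF \<beta>(1), of n] s0 by (intro power_mono) (auto simp: r_def)
        have "heat (s \<beta> n) G (h0 + u + r) \<le> (\<integral>g. hom n (t + (2 * s \<beta> n) * \<bar>g\<bar>) ^ 4 \<partial>N01)"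
        proof (rule heat_abs_le[OF G s0])
          show "integrable N01 (\<lambda>g. hom n (t + (2 * s \<beta> n) * \<bar>g\<bar>) ^ 4)" using kl s0 by simp
          fix g :: real
          have "G (h0 + (u + r + s \<beta> n * \<bar>g\<bar>)) \<le> hom n (2 * (u + r + s \<beta> n * \<bar>g\<bar> + \<xi> / a ^ n)) ^ 4"
            using u r0 s0 by (intro bd) auto
          also have "2 * (u + r + s \<beta> n * \<bar>g\<bar> + \<xi> / a ^ n) = t + (2 * s \<beta> n) * \<bar>g\<bar>"
            by (simp add: t_def r_def algebra_simps)
          finally show "G (h0 + u + r + s \<beta> n * \<bar>g\<bar>) \<le> hom n (t + (2 * s \<beta> n) * \<bar>g\<bar>) ^ 4"
            by (simp add: add.assoc)
        qed
        also have "\<dots> \<le> hom n (t + (t + r)) ^ 4" using kl s0 by (simp add: r_def)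
        also have "\<dots> \<le> E ^ 4"
        proof (rule power_mono)
          have eq: "a ^ n * (t + (t + r)) = 4 * (a ^ n * u) + 5 + 4 * \<xi>"
          proof -
            have "a ^ n * (t + (t + r)) = 4 * (a ^ n * u) + 5 * (a ^ n * r) + 4 * \<xi> * (a ^ n * r)"
              by (simp add: t_def algebra_simps)
            then show ?thesis by (simp add: ar)
          qed
          have "hom n (t + (t + r)) \<le> 1 + W * (a ^ n * (t + (t + r)))"
            using t0 r0 u \<xi> eq by (intro W(2)) auto
          also have "\<dots> \<le> E" unfolding E_def eq using W(1) u \<xi>
            by (intro add_left_mono mult_left_mono) auto
          finally show "hom n (t + (t + r)) \<le> E" .
        qed (rule less_imp_le[OF hom_pos])
        finally show "heat (s \<beta> n) G (h0 + u + r) \<le> E ^ 4" .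
      qed (use expoly_nonneg[OF expoly_heat[OF G]] in auto)
      finally show ?thesis by (simp add: mult.commute)
    qed
    then show ?thesis using E1 by (intro exI[of _ "E ^ 4"]) (auto intro!: one_le_power)
  qed
  then show ?thesis using \<delta>(1) by blast
qed

section \<open>The first moment at and above the annealed critical point\<close>

lemma prod_le_2:
  fixes z :: "nat \<Rightarrow> real"
  assumes "\<And>j. 0 \<le> z j" "(\<Sum>j<n. z j) \<le> 1 / 2"
  shows "(\<Prod>j<n. 1 + z j) \<le> 2" and "1 \<le> (\<Prod>j<n. 1 + z j)"
proof -
  have "(\<Prod>j<n. 1 + z j) \<le> (\<Prod>j<n. exp (z j))"
    using assms(1) by (intro prod_mono) (auto simp: add_nonneg_nonneg)
  also have "\<dots> = exp (\<Sum>j<n. z j)" by (simp add: exp_sum)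
  also have "\<dots> \<le> exp (1 / 2)" using assms(2) by simp
  finally show "(\<Prod>j<n. 1 + z j) \<le> 2" using exp_half_le by linarith
  show "1 \<le> (\<Prod>j<n. 1 + z j)" using assms(1) by (intro prod_ge_1) auto
qed

lemma AA_gt_1_later: "1 < AA \<beta> n h \<Longrightarrow> 1 < AA \<beta> (n + k) h"
proof (induction k)
  case (Suc k)
  have "1 + a * (AA \<beta> (n + k) h - 1) \<le> AA \<beta> (Suc (n + k)) h"
    using ff_ge_linear[of "AA \<beta> (n + k) h"] Suc AA_Suc_ge[of \<beta> "n + k" h] by linarith
  moreover have "0 < a * (AA \<beta> (n + k) h - 1)" using Suc by (intro mult_pos_pos) auto
  ultimately show ?case unfolding add_Suc_right by linarith
qed simp

lemma AA_ge_1_later: "1 \<le> AA \<beta> n h \<Longrightarrow> 1 \<le> AA \<beta> (n + k) h"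
proof (induction k)
  case (Suc k)
  have "1 \<le> ff (AA \<beta> (n + k) h)" using Suc by (intro ff_ge_1) simp
  then show ?case using AA_Suc_ge[of \<beta> "n + k" h] unfolding add_Suc_right by linarith
qed simp

lemma ff_expoly_square: "expoly G \<Longrightarrow> expoly (\<lambda>h. (ff (G h))\<^sup>2)"
  by (intro expoly_power expoly_ff)

text \<open>Iterates \<open>growth_step\<close> with \<zeta> j of order sqrt (\<beta> \<rho>^j),
  which is summable, so that the accumulated factor stays below 2. The base point need not be
  critical: the bound is used at nearby points as well, in order to locate the critical one.\<close>

lemma AA_growth_window:
  "\<exists>C\<ge>1. \<exists>\<delta>>0. C * \<delta> \<le> 1 \<and> (\<forall>\<beta> h0 n \<xi>. 0 < \<beta> \<longrightarrow> \<beta> \<le> \<delta> \<longrightarrow>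
     (\<forall>j\<le>n. 0 \<le> \<xi> j \<and> \<xi> j \<le> C * (\<beta> * \<rho> ^ j) \<and> AA \<beta> j h0 \<le> 1 + \<xi> j) \<longrightarrow>
     (\<forall>v\<ge>0. AA \<beta> n (h0 + v) \<le> hom n (2 * (v + \<xi> n / a ^ n))))"
proof (rule growth_step)
  fix C assume C1: "1 \<le> C" and C: "\<And>\<beta> n y y' h0 c \<xi> \<xi>' \<zeta> v. \<lbrakk>0 \<le> \<beta>; \<beta> \<le> 1; \<And>h. 0 \<le> y h; \<And>h. 0 \<le> y' h;
     expoly (\<lambda>h. (ff (y h))\<^sup>2); expoly (\<lambda>h. (y' h)\<^sup>2);
     \<And>h. (y' h)\<^sup>2 \<le> heat (s \<beta> n) (\<lambda>h. (ff (y h))\<^sup>2) h;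
     \<And>v. 0 \<le> v \<Longrightarrow> y (h0 + v) \<le> hom n (c * (v + \<xi> / a ^ n));
     1 \<le> c; c \<le> 2; 0 \<le> \<xi>; 0 \<le> \<xi>'; y' h0 \<le> 1 + \<xi>'; 0 < \<zeta>; C * \<zeta> \<le> 1;
     C * (\<beta> * \<rho> ^ n) \<le> \<zeta>\<^sup>2; \<xi> \<le> \<zeta>\<^sup>2; 0 \<le> v\<rbrakk> \<Longrightarrow>
     y' (h0 + v) \<le> hom (Suc n) (c * (1 + C * \<zeta>) * (v + \<xi>' / a ^ Suc n))"
  define \<rho>1 where "\<rho>1 = sqrt \<rho>"
  have \<rho>1: "0 < \<rho>1" "\<rho>1 < 1" "\<rho>1\<^sup>2 = \<rho>" using \<rho>_gt \<rho>_lt by (auto simp: \<rho>1_def)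
  \<comment> \<open>The smallness of \<beta> for which the sum of all C \<zeta> j is at most
    1/2.\<close>
  define x where "x = (1 - \<rho>1) / (2 * C)"
  have x: "0 < x" "2 * C * x = 1 - \<rho>1" using \<rho>1 C1 by (auto simp: x_def)
  have xl: "C * x \<le> 1 / 2" using x \<rho>1 by simp
  have xl': "x \<le> 1 / 2" using xl mult_right_mono[OF C1, of x] x(1) by linarith
  define \<delta> where "\<delta> = x\<^sup>2 / C"
  have \<delta>0: "0 < \<delta>" using x C1 by (simp add: \<delta>_def)
  have \<delta>C: "C * \<delta> = x\<^sup>2" using C1 by (simp add: \<delta>_def)
  have x2: "x\<^sup>2 \<le> 1" using xl' x power_le_one[of x 2] by simp
  have "AA \<beta> n (h0 + v) \<le> hom n (2 * (v + \<xi> n / a ^ n))"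
    if \<beta>: "0 < \<beta>" "\<beta> \<le> \<delta>" and hyp: "\<And>j. j \<le> n \<Longrightarrow> 0 \<le> \<xi> j \<and> \<xi> j \<le> C * (\<beta> * \<rho> ^ j) \<and> AA \<beta> j h0 \<le> 1 + \<xi> j"
      and v: "0 \<le> v" for \<beta> h0 n \<xi> v
  proof -
    define \<zeta> where "\<zeta> j = sqrt (C * \<beta>) * \<rho>1 ^ j" for j
    have \<zeta>0: "0 < \<zeta> j" for j using C1 \<beta> \<rho>1 by (simp add: \<zeta>_def)
    have \<zeta>2: "(\<zeta> j)\<^sup>2 = C * (\<beta> * \<rho> ^ j)" for j
    proof -
      have "(\<rho>1 ^ j)\<^sup>2 = \<rho> ^ j" unfolding \<rho>1(3)[symmetric] by (metis power_mult mult.commute)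
      then show ?thesis using C1 \<beta> by (simp add: \<zeta>_def power_mult_distrib)
    qed
    have "C * \<beta> \<le> x\<^sup>2" using mult_left_mono[OF \<beta>(2), of C] C1 \<delta>C by simp
    then have sx: "sqrt (C * \<beta>) \<le> x" using x by (intro real_le_lsqrt) auto
    have zs: "C * \<zeta> j \<le> C * x * \<rho>1 ^ j" for j
      unfolding \<zeta>_def using sx C1 \<rho>1 by (simp add: mult.assoc mult_left_mono mult_right_mono)
    have \<beta>1: "\<beta> \<le> 1"
      using \<beta> \<delta>C x2 mult_right_mono[OF C1, of \<delta>] \<delta>0 by linarith
    have sumz: "(\<Sum>j<k. C * \<zeta> j) \<le> 1 / 2" for k
    proof -
      have "(\<Sum>j<k. C * \<zeta> j) \<le> (\<Sum>j<k. C * x * \<rho>1 ^ j)" by (intro sum_mono zs)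
      also have "\<dots> \<le> C * x * (1 / (1 - \<rho>1))"
        unfolding sum_distrib_left[symmetric] using sum_geometric_le[of \<rho>1 k] \<rho>1 x C1 by (intro mult_left_mono) auto
      also have "\<dots> = 1 / 2" using x \<rho>1 by (simp add: field_simps)
      finally show ?thesis .
    qed
    have Cz0: "0 \<le> C * \<zeta> j" for j using C1 \<zeta>0[of j] by simp
    have Cz1: "C * \<zeta> j \<le> 1" for j
      using sumz[of "Suc j"] sum_nonneg[of "{..<j}" "\<lambda>i. C * \<zeta> i"] Cz0 by simp
    define c where "c k = (\<Prod>j<k. 1 + C * \<zeta> j)" for k
    have c: "1 \<le> c k" "c k \<le> 2" for k unfolding c_def using prod_le_2[OF Cz0 sumz] by auto
    have "\<forall>v\<ge>0. AA \<beta> k (h0 + v) \<le> hom k (c k * (v + \<xi> k / a ^ k))" if "k \<le> n" for k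
      using that
    proof (induction k)
      case 0
      show ?case
      proof (intro allI impI)
        fix v :: real assume "0 \<le> v"
        have "AA \<beta> 0 (h0 + v) = exp v * AA \<beta> 0 h0" by (simp add: exp_add)
        also have "\<dots> \<le> exp v * (1 + \<xi> 0)" using hyp[of 0] by (intro mult_left_mono) auto
        also have "\<dots> \<le> exp v * exp (\<xi> 0)" by (intro mult_left_mono exp_ge_add_one_self) auto
        finally show "AA \<beta> 0 (h0 + v) \<le> hom 0 (c 0 * (v + \<xi> 0 / a ^ 0))" by (simp add: c_def exp_add)
      qed
    next
      case (Suc k)
      have "AA \<beta> (Suc k) (h0 + v) \<le> hom (Suc k) (c k * (1 + C * \<zeta> k) * (v + \<xi> (Suc k) / a ^ Suc k))"
        if "0 \<le> v" for v
      proof (rule C[of \<beta> "AA \<beta> k" _ k _ _ "\<xi> k"])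
        show "(AA \<beta> (Suc k) h)\<^sup>2 \<le> heat (s \<beta> k) (\<lambda>h. (ff (AA \<beta> k h))\<^sup>2) h" for h
          unfolding AA.simps by (intro heat_square_le expoly_ff expoly_AA)
        show "AA \<beta> k (h0 + v) \<le> hom k (c k * (v + \<xi> k / a ^ k))" if "0 \<le> v" for v using Suc that by simp
        show "expoly (\<lambda>h. (ff (AA \<beta> k h))\<^sup>2)" by (intro ff_expoly_square expoly_AA)
        show "expoly (\<lambda>h. (AA \<beta> (Suc k) h)\<^sup>2)" by (intro expoly_power expoly_AA)
      qed (use \<beta> \<beta>1 c hyp[of k] hyp[of "Suc k"] Suc.prems \<zeta>0 \<zeta>2 Cz1 that in \<open>auto simp del: AA.simps\<close>)
      then show ?case by (simp add: c_def del: AA.simps hom.simps power_Suc)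
    qed
    then have "AA \<beta> n (h0 + v) \<le> hom n (c n * (v + \<xi> n / a ^ n))" using v by blast
    also have "\<dots> \<le> hom n (2 * (v + \<xi> n / a ^ n))"
      using c[of n] v hyp[of n] by (intro hom_mono mult_right_mono add_nonneg_nonneg) auto
    finally show ?thesis .
  qed
  then show ?thesis using C1 \<delta>0 \<delta>C x2 by (intro exI[of _ C] conjI exI[of _ \<delta>]) auto
qed

lemma hom_sq_le_4: "0 \<le> t \<Longrightarrow> 0 \<le> y \<Longrightarrow> y \<le> hom n t \<Longrightarrow> ff y \<le> hom n t ^ 4"
proof -
  assume t: "0 \<le> t" and y: "0 \<le> y" "y \<le> hom n t"
  have h: "1 \<le> hom n t" by (rule hom_ge_1[OF t])
  have "ff y \<le> ff (hom n t)" by (rule ff_mono[OF y])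
  also have "\<dots> \<le> (hom n t)\<^sup>2" by (rule ff_le_square[OF h])
  also have "\<dots> \<le> (hom n t) ^ 4" using h by (intro power_increasing) auto
  finally show ?thesis .
qed

text \<open>An absorbing region. With d = C (\<beta> \<rho>^n)^2, a value at most 1 - d is mapped by
  \<open>ff\<close> to at most 1 - a d + d^2 / B, hence to at most 1 - d if d \<le> 2 - B. Smoothing
  adds at most D (\<beta> \<rho>^n)^2. The choice C (1 - \<rho>^2) = D turns this into the threshold
  of the next generation.\<close>

lemma AA_subcritical:
  "\<exists>G\<ge>1. \<exists>C\<ge>1. \<exists>\<delta>>0. C * \<delta> \<le> 2 - B \<and> \<delta> \<le> 1 \<and> G * \<delta> \<le> 1 \<and> (\<forall>\<beta> h0 n k. 0 < \<beta> \<longrightarrow> \<beta> \<le> \<delta> \<longrightarrow>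
     (\<forall>j\<le>n. AA \<beta> j h0 \<le> 1 + G * (\<beta> * \<rho> ^ j)) \<longrightarrow> AA \<beta> n h0 \<le> 1 - C * (\<beta> * \<rho> ^ n)\<^sup>2 \<longrightarrow>
     AA \<beta> (n + k) h0 \<le> 1 - C * (\<beta> * \<rho> ^ (n + k))\<^sup>2)"
proof -
  obtain G \<delta>1 where G: "1 \<le> G" "0 < \<delta>1" "G * \<delta>1 \<le> 1"
    "\<And>\<beta> h0 n \<xi> v. 0 < \<beta> \<Longrightarrow> \<beta> \<le> \<delta>1 \<Longrightarrow>
     (\<forall>j\<le>n. 0 \<le> \<xi> j \<and> \<xi> j \<le> G * (\<beta> * \<rho> ^ j) \<and> AA \<beta> j h0 \<le> 1 + \<xi> j) \<Longrightarrow>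
     0 \<le> v \<Longrightarrow> AA \<beta> n (h0 + v) \<le> hom n (2 * (v + \<xi> n / a ^ n))"
    using AA_growth_window by auto
  obtain \<delta>2 where \<delta>2: "0 < \<delta>2" "\<forall>X. \<exists>C\<ge>1. \<forall>\<beta> n G h0 \<xi> u. 0 \<le> \<beta> \<longrightarrow> \<beta> \<le> \<delta>2 \<longrightarrow> expoly G \<longrightarrow> 0 \<le> \<xi> \<longrightarrow> \<xi> \<le> 1 \<longrightarrow>
     (\<forall>v\<ge>0. G (h0 + v) \<le> hom n (2 * (v + \<xi> / a ^ n)) ^ 4) \<longrightarrow> 0 \<le> u \<longrightarrow> a ^ n * u \<le> X \<longrightarrow>
     heat (s \<beta> n) G (h0 + u) - G (h0 + u) \<le> C * (\<beta> * \<rho> ^ n)\<^sup>2"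
    using heat_window by blast
  obtain D where D: "1 \<le> D" "\<And>\<beta> n G h0 \<xi> u. 0 \<le> \<beta> \<Longrightarrow> \<beta> \<le> \<delta>2 \<Longrightarrow> expoly G \<Longrightarrow> 0 \<le> \<xi> \<Longrightarrow> \<xi> \<le> 1 \<Longrightarrow>
     (\<forall>v\<ge>0. G (h0 + v) \<le> hom n (2 * (v + \<xi> / a ^ n)) ^ 4) \<Longrightarrow> 0 \<le> u \<Longrightarrow> a ^ n * u \<le> 0 \<Longrightarrow>
     heat (s \<beta> n) G (h0 + u) - G (h0 + u) \<le> D * (\<beta> * \<rho> ^ n)\<^sup>2"
    using spec[OF \<delta>2(2), of 0] by blast
  have \<rho>2: "0 < 1 - \<rho>\<^sup>2" using \<rho>_gt \<rho>_lt by (simp add: power_less_one_iff abs_square_less_1)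
  define C where "C = D / (1 - \<rho>\<^sup>2)"
  have CD: "C * (1 - \<rho>\<^sup>2) = D" using \<rho>2 by (simp add: C_def)
  have C1: "1 \<le> C"
  proof -
    have "C * (1 - \<rho>\<^sup>2) \<ge> 1 * (1 - \<rho>\<^sup>2)" using CD D(1) by (smt (verit) zero_le_power2)
    then show ?thesis using \<rho>2 by (rule mult_right_le_imp_le)
  qed
  define \<delta> where "\<delta> = min (min \<delta>1 \<delta>2) (min 1 ((2 - B) / C))"
  have \<delta>: "0 < \<delta>" "\<delta> \<le> \<delta>1" "\<delta> \<le> \<delta>2" "\<delta> \<le> 1" using G(2) \<delta>2(1) C1 B_lt by (auto simp: \<delta>_def)
  have "\<delta> \<le> (2 - B) / C" by (simp add: \<delta>_def)
  then have \<delta>C: "C * \<delta> \<le> 2 - B" using C1 by (simp add: field_simps)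
  have \<delta>G: "G * \<delta> \<le> 1" using G(1,3) \<delta>(2) mult_left_mono[OF \<delta>(2), of G] by linarith
  have "AA \<beta> (n + k) h0 \<le> 1 - C * (\<beta> * \<rho> ^ (n + k))\<^sup>2"
    if \<beta>: "0 < \<beta>" "\<beta> \<le> \<delta>" and hyp: "\<And>j. j \<le> n \<Longrightarrow> AA \<beta> j h0 \<le> 1 + G * (\<beta> * \<rho> ^ j)"
      and start: "AA \<beta> n h0 \<le> 1 - C * (\<beta> * \<rho> ^ n)\<^sup>2" for \<beta> h0 n k
  proof -
    define \<xi> where "\<xi> j = G * (\<beta> * \<rho> ^ j)" for j
    have \<beta>\<rho>: "0 \<le> \<beta> * \<rho> ^ j" "\<beta> * \<rho> ^ j \<le> \<delta>" for j
      using \<beta> \<rho>_pow_le_1[of j] mult_mono[of \<beta> \<delta> "\<rho> ^ j" 1] by auto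
    have \<xi>: "0 \<le> \<xi> j" "\<xi> j \<le> 1" for j
    proof -
      have "G * (\<beta> * \<rho> ^ j) \<le> G * \<delta>" using \<beta>\<rho>[of j] G(1) by (intro mult_left_mono) auto
      then show "\<xi> j \<le> 1" using \<delta>G by (simp add: \<xi>_def)
      show "0 \<le> \<xi> j" unfolding \<xi>_def using G(1) by (intro mult_nonneg_nonneg \<beta>\<rho>) auto
    qed
    have "AA \<beta> (n + k) h0 \<le> 1 - C * (\<beta> * \<rho> ^ (n + k))\<^sup>2 \<and> (\<forall>j\<le>n+k. AA \<beta> j h0 \<le> 1 + \<xi> j)"
    proof (induction k)
      case 0
      then show ?case using start hyp by (auto simp: \<xi>_def)
    next
      case (Suc k)
      let ?m = "n + k"
      define e where "e = (\<beta> * \<rho> ^ ?m)\<^sup>2"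
      define d where "d = C * e"
      have e0: "0 \<le> e" by (simp add: e_def)
      have d0: "0 \<le> d" using e0 C1 by (simp add: d_def)
      have "e \<le> \<delta> * 1" unfolding e_def power2_eq_square using \<beta>\<rho>[of ?m] \<delta> by (intro mult_mono) auto
      then have "d \<le> C * \<delta>" unfolding d_def using C1 by (intro mult_left_mono) auto
      then have dB: "d \<le> 2 - B" using \<delta>C by linarith
      have gr: "AA \<beta> ?m (h0 + v) \<le> hom ?m (2 * (v + \<xi> ?m / a ^ ?m))" if "0 \<le> v" for v
        using G(4)[of \<beta> ?m \<xi> h0 v] \<beta> \<delta> Suc \<xi> that by (auto simp: \<xi>_def)
      have "heat (s \<beta> ?m) (\<lambda>h. ff (AA \<beta> ?m h)) (h0 + 0) - ff (AA \<beta> ?m (h0 + 0)) \<le> D * (\<beta> * \<rho> ^ ?m)\<^sup>2"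
      proof (rule D(2)[where \<xi> = "\<xi> ?m"])
        show "\<forall>v\<ge>0. ff (AA \<beta> ?m (h0 + v)) \<le> hom ?m (2 * (v + \<xi> ?m / a ^ ?m)) ^ 4"
          using gr \<xi> by (intro allI impI hom_sq_le_4) auto
      qed (use \<beta> \<delta> \<xi> in auto)
      then have "AA \<beta> (Suc ?m) h0 \<le> ff (AA \<beta> ?m h0) + D * e" by (simp add: e_def)
      also have "ff (AA \<beta> ?m h0) \<le> ff (1 - d)"
        using Suc by (intro ff_mono) (auto simp: d_def e_def)
      also have "ff (1 - d) = 1 - a * d + d\<^sup>2 / B" using ff_add[of "-d"] by simp
      also have "d\<^sup>2 / B \<le> (2 - B) * d / B"
        using dB d0 B_gt by (intro divide_right_mono) (auto simp: power2_eq_square mult_right_mono)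
      also have "(2 - B) * d / B = a * d - d" using B_gt by (simp add: a_def field_simps)
      finally have "AA \<beta> (Suc ?m) h0 \<le> 1 - d + D * e" by simp
      also have "\<dots> = 1 - C * (\<rho>\<^sup>2 * e)" unfolding CD[symmetric] d_def by (simp add: algebra_simps)
      also have "\<rho>\<^sup>2 * e = (\<beta> * \<rho> ^ Suc ?m)\<^sup>2" by (simp add: e_def power_mult_distrib)
      finally have A: "AA \<beta> (Suc ?m) h0 \<le> 1 - C * (\<beta> * \<rho> ^ Suc ?m)\<^sup>2" .
      moreover have "AA \<beta> (Suc ?m) h0 \<le> 1 + \<xi> (Suc ?m)"
      proof -
        have "0 \<le> C * (\<beta> * \<rho> ^ Suc ?m)\<^sup>2" using C1 by (intro mult_nonneg_nonneg) auto
        then show ?thesis using A \<xi>(1)[of "Suc ?m"] by linarith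
      qed
      ultimately show ?case using Suc by (auto simp: le_Suc_eq simp del: AA.simps)
    qed
    then show ?thesis by blast
  qed
  then show ?thesis using G(1) C1 \<delta> \<delta>C \<delta>G
    by (intro exI[of _ G] conjI exI[of _ C] exI[of _ \<delta>]) auto
qed

definition hcrit :: "real \<Rightarrow> real" where
  "hcrit \<beta> = Sup {h. fa \<beta> h = 0}"

lemma fa_eq_0_iff: "0 \<le> \<beta> \<Longrightarrow> fa \<beta> h = 0 \<longleftrightarrow> (\<forall>n. AA \<beta> n h \<le> 1)"
  using fa_pos[of \<beta> _ h] fa_zero[of \<beta> h] by (metis less_irrefl not_le)

lemma hcrit_upper:
  assumes "0 \<le> \<beta>" "fa \<beta> h = 0" shows "h \<le> hcrit \<beta>"
proof -
  have "x \<le> 0" if "fa \<beta> x = 0" for x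
  proof -
    have "exp (x + \<beta>\<^sup>2 * (1 - \<kappa>) / 2) \<le> exp 0" using fa_eq_0_iff[OF assms(1)] that by (metis AA.simps(1) exp_zero)
    moreover have "0 \<le> \<beta>\<^sup>2 * (1 - \<kappa>) / 2" using \<kappa>_half \<kappa>_pos by simp
    ultimately show ?thesis unfolding exp_le_cancel_iff by linarith
  qed
  then have "bdd_above {h. fa \<beta> h = 0}" by (intro bdd_aboveI[of _ 0]) auto
  then show ?thesis unfolding hcrit_def using assms(2) by (intro cSup_upper) auto
qed

lemma AA_isCont: "isCont (AA \<beta> n) x"
  using expoly_continuous[OF expoly_AA, of UNIV \<beta> n] by (simp add: continuous_on_eq_continuous_at)

text \<open>The first claim is continuity of the moments, as the free energy vanishes exactly when
  no first moment exceeds 1. The second is the growth bound with base value 1. For the third, a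
  first moment at the critical point inside the absorbing region would, by continuity, put points to
  its right into that region; so A_n is at least 1 - C (\<beta> \<rho>^n)^2 there, and increments
  grow by almost a per generation.\<close>

lemma critical_window:
  "\<exists>\<delta>>0. \<forall>\<beta>. 0 < \<beta> \<longrightarrow> \<beta> \<le> \<delta> \<longrightarrow>
     (\<forall>n. AA \<beta> n (hcrit \<beta>) \<le> 1) \<and>
     (\<forall>n. \<forall>v\<ge>0. AA \<beta> n (hcrit \<beta> + v) \<le> hom n (2 * v)) \<and>
     (\<forall>n. \<forall>u\<ge>0. a ^ n * u / 4 \<le> AA \<beta> n (hcrit \<beta> + u))"
proof -
  obtain G C \<delta>1 where C: "1 \<le> G" "1 \<le> C" "0 < \<delta>1" "C * \<delta>1 \<le> 2 - B" "\<delta>1 \<le> 1" "G * \<delta>1 \<le> 1"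
    "\<And>\<beta> h0 n k. 0 < \<beta> \<Longrightarrow> \<beta> \<le> \<delta>1 \<Longrightarrow>
     (\<forall>j\<le>n. AA \<beta> j h0 \<le> 1 + G * (\<beta> * \<rho> ^ j)) \<Longrightarrow> AA \<beta> n h0 \<le> 1 - C * (\<beta> * \<rho> ^ n)\<^sup>2 \<Longrightarrow>
     AA \<beta> (n + k) h0 \<le> 1 - C * (\<beta> * \<rho> ^ (n + k))\<^sup>2"
    using AA_subcritical by blast
  obtain G' \<delta>2 where G': "1 \<le> G'" "0 < \<delta>2" "G' * \<delta>2 \<le> 1"
    "\<And>\<beta> h0 n \<xi> v. 0 < \<beta> \<Longrightarrow> \<beta> \<le> \<delta>2 \<Longrightarrow>
     (\<forall>j\<le>n. 0 \<le> \<xi> j \<and> \<xi> j \<le> G' * (\<beta> * \<rho> ^ j) \<and> AA \<beta> j h0 \<le> 1 + \<xi> j) \<Longrightarrow>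
     0 \<le> v \<Longrightarrow> AA \<beta> n (h0 + v) \<le> hom n (2 * (v + \<xi> n / a ^ n))"
    using AA_growth_window by auto
  define \<delta> where "\<delta> = min (min \<delta>1 \<delta>2) ((1 - \<rho>) / (2 * C))"
  have \<delta>: "0 < \<delta>" "\<delta> \<le> \<delta>1" "\<delta> \<le> \<delta>2" "\<delta> \<le> (1 - \<rho>) / (2 * C)"
    using C G' \<rho>_lt by (auto simp: \<delta>_def)
  have C\<delta>: "C * \<delta> \<le> (1 - \<rho>) / 2" using \<delta>(4) C(2) by (simp add: field_simps)
  have main: "(\<forall>n. AA \<beta> n (hcrit \<beta>) \<le> 1) \<and>
     (\<forall>n. \<forall>v\<ge>0. AA \<beta> n (hcrit \<beta> + v) \<le> hom n (2 * v)) \<and>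
     (\<forall>n. \<forall>u\<ge>0. a ^ n * u / 4 \<le> AA \<beta> n (hcrit \<beta> + u))" if \<beta>: "0 < \<beta>" "\<beta> \<le> \<delta>" for \<beta>
  proof -
    let ?S = "{h. fa \<beta> h = 0}" and ?hc = "hcrit \<beta>"
    have \<beta>0: "0 \<le> \<beta>" using \<beta> by simp
    have \<beta>1: "\<beta> \<le> \<delta>1" "\<beta> \<le> 1" using \<beta> \<delta> C(5) by auto
    have \<beta>\<rho>: "0 < \<beta> * \<rho> ^ j" "\<beta> * \<rho> ^ j \<le> \<delta> * \<rho> ^ j" "\<beta> * \<rho> ^ j \<le> 1" for j
      using \<beta> \<beta>1 \<rho>_pow_le_1[of j] mult_mono[of \<beta> 1 "\<rho> ^ j" 1] by (auto intro!: mult_right_mono)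
    have d2: "C * (\<beta> * \<rho> ^ j)\<^sup>2 \<le> (1 - \<rho>) / 2 * \<rho> ^ j" for j
    proof -
      have "(\<beta> * \<rho> ^ j)\<^sup>2 \<le> \<delta> * \<rho> ^ j * 1" unfolding power2_eq_square
        using \<beta>\<rho>[of j] \<delta> by (intro mult_mono) auto
      then have "C * (\<beta> * \<rho> ^ j)\<^sup>2 \<le> C * (\<delta> * \<rho> ^ j)" using C(2) by (intro mult_left_mono) auto
      also have "\<dots> \<le> (1 - \<rho>) / 2 * \<rho> ^ j" unfolding mult.assoc[symmetric] by (intro mult_right_mono C\<delta>) auto
      finally show ?thesis .
    qed
    have zero: "fa \<beta> h0 = 0" if "\<forall>j\<le>n. AA \<beta> j h0 \<le> 1 + G * (\<beta> * \<rho> ^ j)" "AA \<beta> n h0 \<le> 1 - C * (\<beta> * \<rho> ^ n)\<^sup>2" for n h0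
    proof (rule fa_zero[OF \<beta>0], rule ccontr)
      fix j assume "\<not> AA \<beta> j h0 \<le> 1"
      then have "1 < AA \<beta> (j + n) h0" using AA_gt_1_later by simp
      moreover have "AA \<beta> (n + j) h0 \<le> 1 - C * (\<beta> * \<rho> ^ (n + j))\<^sup>2"
        by (rule C(7)[OF \<beta>(1) \<beta>1(1) that])
      moreover have "0 \<le> C * (\<beta> * \<rho> ^ (n + j))\<^sup>2" using C(2) by simp
      ultimately show False by (simp add: add.commute)
    qed
    have ne: "?S \<noteq> {}"
    proof -
      define h0 where "h0 = ln (1 / 2) - \<beta>\<^sup>2 * (1 - \<kappa>) / 2"
      have h: "AA \<beta> 0 h0 = 1 / 2" by (simp add: h0_def)
      have "C * (\<beta> * \<rho> ^ 0)\<^sup>2 \<le> 1 / 2" using d2[of 0] \<rho>_gt by simp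
      moreover have "0 \<le> G * \<beta>" using C(1) \<beta> by simp
      ultimately have "fa \<beta> h0 = 0" using h by (intro zero[of 0]) auto
      then show ?thesis by blast
    qed
    have le1: "AA \<beta> n ?hc \<le> 1" for n
    proof (rule ccontr)
      assume "\<not> AA \<beta> n ?hc \<le> 1"
      then have "1 < AA \<beta> n ?hc" by simp
      with AA_isCont[where x = ?hc and n = n and \<beta> = \<beta>, unfolded isCont_def] have "\<forall>\<^sub>F x in at ?hc. 1 < AA \<beta> n x"
        by (rule order_tendstoD)
      then obtain d where d: "0 < d" "\<And>x. x \<noteq> ?hc \<Longrightarrow> dist x ?hc < d \<Longrightarrow> 1 < AA \<beta> n x"
        unfolding eventually_at by blast
      obtain x where x: "x \<in> ?S" "?hc - d < x"
        using less_cSupD[OF ne, of "?hc - d"] d(1) by (auto simp: hcrit_def)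
      have "x \<le> ?hc" using x(1) hcrit_upper[OF \<beta>0] by simp
      then have "1 < AA \<beta> n x"
        using d(2)[of x] x(2) \<open>1 < AA \<beta> n ?hc\<close> by (cases "x = ?hc") (auto simp: dist_real_def)
      moreover have "AA \<beta> n x \<le> 1" using x(1) fa_eq_0_iff[OF \<beta>0] by blast
      ultimately show False by simp
    qed
    have ge: "1 - C * (\<beta> * \<rho> ^ n)\<^sup>2 \<le> AA \<beta> n ?hc" for n
    proof (rule ccontr)
      assume n: "\<not> 1 - C * (\<beta> * \<rho> ^ n)\<^sup>2 \<le> AA \<beta> n ?hc"
      have ev1: "\<forall>\<^sub>F x in at_right ?hc. AA \<beta> n x < 1 - C * (\<beta> * \<rho> ^ n)\<^sup>2"
        using n by (intro order_tendstoD[OF tendsto_mono[OF at_le AA_isCont[unfolded isCont_def]]]) auto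
      \<comment> \<open>To the right of \<open>hcrit\<close> first moments above 1 cannot be
        excluded, but by continuity those up to generation n stay below the slackened bounds. This
        is why \<open>AA_subcritical\<close> allows such an excess.\<close>
      have ev2: "\<forall>\<^sub>F x in at_right ?hc. \<forall>j\<in>{..n}. AA \<beta> j x < 1 + G * (\<beta> * \<rho> ^ j)"
      proof (intro eventually_ball_finite ballI)
        fix j
        have "0 < G * (\<beta> * \<rho> ^ j)" using C(1) by (intro mult_pos_pos[OF _ \<beta>\<rho>(1)]) auto
        then have "AA \<beta> j ?hc < 1 + G * (\<beta> * \<rho> ^ j)" using le1[of j] by linarith
        then show "\<forall>\<^sub>F x in at_right ?hc. AA \<beta> j x < 1 + G * (\<beta> * \<rho> ^ j)"
          by (intro order_tendstoD[OF tendsto_mono[OF at_le AA_isCont[unfolded isCont_def]]]) auto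
      qed auto
      have ev3: "\<forall>\<^sub>F x in at_right ?hc. ?hc < x" by (rule eventually_at_right_less)
      obtain x where x: "AA \<beta> n x < 1 - C * (\<beta> * \<rho> ^ n)\<^sup>2" "\<forall>j\<in>{..n}. AA \<beta> j x < 1 + G * (\<beta> * \<rho> ^ j)" "?hc < x"
        using eventually_happens[OF eventually_conj[OF ev1 eventually_conj[OF ev2 ev3]]] by auto
      have "fa \<beta> x = 0" using x by (intro zero[of n]) (auto intro: less_imp_le)
      then show False using hcrit_upper[OF \<beta>0] x(3) by force
    qed
    have up: "AA \<beta> n (?hc + v) \<le> hom n (2 * v)" if "0 \<le> v" for n v
      using G'(4)[of \<beta> n "\<lambda>_. 0" ?hc v] \<beta> \<delta> le1 that G'(1) \<beta>\<rho>(1) by (auto intro: less_imp_le)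
    have low: "a ^ n * u / 4 \<le> AA \<beta> n (?hc + u)" if u: "0 \<le> u" for n u
    proof -
      define e where "e j = C * (\<beta> * \<rho> ^ j)\<^sup>2" for j
      have e0: "0 \<le> e j" for j using C(2) by (simp add: e_def)
      have es: "(\<Sum>j<n. e j) \<le> 1 / 2" for n
      proof -
        have "(\<Sum>j<n. e j) \<le> (\<Sum>j<n. (1 - \<rho>) / 2 * \<rho> ^ j)" unfolding e_def by (intro sum_mono d2)
        also have "\<dots> \<le> (1 - \<rho>) / 2 * (1 / (1 - \<rho>))"
          unfolding sum_distrib_left[symmetric] using sum_geometric_le[of \<rho> n] \<rho>_lt by (intro mult_left_mono) auto
        also have "\<dots> = 1 / 2" using \<rho>_lt by (simp add: field_simps)
        finally show ?thesis .
      qed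
      define \<Delta> where "\<Delta> n = AA \<beta> n (?hc + u) - AA \<beta> n ?hc" for n
      have \<Delta>nn: "0 \<le> \<Delta> n" for n unfolding \<Delta>_def using AA_mono[of ?hc "?hc + u" \<beta> n] u by simp
      have "a ^ n * ((1 - (\<Sum>j<n. e j)) * \<Delta> 0) \<le> \<Delta> n" for n
      proof (induction n)
        case (Suc n)
        let ?F = "\<lambda>h. ff (AA \<beta> n h)" and ?x = "AA \<beta> n (?hc + u)" and ?y = "AA \<beta> n ?hc"
        have F: "expoly ?F" by (intro expoly_ff expoly_AA)
        \<comment> \<open>The increment is itself an exponential polynomial, so smoothing can only
          raise it. What remains is the factor (x + y) / B, at least a (1 - e n) by the lower bound
          at the critical point. In the end the product of the 1 - e n and the initial increment
          each contribute a factor 1/2, together 1/4.\<close>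
        have "?F (?hc + u) - ?F ?hc \<le> heat (s \<beta> n) (\<lambda>h. ?F (h + u) - ?F h) ?hc"
          by (rule heat_ge[OF expoly_increment[OF F u]])
        also have "\<dots> = \<Delta> (Suc n)"
          unfolding \<Delta>_def AA.simps heat_def
          using expoly_integrable[OF F, of "?hc + u" "s \<beta> n"] expoly_integrable[OF F, of ?hc "s \<beta> n"]
          by (simp add: add_ac)
        finally have 1: "?F (?hc + u) - ?F ?hc \<le> \<Delta> (Suc n)" .
        have "?F (?hc + u) - ?F ?hc = (?x - ?y) * ((?x + ?y) / B)"
          using B_gt by (simp add: ff_def power2_eq_square field_simps)
        moreover have "(?x - ?y) * (a * (1 - e n)) \<le> (?x - ?y) * ((?x + ?y) / B)"
        proof (intro mult_left_mono)
          have "1 - e n \<le> ?y" "?y \<le> ?x" using ge[of n] \<Delta>nn[of n] by (auto simp: \<Delta>_def e_def)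
          then have "(1 - e n) + (1 - e n) \<le> ?x + ?y" by (intro add_mono) (auto intro: order_trans)
          then have "2 * (1 - e n) \<le> ?x + ?y" by simp
          then have "2 * (1 - e n) / B \<le> (?x + ?y) / B" using B_gt by (intro divide_right_mono) auto
          then show "a * (1 - e n) \<le> (?x + ?y) / B" by (simp add: a_def)
        qed (use \<Delta>nn[of n] in \<open>simp add: \<Delta>_def\<close>)
        ultimately have 2: "\<Delta> n * (a * (1 - e n)) \<le> \<Delta> (Suc n)" using 1 unfolding \<Delta>_def by linarith
        have en: "e n \<le> 1" using es[of "Suc n"] sum_nonneg[of "{..<n}" e] e0 by simp
        have "(1 - (\<Sum>j<Suc n. e j)) \<le> (1 - (\<Sum>j<n. e j)) * (1 - e n)"
          using mult_nonneg_nonneg[OF sum_nonneg[of "{..<n}" e] e0[of n]] e0 by (simp add: algebra_simps)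
        then have "a ^ Suc n * ((1 - (\<Sum>j<Suc n. e j)) * \<Delta> 0) \<le> a ^ Suc n * (((1 - (\<Sum>j<n. e j)) * (1 - e n)) * \<Delta> 0)"
          using \<Delta>nn by (intro mult_left_mono mult_right_mono) auto
        also have "\<dots> = (a ^ n * ((1 - (\<Sum>j<n. e j)) * \<Delta> 0)) * (a * (1 - e n))" by (simp add: mult_ac)
        also have "\<dots> \<le> \<Delta> n * (a * (1 - e n))" using Suc en by (intro mult_right_mono) auto
        finally show ?case using 2 by linarith
      qed simp
      moreover have "u / 2 \<le> \<Delta> 0"
      proof -
        have "\<Delta> 0 = AA \<beta> 0 ?hc * (exp u - 1)" by (simp add: \<Delta>_def exp_add algebra_simps)
        moreover have "u \<le> exp u - 1" using exp_ge_add_one_self[of u] by linarith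
        then have "1 / 2 * u \<le> AA \<beta> 0 ?hc * (exp u - 1)"
          using ge[of 0] es[of 1] u by (intro mult_mono) (auto simp: e_def)
        ultimately show ?thesis by simp
      qed
      ultimately have "a ^ n * (1 / 2 * (u / 2)) \<le> \<Delta> n"
      proof -
        assume A: "\<And>n. a ^ n * ((1 - (\<Sum>j<n. e j)) * \<Delta> 0) \<le> \<Delta> n" and U: "u / 2 \<le> \<Delta> 0"
        have "a ^ n * (1 / 2 * (u / 2)) \<le> a ^ n * ((1 - (\<Sum>j<n. e j)) * \<Delta> 0)"
          using es[of n] u U by (intro mult_left_mono mult_mono) auto
        then show ?thesis using A[of n] by linarith
      qed
      then show ?thesis using AA_nonneg[of \<beta> n ?hc] unfolding \<Delta>_def by (simp del: AA_nonneg)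
    qed
    show ?thesis using le1 up low by blast
  qed
  then show ?thesis using \<delta>(1) by blast
qed

section \<open>The annealed free energy from a single scale\<close>

text \<open>Beyond the correlation length \<open>n0\<close> the recursion is compared with plain squaring; the Gaussian
  fluctuations are absorbed by a quadratic bound on the logarithm.\<close>

lemma fa_le_at_scale:
  assumes X: "4 \<le> X"
  shows "\<exists>\<iota>>0. \<forall>\<beta> n0 h0 u. 0 < \<beta> \<longrightarrow> \<beta> * \<rho> ^ n0 \<le> \<iota> \<longrightarrow>
     (\<forall>v\<ge>0. AA \<beta> n0 (h0 + v) \<le> hom n0 (2 * v)) \<longrightarrow> 1 \<le> AA \<beta> n0 (h0 + u) \<longrightarrow>
     X \<le> a ^ n0 * u \<longrightarrow> a ^ n0 * u \<le> 2 * X \<longrightarrow>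
     fa \<beta> (h0 + u) \<le> (ln (AA \<beta> n0 (h0 + u)) + 1) / 2 ^ n0"
proof -
  obtain K where K: "1 \<le> K"
    "\<And>m t w. 0 \<le> t \<Longrightarrow> 0 \<le> w \<Longrightarrow> ell m t + p1 m t * w \<le> ell m (t + w)"
    "\<And>m t w. 0 \<le> t \<Longrightarrow> 0 \<le> w \<Longrightarrow> ell m (t + w) \<le> ell m t + p1 m t * w + K * b ^ m * w\<^sup>2"
    using ell_taylor by blast
  obtain W where W: "1 \<le> W" "\<And>m v. 0 \<le> v \<Longrightarrow> a ^ m * v \<le> 16 * X \<Longrightarrow> hom m v \<le> 1 + W * (a ^ m * v)"
    using hom_window[of "16 * X"] by blast
  define E where "E = 1 + W * (16 * X)"
  have E1: "1 \<le> E" using W(1) X by (simp add: E_def)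
  have WE: "hom m v \<le> E" if "0 \<le> v" "a ^ m * v \<le> 16 * X" for m v
  proof -
    have "hom m v \<le> 1 + W * (a ^ m * v)" using W(2) that by blast
    also have "\<dots> \<le> E" unfolding E_def using that W(1) by (intro add_left_mono mult_left_mono) auto
    finally show ?thesis .
  qed
  define G where "G = 12 * E + 48 * K + 64 * E\<^sup>2 + 32 * K + 12 + 1024 * K"
  have G0: "0 < G" using E1 K(1) by (auto simp: G_def intro!: add_pos_nonneg)
  \<comment> \<open>The second entry makes G e times the sum of the \<tau>^j at most 1; this is the
    constant by which the logarithm may grow in the conclusion. The first entry keeps the quadratic
    coefficient in the Gaussian integrals below 1/8.\<close>
  define \<iota> where "\<iota> = min (1 / (128 * K)) ((1 - \<tau>) / G)"
  have \<iota>0: "0 < \<iota>" using G0 K(1) \<tau>_lt by (simp add: \<iota>_def)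
  have "fa \<beta> (h0 + u) \<le> (ln (AA \<beta> n0 (h0 + u)) + 1) / 2 ^ n0"
    if \<beta>: "0 < \<beta>" and \<iota>: "\<beta> * \<rho> ^ n0 \<le> \<iota>" and gr: "\<And>v. 0 \<le> v \<Longrightarrow> AA \<beta> n0 (h0 + v) \<le> hom n0 (2 * v)"
      and A1: "1 \<le> AA \<beta> n0 (h0 + u)" and u1: "X \<le> a ^ n0 * u" and u2: "a ^ n0 * u \<le> 2 * X" for \<beta> n0 h0 u
  proof -
    let ?h = "h0 + u"
    define \<Lambda> where "\<Lambda> = ln (AA \<beta> n0 ?h)"
    have \<Lambda>0: "0 \<le> \<Lambda>" using A1 by (simp add: \<Lambda>_def)
    have "0 < a ^ n0 * u" using u1 X by linarith
    then have u0: "0 < u" by (rule zero_less_mult_pos) simp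
    have uE: "hom n0 (c * u) \<le> E" if "0 \<le> c" "c \<le> 8" for c
    proof (rule WE)
      have "c * (a ^ n0 * u) \<le> 8 * (2 * X)" using u0 that by (intro mult_mono[OF that(2) u2]) auto
      then show "a ^ n0 * (c * u) \<le> 16 * X" by (simp add: mult_ac)
    qed (use that u0 in simp)
    have ua: "1 / u \<le> a ^ n0" using u1 X u0 by (simp add: field_simps)
    define P where "P = 2 * E * a ^ n0"
    define Q where "Q = 4 * K * b ^ n0"
    have P0: "0 < P" and Q0: "0 < Q" using E1 K(1) by (auto simp: P_def Q_def)
    \<comment> \<open>For w up to u convexity between h and h + u suffices, as hom n0 (4 u) is
      bounded. For larger w the Taylor bound at 4 u applies, the homogeneous argument at h0 + u + w
      being 2 (u + w) = 4 u + 2 (w - u). Starting the expansion at u itself keeps the constant term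
      equal to \<Lambda> exactly.\<close>
    have start: "ln (AA \<beta> n0 (?h + w)) \<le> \<Lambda> + P * w + Q * w\<^sup>2" if w: "0 \<le> w" for w
    proof (cases "w \<le> u")
      case True
      define t where "t = w / u"
      have t: "0 \<le> t" "t \<le> 1" "t * u = w" using w True u0 by (auto simp: t_def)
      have tE: "t \<le> a ^ n0 * w" unfolding t_def using mult_right_mono[OF ua w] by simp
      have hu: "?h + u = h0 + 2 * u" by simp
      have "AA \<beta> n0 (?h + u) \<le> hom n0 (2 * (2 * u))" unfolding hu by (rule gr) (use u0 in simp)
      also have "2 * (2 * u) = 4 * u" by simp
      also have "hom n0 (4 * u) \<le> E" by (rule uE) auto
      also have "\<dots> \<le> E * AA \<beta> n0 ?h" using E1 A1 by (intro le_mult_ge_1) auto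
      finally have e: "AA \<beta> n0 (?h + u) \<le> E * AA \<beta> n0 ?h" .
      have "AA \<beta> n0 (?h + w) \<le> (1 - t) * AA \<beta> n0 ?h + t * AA \<beta> n0 (?h + u)"
        using expoly_convex[OF expoly_AA t(1,2), of \<beta> n0 ?h u] t(3) by simp
      also have "\<dots> \<le> 1 * AA \<beta> n0 ?h + t * (E * AA \<beta> n0 ?h)"
        using t e A1 by (intro add_mono mult_right_mono mult_left_mono) auto
      also have "\<dots> = AA \<beta> n0 ?h * (1 + t * E)" by (simp add: algebra_simps)
      finally have "ln (AA \<beta> n0 (?h + w)) \<le> ln (AA \<beta> n0 ?h * (1 + t * E))" by (intro ln_mono) auto
      also have "\<dots> = \<Lambda> + ln (1 + t * E)"
        unfolding \<Lambda>_def using A1 t E1 by (intro ln_mult_pos) (auto intro: add_pos_nonneg)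
      also have "ln (1 + t * E) \<le> t * E" using t E1 by (intro ln_add_one_self_le_self) auto
      also have "t * E \<le> a ^ n0 * w * E" using tE E1 by (intro mult_right_mono) auto
      also have "a ^ n0 * w * E \<le> P * w + Q * w\<^sup>2"
        using Q0 w E1 by (simp add: P_def add_nonneg_nonneg)
      finally show ?thesis by simp
    next
      case False
      then have wu: "u \<le> w" by simp
      have "hom n0 (4 * u) \<le> E" "hom n0 (8 * u) \<le> E" using uE[of 4] uE[of 8] by auto
      then have l: "ell n0 (4 * u) \<le> E" "ell n0 (8 * u) \<le> E"
        using hom_pos unfolding ell_def by (meson ln_bound order_trans)+
      have l0: "0 \<le> ell n0 (4 * u)" unfolding ell_def using hom_ge_1[of "4 * u" n0] u0 by simp
      define p where "p = p1 n0 (4 * u)"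
      have p0: "0 < p" unfolding p_def by (rule p1_pos)
      have "ell n0 (4 * u) + p * (4 * u) \<le> ell n0 (8 * u)" using K(2)[of "4 * u" "4 * u" n0] u0 by (simp add: p_def)
      then have "p * (4 * u) \<le> E" using l l0 by linarith
      then have p4: "p \<le> E / (4 * u)" using u0 by (simp add: field_simps)
      have "ln (AA \<beta> n0 (?h + w)) \<le> ell n0 (4 * u + 2 * (w - u))"
        unfolding ell_def using gr[of "u + w"] u0 w
        by (intro ln_mono) (auto simp: algebra_simps)
      also have "\<dots> \<le> ell n0 (4 * u) + p * (2 * (w - u)) + K * b ^ n0 * (2 * (w - u))\<^sup>2"
        using K(3)[of "4 * u" "2 * (w - u)" n0] u0 wu by (simp add: p_def)
      also have "\<dots> \<le> E * a ^ n0 * w + E * a ^ n0 * w + Q * w\<^sup>2"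
      proof (intro add_mono)
        have "1 / u * u \<le> a ^ n0 * w" using ua wu u0 by (intro mult_mono) auto
        then have "E * 1 \<le> E * (a ^ n0 * w)" using E1 u0 by (intro mult_left_mono) auto
        then show "ell n0 (4 * u) \<le> E * a ^ n0 * w" using l(1) by (simp add: mult_ac)
        have "p * (2 * (w - u)) \<le> (E / (4 * u)) * (2 * w)" using p4 p0 u0 wu E1 by (intro mult_mono) auto
        also have "\<dots> = (1 / u) * (E * w / 2)" by simp
        also have "\<dots> \<le> a ^ n0 * (E * w)" using ua E1 w u0 by (intro mult_mono) auto
        finally show "p * (2 * (w - u)) \<le> E * a ^ n0 * w" by (simp add: mult_ac)
        have "(2 * (w - u))\<^sup>2 \<le> (2 * w)\<^sup>2" using wu u0 by (intro power_mono) auto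
        then have "K * b ^ n0 * (2 * (w - u))\<^sup>2 \<le> K * b ^ n0 * (2 * w)\<^sup>2" using K(1) by (intro mult_left_mono) auto
        then show "K * b ^ n0 * (2 * (w - u))\<^sup>2 \<le> Q * w\<^sup>2" by (simp add: Q_def power_mult_distrib)
      qed
      also have "\<dots> \<le> \<Lambda> + P * w + Q * w\<^sup>2" using \<Lambda>0 by (simp add: P_def)
      finally show ?thesis .
    qed
    define e where "e = \<beta> * \<rho> ^ n0"
    have e0: "0 < e" using \<beta> by (simp add: e_def)
    have eK: "128 * K * e \<le> 1" using \<iota> K(1) unfolding e_def \<iota>_def by (simp add: field_simps)
    have e1: "e \<le> 1" using eK mult_right_mono[of 1 "128 * K" e] K(1) e0 by linarith
    have eG: "G * e \<le> 1 - \<tau>" using \<iota> G0 unfolding e_def \<iota>_def by (simp add: field_simps)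
    define S where "S k = (\<Sum>j<k. \<tau> ^ j)" for k
    have S: "0 \<le> S k" "G * e * S k \<le> 1" for k
    proof -
      show "0 \<le> S k" unfolding S_def by (intro sum_nonneg) auto
      have "S k \<le> 1 / (1 - \<tau>)" unfolding S_def using \<tau>_lt by (intro sum_geometric_le) auto
      then have "G * e * S k \<le> (1 - \<tau>) * (1 / (1 - \<tau>))" using eG G0 e0 \<tau>_lt by (intro mult_mono) (auto simp: S_def sum_nonneg)
      then show "G * e * S k \<le> 1" using \<tau>_lt by simp
    qed
    define lam where "lam k = \<Lambda> + G * e * S k" for k
    define q where "q k = Q * (1 + G * e * S k)" for k
    have q: "0 < q k" "q k \<le> 2 * Q" for k
    proof -
      have "0 \<le> G * e * S k" using G0 e0 S(1) by simp
      then show "0 < q k" using Q0 by (simp add: q_def)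
      show "q k \<le> 2 * Q" unfolding q_def using S(2)[of k] Q0 by (simp add: mult.commute[of _ Q] mult_left_mono)
    qed
    have ge1: "1 \<le> AA \<beta> (n0 + k) (?h + w)" if "0 \<le> w" for k w
      using AA_ge_1_later[OF A1, of k] AA_mono[of ?h "?h + w" \<beta> "n0 + k"] that by linarith
    \<comment> \<open>The linear coefficient P stays fixed. Each smoothing raises the constant and
      the quadratic coefficient, by G e \<tau>^k and by Q times that.\<close>
    have claim: "AA \<beta> (n0 + k) (?h + w) \<le> exp (2 ^ k * (lam k + P * w + q k * w\<^sup>2))" if w: "0 \<le> w" for k w
      using w
    proof (induction k arbitrary: w)
      case 0
      have "AA \<beta> n0 (?h + w) \<le> exp (\<Lambda> + P * w + Q * w\<^sup>2)"
        using start[OF 0] by (metis exp_le_cancel_iff exp_ln AA_pos)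
      then show ?case by (simp add: lam_def q_def S_def)
    next
      case (Suc k)
      define \<sigma> where "\<sigma> = s \<beta> (n0 + k)"
      define T where "T = \<tau> ^ k"
      define N where "N = (2::real) ^ Suc k"
      have \<sigma>0: "0 \<le> \<sigma>" unfolding \<sigma>_def using \<beta> by (intro s_nonneg) auto
      have T0: "0 < T" "T \<le> 1" using \<tau>_pow_le_1 by (auto simp: T_def)
      have N0: "2 \<le> N" by (simp add: N_def)
      have eT: "0 < e * T" "e * T \<le> 1" using e0 T0 e1 mult_mono[of e 1 T 1] by auto
      \<comment> \<open>The power \<kappa>^(n0 + k) is split: \<kappa>^n0 meets b^n0 and yields the
        rate \<rho> up to the scale n0, while \<kappa>^k meets 2^k and yields the rate \<tau> beyond
        it.\<close>
      have s1: "2 ^ k * (\<sigma>\<^sup>2 * b ^ n0) \<le> (e * T)\<^sup>2"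
      proof -
        have "\<sigma>\<^sup>2 * b ^ n0 \<le> \<beta>\<^sup>2 * \<kappa> ^ (n0 + k) * b ^ n0"
          unfolding \<sigma>_def by (intro mult_right_mono s_sq_le) auto
        then have "2 ^ k * (\<sigma>\<^sup>2 * b ^ n0) \<le> 2 ^ k * (\<beta>\<^sup>2 * \<kappa> ^ (n0 + k) * b ^ n0)" by (intro mult_left_mono) auto
        also have "\<dots> = \<beta>\<^sup>2 * (\<rho> ^ n0)\<^sup>2 * (\<tau> ^ k)\<^sup>2"
          unfolding \<rho>_sq \<tau>_sq by (simp add: power_add power_mult_distrib)
        also have "\<dots> = (e * T)\<^sup>2" by (simp add: e_def T_def power_mult_distrib)
        finally show ?thesis .
      qed
      have sb: "\<sigma>\<^sup>2 * b ^ n0 \<le> (e * T)\<^sup>2"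
        using s1 mult_right_mono[of 1 "2 ^ k" "\<sigma>\<^sup>2 * b ^ n0"] by simp
      have e2: "(e * T)\<^sup>2 \<le> e * T" using eT mult_left_mono[of "e * T" 1 "e * T"] by (simp add: power2_eq_square)
      have s2a: "2 ^ k * (\<sigma>\<^sup>2 * (a ^ n0)\<^sup>2) \<le> (e * T)\<^sup>2"
      proof -
        have "2 ^ k * (\<sigma>\<^sup>2 * (a ^ n0)\<^sup>2) \<le> 2 ^ k * (\<sigma>\<^sup>2 * b ^ n0)"
          by (intro mult_left_mono a_pow_b_pow) auto
        then show ?thesis using s1 by linarith
      qed
      have sa: "\<sigma> * a ^ n0 \<le> e * T"
      proof (rule power2_le_imp_le)
        have "(\<sigma> * a ^ n0)\<^sup>2 \<le> \<sigma>\<^sup>2 * b ^ n0"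
          unfolding power_mult_distrib by (intro mult_left_mono a_pow_b_pow) auto
        then show "(\<sigma> * a ^ n0)\<^sup>2 \<le> (e * T)\<^sup>2" using sb by linarith
      qed (use eT in auto)
      define \<alpha> where "\<alpha> = N * ((P + 2 * q k * w) * \<sigma>)"
      define r where "r = N * (q k * \<sigma>\<^sup>2)"
      have \<alpha>0: "0 \<le> \<alpha>" unfolding \<alpha>_def using N0 P0 q[of k] Suc.prems \<sigma>0
        by (intro mult_nonneg_nonneg add_nonneg_nonneg) auto
      have r0: "0 \<le> r" unfolding r_def using N0 q[of k] by simp
      have qs: "2 ^ k * (q k * \<sigma>\<^sup>2) \<le> 8 * K * (e * T)\<^sup>2"
      proof -
        have "2 ^ k * (q k * \<sigma>\<^sup>2) \<le> 2 ^ k * (2 * Q * \<sigma>\<^sup>2)" using q[of k] by (intro mult_left_mono mult_right_mono) auto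
        also have "\<dots> = 8 * K * (2 ^ k * (\<sigma>\<^sup>2 * b ^ n0))" by (simp add: Q_def)
        also have "\<dots> \<le> 8 * K * (e * T)\<^sup>2" using s1 K(1) by (intro mult_left_mono) auto
        finally show ?thesis .
      qed
      have r8: "r \<le> 1 / 8"
      proof -
        have "e * T \<le> e * 1" using e0 T0 by (intro mult_left_mono) auto
        then have "(e * T)\<^sup>2 \<le> e * 1" using e2 by linarith
        then have "8 * K * (e * T)\<^sup>2 \<le> 8 * K * (e * 1)" using K(1) by (intro mult_left_mono) auto
        then show ?thesis using qs eK by (simp add: r_def N_def)
      qed
      define c where "c = N * (lam k + P * w + q k * w\<^sup>2)"
      have "AA \<beta> (n0 + Suc k) (?h + w) \<le> (\<integral>g. exp c * exp (\<alpha> * \<bar>g\<bar> + r * g\<^sup>2) \<partial>N01)"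
        unfolding add_Suc_right AA.simps \<sigma>_def[symmetric]
      proof (rule heat_abs_le[OF expoly_ff[OF expoly_AA] \<sigma>0])
        show "integrable N01 (\<lambda>g. exp c * exp (\<alpha> * \<bar>g\<bar> + r * g\<^sup>2))"
          by (intro integrable_mult_right std_normal_exp_quadratic \<alpha>0 r0 r8)
        fix g :: real
        let ?w = "w + \<sigma> * \<bar>g\<bar>"
        have w0: "0 \<le> ?w" using Suc.prems \<sigma>0 by simp
        have "ff (AA \<beta> (n0 + k) (?h + ?w)) \<le> (AA \<beta> (n0 + k) (?h + ?w))\<^sup>2"
          by (intro ff_le_square ge1 w0)
        also have "\<dots> \<le> (exp (2 ^ k * (lam k + P * ?w + q k * ?w\<^sup>2)))\<^sup>2"
          using Suc.IH[OF w0] by (intro power_mono) auto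
        also have "\<dots> = exp (N * (lam k + P * ?w + q k * ?w\<^sup>2))"
          unfolding exp_double[symmetric] N_def by simp
        also have "N * (lam k + P * ?w + q k * ?w\<^sup>2) = c + (\<alpha> * \<bar>g\<bar> + r * g\<^sup>2)"
          unfolding c_def \<alpha>_def r_def by (simp add: power2_sum power_mult_distrib algebra_simps)
        finally show "ff (AA \<beta> (n0 + k) (?h + w + \<sigma> * \<bar>g\<bar>)) \<le> exp c * exp (\<alpha> * \<bar>g\<bar> + r * g\<^sup>2)"
          by (simp add: exp_add add.assoc)
      qed
      also have "\<dots> \<le> exp c * exp (6 * \<alpha> + 4 * \<alpha>\<^sup>2 + 4 * r)"
        using std_normal_exp_quadratic(2)[OF \<alpha>0 r0 r8] by simp
      also have "\<dots> = exp (c + (6 * \<alpha> + 4 * \<alpha>\<^sup>2 + 4 * r))" by (simp add: exp_add)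
      also have "\<dots> \<le> exp (N * (lam (Suc k) + P * w + q (Suc k) * w\<^sup>2))"
      proof -
        have w2: "0 \<le> w\<^sup>2" by simp
        have 1: "6 * (P * \<sigma>) \<le> 12 * E * (e * T)"
        proof -
          have "6 * (P * \<sigma>) = 12 * E * (\<sigma> * a ^ n0)" by (simp add: P_def)
          also have "\<dots> \<le> 12 * E * (e * T)" using sa E1 by (intro mult_left_mono) auto
          finally show ?thesis .
        qed
        have Qs: "Q * \<sigma>\<^sup>2 \<le> 4 * K * (e * T)\<^sup>2"
          unfolding Q_def using mult_left_mono[OF sb, of "4 * K"] K(1) by (simp add: mult_ac)
        \<comment> \<open>The mixed term w \<sigma> is split by Young's inequality with weight e T.
          Since Q \<sigma>^2 is of order (e T)^2, both parts are of order e T, the first with the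
          factor w^2 and thus charged to the quadratic coefficient.\<close>
        have 2: "12 * (q k * w * \<sigma>) \<le> 12 * Q * (e * T) * w\<^sup>2 + 48 * K * (e * T)"
        proof -
          have "0 \<le> (e * T * w - \<sigma>)\<^sup>2" by simp
          then have am: "2 * (e * T) * (w * \<sigma>) \<le> (e * T)\<^sup>2 * w\<^sup>2 + \<sigma>\<^sup>2"
            by (simp add: power2_diff power_mult_distrib algebra_simps)
          have "(e * T) * (12 * (q k * w * \<sigma>)) \<le> (e * T) * (12 * (2 * Q * w * \<sigma>))"
            using q[of k] Suc.prems \<sigma>0 eT by (intro mult_left_mono mult_right_mono) auto
          also have "\<dots> = 12 * Q * (2 * (e * T) * (w * \<sigma>))" by simp
          also have "\<dots> \<le> 12 * Q * ((e * T)\<^sup>2 * w\<^sup>2 + \<sigma>\<^sup>2)" using am Q0 by (intro mult_left_mono) auto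
          also have "\<dots> = 12 * Q * ((e * T)\<^sup>2 * w\<^sup>2) + 12 * (Q * \<sigma>\<^sup>2)" by (simp add: algebra_simps)
          also have "\<dots> \<le> 12 * Q * ((e * T)\<^sup>2 * w\<^sup>2) + 12 * (4 * K * (e * T)\<^sup>2)" using Qs by simp
          also have "\<dots> = (e * T) * (12 * Q * (e * T) * w\<^sup>2 + 48 * K * (e * T))"
            by (simp add: power2_eq_square algebra_simps)
          finally show ?thesis using eT(1) by (rule mult_left_le_imp_le)
        qed
        have 3: "4 * \<alpha>\<^sup>2 \<le> N * (64 * E\<^sup>2 * (e * T) + 1024 * K * Q * (e * T) * w\<^sup>2)"
        proof -
          have sq: "(x + y)\<^sup>2 \<le> 2 * (x\<^sup>2 + y\<^sup>2)" for x y :: real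
            using zero_le_power2[of "x - y"] by (simp add: power2_diff power2_sum)
          have N2: "N\<^sup>2 = N * (2 * 2 ^ k)" by (simp add: N_def power2_eq_square)
          have "4 * \<alpha>\<^sup>2 = N * (8 * (2 ^ k * ((P + 2 * q k * w)\<^sup>2 * \<sigma>\<^sup>2)))"
            unfolding \<alpha>_def power_mult_distrib N2 by simp
          also have "\<dots> \<le> N * (8 * (2 ^ k * (2 * (P\<^sup>2 + (2 * q k * w)\<^sup>2) * \<sigma>\<^sup>2)))"
            using sq N0 by (intro mult_left_mono mult_right_mono) auto
          also have "\<dots> = N * (16 * (2 ^ k * (P\<^sup>2 * \<sigma>\<^sup>2)) + 64 * (q k * (2 ^ k * (q k * \<sigma>\<^sup>2))) * w\<^sup>2)"
            by (simp add: power_mult_distrib power2_eq_square algebra_simps)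
          also have "\<dots> \<le> N * (64 * E\<^sup>2 * (e * T) + 1024 * K * Q * (e * T) * w\<^sup>2)"
          proof (intro mult_left_mono add_mono mult_right_mono)
            have "16 * (2 ^ k * (P\<^sup>2 * \<sigma>\<^sup>2)) = 64 * E\<^sup>2 * (2 ^ k * (\<sigma>\<^sup>2 * (a ^ n0)\<^sup>2))"
              by (simp add: P_def power_mult_distrib)
            also have "\<dots> \<le> 64 * E\<^sup>2 * (e * T)" using s2a e2 by (intro mult_left_mono) auto
            finally show "16 * (2 ^ k * (P\<^sup>2 * \<sigma>\<^sup>2)) \<le> 64 * E\<^sup>2 * (e * T)" .
            have "q k * (2 ^ k * (q k * \<sigma>\<^sup>2)) \<le> (2 * Q) * (8 * K * (e * T)\<^sup>2)"
              using q(1)[of k] Q0 by (intro mult_mono[OF q(2) qs]) auto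
            also have "\<dots> \<le> (2 * Q) * (8 * K * (e * T))" using e2 Q0 K(1) by (intro mult_left_mono) auto
            finally have "64 * (q k * (2 ^ k * (q k * \<sigma>\<^sup>2))) \<le> 64 * ((2 * Q) * (8 * K * (e * T)))" by (rule mult_left_mono) simp
            also have "\<dots> = 1024 * K * Q * (e * T)" by simp
            finally show "64 * (q k * (2 ^ k * (q k * \<sigma>\<^sup>2))) \<le> 1024 * K * Q * (e * T)" .
          qed (use N0 in auto)
          finally show ?thesis .
        qed
        have 4: "4 * r \<le> N * (32 * K * (e * T))"
        proof -
          have "q k * \<sigma>\<^sup>2 \<le> 2 ^ k * (q k * \<sigma>\<^sup>2)"
            using mult_right_mono[of 1 "2 ^ k" "q k * \<sigma>\<^sup>2"] q[of k] by simp
          also have "\<dots> \<le> 8 * K * (e * T)\<^sup>2" by (rule qs)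
          also have "\<dots> \<le> 8 * K * (e * T)" using e2 K(1) by (intro mult_left_mono) auto
          finally have "4 * (q k * \<sigma>\<^sup>2) \<le> 4 * (8 * K * (e * T))" by (rule mult_left_mono) simp
          then have "4 * (q k * \<sigma>\<^sup>2) \<le> 32 * K * (e * T)" by simp
          then have "N * (4 * (q k * \<sigma>\<^sup>2)) \<le> N * (32 * K * (e * T))" using N0 by (intro mult_left_mono) auto
          then show ?thesis by (simp add: r_def mult_ac)
        qed
        have 5: "6 * \<alpha> = N * (6 * (P * \<sigma>) + 12 * (q k * w * \<sigma>))" by (simp add: \<alpha>_def algebra_simps)
        have "6 * \<alpha> \<le> N * (12 * E * (e * T) + (12 * Q * (e * T) * w\<^sup>2 + 48 * K * (e * T)))"
          unfolding 5 using N0 by (intro mult_left_mono add_mono 1 2) auto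
        with 3 4 have "6 * \<alpha> + 4 * \<alpha>\<^sup>2 + 4 * r
           \<le> N * (12 * E * (e * T) + (12 * Q * (e * T) * w\<^sup>2 + 48 * K * (e * T)))
             + N * (64 * E\<^sup>2 * (e * T) + 1024 * K * Q * (e * T) * w\<^sup>2) + N * (32 * K * (e * T))" by linarith
        also have "\<dots> = N * ((12 * E + 48 * K + 64 * E\<^sup>2 + 32 * K) * (e * T) + (12 + 1024 * K) * (e * T) * Q * w\<^sup>2)"
          by (simp add: algebra_simps)
        also have "\<dots> \<le> N * (G * (e * T) + G * (e * T) * Q * w\<^sup>2)"
        proof -
          have "12 * E + 48 * K + 64 * E\<^sup>2 + 32 * K \<le> G" "12 + 1024 * K \<le> G"
            using E1 K(1) zero_le_power2[of E] unfolding G_def by linarith+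
          then show ?thesis using N0 eT Q0 by (intro mult_left_mono add_mono mult_right_mono) auto
        qed
        finally have "c + (6 * \<alpha> + 4 * \<alpha>\<^sup>2 + 4 * r) \<le> c + N * (G * (e * T) + G * (e * T) * Q * w\<^sup>2)" by simp
        also have "\<dots> = N * (lam (Suc k) + P * w + q (Suc k) * w\<^sup>2)"
          unfolding c_def lam_def q_def S_def T_def by (simp add: algebra_simps)
        finally show ?thesis by simp
      qed
      finally show ?case by (simp only: N_def)
    qed
    have ub: "ln (AA \<beta> (k + n0) ?h) / 2 ^ (k + n0) \<le> (\<Lambda> + 1) / 2 ^ n0" for k
    proof -
      have "ln (AA \<beta> (n0 + k) ?h) \<le> ln (exp (2 ^ k * lam k))"
        using claim[of 0 k] by (intro ln_mono) auto
      also have "\<dots> \<le> 2 ^ k * (\<Lambda> + 1)" using S(2)[of k] by (simp add: lam_def)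
      finally show ?thesis by (simp add: power_add field_simps add.commute)
    qed
    have "fa \<beta> ?h \<le> (\<Lambda> + 1) / 2 ^ n0"
      using LIMSEQ_ignore_initial_segment[OF fa_lim_and_ge(1), of \<beta> n0 ?h] \<beta> ub
      by (intro LIMSEQ_le_const2) auto
    then show ?thesis by (simp add: \<Lambda>_def)
  qed
  then show ?thesis using \<iota>0 by blast
qed

section \<open>The variance up to and at the correlation length\<close>

definition V :: "real \<Rightarrow> nat \<Rightarrow> real \<Rightarrow> real" where
  "V \<beta> n h = DD \<beta> n h - (AA \<beta> n h)\<^sup>2"

lemma V_nonneg: "0 \<le> V \<beta> n h"
  using AA_DD[of \<beta> n h] by (simp add: V_def)

lemma V_0:
  assumes "0 \<le> \<beta>" "\<beta> \<le> 1" shows "V \<beta> 0 h \<le> (AA \<beta> 0 h)\<^sup>2 * (2 * \<beta>\<^sup>2)"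
proof -
  define x where "x = \<beta>\<^sup>2 * (1 - \<kappa>)"
  have x0: "0 \<le> x" using \<kappa>_half \<kappa>_pos by (simp add: x_def)
  have x\<beta>: "x \<le> \<beta>\<^sup>2 * 1" unfolding x_def using \<kappa>_pos by (intro mult_left_mono) auto
  have "\<beta>\<^sup>2 \<le> 1" using assms by (simp add: power_le_one)
  then have x1: "x \<le> 1" using x\<beta> by simp
  have "exp x \<le> 1 + x + x\<^sup>2" using exp_bound[OF x0 x1] .
  moreover have "x\<^sup>2 \<le> x" using x0 x1 mult_left_mono[OF x1 x0] by (simp add: power2_eq_square)
  ultimately have e: "exp x - 1 \<le> 2 * \<beta>\<^sup>2" using x\<beta> by linarith
  have "V \<beta> 0 h = exp (2 * h + 2 * x) - exp (2 * (h + x / 2))"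
    unfolding V_def AA.simps DD.simps exp_double[symmetric] x_def by (simp add: mult.assoc)
  also have "\<dots> = exp (2 * (h + x / 2)) * (exp x - 1)"
    by (simp add: exp_add[symmetric] algebra_simps)
  also have "\<dots> \<le> exp (2 * (h + x / 2)) * (2 * \<beta>\<^sup>2)" using e by (intro mult_left_mono) auto
  also have "exp (2 * (h + x / 2)) = (AA \<beta> 0 h)\<^sup>2" unfolding AA.simps exp_double x_def ..
  finally show ?thesis .
qed

text \<open>Up to smoothing the new variance is (D^2 - A^4) / B^2, and D^2 - A^4 = V (2 A^2 + V)
  explains the factor 2 / B^2. As A^4 has the wrong sign for an exponential polynomial, it is moved
  to the other side, where \<open>heat_ge\<close> suffices for it.\<close>

lemma V_Suc_le:
  "V \<beta> (Suc n) h \<le> 2 / B\<^sup>2 * (V \<beta> n h * ((AA \<beta> n h)\<^sup>2 + V \<beta> n h / 2))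
     + (heat (s \<beta> n) (\<lambda>h. (DD \<beta> n h)\<^sup>2) h - (DD \<beta> n h)\<^sup>2)
     + (heat (s \<beta> n) (\<lambda>h. (ff (AA \<beta> n h))\<^sup>2) h - (ff (AA \<beta> n h))\<^sup>2)"
proof -
  let ?A = "AA \<beta> n" and ?D = "DD \<beta> n" and ?s = "s \<beta> n"
  have eA: "expoly (\<lambda>h. (?A h) ^ 4 / B\<^sup>2)" using B_gt by (intro expoly_divide expoly_power expoly_AA) auto
  have eD: "expoly (\<lambda>h. (?D h)\<^sup>2)" by (intro expoly_power expoly_DD)
  have eD': "expoly (\<lambda>h. (?D h)\<^sup>2 / B\<^sup>2)" using B_gt by (intro expoly_divide eD) auto
  have eF: "expoly (\<lambda>h. (ff (?A h))\<^sup>2)" by (intro ff_expoly_square expoly_AA)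
  have eS: "expoly (\<lambda>h. ((?D h)\<^sup>2 + 2 * (B - 1) * (?A h)\<^sup>2 + (B - 1)\<^sup>2) / B\<^sup>2)"
    by (intro expoly_DD_step expoly_DD expoly_AA)
  have eq: "((?D h)\<^sup>2 + 2 * (B - 1) * (?A h)\<^sup>2 + (B - 1)\<^sup>2) / B\<^sup>2 + (?A h) ^ 4 / B\<^sup>2
      = (?D h)\<^sup>2 / B\<^sup>2 + (ff (?A h))\<^sup>2" for h
    unfolding ff_square add_divide_distrib[symmetric] by (simp add: algebra_simps)
  have "DD \<beta> (Suc n) h + heat ?s (\<lambda>h. (?A h) ^ 4 / B\<^sup>2) h = heat ?s (\<lambda>h. (?D h)\<^sup>2 / B\<^sup>2) h + heat ?s (\<lambda>h. (ff (?A h))\<^sup>2) h"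
    unfolding DD.simps heat_add[OF eS eA, symmetric] heat_add[OF eD' eF, symmetric] eq ..
  moreover have "(?A h) ^ 4 / B\<^sup>2 \<le> heat ?s (\<lambda>h. (?A h) ^ 4 / B\<^sup>2) h" by (rule heat_ge[OF eA])
  moreover have "heat ?s (\<lambda>h. (?D h)\<^sup>2 / B\<^sup>2) h = heat ?s (\<lambda>h. (?D h)\<^sup>2) h / B\<^sup>2"
    unfolding heat_def by simp
  ultimately have 1: "DD \<beta> (Suc n) h \<le> heat ?s (\<lambda>h. (?D h)\<^sup>2) h / B\<^sup>2 + heat ?s (\<lambda>h. (ff (?A h))\<^sup>2) h - (?A h) ^ 4 / B\<^sup>2"
    by linarith
  have 2: "(ff (?A h))\<^sup>2 \<le> (AA \<beta> (Suc n) h)\<^sup>2"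
    using AA_Suc_ge[of \<beta> n h] less_imp_le[OF ff_pos] by (intro power_mono) auto
  define x where "x = heat ?s (\<lambda>h. (?D h)\<^sup>2) h - (?D h)\<^sup>2"
  have x0: "0 \<le> x" unfolding x_def using heat_ge[OF eD, of h ?s] by simp
  have "1 \<le> B\<^sup>2" using B_gt by simp
  then have 3: "x / B\<^sup>2 \<le> x" using x0 B_gt by (simp add: pos_divide_le_eq le_mult_ge_1)
  have 4: "heat ?s (\<lambda>h. (?D h)\<^sup>2) h / B\<^sup>2 = (?D h)\<^sup>2 / B\<^sup>2 + x / B\<^sup>2"
    unfolding x_def by (simp add: diff_divide_distrib)
  have d: "?D h = (?A h)\<^sup>2 + V \<beta> n h" by (simp add: V_def)
  have 5: "(?D h)\<^sup>2 / B\<^sup>2 - (?A h) ^ 4 / B\<^sup>2 = 2 / B\<^sup>2 * (V \<beta> n h * ((?A h)\<^sup>2 + V \<beta> n h / 2))"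
    unfolding d diff_divide_distrib[symmetric]
    by (simp add: power2_eq_square power4_eq_xxxx algebra_simps add_divide_distrib)
  show ?thesis using 1 2 3 4 5 unfolding V_def[of \<beta> "Suc n"] x_def by linarith
qed

text \<open>Two bounds proved by one induction, because each needs the other: growth of the second
  moment requires its value at the critical point, hence the variance, and the source of the
  variance requires the growth of D to control the smoothing. The rate q of the standard deviation
  is at least sqrt 2 / B, and q > \<rho> makes the sources summable relative to it. The condition on
  \<beta> times the sum of the q^n is common to all three regimes.\<close>

lemma DD_growth_and_variance:
  assumes q: "0 < q" "\<rho> < q" "2 / B\<^sup>2 \<le> q\<^sup>2"
  shows "\<exists>\<delta>>0. \<exists>C\<ge>1. \<forall>\<beta> N. 0 < \<beta> \<longrightarrow> \<beta> \<le> \<delta> \<longrightarrow> \<beta> * (\<Sum>n<N. q ^ n) \<le> \<delta> \<longrightarrow>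
     (\<forall>n\<le>N. (\<forall>v\<ge>0. DD \<beta> n (hcrit \<beta> + v) \<le> (hom n (2 * (v + C * (\<beta> * q ^ n)\<^sup>2 / a ^ n)))\<^sup>2)
        \<and> (\<forall>u\<ge>0. a ^ n * u \<le> 1 \<longrightarrow> V \<beta> n (hcrit \<beta> + u) \<le> C * (\<beta> * q ^ n)\<^sup>2)
        \<and> (n < N \<longrightarrow> C * (\<beta> * q ^ n)\<^sup>2 \<le> 1))"
proof (rule growth_step)
  fix Cg assume Cg1: "1 \<le> Cg" and Cg: "\<And>\<beta> n y y' h0 c \<xi> \<xi>' \<zeta> v. \<lbrakk>0 \<le> \<beta>; \<beta> \<le> 1; \<And>h. 0 \<le> y h; \<And>h. 0 \<le> y' h;
     expoly (\<lambda>h. (ff (y h))\<^sup>2); expoly (\<lambda>h. (y' h)\<^sup>2);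
     \<And>h. (y' h)\<^sup>2 \<le> heat (s \<beta> n) (\<lambda>h. (ff (y h))\<^sup>2) h;
     \<And>v. 0 \<le> v \<Longrightarrow> y (h0 + v) \<le> hom n (c * (v + \<xi> / a ^ n));
     1 \<le> c; c \<le> 2; 0 \<le> \<xi>; 0 \<le> \<xi>'; y' h0 \<le> 1 + \<xi>'; 0 < \<zeta>; Cg * \<zeta> \<le> 1;
     Cg * (\<beta> * \<rho> ^ n) \<le> \<zeta>\<^sup>2; \<xi> \<le> \<zeta>\<^sup>2; 0 \<le> v\<rbrakk> \<Longrightarrow>
     y' (h0 + v) \<le> hom (Suc n) (c * (1 + Cg * \<zeta>) * (v + \<xi>' / a ^ Suc n))"
  obtain \<delta>1 where \<delta>1: "0 < \<delta>1" "\<forall>\<beta>. 0 < \<beta> \<longrightarrow> \<beta> \<le> \<delta>1 \<longrightarrow>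
     (\<forall>n. AA \<beta> n (hcrit \<beta>) \<le> 1) \<and>
     (\<forall>n. \<forall>v\<ge>0. AA \<beta> n (hcrit \<beta> + v) \<le> hom n (2 * v)) \<and>
     (\<forall>n. \<forall>u\<ge>0. a ^ n * u / 4 \<le> AA \<beta> n (hcrit \<beta> + u))"
    using critical_window by blast
  obtain \<delta>2 where \<delta>2: "0 < \<delta>2" "\<forall>X. \<exists>C\<ge>1. \<forall>\<beta> n G h0 \<xi> u. 0 \<le> \<beta> \<longrightarrow> \<beta> \<le> \<delta>2 \<longrightarrow> expoly G \<longrightarrow> 0 \<le> \<xi> \<longrightarrow> \<xi> \<le> 1 \<longrightarrow>
     (\<forall>v\<ge>0. G (h0 + v) \<le> hom n (2 * (v + \<xi> / a ^ n)) ^ 4) \<longrightarrow> 0 \<le> u \<longrightarrow> a ^ n * u \<le> X \<longrightarrow>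
     heat (s \<beta> n) G (h0 + u) - G (h0 + u) \<le> C * (\<beta> * \<rho> ^ n)\<^sup>2"
    using heat_window by blast
  obtain Cw where Cw: "1 \<le> Cw" "\<And>\<beta> n G h0 \<xi> u. 0 \<le> \<beta> \<Longrightarrow> \<beta> \<le> \<delta>2 \<Longrightarrow> expoly G \<Longrightarrow> 0 \<le> \<xi> \<Longrightarrow> \<xi> \<le> 1 \<Longrightarrow>
     (\<forall>v\<ge>0. G (h0 + v) \<le> hom n (2 * (v + \<xi> / a ^ n)) ^ 4) \<Longrightarrow> 0 \<le> u \<Longrightarrow> a ^ n * u \<le> 1 \<Longrightarrow>
     heat (s \<beta> n) G (h0 + u) - G (h0 + u) \<le> Cw * (\<beta> * \<rho> ^ n)\<^sup>2"
    using spec[OF \<delta>2(2), of 1] by blast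
  obtain W where W: "1 \<le> W" "\<And>m v. 0 \<le> v \<Longrightarrow> a ^ m * v \<le> 2 \<Longrightarrow> hom m v \<le> 1 + W * (a ^ m * v)"
    using hom_window[of 2] by blast
  \<comment> \<open>Ensures \<Gamma> + 4 W \<le> \<Gamma> a. The factor A^2 \<le> exp (4 W a^n u) in
    the recursion is then absorbed when exp (\<Gamma> a^n u) is replaced by exp (\<Gamma> a^(n+1)
    u).\<close>
  define k where "k = 4 * W / (a - 1)"
  have k: "k * (a - 1) = 4 * W" "0 \<le> k" using a_gt W(1) by (auto simp: k_def)
  define \<Gamma> where "\<Gamma> = 4 + k"
  have \<Gamma>a: "\<Gamma> + 4 * W \<le> \<Gamma> * a"
  proof -
    have "\<Gamma> * a = \<Gamma> + 4 * (a - 1) + k * (a - 1)" by (simp add: \<Gamma>_def algebra_simps)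
    then show ?thesis using k a_gt by simp
  qed
  have \<Gamma>2: "4 \<le> \<Gamma>" using k by (simp add: \<Gamma>_def)
  define M where "M = q\<^sup>2"
  have M0: "0 < M" using q by (simp add: M_def)
  define r where "r = \<rho>\<^sup>2 / M"
  have r: "0 \<le> r" "r < 1"
    using q \<rho>_gt power_strict_mono[of \<rho> q 2] by (auto simp: r_def M_def)
  define Dw where "Dw = 2 * Cw"
  \<comment> \<open>The accumulated sources: that of generation j, measured in units of (\<beta>
    q^j)^2, is of order (\<rho>^2 / q^2)^j. The initial value 2 is the constant of
    \<open>V_0\<close>.\<close>
  define U where "U n = 2 + Dw / M * (\<Sum>j<n. r ^ j)" for n
  define Ub where "Ub = 2 + Dw / M * (1 / (1 - r))"
  have U: "2 \<le> U n" "U n \<le> Ub" for n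
  proof -
    have D0: "0 \<le> Dw / M" using M0 Cw(1) by (simp add: Dw_def)
    then have "0 \<le> Dw / M * (\<Sum>j<n. r ^ j)" using r by (intro mult_nonneg_nonneg sum_nonneg) auto
    then show "2 \<le> U n" by (simp add: U_def)
    have "Dw / M * (\<Sum>j<n. r ^ j) \<le> Dw / M * (1 / (1 - r))"
      by (rule mult_left_mono[OF sum_geometric_le[OF r] D0])
    then show "U n \<le> Ub" by (simp add: U_def Ub_def)
  qed
  have Ub2: "2 \<le> Ub" using U[of 0] by simp
  define L where "L = exp \<Gamma> * (2 * Ub)"
  have L: "4 \<le> L" "2 * Ub \<le> L"
  proof -
    have "1 * (2 * Ub) \<le> exp \<Gamma> * (2 * Ub)" using \<Gamma>2 Ub2 by (intro mult_right_mono) auto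
    then show "2 * Ub \<le> L" by (simp add: L_def)
    then show "4 \<le> L" using Ub2 by simp
  qed
  define \<rho>1 where "\<rho>1 = sqrt \<rho>"
  have \<rho>1: "0 < \<rho>1" "\<rho>1 < 1" "\<rho>1\<^sup>2 = \<rho>" using \<rho>_gt \<rho>_lt by (auto simp: \<rho>1_def)
  define x where "x = (1 - \<rho>1) / (4 * Cg)"
  have x: "0 < x" "4 * Cg * x = 1 - \<rho>1" using \<rho>1 Cg1 by (auto simp: x_def)
  define d4 where "d4 = x\<^sup>2 / Cg"
  define d5 where "d5 = 1 / (4 * Cg * sqrt L)"
  define d6 where "d6 = 1 / (2 * L)"
  have d: "0 < d4" "0 < d5" "0 < d6" using x Cg1 L by (auto simp: d4_def d5_def d6_def)
  define \<delta> where "\<delta> = min (min 1 (min \<delta>1 \<delta>2)) (min d4 (min d5 d6))"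
  have \<delta>: "0 < \<delta>" "\<delta> \<le> 1" "\<delta> \<le> \<delta>1" "\<delta> \<le> \<delta>2" "\<delta> \<le> d4" "\<delta> \<le> d5" "\<delta> \<le> d6"
    unfolding \<delta>_def using \<delta>1(1) \<delta>2(1) d by (simp_all add: min_le_iff_disj)
  have \<delta>x: "Cg * \<delta> \<le> x\<^sup>2" using \<delta>(5) Cg1 by (simp add: field_simps d4_def)
  have \<delta>L: "Cg * sqrt L * \<delta> \<le> 1 / 4"
  proof -
    have "Cg * sqrt L * \<delta> \<le> Cg * sqrt L * (1 / (4 * Cg * sqrt L))" using \<delta>(6) Cg1 L by (intro mult_left_mono) (auto simp: d5_def)
    also have "\<dots> = 1 / 4" using Cg1 L by simp
    finally show ?thesis .
  qed
  have \<delta>2L: "L * \<delta> \<le> 1 / 2"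
  proof -
    have "L * \<delta> \<le> L * (1 / (2 * L))" using \<delta>(7) L by (intro mult_left_mono) (auto simp: d6_def)
    also have "\<dots> = 1 / 2" using L by simp
    finally show ?thesis .
  qed
  have main: "(\<forall>v\<ge>0. DD \<beta> n (hcrit \<beta> + v) \<le> (hom n (2 * (v + L * (\<beta> * q ^ n)\<^sup>2 / a ^ n)))\<^sup>2)
        \<and> (\<forall>u\<ge>0. a ^ n * u \<le> 1 \<longrightarrow> V \<beta> n (hcrit \<beta> + u) \<le> L * (\<beta> * q ^ n)\<^sup>2)
        \<and> (n < N \<longrightarrow> L * (\<beta> * q ^ n)\<^sup>2 \<le> 1)"
    if \<beta>: "0 < \<beta>" "\<beta> \<le> \<delta>" and sum: "\<beta> * (\<Sum>n<N. q ^ n) \<le> \<delta>" and nN: "n \<le> N" for \<beta> N n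
  proof -
    let ?hc = "hcrit \<beta>"
    have \<beta>1: "0 \<le> \<beta>" "\<beta> \<le> 1" "\<beta> \<le> \<delta>1" "\<beta> \<le> \<delta>2" using \<beta> \<delta> by auto
    have hcA: "AA \<beta> n ?hc \<le> 1" "0 \<le> v \<Longrightarrow> AA \<beta> n (?hc + v) \<le> hom n (2 * v)" for n v
      using spec[OF \<delta>1(2), of \<beta>] \<beta>(1) \<beta>1(3) by blast+
    define t where "t j = \<beta> * q ^ j" for j
    have t0: "0 < t j" for j using \<beta> q by (simp add: t_def)
    have tsum: "(\<Sum>j<N. t j) \<le> \<delta>" using sum by (simp add: t_def sum_distrib_left)
    have tsum': "(\<Sum>j<n. t j) \<le> \<delta>" if "n \<le> N" for n
      using tsum sum_mono2[of "{..<N}" "{..<n}" t] that t0 by (auto intro: less_imp_le order_trans)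
    have t\<delta>: "t j \<le> \<delta>" if "j < N" for j
      using member_le_sum[of j "{..<N}" t] that t0 tsum by (auto intro: less_imp_le order_trans)
    define e where "e j = L * (t j)\<^sup>2" for j
    have e0: "0 \<le> e j" for j using L by (simp add: e_def)
    have tM: "(t j)\<^sup>2 = \<beta>\<^sup>2 * M ^ j" for j
      unfolding t_def M_def power_mult_distrib by (simp add: power_mult[symmetric] mult.commute)
    have esum: "(\<Sum>j<n. e j) \<le> 1 / 2" if "n \<le> N" for n
    proof -
      have "(\<Sum>j<n. e j) \<le> (\<Sum>j<n. (L * \<delta>) * t j)"
      proof (rule sum_mono)
        fix j assume "j \<in> {..<n}"
        then have "t j * t j \<le> \<delta> * t j" using t\<delta>[of j] that t0[of j] by (intro mult_right_mono) auto
        then show "e j \<le> (L * \<delta>) * t j" unfolding e_def power2_eq_square mult.assoc using L by (intro mult_left_mono) auto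
      qed
      also have "\<dots> \<le> (1 / 2) * \<delta>"
        unfolding sum_distrib_left[symmetric] using \<delta>2L tsum'[OF that] L \<delta> t0
        by (intro mult_mono) (auto intro!: sum_nonneg less_imp_le[OF t0])
      finally show ?thesis using \<delta>(2) by simp
    qed
    have e1: "e j \<le> 1" if "j < N" for j
      using esum[of N] member_le_sum[of j "{..<N}" e] that e0 by auto
    \<comment> \<open>These factors pay for the term V / 2 in \<open>V_Suc_le\<close>, by which the
      recursion of the variance fails to be linear.\<close>
    define En where "En n = (\<Prod>j<n. 1 + e j)" for n
    have En: "En n \<le> 2" "1 \<le> En n" if "n \<le> N" for n
      unfolding En_def using prod_le_2[OF e0 esum[OF that]] by auto
    \<comment> \<open>The first summand dominates the smoothing error, the second the excess e j of
      the second moment at the critical point; \<open>growth_step\<close> compares both with the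
      square of \<zeta>. Hence \<zeta> is linear in \<beta> q^j, and it is the sum of the \<beta>
      q^j, not of their squares, that has to be small.\<close>
    define \<zeta> where "\<zeta> j = sqrt (Cg * \<beta>) * \<rho>1 ^ j + sqrt L * t j" for j
    have \<zeta>0: "0 < \<zeta> j" for j unfolding \<zeta>_def using Cg1 \<beta> \<rho>1 L t0 by (intro add_pos_pos mult_pos_pos) auto
    have \<zeta>2: "Cg * (\<beta> * \<rho> ^ j) \<le> (\<zeta> j)\<^sup>2" "e j \<le> (\<zeta> j)\<^sup>2" for j
    proof -
      have nn: "0 \<le> sqrt (Cg * \<beta>) * \<rho>1 ^ j" "0 \<le> sqrt L * t j" using Cg1 \<beta> \<rho>1 L t0[of j] by auto
      have "(\<rho>1 ^ j)\<^sup>2 = \<rho> ^ j" unfolding \<rho>1(3)[symmetric] by (metis power_mult mult.commute)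
      then have 1: "(sqrt (Cg * \<beta>) * \<rho>1 ^ j)\<^sup>2 = Cg * (\<beta> * \<rho> ^ j)" using Cg1 \<beta> by (simp add: power_mult_distrib)
      have 2: "(sqrt L * t j)\<^sup>2 = e j" using L by (simp add: power_mult_distrib e_def)
      show "Cg * (\<beta> * \<rho> ^ j) \<le> (\<zeta> j)\<^sup>2" unfolding 1[symmetric] \<zeta>_def using nn by (intro power_mono) auto
      show "e j \<le> (\<zeta> j)\<^sup>2" unfolding 2[symmetric] \<zeta>_def using nn by (intro power_mono) auto
    qed
    have Cz0: "0 \<le> Cg * \<zeta> j" for j using Cg1 \<zeta>0[of j] by simp
    have zsum: "(\<Sum>j<n. Cg * \<zeta> j) \<le> 1 / 2" if "n \<le> N" for n
    proof -
      have "Cg * \<beta> \<le> x\<^sup>2" using Cg1 by (intro order_trans[OF mult_left_mono[OF \<beta>(2)] \<delta>x]) auto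
      then have sx: "sqrt (Cg * \<beta>) \<le> x" using x by (intro real_le_lsqrt) auto
      have "(\<Sum>j<n. Cg * \<zeta> j) = Cg * sqrt (Cg * \<beta>) * (\<Sum>j<n. \<rho>1 ^ j) + Cg * sqrt L * (\<Sum>j<n. t j)"
        unfolding \<zeta>_def by (simp add: sum_distrib_left sum.distrib distrib_left mult.assoc)
      also have "\<dots> \<le> Cg * x * (1 / (1 - \<rho>1)) + Cg * sqrt L * \<delta>"
        using sx Cg1 \<rho>1 L tsum'[OF that] sum_geometric_le[of \<rho>1 n] x
        by (intro add_mono mult_mono mult_left_mono) (auto intro!: sum_nonneg)
      also have "Cg * x * (1 / (1 - \<rho>1)) = 1 / 4" using x \<rho>1 by (simp add: field_simps)
      finally show ?thesis using \<delta>L by simp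
    qed
    have Cz1: "Cg * \<zeta> j \<le> 1" if "j < N" for j
      using zsum[of N] member_le_sum[of j "{..<N}" "\<lambda>j. Cg * \<zeta> j"] that Cz0 by auto
    define c where "c k = (\<Prod>j<k. 1 + Cg * \<zeta> j)" for k
    have c: "1 \<le> c k" "c k \<le> 2" if "k \<le> N" for k
      unfolding c_def using prod_le_2[OF Cz0 zsum[OF that]] by auto
    have AAsq: "(AA \<beta> n (?hc + u))\<^sup>2 \<le> exp (4 * W * (a ^ n * u))" if u: "0 \<le> u" "a ^ n * u \<le> 1" for n u
    proof -
      have "AA \<beta> n (?hc + u) \<le> 1 + W * (a ^ n * (2 * u))" using hcA(2)[OF u(1), of n] W(2)[of "2 * u" n] u by simp
      also have "\<dots> \<le> exp (2 * W * (a ^ n * u))" using exp_ge_add_one_self[of "2 * W * (a ^ n * u)"] by (simp add: mult_ac)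
      finally have "(AA \<beta> n (?hc + u))\<^sup>2 \<le> (exp (2 * W * (a ^ n * u)))\<^sup>2" by (intro power_mono) auto
      then show ?thesis unfolding exp_double[symmetric] by (simp add: mult_ac)
    qed
    have Vbound: "V \<beta> n (?hc + u) \<le> e n"
      if "V \<beta> n (?hc + u) \<le> (t n)\<^sup>2 * (U n * En n * exp (\<Gamma> * (a ^ n * u)))" "0 \<le> u" "a ^ n * u \<le> 1" "n \<le> N" for n u
    proof -
      have "exp (\<Gamma> * (a ^ n * u)) \<le> exp \<Gamma>" using that(3) \<Gamma>2 mult_left_mono[of "a ^ n * u" 1 \<Gamma>] by simp
      then have "U n * En n * exp (\<Gamma> * (a ^ n * u)) \<le> Ub * 2 * exp \<Gamma>"
        using U[of n] En[OF that(4)] Ub2 by (intro mult_mono) auto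
      then have "(t n)\<^sup>2 * (U n * En n * exp (\<Gamma> * (a ^ n * u))) \<le> (t n)\<^sup>2 * (Ub * 2 * exp \<Gamma>)"
        by (intro mult_left_mono) auto
      then show ?thesis using that(1) by (simp add: e_def L_def mult_ac)
    qed
    have joint: "(\<forall>v\<ge>0. sqrt (DD \<beta> n (?hc + v)) \<le> hom n (c n * (v + e n / a ^ n)))
       \<and> (\<forall>u\<ge>0. a ^ n * u \<le> 1 \<longrightarrow> V \<beta> n (?hc + u) \<le> (t n)\<^sup>2 * (U n * En n * exp (\<Gamma> * (a ^ n * u))))" if "n \<le> N" for n
      using that
    proof (induction n)
      case 0
      have V0: "V \<beta> 0 (?hc + u) \<le> (t 0)\<^sup>2 * (U 0 * En 0 * exp (\<Gamma> * (a ^ 0 * u)))" if u: "0 \<le> u" for u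
      proof -
        have "V \<beta> 0 (?hc + u) \<le> (AA \<beta> 0 (?hc + u))\<^sup>2 * (2 * \<beta>\<^sup>2)" by (rule V_0[OF \<beta>1(1,2)])
        also have "\<dots> \<le> exp (\<Gamma> * u) * (2 * \<beta>\<^sup>2)"
        proof (intro mult_right_mono)
          have "AA \<beta> 0 (?hc + u) \<le> exp (2 * u)" using hcA(2)[OF u, of 0] by simp
          then have "(AA \<beta> 0 (?hc + u))\<^sup>2 \<le> (exp (2 * u))\<^sup>2" by (intro power_mono) auto
          also have "\<dots> \<le> exp (\<Gamma> * u)" unfolding exp_double[symmetric] using \<Gamma>2 u mult_right_mono[of 4 \<Gamma> u] by simp
          finally show "(AA \<beta> 0 (?hc + u))\<^sup>2 \<le> exp (\<Gamma> * u)" .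
        qed auto
        finally show ?thesis by (simp add: t_def U_def En_def mult_ac)
      qed
      have "sqrt (DD \<beta> 0 (?hc + v)) \<le> hom 0 (c 0 * (v + e 0 / a ^ 0))" if v: "0 \<le> v" for v
      proof (rule real_le_lsqrt)
        have "DD \<beta> 0 (?hc + v) = exp (2 * v) * DD \<beta> 0 ?hc" by (simp add: exp_add[symmetric] algebra_simps)
        also have "DD \<beta> 0 ?hc = (AA \<beta> 0 ?hc)\<^sup>2 + V \<beta> 0 ?hc" by (simp add: V_def)
        also have "\<dots> \<le> 1 + e 0"
          using hcA(1)[of 0] V0[of 0] Vbound[of 0 0] power_le_one[of "AA \<beta> 0 ?hc" 2]
          by (intro add_mono) auto
        also have "1 + e 0 \<le> exp (2 * e 0)" using exp_ge_add_one_self[of "2 * e 0"] e0[of 0] by linarith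
        also have "exp (2 * v) * exp (2 * e 0) = (exp (v + e 0))\<^sup>2"
          unfolding exp_double[symmetric] exp_add[symmetric] by (simp add: algebra_simps)
        finally show "DD \<beta> 0 (?hc + v) \<le> (hom 0 (c 0 * (v + e 0 / a ^ 0)))\<^sup>2" by (simp add: c_def del: DD.simps)
      qed (auto intro: less_imp_le[OF hom_pos] simp del: DD.simps hom.simps)
      then show ?case using V0 by blast
    next
      case (Suc n)
      then have nN: "n < N" "n \<le> N" by auto
      have IH1: "sqrt (DD \<beta> n (?hc + v)) \<le> hom n (c n * (v + e n / a ^ n))" if "0 \<le> v" for v using Suc that by auto
      have IH2: "V \<beta> n (?hc + u) \<le> (t n)\<^sup>2 * (U n * En n * exp (\<Gamma> * (a ^ n * u)))" if "0 \<le> u" "a ^ n * u \<le> 1" for u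
        using Suc that by auto
      have gD: "DD \<beta> n (?hc + v) \<le> (hom n (2 * (v + e n / a ^ n)))\<^sup>2" if "0 \<le> v" for v
      proof -
        have "c n * (v + e n / a ^ n) \<le> 2 * (v + e n / a ^ n)"
          using c[OF nN(2)] that e0[of n] by (intro mult_right_mono) auto
        then have "sqrt (DD \<beta> n (?hc + v)) \<le> hom n (2 * (v + e n / a ^ n))"
          by (rule order_trans[OF IH1[OF that] hom_mono])
        then have "(sqrt (DD \<beta> n (?hc + v)))\<^sup>2 \<le> (hom n (2 * (v + e n / a ^ n)))\<^sup>2" by (intro power_mono) auto
        then show ?thesis by simp
      qed
      have VS: "V \<beta> (Suc n) (?hc + u) \<le> (t (Suc n))\<^sup>2 * (U (Suc n) * En (Suc n) * exp (\<Gamma> * (a ^ Suc n * u)))"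
        if u: "0 \<le> u" "a ^ Suc n * u \<le> 1" for u
      proof -
        define y where "y = a ^ n * u"
        have y0: "0 \<le> y" using u by (simp add: y_def)
        have "1 * y \<le> a * y" using a_gt y0 by (intro mult_right_mono) auto
        moreover have "a * y = a ^ Suc n * u" by (simp add: y_def)
        ultimately have y1: "y \<le> 1" using u(2) by linarith
        have h1: "heat (s \<beta> n) (\<lambda>h. (DD \<beta> n h)\<^sup>2) (?hc + u) - (DD \<beta> n (?hc + u))\<^sup>2 \<le> Cw * (\<beta> * \<rho> ^ n)\<^sup>2"
        proof (rule Cw(2)[OF \<beta>1(1) \<beta>1(4) _ e0 e1[OF nN(1)]])
          show "\<forall>v\<ge>0. (DD \<beta> n (?hc + v))\<^sup>2 \<le> hom n (2 * (v + e n / a ^ n)) ^ 4"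
          proof (intro allI impI)
            fix v :: real assume "0 \<le> v"
            then have "(DD \<beta> n (?hc + v))\<^sup>2 \<le> ((hom n (2 * (v + e n / a ^ n)))\<^sup>2)\<^sup>2" by (intro power_mono gD) auto
            then show "(DD \<beta> n (?hc + v))\<^sup>2 \<le> hom n (2 * (v + e n / a ^ n)) ^ 4" by simp
          qed
        qed (use u y1 in \<open>auto simp: y_def intro!: expoly_power expoly_DD\<close>)
        have h2: "heat (s \<beta> n) (\<lambda>h. (ff (AA \<beta> n h))\<^sup>2) (?hc + u) - (ff (AA \<beta> n (?hc + u)))\<^sup>2 \<le> Cw * (\<beta> * \<rho> ^ n)\<^sup>2"
        proof (rule Cw(2)[OF \<beta>1(1) \<beta>1(4) ff_expoly_square[OF expoly_AA] e0 e1[OF nN(1)]])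
          show "\<forall>v\<ge>0. (ff (AA \<beta> n (?hc + v)))\<^sup>2 \<le> hom n (2 * (v + e n / a ^ n)) ^ 4"
          proof (intro allI impI)
            fix v :: real assume v: "0 \<le> v"
            let ?H = "hom n (2 * (v + e n / a ^ n))"
            have "AA \<beta> n (?hc + v) \<le> ?H"
              using hcA(2)[OF v, of n] hom_mono[of "2 * v" "2 * (v + e n / a ^ n)" n] e0[of n] by (auto intro: order_trans)
            then have "ff (AA \<beta> n (?hc + v)) \<le> ff ?H" by (intro ff_mono) auto
            also have "\<dots> \<le> ?H\<^sup>2" using v e0[of n] by (intro ff_le_square hom_ge_1) auto
            finally have "(ff (AA \<beta> n (?hc + v)))\<^sup>2 \<le> (?H\<^sup>2)\<^sup>2" using less_imp_le[OF ff_pos] by (intro power_mono) auto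
            then show "(ff (AA \<beta> n (?hc + v)))\<^sup>2 \<le> ?H ^ 4" by simp
          qed
        qed (use u y1 in \<open>auto simp: y_def\<close>)
        let ?V = "V \<beta> n (?hc + u)"
        have V1: "?V \<le> (t n)\<^sup>2 * (U n * En n * exp (\<Gamma> * y))" using IH2[of u] u y1 by (simp add: y_def)
        have V2: "?V \<le> e n" using Vbound[of n u] V1 u y1 nN by (simp add: y_def)
        have "(AA \<beta> n (?hc + u))\<^sup>2 + ?V / 2 \<le> exp (4 * W * y) + exp (4 * W * y) * e n"
        proof (intro add_mono)
          show "(AA \<beta> n (?hc + u))\<^sup>2 \<le> exp (4 * W * y)" using AAsq[OF u(1), of n] y1 by (simp add: y_def)
          have "1 \<le> exp (4 * W * y)" using W(1) y0 by simp
          then have "1 * e n \<le> exp (4 * W * y) * e n" using e0 by (intro mult_right_mono) auto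
          then show "?V / 2 \<le> exp (4 * W * y) * e n" using V2 V_nonneg[of \<beta> n "?hc + u"] by linarith
        qed
        then have "?V * ((AA \<beta> n (?hc + u))\<^sup>2 + ?V / 2) \<le> ((t n)\<^sup>2 * (U n * En n * exp (\<Gamma> * y))) * (exp (4 * W * y) * (1 + e n))"
          using V1 V_nonneg[of \<beta> n "?hc + u"] U[of n] En[OF nN(2)]
          by (intro mult_mono) (auto simp: distrib_left)
        also have "\<dots> = (t n)\<^sup>2 * (U n * En (Suc n) * exp ((\<Gamma> + 4 * W) * y))"
          by (simp add: En_def exp_add algebra_simps)
        also have "\<dots> \<le> (t n)\<^sup>2 * (U n * En (Suc n) * exp (\<Gamma> * a * y))"
          using \<Gamma>a y0 U[of n] En[OF Suc.prems] by (intro mult_left_mono) (auto intro!: mult_right_mono)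
        finally have m: "?V * ((AA \<beta> n (?hc + u))\<^sup>2 + ?V / 2) \<le> (t n)\<^sup>2 * (U n * En (Suc n) * exp (\<Gamma> * a * y))" .
        have "2 / B\<^sup>2 * (?V * ((AA \<beta> n (?hc + u))\<^sup>2 + ?V / 2)) \<le> M * ((t n)\<^sup>2 * (U n * En (Suc n) * exp (\<Gamma> * a * y)))"
          using M0 V_nonneg[of \<beta> n "?hc + u"] by (intro mult_mono[OF q(3)[folded M_def] m]) auto
        then have "V \<beta> (Suc n) (?hc + u) \<le> M * ((t n)\<^sup>2 * (U n * En (Suc n) * exp (\<Gamma> * a * y))) + Dw * (\<beta> * \<rho> ^ n)\<^sup>2"
          using V_Suc_le[of \<beta> n "?hc + u"] h1 h2 unfolding Dw_def by linarith
        also have "Dw * (\<beta> * \<rho> ^ n)\<^sup>2 = M * ((t n)\<^sup>2 * (Dw / M * r ^ n * 1))"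
          using M0 unfolding tM r_def by (simp add: power_mult_distrib power_divide power_mult[symmetric] mult.commute[of 2])
        also have "\<dots> \<le> M * ((t n)\<^sup>2 * (Dw / M * r ^ n * (En (Suc n) * exp (\<Gamma> * a * y))))"
        proof (intro mult_left_mono)
          have "1 * 1 \<le> En (Suc n) * exp (\<Gamma> * a * y)" using En[OF Suc.prems] \<Gamma>2 y0 by (intro mult_mono) auto
          then show "1 \<le> En (Suc n) * exp (\<Gamma> * a * y)" by simp
        qed (use M0 Cw(1) r in \<open>auto simp: Dw_def\<close>)
        also have "M * ((t n)\<^sup>2 * (U n * En (Suc n) * exp (\<Gamma> * a * y))) + M * ((t n)\<^sup>2 * (Dw / M * r ^ n * (En (Suc n) * exp (\<Gamma> * a * y))))
            = (M * (t n)\<^sup>2) * ((U n + Dw / M * r ^ n) * En (Suc n) * exp (\<Gamma> * a * y))" by (simp add: algebra_simps)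
        also have "U n + Dw / M * r ^ n = U (Suc n)" by (simp add: U_def algebra_simps)
        also have "M * (t n)\<^sup>2 = (t (Suc n))\<^sup>2" unfolding tM by simp
        also have "\<Gamma> * a * y = \<Gamma> * (a ^ Suc n * u)" by (simp add: y_def)
        finally show ?thesis by simp
      qed
      have "sqrt (DD \<beta> (Suc n) (?hc + v)) \<le> hom (Suc n) (c n * (1 + Cg * \<zeta> n) * (v + e (Suc n) / a ^ Suc n))"
        if v: "0 \<le> v" for v
      proof (rule Cg[of \<beta> "\<lambda>h. sqrt (DD \<beta> n h)" "\<lambda>h. sqrt (DD \<beta> (Suc n) h)" n ?hc "c n" "e n" "e (Suc n)" "\<zeta> n" v])
        have sq: "(ff (sqrt (DD \<beta> n h)))\<^sup>2 = ((DD \<beta> n h)\<^sup>2 + 2 * (B - 1) * DD \<beta> n h + (B - 1)\<^sup>2) / B\<^sup>2" for h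
        proof -
          have "y ^ 4 = (y\<^sup>2)\<^sup>2" for y :: real by simp
          then have "(sqrt (DD \<beta> n h)) ^ 4 = (DD \<beta> n h)\<^sup>2" by (metis real_sqrt_pow2 DD_nonneg)
          then show ?thesis unfolding ff_square by simp
        qed
        have ex: "expoly (\<lambda>h. ((DD \<beta> n h)\<^sup>2 + 2 * (B - 1) * DD \<beta> n h + (B - 1)\<^sup>2) / B\<^sup>2)"
          using B_gt by (intro expoly_divide expoly_add expoly_mult expoly_const expoly_power expoly_DD) auto
        show "expoly (\<lambda>h. (ff (sqrt (DD \<beta> n h)))\<^sup>2)" unfolding sq by (rule ex)
        show "expoly (\<lambda>h. (sqrt (DD \<beta> (Suc n) h))\<^sup>2)" using expoly_DD[of \<beta> "Suc n"] by (simp del: DD.simps)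
        show "(sqrt (DD \<beta> (Suc n) h))\<^sup>2 \<le> heat (s \<beta> n) (\<lambda>h. (ff (sqrt (DD \<beta> n h)))\<^sup>2) h" for h
        proof -
          have "DD \<beta> (Suc n) h \<le> heat (s \<beta> n) (\<lambda>h. (ff (sqrt (DD \<beta> n h)))\<^sup>2) h"
            unfolding DD.simps sq
            using AA_DD[of \<beta> n] B_gt
            by (intro heat_mono expoly_DD_step expoly_DD expoly_AA ex divide_right_mono add_mono mult_left_mono) auto
          then show ?thesis by (simp del: DD.simps)
        qed
        have "V \<beta> (Suc n) ?hc \<le> e (Suc n)" using VS[of 0] Vbound[of "Suc n" 0] Suc.prems by simp
        then have "DD \<beta> (Suc n) ?hc \<le> 1 + e (Suc n)"
          using hcA(1)[of "Suc n"] power_le_one[of "AA \<beta> (Suc n) ?hc" 2] by (simp add: V_def del: AA.simps DD.simps)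
        also have "\<dots> \<le> (1 + e (Suc n))\<^sup>2" using e0[of "Suc n"] by (simp add: power2_eq_square algebra_simps)
        finally show "sqrt (DD \<beta> (Suc n) ?hc) \<le> 1 + e (Suc n)" using e0[of "Suc n"] by (intro real_le_lsqrt) auto
      qed (use \<beta>1 IH1 c[OF nN(2)] e0 \<zeta>0 \<zeta>2 Cz1[OF nN(1)] v in \<open>auto simp del: DD.simps\<close>)
      then show ?case using VS by (simp add: c_def del: DD.simps hom.simps power_Suc)
    qed
    have "DD \<beta> n (?hc + v) \<le> (hom n (2 * (v + e n / a ^ n)))\<^sup>2" if "0 \<le> v" for v
    proof -
      have "sqrt (DD \<beta> n (?hc + v)) \<le> hom n (c n * (v + e n / a ^ n))" using joint[OF nN] that by blast
      also have "\<dots> \<le> hom n (2 * (v + e n / a ^ n))"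
        using c[OF nN] that e0[of n] by (intro hom_mono mult_right_mono add_nonneg_nonneg) auto
      finally have "(sqrt (DD \<beta> n (?hc + v)))\<^sup>2 \<le> (hom n (2 * (v + e n / a ^ n)))\<^sup>2" by (intro power_mono) auto
      then show ?thesis by simp
    qed
    moreover have "V \<beta> n (?hc + u) \<le> e n" if "0 \<le> u" "a ^ n * u \<le> 1" for u
      using Vbound joint[OF nN] that nN by blast
    ultimately show ?thesis using e1[of n] by (auto simp: e_def t_def)
  qed
  show ?thesis using main \<delta>(1) L(1) by (intro exI[of _ \<delta>] conjI exI[of _ L]) auto
qed

text \<open>Enlarges the window from a^n u \<le> 1 to a^n u \<le> X. It suffices to go back k
  generations with X < a^k; each of these k steps costs only a constant factor \<Lambda>. The
  smallness hypothesis on C (\<beta> q^N)^2 keeps the variance below 1 meanwhile, so that the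
  recursion is bounded by a linear one.\<close>

lemma variance_at_scale:
  assumes q: "0 < q" "\<rho> < q" "2 / B\<^sup>2 \<le> q\<^sup>2"
  shows "\<exists>\<delta>>0. \<forall>X\<ge>0. \<exists>C\<ge>1. \<forall>\<beta> N u. 0 < \<beta> \<longrightarrow> \<beta> \<le> \<delta> \<longrightarrow> \<beta> * (\<Sum>n<N. q ^ n) \<le> \<delta> \<longrightarrow>
     0 \<le> u \<longrightarrow> a ^ N * u \<le> X \<longrightarrow> C * (\<beta> * q ^ N)\<^sup>2 \<le> 1 \<longrightarrow> V \<beta> N (hcrit \<beta> + u) \<le> C * (\<beta> * q ^ N)\<^sup>2"
proof -
  obtain \<delta>1 where \<delta>1: "0 < \<delta>1" "\<forall>\<beta>. 0 < \<beta> \<longrightarrow> \<beta> \<le> \<delta>1 \<longrightarrow>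
     (\<forall>n. AA \<beta> n (hcrit \<beta>) \<le> 1) \<and>
     (\<forall>n. \<forall>v\<ge>0. AA \<beta> n (hcrit \<beta> + v) \<le> hom n (2 * v)) \<and>
     (\<forall>n. \<forall>u\<ge>0. a ^ n * u / 4 \<le> AA \<beta> n (hcrit \<beta> + u))"
    using critical_window by blast
  obtain \<delta>2 where \<delta>2: "0 < \<delta>2" "\<forall>X. \<exists>C\<ge>1. \<forall>\<beta> n G h0 \<xi> u. 0 \<le> \<beta> \<longrightarrow> \<beta> \<le> \<delta>2 \<longrightarrow> expoly G \<longrightarrow> 0 \<le> \<xi> \<longrightarrow> \<xi> \<le> 1 \<longrightarrow>
     (\<forall>v\<ge>0. G (h0 + v) \<le> hom n (2 * (v + \<xi> / a ^ n)) ^ 4) \<longrightarrow> 0 \<le> u \<longrightarrow> a ^ n * u \<le> X \<longrightarrow>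
     heat (s \<beta> n) G (h0 + u) - G (h0 + u) \<le> C * (\<beta> * \<rho> ^ n)\<^sup>2"
    using heat_window by blast
  obtain \<delta>3 L where L: "0 < \<delta>3" "1 \<le> L" "\<forall>\<beta> N. 0 < \<beta> \<longrightarrow> \<beta> \<le> \<delta>3 \<longrightarrow> \<beta> * (\<Sum>n<N. q ^ n) \<le> \<delta>3 \<longrightarrow>
     (\<forall>n\<le>N. (\<forall>v\<ge>0. DD \<beta> n (hcrit \<beta> + v) \<le> (hom n (2 * (v + L * (\<beta> * q ^ n)\<^sup>2 / a ^ n)))\<^sup>2)
        \<and> (\<forall>u\<ge>0. a ^ n * u \<le> 1 \<longrightarrow> V \<beta> n (hcrit \<beta> + u) \<le> L * (\<beta> * q ^ n)\<^sup>2)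
        \<and> (n < N \<longrightarrow> L * (\<beta> * q ^ n)\<^sup>2 \<le> 1))"
    using DD_growth_and_variance[OF q] by (elim exE conjE) (rule that)
  define \<delta> where "\<delta> = min (min 1 \<delta>1) (min \<delta>2 \<delta>3)"
  have \<delta>: "0 < \<delta>" "\<delta> \<le> 1" "\<delta> \<le> \<delta>1" "\<delta> \<le> \<delta>2" "\<delta> \<le> \<delta>3"
    unfolding \<delta>_def using \<delta>1(1) \<delta>2(1) L(1) by (simp_all add: min_le_iff_disj)
  have "\<exists>C\<ge>1. \<forall>\<beta> N u. 0 < \<beta> \<longrightarrow> \<beta> \<le> \<delta> \<longrightarrow> \<beta> * (\<Sum>n<N. q ^ n) \<le> \<delta> \<longrightarrow>
     0 \<le> u \<longrightarrow> a ^ N * u \<le> X \<longrightarrow> C * (\<beta> * q ^ N)\<^sup>2 \<le> 1 \<longrightarrow> V \<beta> N (hcrit \<beta> + u) \<le> C * (\<beta> * q ^ N)\<^sup>2"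
    if X: "0 \<le> X" for X
  proof -
    obtain Cx where Cx: "1 \<le> Cx" "\<And>\<beta> n G h0 \<xi> u. 0 \<le> \<beta> \<Longrightarrow> \<beta> \<le> \<delta>2 \<Longrightarrow> expoly G \<Longrightarrow> 0 \<le> \<xi> \<Longrightarrow> \<xi> \<le> 1 \<Longrightarrow>
       (\<forall>v\<ge>0. G (h0 + v) \<le> hom n (2 * (v + \<xi> / a ^ n)) ^ 4) \<Longrightarrow> 0 \<le> u \<Longrightarrow> a ^ n * u \<le> X \<Longrightarrow>
       heat (s \<beta> n) G (h0 + u) - G (h0 + u) \<le> Cx * (\<beta> * \<rho> ^ n)\<^sup>2"
      using spec[OF \<delta>2(2), of X] by blast
    obtain W where W: "1 \<le> W" "\<And>m v. 0 \<le> v \<Longrightarrow> a ^ m * v \<le> 2 * X \<Longrightarrow> hom m v \<le> 1 + W * (a ^ m * v)"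
      using hom_window[of "2 * X"] by blast
    obtain k where k: "X < a ^ k" using real_arch_pow[OF a_gt] by blast
    define A where "A = (1 + W * (2 * X))\<^sup>2"
    define C0 where "C0 = L + 2 * exp (4 * X)"
    define \<Lambda> where "\<Lambda> = A + 1 + 2 * Cx / q\<^sup>2"
    \<comment> \<open>Going back one generation multiplies (\<beta> q^n)^2 by 1 / q^2, which may lie
      on either side of 1; R bounds it in both cases.\<close>
    define R where "R = max 1 (1 / q\<^sup>2)"
    have A0: "0 \<le> A" by (simp add: A_def)
    have \<Lambda>1: "1 \<le> \<Lambda>" using A0 Cx(1) by (simp add: \<Lambda>_def)
    have R1: "1 \<le> R" "1 \<le> R * q\<^sup>2" using q by (auto simp: R_def max_def field_simps)
    have C01: "1 \<le> C0" using L(2) by (simp add: C0_def add_increasing2)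
    define C where "C = C0 * \<Lambda> ^ k * R ^ k"
    have "1 * 1 \<le> C0 * \<Lambda> ^ k" using C01 one_le_power[OF \<Lambda>1, of k] by (intro mult_mono) auto
    then have "1 * 1 \<le> (C0 * \<Lambda> ^ k) * R ^ k" using one_le_power[OF R1(1), of k] by (intro mult_mono) auto
    then have C1: "1 \<le> C" by (simp add: C_def)
    have "V \<beta> N (hcrit \<beta> + u) \<le> C * (\<beta> * q ^ N)\<^sup>2"
      if \<beta>: "0 < \<beta>" "\<beta> \<le> \<delta>" and sum: "\<beta> * (\<Sum>n<N. q ^ n) \<le> \<delta>" and u: "0 \<le> u" "a ^ N * u \<le> X"
        and small: "C * (\<beta> * q ^ N)\<^sup>2 \<le> 1" for \<beta> N u
    proof -
      let ?hc = "hcrit \<beta>"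
      define t where "t j = \<beta> * q ^ j" for j
      have t0: "0 < t j" for j using \<beta> q by (simp add: t_def)
      have tS: "(t (Suc j))\<^sup>2 = q\<^sup>2 * (t j)\<^sup>2" for j by (simp add: t_def power_mult_distrib)
      have \<beta>1: "0 \<le> \<beta>" "\<beta> \<le> 1" "\<beta> \<le> \<delta>1" "\<beta> \<le> \<delta>2" "\<beta> \<le> \<delta>3" using \<beta> \<delta> by auto
      have hcA: "0 \<le> v \<Longrightarrow> AA \<beta> n (?hc + v) \<le> hom n (2 * v)" for n v
        using spec[OF \<delta>1(2), of \<beta>] \<beta>(1) \<beta>1(3) by blast
      have sum3: "\<beta> * (\<Sum>n<N. q ^ n) \<le> \<delta>3" using sum \<delta>(5) by linarith
      have DL: "0 \<le> v \<Longrightarrow> DD \<beta> n (?hc + v) \<le> (hom n (2 * (v + L * (t n)\<^sup>2 / a ^ n)))\<^sup>2"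
        "0 \<le> u \<Longrightarrow> a ^ n * u \<le> 1 \<Longrightarrow> V \<beta> n (?hc + u) \<le> L * (t n)\<^sup>2"
        "n < N \<Longrightarrow> L * (t n)\<^sup>2 \<le> 1" if "n \<le> N" for n v u
        using L(3) \<beta>(1) \<beta>1(5) sum3 that unfolding t_def by blast+
      define n1 where "n1 = N - k"
      have base: "V \<beta> n1 (?hc + u) \<le> C0 * (t n1)\<^sup>2"
      proof (cases "k \<le> N")
        case True
        have "a ^ n1 * u * a ^ k = a ^ N * u" using True by (simp add: n1_def power_add[symmetric])
        then have "a ^ n1 * u * a ^ k \<le> 1 * a ^ k" using u k by linarith
        then have "a ^ n1 * u \<le> 1" by (rule mult_right_le_imp_le) simp
        then have "V \<beta> n1 (?hc + u) \<le> L * (t n1)\<^sup>2" using DL(2)[of n1 u] u by (simp add: n1_def)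
        also have "\<dots> \<le> C0 * (t n1)\<^sup>2" by (intro mult_right_mono) (auto simp: C0_def)
        finally show ?thesis .
      next
        case False
        then have n1: "n1 = 0" by (simp add: n1_def)
        have "1 * u \<le> a ^ N * u" using u one_le_a_pow by (intro mult_right_mono) auto
        then have uX: "u \<le> X" using u by simp
        have "AA \<beta> 0 (?hc + u) \<le> exp (2 * u)" using hcA[OF u(1), of 0] by simp
        then have "(AA \<beta> 0 (?hc + u))\<^sup>2 \<le> (exp (2 * u))\<^sup>2" by (intro power_mono) auto
        also have "\<dots> \<le> exp (4 * X)" unfolding exp_double[symmetric] using uX by simp
        finally have "(AA \<beta> 0 (?hc + u))\<^sup>2 * (2 * \<beta>\<^sup>2) \<le> exp (4 * X) * (2 * \<beta>\<^sup>2)" by (intro mult_right_mono) auto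
        also have "\<dots> \<le> C0 * \<beta>\<^sup>2"
          using L(2) mult_nonneg_nonneg[of L "\<beta>\<^sup>2"] by (simp add: C0_def algebra_simps)
        finally show ?thesis unfolding n1 using V_0[OF \<beta>1(1,2), of "?hc + u"] by (simp add: t_def)
      qed
      have tR: "(t n)\<^sup>2 \<le> R ^ (N - n) * (t N)\<^sup>2" if "n \<le> N" for n
        using that
      proof (induction n rule: inc_induct)
        case (step n)
        have "1 * (t n)\<^sup>2 \<le> R * q\<^sup>2 * (t n)\<^sup>2" using R1(2) by (intro mult_right_mono) auto
        also have "\<dots> = R * (t (Suc n))\<^sup>2" by (simp add: tS)
        also have "\<dots> \<le> R * (R ^ (N - Suc n) * (t N)\<^sup>2)" using step R1 by (intro mult_left_mono) auto
        also have "\<dots> = R ^ (N - n) * (t N)\<^sup>2"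
          using step(2) by (simp add: Suc_diff_Suc[symmetric] mult.assoc)
        finally show ?case by simp
      qed simp
      have step: "V \<beta> (n1 + j) (?hc + u) \<le> C0 * \<Lambda> ^ j * (t (n1 + j))\<^sup>2" if "n1 + j \<le> N" for j
        using that
      proof (induction j)
        case 0
        then show ?case using base by simp
      next
        case (Suc j)
        let ?n = "n1 + j"
        have nN: "?n < N" "?n \<le> N" using Suc by auto
        have jk: "j \<le> k" "N - ?n \<le> k" using Suc by (auto simp: n1_def)
        let ?V = "V \<beta> ?n (?hc + u)"
        have IH: "?V \<le> C0 * \<Lambda> ^ j * (t ?n)\<^sup>2" using Suc by simp
        have V1: "?V \<le> 1"
        proof -
          have "C0 * \<Lambda> ^ j * (t ?n)\<^sup>2 \<le> C0 * \<Lambda> ^ k * (R ^ k * (t N)\<^sup>2)"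
          proof (intro mult_mono)
            show "\<Lambda> ^ j \<le> \<Lambda> ^ k" using \<Lambda>1 jk by (intro power_increasing) auto
            have "R ^ (N - ?n) \<le> R ^ k" using R1 jk by (intro power_increasing) auto
            then have "R ^ (N - ?n) * (t N)\<^sup>2 \<le> R ^ k * (t N)\<^sup>2" by (intro mult_right_mono) auto
            then show "(t ?n)\<^sup>2 \<le> R ^ k * (t N)\<^sup>2" using tR[OF nN(2)] by linarith
          qed (use C01 \<Lambda>1 in auto)
          also have "\<dots> = C * (\<beta> * q ^ N)\<^sup>2" by (simp add: C_def t_def mult_ac)
          finally show ?thesis using IH small by linarith
        qed
        have "a ^ ?n * u \<le> a ^ N * u" using nN u a_gt by (intro mult_right_mono power_increasing) auto
        then have uX: "a ^ ?n * u \<le> X" using u by linarith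
        have e: "0 \<le> L * (t ?n)\<^sup>2" "L * (t ?n)\<^sup>2 \<le> 1" using L(2) DL(3)[OF nN(2,1)] by auto
        have h1: "heat (s \<beta> ?n) (\<lambda>h. (DD \<beta> ?n h)\<^sup>2) (?hc + u) - (DD \<beta> ?n (?hc + u))\<^sup>2 \<le> Cx * (\<beta> * \<rho> ^ ?n)\<^sup>2"
        proof (rule Cx(2)[OF \<beta>1(1) \<beta>1(4) _ e _ u(1) uX])
          show "\<forall>v\<ge>0. (DD \<beta> ?n (?hc + v))\<^sup>2 \<le> hom ?n (2 * (v + L * (t ?n)\<^sup>2 / a ^ ?n)) ^ 4"
          proof (intro allI impI)
            fix v :: real assume "0 \<le> v"
            then have "(DD \<beta> ?n (?hc + v))\<^sup>2 \<le> ((hom ?n (2 * (v + L * (t ?n)\<^sup>2 / a ^ ?n)))\<^sup>2)\<^sup>2"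
              using DL(1)[OF nN(2)] by (intro power_mono) auto
            then show "(DD \<beta> ?n (?hc + v))\<^sup>2 \<le> hom ?n (2 * (v + L * (t ?n)\<^sup>2 / a ^ ?n)) ^ 4" by simp
          qed
        qed (intro expoly_power expoly_DD)
        have h2: "heat (s \<beta> ?n) (\<lambda>h. (ff (AA \<beta> ?n h))\<^sup>2) (?hc + u) - (ff (AA \<beta> ?n (?hc + u)))\<^sup>2 \<le> Cx * (\<beta> * \<rho> ^ ?n)\<^sup>2"
        proof (rule Cx(2)[OF \<beta>1(1) \<beta>1(4) ff_expoly_square[OF expoly_AA] e _ u(1) uX])
          show "\<forall>v\<ge>0. (ff (AA \<beta> ?n (?hc + v)))\<^sup>2 \<le> hom ?n (2 * (v + L * (t ?n)\<^sup>2 / a ^ ?n)) ^ 4"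
          proof (intro allI impI)
            fix v :: real assume v: "0 \<le> v"
            let ?H = "hom ?n (2 * (v + L * (t ?n)\<^sup>2 / a ^ ?n))"
            have "AA \<beta> ?n (?hc + v) \<le> ?H"
              using hcA[OF v, of ?n] hom_mono[of "2 * v" "2 * (v + L * (t ?n)\<^sup>2 / a ^ ?n)" ?n] e by (auto intro: order_trans)
            then have "ff (AA \<beta> ?n (?hc + v)) \<le> ff ?H" by (intro ff_mono) auto
            also have "\<dots> \<le> ?H\<^sup>2" using v e by (intro ff_le_square hom_ge_1) auto
            finally have "(ff (AA \<beta> ?n (?hc + v)))\<^sup>2 \<le> (?H\<^sup>2)\<^sup>2" using less_imp_le[OF ff_pos] by (intro power_mono) auto
            then show "(ff (AA \<beta> ?n (?hc + v)))\<^sup>2 \<le> ?H ^ 4" by simp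
          qed
        qed
        have "AA \<beta> ?n (?hc + u) \<le> 1 + W * (a ^ ?n * (2 * u))"
          using hcA[OF u(1), of ?n] W(2)[of "2 * u" ?n] u uX by (simp add: mult.left_commute)
        also have "\<dots> \<le> 1 + W * (2 * X)" using uX W(1) by (intro add_left_mono mult_left_mono) auto
        finally have "(AA \<beta> ?n (?hc + u))\<^sup>2 \<le> A" unfolding A_def by (intro power_mono) auto
        then have "?V * ((AA \<beta> ?n (?hc + u))\<^sup>2 + ?V / 2) \<le> (C0 * \<Lambda> ^ j * (t ?n)\<^sup>2) * (A + 1)"
          using IH V1 V_nonneg[of \<beta> ?n "?hc + u"] C01 \<Lambda>1 by (intro mult_mono add_mono) auto
        then have m: "2 / B\<^sup>2 * (?V * ((AA \<beta> ?n (?hc + u))\<^sup>2 + ?V / 2)) \<le> q\<^sup>2 * ((C0 * \<Lambda> ^ j * (t ?n)\<^sup>2) * (A + 1))"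
          using V_nonneg[of \<beta> ?n "?hc + u"] by (intro mult_mono[OF q(3)]) auto
        have \<rho>t: "(\<beta> * \<rho> ^ ?n)\<^sup>2 \<le> (t ?n)\<^sup>2"
          unfolding t_def using q \<beta>1 by (intro power_mono mult_left_mono) auto
        have "2 * Cx * (\<beta> * \<rho> ^ ?n)\<^sup>2 \<le> 2 * Cx * (t ?n)\<^sup>2" using \<rho>t Cx(1) by (intro mult_left_mono) auto
        also have "\<dots> \<le> (C0 * \<Lambda> ^ j) * (2 * Cx * (t ?n)\<^sup>2)"
        proof -
          have "1 * 1 \<le> C0 * \<Lambda> ^ j" using C01 one_le_power[OF \<Lambda>1, of j] by (intro mult_mono) auto
          then have "1 * (2 * Cx * (t ?n)\<^sup>2) \<le> (C0 * \<Lambda> ^ j) * (2 * Cx * (t ?n)\<^sup>2)"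
            using Cx(1) by (intro mult_right_mono) auto
          then show ?thesis by simp
        qed
        also have "\<dots> = q\<^sup>2 * ((C0 * \<Lambda> ^ j * (t ?n)\<^sup>2) * (2 * Cx / q\<^sup>2))" using q(1) by simp
        finally have "V \<beta> (Suc ?n) (?hc + u) \<le> q\<^sup>2 * ((C0 * \<Lambda> ^ j * (t ?n)\<^sup>2) * (A + 1)) + q\<^sup>2 * ((C0 * \<Lambda> ^ j * (t ?n)\<^sup>2) * (2 * Cx / q\<^sup>2))"
          using V_Suc_le[of \<beta> ?n "?hc + u"] h1 h2 m by linarith
        also have "\<dots> = C0 * \<Lambda> ^ Suc j * (t (Suc ?n))\<^sup>2" unfolding tS \<Lambda>_def by (simp add: algebra_simps)
        finally show ?case by simp
      qed
      define j where "j = N - n1"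
      have j: "n1 + j = N" "j \<le> k" by (auto simp: j_def n1_def)
      have "V \<beta> N (?hc + u) \<le> C0 * \<Lambda> ^ j * (t N)\<^sup>2" using step[of j] j by simp
      also have "\<dots> \<le> C0 * \<Lambda> ^ k * R ^ k * (t N)\<^sup>2"
      proof (intro mult_right_mono)
        have "\<Lambda> ^ j \<le> \<Lambda> ^ k" using \<Lambda>1 j by (intro power_increasing) auto
        then have "C0 * \<Lambda> ^ j * 1 \<le> C0 * \<Lambda> ^ k * R ^ k"
          using C01 \<Lambda>1 one_le_power[OF R1(1), of k] by (intro mult_mono) auto
        then show "C0 * \<Lambda> ^ j \<le> C0 * \<Lambda> ^ k * R ^ k" by simp
      qed auto
      finally show ?thesis by (simp add: C_def t_def)
    qed
    then show ?thesis using C1 by blast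
  qed
  then show ?thesis using \<delta>(1) by blast
qed

section \<open>Comparison of the free energies at the correlation length\<close>

text \<open>The analysis is kept apart from the probability: of the function F, later the quenched
  free energy, only the outcome of the second moment method is assumed. At a scale with a^n u
  between X and 2 X the annealed side is at most \<Lambda> + 1 per block and the quenched side about
  \<Lambda>, so a large \<Lambda> makes the constants relatively small. The threshold \<delta> is
  chosen before \<eta>.\<close>

lemma free_energy_comparison:
  assumes q: "0 < q" "\<rho> < q" "2 / B\<^sup>2 \<le> q\<^sup>2"
    and F: "\<And>\<beta> h n. 0 < \<beta> \<Longrightarrow> 1 \<le> n \<Longrightarrow> 2 \<le> AA \<beta> n h \<Longrightarrow>
      ((1 - 4 * V \<beta> n h) * (ln (AA \<beta> n h) - ln 2) - D) / 2 ^ n \<le> F \<beta> h"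
    and D: "0 \<le> D"
  shows "\<exists>\<delta>>0. \<forall>\<eta>. 0 < \<eta> \<longrightarrow> \<eta> < 1 \<longrightarrow> (\<exists>X\<ge>4. \<exists>\<theta>>0. \<forall>\<beta> n u. 0 < \<beta> \<longrightarrow> \<beta> \<le> \<delta> \<longrightarrow> 1 \<le> n \<longrightarrow>
     \<beta> * (\<Sum>j<n. q ^ j) \<le> \<delta> \<longrightarrow> X \<le> a ^ n * u \<longrightarrow> a ^ n * u \<le> 2 * X \<longrightarrow> \<beta> * q ^ n \<le> \<theta> \<longrightarrow> \<beta> * \<rho> ^ n \<le> \<theta> \<longrightarrow>
     (1 - \<eta>) * fa \<beta> (hcrit \<beta> + u) \<le> F \<beta> (hcrit \<beta> + u))"
proof -
  obtain \<delta>1 where \<delta>1: "0 < \<delta>1" "\<forall>\<beta>. 0 < \<beta> \<longrightarrow> \<beta> \<le> \<delta>1 \<longrightarrow>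
     (\<forall>n. AA \<beta> n (hcrit \<beta>) \<le> 1) \<and>
     (\<forall>n. \<forall>v\<ge>0. AA \<beta> n (hcrit \<beta> + v) \<le> hom n (2 * v)) \<and>
     (\<forall>n. \<forall>u\<ge>0. a ^ n * u / 4 \<le> AA \<beta> n (hcrit \<beta> + u))"
    using critical_window by blast
  obtain \<delta>2 where \<delta>2: "0 < \<delta>2" "\<forall>X\<ge>0. \<exists>C\<ge>1. \<forall>\<beta> N u. 0 < \<beta> \<longrightarrow> \<beta> \<le> \<delta>2 \<longrightarrow> \<beta> * (\<Sum>n<N. q ^ n) \<le> \<delta>2 \<longrightarrow>
     0 \<le> u \<longrightarrow> a ^ N * u \<le> X \<longrightarrow> C * (\<beta> * q ^ N)\<^sup>2 \<le> 1 \<longrightarrow> V \<beta> N (hcrit \<beta> + u) \<le> C * (\<beta> * q ^ N)\<^sup>2"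
    using variance_at_scale[OF q] by blast
  define \<delta> where "\<delta> = min \<delta>1 \<delta>2"
  have \<delta>: "0 < \<delta>" "\<delta> \<le> \<delta>1" "\<delta> \<le> \<delta>2" using \<delta>1(1) \<delta>2(1) by (auto simp: \<delta>_def)
  have "\<exists>X\<ge>4. \<exists>\<theta>>0. \<forall>\<beta> n u. 0 < \<beta> \<longrightarrow> \<beta> \<le> \<delta> \<longrightarrow> 1 \<le> n \<longrightarrow>
     \<beta> * (\<Sum>j<n. q ^ j) \<le> \<delta> \<longrightarrow> X \<le> a ^ n * u \<longrightarrow> a ^ n * u \<le> 2 * X \<longrightarrow> \<beta> * q ^ n \<le> \<theta> \<longrightarrow> \<beta> * \<rho> ^ n \<le> \<theta> \<longrightarrow>
     (1 - \<eta>) * fa \<beta> (hcrit \<beta> + u) \<le> F \<beta> (hcrit \<beta> + u)" if \<eta>: "0 < \<eta>" "\<eta> < 1" for \<eta>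
  proof -
    \<comment> \<open>With this X the lower bound X / 4 of the first moment gives \<eta> / 2 *
      \<Lambda> \<ge> 2 + D, which pays for all constants. The other half of \<eta> pays for 4
      V.\<close>
    define X where "X = 4 * exp (2 * (2 + D) / \<eta>)"
    have X4: "4 \<le> X" using D \<eta> by (simp add: X_def)
    have lnX: "\<eta> / 2 * ln (X / 4) = 2 + D" using \<eta> by (simp add: X_def)
    obtain \<iota> where \<iota>: "0 < \<iota>" "\<forall>\<beta> n0 h0 u. 0 < \<beta> \<longrightarrow> \<beta> * \<rho> ^ n0 \<le> \<iota> \<longrightarrow>
     (\<forall>v\<ge>0. AA \<beta> n0 (h0 + v) \<le> hom n0 (2 * v)) \<longrightarrow> 1 \<le> AA \<beta> n0 (h0 + u) \<longrightarrow>
     X \<le> a ^ n0 * u \<longrightarrow> a ^ n0 * u \<le> 2 * X \<longrightarrow>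
     fa \<beta> (h0 + u) \<le> (ln (AA \<beta> n0 (h0 + u)) + 1) / 2 ^ n0"
      using fa_le_at_scale[OF X4] by blast
    obtain C where C: "1 \<le> C" "\<forall>\<beta> N u. 0 < \<beta> \<longrightarrow> \<beta> \<le> \<delta>2 \<longrightarrow> \<beta> * (\<Sum>n<N. q ^ n) \<le> \<delta>2 \<longrightarrow>
     0 \<le> u \<longrightarrow> a ^ N * u \<le> 2 * X \<longrightarrow> C * (\<beta> * q ^ N)\<^sup>2 \<le> 1 \<longrightarrow> V \<beta> N (hcrit \<beta> + u) \<le> C * (\<beta> * q ^ N)\<^sup>2"
    proof -
      have "0 \<le> 2 * X" using X4 by simp
      from spec[OF \<delta>2(2), of "2 * X", THEN mp, OF this] show ?thesis by (elim exE conjE) (rule that)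
    qed
    define \<theta> where "\<theta> = min \<iota> (sqrt (\<eta> / (8 * C)))"
    have \<theta>: "0 < \<theta>" "\<theta> \<le> \<iota>" using \<iota>(1) \<eta> C(1) by (auto simp: \<theta>_def)
    have \<theta>2: "C * \<theta>\<^sup>2 \<le> \<eta> / 8"
    proof -
      have "\<theta>\<^sup>2 \<le> (sqrt (\<eta> / (8 * C)))\<^sup>2" using \<theta>(1) by (intro power_mono) (auto simp: \<theta>_def)
      also have "\<dots> = \<eta> / (8 * C)" using \<eta> C(1) by simp
      finally have "C * \<theta>\<^sup>2 \<le> C * (\<eta> / (8 * C))" using C(1) by (intro mult_left_mono) auto
      also have "\<dots> = \<eta> / 8" using C(1) by simp
      finally show ?thesis .
    qed
    have "(1 - \<eta>) * fa \<beta> (hcrit \<beta> + u) \<le> F \<beta> (hcrit \<beta> + u)"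
      if \<beta>: "0 < \<beta>" "\<beta> \<le> \<delta>" and n: "1 \<le> n" and sum: "\<beta> * (\<Sum>j<n. q ^ j) \<le> \<delta>"
        and u1: "X \<le> a ^ n * u" and u2: "a ^ n * u \<le> 2 * X" and t1: "\<beta> * q ^ n \<le> \<theta>" and t2: "\<beta> * \<rho> ^ n \<le> \<theta>" for \<beta> n u
    proof -
      let ?h = "hcrit \<beta> + u"
      have "0 < a ^ n * u" using u1 X4 by linarith
      then have u0: "0 < u" by (rule zero_less_mult_pos) simp
      have cw: "0 \<le> v \<Longrightarrow> AA \<beta> m (hcrit \<beta> + v) \<le> hom m (2 * v)" "0 \<le> v \<Longrightarrow> a ^ m * v / 4 \<le> AA \<beta> m (hcrit \<beta> + v)" for m v
        using spec[OF \<delta>1(2), of \<beta>] \<beta> \<delta>(2) by auto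
      have "X / 4 \<le> AA \<beta> n ?h" using cw(2)[of u n] u0 u1 by linarith
      then have A1: "1 \<le> AA \<beta> n ?h" and lnA: "ln (X / 4) \<le> ln (AA \<beta> n ?h)"
        using X4 by (auto intro!: ln_mono)
      define \<Lambda> where "\<Lambda> = ln (AA \<beta> n ?h)"
      have \<Lambda>: "2 + D \<le> \<eta> / 2 * \<Lambda>" unfolding lnX[symmetric] \<Lambda>_def using lnA \<eta> by (intro mult_left_mono) auto
      have \<Lambda>1: "1 \<le> \<Lambda>"
      proof (rule ccontr)
        assume "\<not> 1 \<le> \<Lambda>"
        then have "\<eta> / 2 * \<Lambda> \<le> \<eta> / 2 * 1" using \<eta> by (intro mult_left_mono) auto
        then show False using \<Lambda> D \<eta> by linarith
      qed
      have A2: "2 \<le> AA \<beta> n ?h"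
        using exp_ge_add_one_self[of \<Lambda>] \<Lambda>1 A1 unfolding \<Lambda>_def by (simp add: exp_ln)
      have fa: "fa \<beta> ?h \<le> (\<Lambda> + 1) / 2 ^ n"
        unfolding \<Lambda>_def using \<iota>(2) \<beta> t2 \<theta>(2) cw(1) A1 u1 u2 by (meson order_trans)
      have "(\<beta> * q ^ n)\<^sup>2 \<le> \<theta>\<^sup>2" using t1 \<beta> q by (intro power_mono) auto
      then have Ct: "C * (\<beta> * q ^ n)\<^sup>2 \<le> \<eta> / 8" using \<theta>2 C(1) mult_left_mono[of "(\<beta> * q ^ n)\<^sup>2" "\<theta>\<^sup>2" C] by linarith
      have "V \<beta> n ?h \<le> C * (\<beta> * q ^ n)\<^sup>2"
      proof (rule C(2)[rule_format])
        show "\<beta> * (\<Sum>n<n. q ^ n) \<le> \<delta>2" using sum \<delta>(3) by linarith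
        show "C * (\<beta> * q ^ n)\<^sup>2 \<le> 1" using Ct \<eta> by linarith
      qed (use \<beta> \<delta> u0 u2 in auto)
      then have V: "4 * V \<beta> n ?h \<le> \<eta> / 2" using Ct by linarith
      have l2: "ln (2::real) \<le> 1" using ln_le_minus_one[of "2::real"] by simp
      have l20: "0 \<le> ln (2::real)" by simp
      have "(1 - \<eta>) * (\<Lambda> + 1) \<le> (1 - \<eta> / 2) * (\<Lambda> - ln 2) - D"
      proof -
        have "(1 - \<eta> / 2) * ln 2 \<le> 1 * 1" using l2 l20 \<eta> by (intro mult_mono) auto
        moreover have "(1 - \<eta>) * 1 \<le> 1" using \<eta> by simp
        ultimately show ?thesis using \<Lambda> by (simp add: algebra_simps)
      qed
      also have "\<dots> \<le> (1 - 4 * V \<beta> n ?h) * (\<Lambda> - ln 2) - D"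
        using V \<Lambda>1 l2 by (intro diff_right_mono mult_right_mono) auto
      finally have "(1 - \<eta>) * (\<Lambda> + 1) / 2 ^ n \<le> ((1 - 4 * V \<beta> n ?h) * (\<Lambda> - ln 2) - D) / 2 ^ n"
        by (intro divide_right_mono) auto
      also have "\<dots> \<le> F \<beta> ?h" unfolding \<Lambda>_def by (rule F[OF \<beta>(1) n A2])
      finally have "(1 - \<eta>) * ((\<Lambda> + 1) / 2 ^ n) \<le> F \<beta> ?h" by simp
      moreover have "(1 - \<eta>) * fa \<beta> ?h \<le> (1 - \<eta>) * ((\<Lambda> + 1) / 2 ^ n)" using fa \<eta> by (intro mult_left_mono) auto
      ultimately show ?thesis by linarith
    qed
    then show ?thesis using X4 \<theta>(1) by blast
  qed
  then show ?thesis using \<delta>(1) by blast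
qed

text \<open>The least admissible n does not overshoot by more than the factor a, and a < 2.\<close>

lemma obtain_scale:
  assumes "0 < u" "0 < X" "a ^ m * u < X"
  obtains n where "m < n" "X \<le> a ^ n * u" "a ^ n * u \<le> 2 * X"
proof -
  obtain k where "X / u < a ^ k" using real_arch_pow[OF a_gt] by blast
  then have ex: "\<exists>n. X \<le> a ^ n * u" using assms(1) by (auto simp: field_simps intro: less_imp_le)
  define n where "n = (LEAST n. X \<le> a ^ n * u)"
  have n: "X \<le> a ^ n * u" unfolding n_def by (rule LeastI_ex[OF ex])
  have less: "a ^ j * u < X" if "j < n" for j using not_less_Least[of j] that unfolding n_def by fastforce
  have "m < n"
  proof (rule ccontr)
    assume "\<not> m < n"
    then have "a ^ n * u \<le> a ^ m * u" using a_gt assms(1) by (intro mult_right_mono power_increasing) auto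
    then show False using n assms(3) by linarith
  qed
  then obtain j where j: "n = Suc j" by (cases n) auto
  have "a * (a ^ j * u) \<le> 2 * X" using less[of j] j a_lt assms(1) by (intro mult_mono) auto
  then have "a ^ n * u \<le> 2 * X" by (simp add: j)
  then show ?thesis using that \<open>m < n\<close> n by blast
qed

end

section \<open>Joint laws from characteristic functions\<close>

text \<open>A bounded signed weight W is reduced to a probability measure: 2 + W is positive, and
  its total mass m is the same on both sides by the hypothesis at t = 0. Uniqueness for one real
  variable under the density (2 + W) / m and under the original measure then gives the claim by
  subtraction.\<close>

lemma weighted_uniqueness:
  fixes X :: "'a \<Rightarrow> real" and Y :: "'b \<Rightarrow> real"
  assumes M: "prob_space M" and N: "prob_space N"
    and X [measurable]: "X \<in> borel_measurable M" and Y [measurable]: "Y \<in> borel_measurable N"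
    and W [measurable]: "W \<in> borel_measurable M" and W' [measurable]: "W' \<in> borel_measurable N"
    and Wb: "\<And>x. \<bar>W x\<bar> \<le> 1" and Wb': "\<And>x. \<bar>W' x\<bar> \<le> 1"
    and ch: "\<And>t. (CLINT x|M. iexp (t * X x)) = (CLINT x|N. iexp (t * Y x))"
    and chW: "\<And>t. (CLINT x|M. W x *\<^sub>R iexp (t * X x)) = (CLINT x|N. W' x *\<^sub>R iexp (t * Y x))"
    and A [measurable]: "A \<in> sets borel"
  shows "(\<integral>x. W x * indicator A (X x) \<partial>M) = (\<integral>x. W' x * indicator A (Y x) \<partial>N)"
proof -
  interpret M: prob_space M by fact
  interpret N: prob_space N by fact
  have iM: "integrable M (\<lambda>x. iexp (t * X x))" "integrable M (\<lambda>x. W x *\<^sub>R iexp (t * X x))" "integrable M W" for t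
    using Wb by (auto intro!: M.integrable_const_bound[where B = 1])
  have iN: "integrable N (\<lambda>x. iexp (t * Y x))" "integrable N (\<lambda>x. W' x *\<^sub>R iexp (t * Y x))" "integrable N W'" for t
    using Wb' by (auto intro!: N.integrable_const_bound[where B = 1])
  have iMA: "integrable M (\<lambda>x. W x * indicator A (X x))" "integrable M (\<lambda>x. indicator A (X x) :: real)"
    using Wb by (auto intro!: M.integrable_const_bound[where B = 1] simp: indicator_def)
  have iNA: "integrable N (\<lambda>x. W' x * indicator A (Y x))" "integrable N (\<lambda>x. indicator A (Y x) :: real)"
    using Wb' by (auto intro!: N.integrable_const_bound[where B = 1] simp: indicator_def)
  have "complex_of_real (\<integral>x. W x \<partial>M) = complex_of_real (\<integral>x. W' x \<partial>N)"
    using chW[of 0] by (simp add: scaleR_conv_of_real integral_complex_of_real)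
  then have Weq: "(\<integral>x. W x \<partial>M) = (\<integral>x. W' x \<partial>N)" by simp
  define m where "m = 2 + (\<integral>x. W x \<partial>M)"
  have "- 1 \<le> (\<integral>x. W x \<partial>M)"
    using M.integral_ge_const[OF iM(3), of "-1"] Wb by (auto simp: abs_le_iff intro!: AE_I2)
  then have m1: "1 \<le> m" by (simp add: m_def)
  define f where "f x = (2 + W x) / m" for x
  define g where "g x = (2 + W' x) / m" for x
  have [measurable]: "f \<in> borel_measurable M" "g \<in> borel_measurable N"
    unfolding f_def[abs_def] g_def[abs_def] by measurable
  have f0: "0 \<le> f x" for x using Wb[of x] m1 by (auto simp: f_def abs_le_iff intro!: divide_nonneg_pos)
  have g0: "0 \<le> g x" for x using Wb'[of x] m1 by (auto simp: g_def abs_le_iff intro!: divide_nonneg_pos)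
  have pf: "prob_space (density M f)"
  proof (rule prob_spaceI)
    have "emeasure (density M f) (space (density M f)) = (\<integral>\<^sup>+x. ennreal (f x) \<partial>M)"
      by (simp add: emeasure_density)
    also have "\<dots> = ennreal (\<integral>x. f x \<partial>M)"
      using f0 iM(3) by (intro nn_integral_eq_integral) (auto simp: f_def[abs_def])
    also have "(\<integral>x. f x \<partial>M) = 1" using iM(3) m1 by (simp add: f_def[abs_def] m_def M.prob_space)
    finally show "emeasure (density M f) (space (density M f)) = 1" by simp
  qed
  have pg: "prob_space (density N g)"
  proof (rule prob_spaceI)
    have "emeasure (density N g) (space (density N g)) = (\<integral>\<^sup>+x. ennreal (g x) \<partial>N)"
      by (simp add: emeasure_density)
    also have "\<dots> = ennreal (\<integral>x. g x \<partial>N)"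
      using g0 iN(3) by (intro nn_integral_eq_integral) (auto simp: g_def[abs_def])
    also have "(\<integral>x. g x \<partial>N) = 1" using iN(3) m1 by (simp add: g_def[abs_def] m_def N.prob_space Weq)
    finally show "emeasure (density N g) (space (density N g)) = 1" by simp
  qed
  have "distr (density M f) borel X = distr (density N g) borel Y"
  proof (rule Levy_uniqueness)
    show "real_distribution (distr (density M f) borel X)" "real_distribution (distr (density N g) borel Y)"
      using pf pg by (auto intro!: prob_space.real_distribution_distr)
    show "char (distr (density M f) borel X) = char (distr (density N g) borel Y)"
    proof
      fix t
      have "char (distr (density M f) borel X) t = (CLINT x|M. f x *\<^sub>R iexp (t * X x))"
        unfolding char_def using f0 by (simp add: integral_distr integral_density)
      also have "\<dots> = (CLINT x|M. (2 / m) *\<^sub>R iexp (t * X x) + (1 / m) *\<^sub>R (W x *\<^sub>R iexp (t * X x)))"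
        by (simp add: f_def add_divide_distrib scaleR_add_left)
      also have "\<dots> = (2 / m) *\<^sub>R (CLINT x|M. iexp (t * X x)) + (1 / m) *\<^sub>R (CLINT x|M. W x *\<^sub>R iexp (t * X x))"
        using iM(1,2)[of t] by (subst Bochner_Integration.integral_add) (auto simp del: scaleR_scaleR)
      also have "\<dots> = (2 / m) *\<^sub>R (CLINT x|N. iexp (t * Y x)) + (1 / m) *\<^sub>R (CLINT x|N. W' x *\<^sub>R iexp (t * Y x))"
        unfolding ch chW ..
      also have "\<dots> = (CLINT x|N. (2 / m) *\<^sub>R iexp (t * Y x) + (1 / m) *\<^sub>R (W' x *\<^sub>R iexp (t * Y x)))"
        using iN(1,2)[of t] by (subst Bochner_Integration.integral_add) (auto simp del: scaleR_scaleR)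
      also have "\<dots> = (CLINT x|N. g x *\<^sub>R iexp (t * Y x))"
        by (simp add: g_def add_divide_distrib scaleR_add_left)
      also have "\<dots> = char (distr (density N g) borel Y) t"
        unfolding char_def using g0 by (simp add: integral_distr integral_density)
      finally show "char (distr (density M f) borel X) t = char (distr (density N g) borel Y) t" .
    qed
  qed
  note eq = this
  have "(\<integral>x. f x * indicator A (X x) \<partial>M) = (\<integral>y. indicator A y \<partial>distr (density M f) borel X)"
    using f0 by (subst integral_distr) (simp_all add: integral_density)
  also have "\<dots> = (\<integral>x. g x * indicator A (Y x) \<partial>N)"
    unfolding eq using g0 by (subst integral_distr) (simp_all add: integral_density)
  finally have "(\<integral>x. f x * indicator A (X x) \<partial>M) = (\<integral>x. g x * indicator A (Y x) \<partial>N)" .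
  moreover have "f x * indicator A (X x) = 1 / m * (2 * indicator A (X x) + W x * indicator A (X x))" for x
    by (simp add: f_def field_simps)
  moreover have "g x * indicator A (Y x) = 1 / m * (2 * indicator A (Y x) + W' x * indicator A (Y x))" for x
    by (simp add: g_def field_simps)
  ultimately have "1 / m * (2 * (\<integral>x. indicator A (X x) \<partial>M) + (\<integral>x. W x * indicator A (X x) \<partial>M))
      = 1 / m * (2 * (\<integral>x. indicator A (Y x) \<partial>N) + (\<integral>x. W' x * indicator A (Y x) \<partial>N))"
    using iMA iNA by (simp add: integral_mult_right_zero del: integral_mult_right_zero)
  moreover have "(\<integral>x. indicator A (X x) \<partial>M) = (\<integral>x. indicator A (Y x) \<partial>N :: real)"
  proof -
    have "distr M borel X = distr N borel Y"
    proof (rule Levy_uniqueness)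
      show "real_distribution (distr M borel X)" "real_distribution (distr N borel Y)" by auto
      show "char (distr M borel X) = char (distr N borel Y)"
        using ch by (auto simp: char_def integral_distr)
    qed
    note eq = this
    have "(\<integral>x. indicator A (X x) \<partial>M) = (\<integral>y. indicator A y \<partial>distr M borel X :: real)"
      by (subst integral_distr) simp_all
    also have "\<dots> = (\<integral>x. indicator A (Y x) \<partial>N)"
      unfolding eq by (subst integral_distr) simp_all
    finally show ?thesis .
  qed
  ultimately show ?thesis using m1 by simp
qed

lemma iexp_cos_sin: "iexp x = complex_of_real (cos x) + \<i> * complex_of_real (sin x)"
  by (simp add: cis_conv_exp[symmetric] complex_eq_iff)

text \<open>Coordinates are turned one at a time from frequencies into test sets.\<close>

lemma joint_uniqueness_boxes:
  fixes X :: "'i \<Rightarrow> 'a \<Rightarrow> real" and Y :: "'i \<Rightarrow> 'b \<Rightarrow> real"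
  assumes M: "prob_space M" and N: "prob_space N"
    and X [measurable]: "\<And>i. X i \<in> borel_measurable M" and Y [measurable]: "\<And>i. Y i \<in> borel_measurable N"
    and ch: "\<And>K b. finite K \<Longrightarrow> K \<subseteq> I \<Longrightarrow> (CLINT x|M. iexp (\<Sum>k\<in>K. b k * X k x)) = (CLINT x|N. iexp (\<Sum>k\<in>K. b k * Y k x))"
    and A [measurable]: "\<And>i. A i \<in> sets borel"
    and J: "finite J" "J \<subseteq> I"
  shows "finite K \<Longrightarrow> K \<subseteq> I - J \<Longrightarrow>
    (CLINT x|M. (\<Prod>j\<in>J. indicator (A j) (X j x)) *\<^sub>R iexp (\<Sum>k\<in>K. b k * X k x))
      = (CLINT x|N. (\<Prod>j\<in>J. indicator (A j) (Y j x)) *\<^sub>R iexp (\<Sum>k\<in>K. b k * Y k x))"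
  using J
proof (induction J arbitrary: K b rule: finite_induct)
  case empty
  then show ?case using ch by simp
next
  case (insert j J)
  interpret M: prob_space M by fact
  interpret N: prob_space N by fact
  define P where "P x = (\<Prod>i\<in>J. indicator (A i) (X i x) :: real)" for x
  define Q where "Q x = (\<Prod>i\<in>J. indicator (A i) (Y i x) :: real)" for x
  define \<theta> where "\<theta> x = (\<Sum>k\<in>K. b k * X k x)" for x
  define \<phi> where "\<phi> x = (\<Sum>k\<in>K. b k * Y k x)" for x
  have [measurable]: "P \<in> borel_measurable M" "Q \<in> borel_measurable N" "\<theta> \<in> borel_measurable M" "\<phi> \<in> borel_measurable N"
    unfolding P_def[abs_def] Q_def[abs_def] \<theta>_def[abs_def] \<phi>_def[abs_def] by measurable
  have P01: "0 \<le> P x" "P x \<le> 1" for x unfolding P_def by (auto intro!: prod_nonneg prod_le_1 simp: indicator_def)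
  have Q01: "0 \<le> Q x" "Q x \<le> 1" for x unfolding Q_def by (auto intro!: prod_nonneg prod_le_1 simp: indicator_def)
  have jK: "j \<notin> K" "j \<in> I" "K \<subseteq> I - J" using insert by auto
  have shift: "(CLINT x|M. P x *\<^sub>R iexp (\<epsilon> * \<theta> x + t * X j x)) = (CLINT x|N. Q x *\<^sub>R iexp (\<epsilon> * \<phi> x + t * Y j x))" for \<epsilon> t :: real
  proof -
    define b' where "b' k = (if k = j then t else \<epsilon> * b k)" for k
    have "(\<Sum>k\<in>insert j K. b' k * X k x) = \<epsilon> * \<theta> x + t * X j x" for x
    proof -
      have "(\<Sum>k\<in>K. b' k * X k x) = (\<Sum>k\<in>K. \<epsilon> * (b k * X k x))"
        using jK by (intro sum.cong) (auto simp: b'_def)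
      then show ?thesis using jK insert.prems by (simp add: \<theta>_def sum_distrib_left b'_def)
    qed
    moreover have "(\<Sum>k\<in>insert j K. b' k * Y k x) = \<epsilon> * \<phi> x + t * Y j x" for x
    proof -
      have "(\<Sum>k\<in>K. b' k * Y k x) = (\<Sum>k\<in>K. \<epsilon> * (b k * Y k x))"
        using jK by (intro sum.cong) (auto simp: b'_def)
      then show ?thesis using jK insert.prems by (simp add: \<phi>_def sum_distrib_left b'_def)
    qed
    ultimately show ?thesis
      using insert.IH[of "insert j K" b'] insert.prems insert.hyps jK by (simp add: P_def Q_def)
  qed
  have iM: "integrable M (\<lambda>x. P x *\<^sub>R iexp (\<epsilon> * \<theta> x + t * X j x))" for \<epsilon> t :: real
    using P01 by (intro M.integrable_const_bound[where B = 1]) auto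
  have iN: "integrable N (\<lambda>x. Q x *\<^sub>R iexp (\<epsilon> * \<phi> x + t * Y j x))" for \<epsilon> t :: real
    using Q01 by (intro N.integrable_const_bound[where B = 1]) auto
  have chj: "(CLINT x|M. iexp (t * X j x)) = (CLINT x|N. iexp (t * Y j x))" for t
    using ch[of "{j}" "\<lambda>_. t"] jK by simp
  \<comment> \<open>The remaining phase enters through its cosine and sine, which are bounded real
    weights. Each is a combination of the phases with \<epsilon> = 1 and \<epsilon> = -1, so the
    induction hypothesis applies to both.\<close>
  have cosx: "(p * cos u) *\<^sub>R iexp v = (1/2) *\<^sub>R (p *\<^sub>R iexp (1 * u + v) + p *\<^sub>R iexp ((-1) * u + v))"
    and sinx: "(p * sin u) *\<^sub>R iexp v = (1/2) *\<^sub>R ((- \<i>) * (p *\<^sub>R iexp (1 * u + v) - p *\<^sub>R iexp ((-1) * u + v)))" for p u v :: real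
    unfolding iexp_cos_sin by (auto simp: complex_eq_iff cos_add sin_add cos_diff sin_diff algebra_simps)
  have C: "(\<integral>x. (P x * cos (\<theta> x)) * indicator (A j) (X j x) \<partial>M) = (\<integral>x. (Q x * cos (\<phi> x)) * indicator (A j) (Y j x) \<partial>N)"
  proof (rule weighted_uniqueness[OF M N X Y])
    show "\<bar>P x * cos (\<theta> x)\<bar> \<le> 1" for x using P01[of x] by (simp add: abs_mult mult_le_one)
    show "\<bar>Q x * cos (\<phi> x)\<bar> \<le> 1" for x using Q01[of x] by (simp add: abs_mult mult_le_one)
    show "(CLINT x|M. (P x * cos (\<theta> x)) *\<^sub>R iexp (t * X j x)) = (CLINT x|N. (Q x * cos (\<phi> x)) *\<^sub>R iexp (t * Y j x))" for t
      unfolding cosx by (simp only: integral_scaleR_right Bochner_Integration.integral_add[OF iM iM] Bochner_Integration.integral_add[OF iN iN] shift)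
  qed (use chj in auto)
  have S: "(\<integral>x. (P x * sin (\<theta> x)) * indicator (A j) (X j x) \<partial>M) = (\<integral>x. (Q x * sin (\<phi> x)) * indicator (A j) (Y j x) \<partial>N)"
  proof (rule weighted_uniqueness[OF M N X Y])
    show "\<bar>P x * sin (\<theta> x)\<bar> \<le> 1" for x using P01[of x] by (simp add: abs_mult mult_le_one)
    show "\<bar>Q x * sin (\<phi> x)\<bar> \<le> 1" for x using Q01[of x] by (simp add: abs_mult mult_le_one)
    show "(CLINT x|M. (P x * sin (\<theta> x)) *\<^sub>R iexp (t * X j x)) = (CLINT x|N. (Q x * sin (\<phi> x)) *\<^sub>R iexp (t * Y j x))" for t
      unfolding sinx by (simp only: integral_scaleR_right integral_mult_right_zero Bochner_Integration.integral_diff[OF iM iM] Bochner_Integration.integral_diff[OF iN iN] shift)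
  qed (use chj in auto)
  have split: "(p * i) *\<^sub>R iexp u = complex_of_real ((p * cos u) * i) + \<i> * complex_of_real ((p * sin u) * i)" for p i u :: real
    unfolding iexp_cos_sin by (simp add: complex_eq_iff algebra_simps)
  have iM': "integrable M (\<lambda>x. complex_of_real ((P x * cos (\<theta> x)) * indicator (A j) (X j x)))"
      "integrable M (\<lambda>x. \<i> * complex_of_real ((P x * sin (\<theta> x)) * indicator (A j) (X j x)))"
    using P01 by (auto intro!: M.integrable_const_bound[where B = 1] simp: norm_mult indicator_def abs_mult mult_le_one)
  have iN': "integrable N (\<lambda>x. complex_of_real ((Q x * cos (\<phi> x)) * indicator (A j) (Y j x)))"
      "integrable N (\<lambda>x. \<i> * complex_of_real ((Q x * sin (\<phi> x)) * indicator (A j) (Y j x)))"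
    using Q01 by (auto intro!: N.integrable_const_bound[where B = 1] simp: norm_mult indicator_def abs_mult mult_le_one)
  have "(CLINT x|M. (P x * indicator (A j) (X j x)) *\<^sub>R iexp (\<theta> x)) = (CLINT x|N. (Q x * indicator (A j) (Y j x)) *\<^sub>R iexp (\<phi> x))"
    unfolding split Bochner_Integration.integral_add[OF iM'] Bochner_Integration.integral_add[OF iN']
    by (simp only: integral_mult_right_zero integral_complex_of_real C S)
  then show ?case using insert.hyps by (simp add: P_def Q_def \<theta>_def \<phi>_def mult.commute)
qed

text \<open>Once every coordinate has been turned into a test set no frequency is left, and the box
  statement with empty K says that all boxes have equal probability. Boxes determine the
  measure.\<close>

lemma joint_uniqueness:
  fixes X :: "'i \<Rightarrow> 'a \<Rightarrow> real" and Y :: "'i \<Rightarrow> 'b \<Rightarrow> real"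
  assumes M: "prob_space M" and N: "prob_space N" and I: "finite I"
    and X [measurable]: "\<And>i. X i \<in> borel_measurable M" and Y [measurable]: "\<And>i. Y i \<in> borel_measurable N"
    and ch: "\<And>K b. finite K \<Longrightarrow> K \<subseteq> I \<Longrightarrow> (CLINT x|M. iexp (\<Sum>k\<in>K. b k * X k x)) = (CLINT x|N. iexp (\<Sum>k\<in>K. b k * Y k x))"
  shows "distr M (PiM I (\<lambda>_. borel)) (\<lambda>x. \<lambda>i\<in>I. X i x) = distr N (PiM I (\<lambda>_. borel)) (\<lambda>x. \<lambda>i\<in>I. Y i x)"
proof (rule measure_eqI_PiM_finite[OF I])
  interpret M: prob_space M by fact
  interpret N: prob_space N by fact
  have mX [measurable]: "(\<lambda>x. \<lambda>i\<in>I. X i x) \<in> measurable M (PiM I (\<lambda>_. borel))" by measurable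
  have mY [measurable]: "(\<lambda>x. \<lambda>i\<in>I. Y i x) \<in> measurable N (PiM I (\<lambda>_. borel))" by measurable
  show "range (\<lambda>_::nat. Pi\<^sub>E I (\<lambda>_. UNIV :: real set)) \<subseteq> prod_algebra I (\<lambda>_. borel)"
    using prod_algebraI_finite[OF I, of "\<lambda>_. UNIV" "\<lambda>_. borel"] by auto
  show "(\<Union>i::nat. Pi\<^sub>E I (\<lambda>_. UNIV :: real set)) = space (PiM I (\<lambda>_. borel))" by (simp add: space_PiM)
  show "emeasure (distr M (PiM I (\<lambda>_. borel)) (\<lambda>x. \<lambda>i\<in>I. X i x)) (Pi\<^sub>E I (\<lambda>_. UNIV)) \<noteq> \<infinity>"
    using prob_space.emeasure_le_1[OF M.prob_space_distr[OF mX]] by (metis ennreal_one_less_top infinity_ennreal_def not_le)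
  fix A :: "'i \<Rightarrow> real set" assume A': "\<And>i. i \<in> I \<Longrightarrow> A i \<in> sets borel"
  \<comment> \<open>The box lemma asks for measurable sets at every index, whereas A is known to be
    measurable only on I.\<close>
  define A1 where "A1 i = (if i \<in> I then A i else {})" for i
  have [measurable]: "A1 i \<in> sets borel" for i using A' by (auto simp: A1_def)
  have AE: "Pi\<^sub>E I A = Pi\<^sub>E I A1" by (auto simp: A1_def PiE_def Pi_def)
  have S: "Pi\<^sub>E I A1 \<in> sets (PiM I (\<lambda>_. borel))" using I by (intro sets_PiM_I_finite) auto
  have pX: "(\<Prod>j\<in>I. indicator (A1 j) (X j x)) = (indicator ((\<lambda>x. \<lambda>i\<in>I. X i x) -` Pi\<^sub>E I A1) x :: real)" for x
    using I by (auto simp: indicator_def PiE_def Pi_def intro!: prod.neutral)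
  have pY: "(\<Prod>j\<in>I. indicator (A1 j) (Y j x)) = (indicator ((\<lambda>x. \<lambda>i\<in>I. Y i x) -` Pi\<^sub>E I A1) x :: real)" for x
    using I by (auto simp: indicator_def PiE_def Pi_def intro!: prod.neutral)
  have "(CLINT x|M. (\<Prod>j\<in>I. indicator (A1 j) (X j x)) *\<^sub>R iexp (\<Sum>k\<in>{}. 0 * X k x))
      = (CLINT x|N. (\<Prod>j\<in>I. indicator (A1 j) (Y j x)) *\<^sub>R iexp (\<Sum>k\<in>{}. 0 * Y k x))"
    by (rule joint_uniqueness_boxes[OF M N X Y ch _ I order_refl]) auto
  then have "complex_of_real (\<integral>x. indicator ((\<lambda>x. \<lambda>i\<in>I. X i x) -` Pi\<^sub>E I A1) x \<partial>M)
      = complex_of_real (\<integral>x. indicator ((\<lambda>x. \<lambda>i\<in>I. Y i x) -` Pi\<^sub>E I A1) x \<partial>N)"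
    unfolding pX pY by (simp add: scaleR_conv_of_real integral_complex_of_real)
  then have "measure M ((\<lambda>x. \<lambda>i\<in>I. X i x) -` Pi\<^sub>E I A1 \<inter> space M) = measure N ((\<lambda>x. \<lambda>i\<in>I. Y i x) -` Pi\<^sub>E I A1 \<inter> space N)"
    by simp
  then show "emeasure (distr M (PiM I (\<lambda>_. borel)) (\<lambda>x. \<lambda>i\<in>I. X i x)) (Pi\<^sub>E I A)
      = emeasure (distr N (PiM I (\<lambda>_. borel)) (\<lambda>x. \<lambda>i\<in>I. Y i x)) (Pi\<^sub>E I A)"
    unfolding AE using S by (simp add: emeasure_distr M.emeasure_eq_measure N.emeasure_eq_measure)
qed simp_all

section \<open>Pathwise structure of the partition function\<close>

text \<open>A variable common to the whole block acts as a shift of h. Through this every shared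
  Gaussian becomes a convolution in h.\<close>

lemma Z_shift: "Z B \<beta> h (\<lambda>j. c + w j) n i = Z B \<beta> (h + \<beta> * c) w n i"
  by (induction n arbitrary: i) (simp_all add: algebra_simps)

lemma Z_block:
  "1 \<le> i \<Longrightarrow> Z B \<beta> h w n i = Z B \<beta> h (\<lambda>j. w (j + (i - 1) * 2 ^ n)) n 1"
proof (induction n arbitrary: i w)
  case (Suc n)
  let ?w = "\<lambda>j. w (j + (i - 1) * 2 ^ Suc n)"
  have 1: "Z B \<beta> h w n (2 * i - 1) = Z B \<beta> h ?w n 1"
  proof -
    have e1: "(2 * i - 1 - 1) * 2 ^ n = (i - 1) * 2 ^ Suc n" and i1: "1 \<le> 2 * i - 1"
      using Suc.prems by (cases i; simp)+
    show ?thesis using Suc.IH[OF i1, of w] unfolding e1 .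
  qed
  have e: "2 ^ n + (i - 1) * 2 ^ Suc n = (2 * i - 1) * 2 ^ n"
    if "1 \<le> i" for i :: nat using that by (cases i) (auto simp: algebra_simps)
  have 2: "Z B \<beta> h ?w n 2 = Z B \<beta> h w n (2 * i)"
    using Suc.IH[of 2 ?w] Suc.IH[of "2 * i" w] Suc.prems e[OF Suc.prems]
    by (simp add: add.assoc del: power_Suc)
  have "Z B \<beta> h w (Suc n) i = (Z B \<beta> h ?w n 1 * Z B \<beta> h ?w n 2 + B - 1) / B"
    unfolding 2 1[symmetric] by simp
  also have "\<dots> = Z B \<beta> h ?w (Suc n) 1" by (simp del: power_Suc)
  finally show ?case .
qed simp

text \<open>The first block of generation n reads the indices 1 to 2^n, so environments may be glued
  together or cut off outside that range.\<close>

lemma Z_local: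
  "(\<And>j. 1 \<le> j \<Longrightarrow> j \<le> 2 ^ n \<Longrightarrow> w j = w' j) \<Longrightarrow> Z B \<beta> h w n 1 = Z B \<beta> h w' n 1"
proof (induction n arbitrary: w w')
  case (Suc n)
  have 1: "Z B \<beta> h w n 1 = Z B \<beta> h w' n 1" using Suc.prems by (intro Suc.IH) auto
  have "Z B \<beta> h (\<lambda>j. w (j + 2 ^ n)) n 1 = Z B \<beta> h (\<lambda>j. w' (j + 2 ^ n)) n 1"
    using Suc.prems by (intro Suc.IH) auto
  then have 2: "Z B \<beta> h w n 2 = Z B \<beta> h w' n 2" using Z_block[of 2 B \<beta> h _ n] by simp
  show ?case using 1 2 by simp
qed simp

lemma Z_measurable:
  assumes [measurable]: "H \<in> borel_measurable M" and W: "\<And>j. (\<lambda>x. W x j) \<in> borel_measurable M"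
  shows "(\<lambda>x. Z B \<beta> (H x) (W x) n i) \<in> borel_measurable M"
proof (induction n arbitrary: i)
  case 0
  have [measurable]: "(\<lambda>x. W x i) \<in> borel_measurable M" by (rule W)
  show ?case by simp
next
  case (Suc n)
  note [measurable] = Suc
  show ?case by simp
qed

abbreviation FS :: "(nat \<Rightarrow> real) measure" where
  "FS \<equiv> PiM UNIV (\<lambda>_. borel)"

lemma FS_coord [measurable]: "f \<in> measurable M FS \<Longrightarrow> (\<lambda>x. f x j) \<in> borel_measurable M"
  by (rule measurable_compose[OF _ measurable_component_singleton[of j UNIV "\<lambda>_. borel"]]) auto

lemma prob_space_pair:
  assumes "prob_space M" "prob_space N" shows "prob_space (M \<Otimes>\<^sub>M N)"
proof -
  interpret M: prob_space M by fact
  interpret N: prob_space N by fact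
  interpret pair_prob_space M N ..
  show ?thesis by (rule P.prob_space_axioms)
qed

lemma std_normal_nn_symmetric:
  assumes [measurable]: "u \<in> borel_measurable borel"
  shows "(\<integral>\<^sup>+g. u (- g) \<partial>N01) = (\<integral>\<^sup>+g. u g \<partial>N01)"
proof -
  have "(\<integral>\<^sup>+g. u g \<partial>N01) = (\<integral>\<^sup>+x. ennreal (std_normal_density x) * u x \<partial>lborel)"
    by (simp add: nn_integral_density)
  also have "\<dots> = ennreal \<bar>- 1\<bar> * (\<integral>\<^sup>+x. ennreal (std_normal_density (0 + (- 1) * x)) * u (0 + (- 1) * x) \<partial>lborel)"
    by (rule nn_integral_real_affine) auto
  also have "\<dots> = (\<integral>\<^sup>+x. ennreal (std_normal_density x) * u (- x) \<partial>lborel)"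
    by (simp add: std_normal_density_def)
  also have "\<dots> = (\<integral>\<^sup>+g. u (- g) \<partial>N01)"
    by (simp add: nn_integral_density)
  finally show ?thesis ..
qed

context hier_pinning
begin

section \<open>The field of a block, glued from independent halves\<close>

definition cn :: "nat \<Rightarrow> real" where "cn n = sqrt (\<kappa> ^ Suc n * (1 - \<kappa>))"

lemma s_cn: "s \<beta> n = \<beta> * cn n"
  by (simp add: s_def cn_def)

definition glue :: "nat \<Rightarrow> real \<times> (nat \<Rightarrow> real) \<times> (nat \<Rightarrow> real) \<Rightarrow> nat \<Rightarrow> real" where
  "glue n p j = cn n * fst p + (if j \<le> 2 ^ n then fst (snd p) j else snd (snd p) (j - 2 ^ n))"

text \<open>The field of a block of generation \<open>n\<close> without the Gaussian variable common to the whole block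
  and to its surroundings.\<close>

primrec inner :: "nat \<Rightarrow> (nat \<Rightarrow> real) measure" where
  "inner 0 = distr N01 FS (\<lambda>g j. sqrt (1 - \<kappa>) * g)"
| "inner (Suc n) = distr (N01 \<Otimes>\<^sub>M (inner n \<Otimes>\<^sub>M inner n)) FS (glue n)"

lemma sets_inner [simp, measurable_cong]: "sets (inner n) = sets FS"
  by (cases n) auto

lemma space_inner [simp]: "space (inner n) = UNIV"
  using sets_eq_imp_space_eq[OF sets_inner] by (simp add: space_PiM)

lemma glue_measurable [measurable]: "glue n \<in> measurable (N01 \<Otimes>\<^sub>M (inner n \<Otimes>\<^sub>M inner n)) FS"
proof (rule measurable_PiM_single')
  show "(\<lambda>p. glue n p j) \<in> borel_measurable (N01 \<Otimes>\<^sub>M (inner n \<Otimes>\<^sub>M inner n))" for j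
    unfolding glue_def by (cases "j \<le> 2 ^ n") simp_all
qed auto

lemma base_measurable [measurable]: "(\<lambda>g j. c * g) \<in> measurable N01 FS"
  by (rule measurable_PiM_single') auto

lemma prob_inner: "prob_space (inner n)"
proof (induction n)
  case 0
  then show ?case by (simp add: prob_space.prob_space_distr[OF prob_space_N01])
next
  case (Suc n)
  then show ?case
    by (auto intro!: prob_space.prob_space_distr prob_space_pair prob_space_N01)
qed

lemma inner_Suc_nn:
  assumes [measurable]: "F \<in> borel_measurable FS"
  shows "(\<integral>\<^sup>+\<eta>. F \<eta> \<partial>inner (Suc n)) = (\<integral>\<^sup>+g. \<integral>\<^sup>+\<eta>. \<integral>\<^sup>+\<eta>'. F (glue n (g, \<eta>, \<eta>')) \<partial>inner n \<partial>inner n \<partial>N01)"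
proof -
  interpret K: prob_space "inner n" by (rule prob_inner)
  interpret KK: prob_space "inner n \<Otimes>\<^sub>M inner n" by (intro prob_space_pair prob_inner)
  have "(\<integral>\<^sup>+\<eta>. F \<eta> \<partial>inner (Suc n)) = (\<integral>\<^sup>+p. F (glue n p) \<partial>(N01 \<Otimes>\<^sub>M (inner n \<Otimes>\<^sub>M inner n)))"
    by (simp add: nn_integral_distr)
  also have "\<dots> = (\<integral>\<^sup>+g. \<integral>\<^sup>+q. F (glue n (g, q)) \<partial>(inner n \<Otimes>\<^sub>M inner n) \<partial>N01)"
    by (subst KK.nn_integral_fst[symmetric]) auto
  also have "\<dots> = (\<integral>\<^sup>+g. \<integral>\<^sup>+\<eta>. \<integral>\<^sup>+\<eta>'. F (glue n (g, \<eta>, \<eta>')) \<partial>inner n \<partial>inner n \<partial>N01)"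
    by (intro nn_integral_cong) (subst K.nn_integral_fst[symmetric], auto)
  finally show ?thesis .
qed

definition zz :: "real \<Rightarrow> nat \<Rightarrow> real \<Rightarrow> (nat \<Rightarrow> real) \<Rightarrow> real" where
  "zz \<beta> n h w = Z B \<beta> h w n 1"

lemma zz_measurable [measurable]:
  "H \<in> borel_measurable M \<Longrightarrow> W \<in> measurable M FS \<Longrightarrow> (\<lambda>x. zz \<beta> n (H x) (W x)) \<in> borel_measurable M"
  unfolding zz_def by (rule Z_measurable) (auto intro: FS_coord)

definition mix :: "real \<Rightarrow> real \<Rightarrow> real" where "mix x y = (x * y + B - 1) / B"

lemma zz_Suc: "zz \<beta> (Suc n) h w = mix (zz \<beta> n h w) (zz \<beta> n h (\<lambda>j. w (j + 2 ^ n)))"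
  using Z_block[of 2 B \<beta> h w n] by (simp add: zz_def mix_def)

text \<open>Given g, both halves are independent and see the same shifted field h + s g. This is the
  origin of the operator \<open>heat\<close> in the recursions.\<close>

lemma zz_glue: "zz \<beta> (Suc n) h (glue n (g, \<eta>, \<eta>')) = mix (zz \<beta> n (h + s \<beta> n * g) \<eta>) (zz \<beta> n (h + s \<beta> n * g) \<eta>')"
proof -
  have 1: "zz \<beta> n h (glue n (g, \<eta>, \<eta>')) = zz \<beta> n (h + s \<beta> n * g) \<eta>"
    using Z_local[of n "glue n (g, \<eta>, \<eta>')" "\<lambda>j. cn n * g + \<eta> j" B \<beta> h] Z_shift[of B \<beta> h "cn n * g" \<eta> n 1]
    by (simp add: zz_def glue_def s_cn mult.assoc)
  have 2: "zz \<beta> n h (\<lambda>j. glue n (g, \<eta>, \<eta>') (j + 2 ^ n)) = zz \<beta> n (h + s \<beta> n * g) \<eta>'"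
    using Z_local[of n "\<lambda>j. glue n (g, \<eta>, \<eta>') (j + 2 ^ n)" "\<lambda>j. cn n * g + \<eta>' j" B \<beta> h] Z_shift[of B \<beta> h "cn n * g" \<eta>' n 1]
    by (simp add: zz_def glue_def s_cn mult.assoc)
  show ?thesis unfolding zz_Suc 1 2 ..
qed

lemma zz_pos: "0 < zz \<beta> n h w"
proof (induction n arbitrary: w)
  case (Suc n)
  then show ?case unfolding zz_Suc mix_def using B_gt
    by (intro divide_pos_pos) (auto simp: add_diff_eq[symmetric] intro!: add_pos_pos)
qed (simp add: zz_def)

lemma zz_ge: "1 \<le> n \<Longrightarrow> (B - 1) / B \<le> zz \<beta> n h w"
proof (cases n)
  case (Suc m)
  have "0 < zz \<beta> m h w * zz \<beta> m h (\<lambda>j. w (j + 2 ^ m))" by (intro mult_pos_pos zz_pos)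
  then show ?thesis unfolding Suc zz_Suc mix_def using B_gt by (intro divide_right_mono) auto
qed simp

text \<open>Pathwise, the logarithmic derivative in h lies between 0 and the number of
  sites.\<close>

lemma zz_mono_growth: "0 \<le> t \<Longrightarrow> zz \<beta> n h w \<le> zz \<beta> n (h + t) w \<and> zz \<beta> n (h + t) w \<le> exp (2 ^ n * t) * zz \<beta> n h w"
proof (induction n arbitrary: w)
  case 0
  then show ?case by (simp add: zz_def exp_add algebra_simps)
next
  case (Suc n)
  let ?x = "zz \<beta> n h w" and ?y = "zz \<beta> n h (\<lambda>j. w (j + 2 ^ n))"
  let ?x' = "zz \<beta> n (h + t) w" and ?y' = "zz \<beta> n (h + t) (\<lambda>j. w (j + 2 ^ n))" and ?e = "exp (2 ^ n * t)"
  note IH = Suc.IH[OF Suc.prems, of w] Suc.IH[OF Suc.prems, of "\<lambda>j. w (j + 2 ^ n)"]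
  have p: "0 \<le> ?x" "0 \<le> ?y" "0 \<le> ?x'" "0 \<le> ?y'" by (simp_all add: less_imp_le[OF zz_pos])
  have 1: "?x * ?y \<le> ?x' * ?y'" using IH p by (intro mult_mono) auto
  have "?x' * ?y' \<le> (?e * ?x) * (?e * ?y)" using IH p by (intro mult_mono) auto
  also have "\<dots> = (?e * ?e) * (?x * ?y)" by (simp only: mult_ac)
  also have "?e * ?e = exp (2 ^ Suc n * t)" by (simp only: power_Suc mult.assoc exp_double power2_eq_square)
  finally have 2: "?x' * ?y' \<le> exp (2 ^ Suc n * t) * (?x * ?y)" .
  have 3: "B - 1 \<le> exp (2 ^ Suc n * t) * (B - 1)" 
  proof -
    have "1 * (B - 1) \<le> E * (B - 1)" if "1 \<le> E" for E :: real using that B_gt by (intro mult_right_mono) auto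
    from this[of "exp (2 ^ Suc n * t)"] show ?thesis using Suc.prems by simp
  qed
  have "mix ?x' ?y' \<le> (exp (2 ^ Suc n * t) * (?x * ?y) + exp (2 ^ Suc n * t) * (B - 1)) / B"
    unfolding mix_def add_diff_eq[symmetric] using B_gt by (intro divide_right_mono add_mono 2 3) auto
  also have "\<dots> = exp (2 ^ Suc n * t) * mix ?x ?y" by (simp add: mix_def algebra_simps)
  finally have "mix ?x' ?y' \<le> exp (2 ^ Suc n * t) * mix ?x ?y" .
  moreover have "mix ?x ?y \<le> mix ?x' ?y'" unfolding mix_def using 1 B_gt by (intro divide_right_mono) auto
  ultimately show ?case unfolding zz_Suc by simp
qed

lemma ln_zz_lipschitz: "\<bar>ln (zz \<beta> n (h + t) w) - ln (zz \<beta> n h w)\<bar> \<le> 2 ^ n * \<bar>t\<bar>"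
proof -
  have A: "\<bar>ln (zz \<beta> n (h + t) w) - ln (zz \<beta> n h w)\<bar> \<le> 2 ^ n * t" if "0 \<le> t" for h t
  proof -
    note g = zz_mono_growth[OF that, of \<beta> n h w]
    have "ln (zz \<beta> n h w) \<le> ln (zz \<beta> n (h + t) w)" using g by (intro ln_mono zz_pos) auto
    moreover have "ln (zz \<beta> n (h + t) w) \<le> ln (exp (2 ^ n * t) * zz \<beta> n h w)" using g by (intro ln_mono zz_pos) auto
    moreover have "ln (exp (2 ^ n * t) * zz \<beta> n h w) = 2 ^ n * t + ln (zz \<beta> n h w)" using zz_pos[of \<beta> n h w] by (simp add: ln_mult_pos)
    ultimately show ?thesis by simp
  qed
  show ?thesis
  proof (cases "0 \<le> t")
    case False
    then show ?thesis using A[of "-t" "h + t"] by simp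
  qed (use A in simp)
qed

text \<open>A polynomial in exp h with positive coefficients is log-convex. The midpoint form is
  proved because it is what averaging over g and -g needs. In the induction the products satisfy p^2
  \<le> (x x') (y y'), and 2 p \<le> x x' + y y' follows, which handles the terms mixed with B -
  1.\<close>

lemma zz_log_midconvex: "(zz \<beta> n h w)\<^sup>2 \<le> zz \<beta> n (h + t) w * zz \<beta> n (h - t) w"
proof (induction n arbitrary: w)
  case 0
  then show ?case by (simp add: zz_def exp_add[symmetric] exp_double[symmetric])
next
  case (Suc n)
  let ?w = "\<lambda>j. w (j + 2 ^ n)"
  define x y where "x = zz \<beta> n (h + t) w" and "y = zz \<beta> n (h - t) w"
  define x' y' where "x' = zz \<beta> n (h + t) ?w" and "y' = zz \<beta> n (h - t) ?w"
  define p where "p = zz \<beta> n h w * zz \<beta> n h ?w"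
  have pos: "0 < x" "0 < y" "0 < x'" "0 < y'" "0 < p" unfolding x_def y_def x'_def y'_def p_def by (intro zz_pos mult_pos_pos)+
  have "p\<^sup>2 \<le> (x * y) * (x' * y')" unfolding p_def power_mult_distrib x_def y_def x'_def y'_def
    using Suc by (intro mult_mono) (auto intro: less_imp_le zz_pos mult_pos_pos)
  then have P: "p\<^sup>2 \<le> (x * x') * (y * y')" by (simp add: mult_ac)
  have Q: "2 * p \<le> x * x' + y * y'"
  proof (rule power2_le_imp_le)
    have "(2 * p)\<^sup>2 \<le> 4 * ((x * x') * (y * y'))" using P by (simp add: power_mult_distrib)
    also have "\<dots> \<le> (x * x' + y * y')\<^sup>2"
    proof -
      have "4 * (u * v) \<le> (u + v)\<^sup>2" for u v :: real
        using zero_le_power2[of "u - v"] by (simp add: power2_diff power2_sum)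
      then show ?thesis .
    qed
    finally show "(2 * p)\<^sup>2 \<le> (x * x' + y * y')\<^sup>2" .
  qed (use pos in \<open>auto intro!: add_nonneg_nonneg less_imp_le mult_pos_pos\<close>)
  define c where "c = B - 1"
  have c: "0 < c" using B_gt by (simp add: c_def)
  have "(p + c)\<^sup>2 = p\<^sup>2 + c * (2 * p) + c\<^sup>2" by (simp add: power2_sum)
  also have "\<dots> \<le> (x * x') * (y * y') + c * (x * x' + y * y') + c\<^sup>2"
    using P Q c by (intro add_mono mult_left_mono) auto
  also have "\<dots> = (x * x' + c) * (y * y' + c)" by (simp add: power2_eq_square algebra_simps)
  finally have "(p + c)\<^sup>2 / B\<^sup>2 \<le> (x * x' + c) * (y * y' + c) / B\<^sup>2" using B_gt by (intro divide_right_mono) auto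
  then show ?case
    unfolding zz_Suc mix_def x_def[symmetric] y_def[symmetric] x'_def[symmetric] y'_def[symmetric]
    by (simp add: p_def c_def add_diff_eq power_divide power2_eq_square)
qed

subsection \<open>Moments of the partition function\<close>

lemma nn_heat:
  assumes "expoly G" shows "(\<integral>\<^sup>+g. ennreal (G (h + t * g)) \<partial>N01) = ennreal (heat t G h)"
  unfolding heat_def using assms
  by (intro nn_integral_eq_integral expoly_integrable) (auto intro: expoly_nonneg)

lemma nn_integral_affine_prob:
  assumes "prob_space K" and [measurable]: "f \<in> borel_measurable K" and f: "\<And>x. 0 \<le> f x"
    and i: "(\<integral>\<^sup>+x. ennreal (f x) \<partial>K) = ennreal m" and m: "0 \<le> m" and c: "0 \<le> c" "0 \<le> d"
  shows "(\<integral>\<^sup>+x. ennreal (c * f x + d) \<partial>K) = ennreal (c * m + d)"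
proof -
  interpret prob_space K by fact
  have "(\<integral>\<^sup>+x. ennreal (c * f x + d) \<partial>K) = (\<integral>\<^sup>+x. ennreal c * ennreal (f x) + ennreal d \<partial>K)"
    using f c by (intro nn_integral_cong) (simp add: ennreal_mult ennreal_plus)
  also have "\<dots> = ennreal c * ennreal m + ennreal d"
    by (subst nn_integral_add) (auto simp: nn_integral_cmult i emeasure_space_1)
  finally show ?thesis using c m by (simp add: ennreal_mult ennreal_plus)
qed

text \<open>Gives \<open>AA\<close> its meaning: by independence of the halves the mean of
  \<open>mix\<close> is \<open>ff\<close> of the mean, and integrating over g is
  \<open>heat\<close>. With extended non-negative integrals no integrability has to be known
  beforehand.\<close>

lemma nn_zz: "(\<integral>\<^sup>+\<eta>. ennreal (zz \<beta> n h \<eta>) \<partial>inner n) = ennreal (AA \<beta> n h)"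
proof (induction n arbitrary: h)
  case 0
  have k: "0 \<le> 1 - \<kappa>" using \<kappa>_half \<kappa>_pos by simp
  have "(\<integral>\<^sup>+\<eta>. ennreal (zz \<beta> 0 h \<eta>) \<partial>inner 0) = (\<integral>\<^sup>+g. ennreal (exp h * exp ((\<beta> * sqrt (1 - \<kappa>)) * g)) \<partial>N01)"
    unfolding inner.simps by (subst nn_integral_distr, measurable) (simp add: zz_def exp_add algebra_simps)
  also have "\<dots> = ennreal (\<integral>g. exp h * exp ((\<beta> * sqrt (1 - \<kappa>)) * g) \<partial>N01)"
    using std_normal_exp(1) by (intro nn_integral_eq_integral) auto
  also have "(\<integral>g. exp h * exp ((\<beta> * sqrt (1 - \<kappa>)) * g) \<partial>N01) = AA \<beta> 0 h"
    using k by (simp add: std_normal_exp power_mult_distrib exp_add)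
  finally show ?case .
next
  case (Suc n)
  let ?K = "inner n"
  have "(\<integral>\<^sup>+\<eta>. \<integral>\<^sup>+\<eta>'. ennreal (mix (zz \<beta> n h \<eta>) (zz \<beta> n h \<eta>')) \<partial>?K \<partial>?K) = ennreal (ff (AA \<beta> n h))" for h
  proof -
    have m: "mix x y = (x / B) * y + (B - 1) / B" for x y using B_gt by (simp add: mix_def field_simps)
    have "(\<integral>\<^sup>+\<eta>'. ennreal (mix (zz \<beta> n h \<eta>) (zz \<beta> n h \<eta>')) \<partial>?K) = ennreal (zz \<beta> n h \<eta> / B * AA \<beta> n h + (B - 1) / B)" for \<eta>
      unfolding m using B_gt zz_pos[of \<beta> n h]
      by (intro nn_integral_affine_prob prob_inner Suc) (auto intro: less_imp_le)
    then have "(\<integral>\<^sup>+\<eta>. \<integral>\<^sup>+\<eta>'. ennreal (mix (zz \<beta> n h \<eta>) (zz \<beta> n h \<eta>')) \<partial>?K \<partial>?K)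
        = (\<integral>\<^sup>+\<eta>. ennreal (AA \<beta> n h / B * zz \<beta> n h \<eta> + (B - 1) / B) \<partial>?K)" by (simp add: mult.commute)
    also have "\<dots> = ennreal (AA \<beta> n h / B * AA \<beta> n h + (B - 1) / B)"
      using B_gt zz_pos[of \<beta> n h] by (intro nn_integral_affine_prob prob_inner Suc) (auto intro: less_imp_le)
    also have "AA \<beta> n h / B * AA \<beta> n h + (B - 1) / B = ff (AA \<beta> n h)" using B_gt by (simp add: ff_def field_simps power2_eq_square)
    finally show ?thesis .
  qed
  note A = this
  have "(\<integral>\<^sup>+\<eta>. ennreal (zz \<beta> (Suc n) h \<eta>) \<partial>inner (Suc n))
      = (\<integral>\<^sup>+g. \<integral>\<^sup>+\<eta>. \<integral>\<^sup>+\<eta>'. ennreal (mix (zz \<beta> n (h + s \<beta> n * g) \<eta>) (zz \<beta> n (h + s \<beta> n * g) \<eta>')) \<partial>?K \<partial>?K \<partial>N01)"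
    unfolding zz_glue[symmetric] by (rule inner_Suc_nn) measurable
  also have "\<dots> = ennreal (AA \<beta> (Suc n) h)"
    unfolding A AA.simps by (rule nn_heat[OF expoly_ff[OF expoly_AA]])
  finally show ?case .
qed

lemma nn_zz_square: "(\<integral>\<^sup>+\<eta>. ennreal ((zz \<beta> n h \<eta>)\<^sup>2) \<partial>inner n) = ennreal (DD \<beta> n h)"
proof (induction n arbitrary: h)
  case 0
  have k: "0 \<le> 1 - \<kappa>" using \<kappa>_half \<kappa>_pos by simp
  have "(\<integral>\<^sup>+\<eta>. ennreal ((zz \<beta> 0 h \<eta>)\<^sup>2) \<partial>inner 0) = (\<integral>\<^sup>+g. ennreal (exp (2 * h) * exp ((2 * \<beta> * sqrt (1 - \<kappa>)) * g)) \<partial>N01)"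
    unfolding inner.simps
    by (subst nn_integral_distr, measurable) (simp add: zz_def exp_double[symmetric] exp_add[symmetric] algebra_simps)
  also have "\<dots> = ennreal (\<integral>g. exp (2 * h) * exp ((2 * \<beta> * sqrt (1 - \<kappa>)) * g) \<partial>N01)"
    using std_normal_exp(1) by (intro nn_integral_eq_integral) auto
  also have "(\<integral>g. exp (2 * h) * exp ((2 * \<beta> * sqrt (1 - \<kappa>)) * g) \<partial>N01) = DD \<beta> 0 h"
    using k by (simp add: std_normal_exp power_mult_distrib exp_add)
  finally show ?case .
next
  case (Suc n)
  let ?K = "inner n"
  have "(\<integral>\<^sup>+\<eta>. \<integral>\<^sup>+\<eta>'. ennreal ((mix (zz \<beta> n h \<eta>) (zz \<beta> n h \<eta>'))\<^sup>2) \<partial>?K \<partial>?K)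
      = ennreal (((DD \<beta> n h)\<^sup>2 + 2 * (B - 1) * (AA \<beta> n h)\<^sup>2 + (B - 1)\<^sup>2) / B\<^sup>2)" for h
  proof -
    interpret K: prob_space ?K by (rule prob_inner)
    let ?z = "zz \<beta> n h" and ?A = "AA \<beta> n h" and ?D = "DD \<beta> n h"
    define c1 c2 c3 where "c1 = 1 / B\<^sup>2" and "c2 = 2 * (B - 1) / B\<^sup>2" and "c3 = (B - 1)\<^sup>2 / B\<^sup>2"
    have c: "0 \<le> c1" "0 \<le> c2" "0 \<le> c3" using B_gt by (auto simp: c1_def c2_def c3_def)
    have z0: "0 \<le> ?z x" for x by (rule less_imp_le[OF zz_pos])
    have m: "(mix x y)\<^sup>2 = c1 * x\<^sup>2 * y\<^sup>2 + (c2 * x * y + c3)" for x y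
    proof -
      have "(x * y + B - 1)\<^sup>2 = x\<^sup>2 * y\<^sup>2 + 2 * (B - 1) * x * y + (B - 1)\<^sup>2" by algebra
      then show ?thesis by (simp add: mix_def c1_def c2_def c3_def power_divide add_divide_distrib)
    qed
    \<comment> \<open>Integration against one half replaces the square by D and the first power by
      A. It is applied twice, once for each half.\<close>
    have st: "(\<integral>\<^sup>+\<eta>'. ennreal (p * (?z \<eta>')\<^sup>2 + (r * ?z \<eta>' + c)) \<partial>?K) = ennreal (p * ?D + (r * ?A + c))"
      if "0 \<le> p" "0 \<le> r" "0 \<le> c" for p r c
    proof -
      have i1: "(\<integral>\<^sup>+\<eta>'. ennreal (p * (?z \<eta>')\<^sup>2 + 0) \<partial>?K) = ennreal (p * ?D + 0)"
        by (rule nn_integral_affine_prob[OF prob_inner _ _ Suc]) (use that in auto)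
      have i2: "(\<integral>\<^sup>+\<eta>'. ennreal (r * ?z \<eta>' + c) \<partial>?K) = ennreal (r * ?A + c)"
        by (rule nn_integral_affine_prob[OF prob_inner _ _ nn_zz]) (use that z0 in auto)
      have "(\<integral>\<^sup>+\<eta>'. ennreal (p * (?z \<eta>')\<^sup>2 + (r * ?z \<eta>' + c)) \<partial>?K)
         = (\<integral>\<^sup>+\<eta>'. ennreal (p * (?z \<eta>')\<^sup>2 + 0) + ennreal (r * ?z \<eta>' + c) \<partial>?K)"
        using that z0 by (intro nn_integral_cong) (simp add: ennreal_plus[symmetric] del: ennreal_plus)
      also have "\<dots> = ennreal (p * ?D + 0) + ennreal (r * ?A + c)"
        unfolding i1[symmetric] i2[symmetric] by (rule nn_integral_add) measurable
      also have "\<dots> = ennreal (p * ?D + (r * ?A + c))"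
        using that by (simp add: ennreal_plus[symmetric] del: ennreal_plus)
      finally show ?thesis .
    qed
    have "(\<integral>\<^sup>+\<eta>. \<integral>\<^sup>+\<eta>'. ennreal ((mix (?z \<eta>) (?z \<eta>'))\<^sup>2) \<partial>?K \<partial>?K)
        = (\<integral>\<^sup>+\<eta>. ennreal ((c1 * ?D) * (?z \<eta>)\<^sup>2 + ((c2 * ?A) * ?z \<eta> + c3)) \<partial>?K)"
    proof (rule nn_integral_cong)
      fix \<eta>
      have "(\<integral>\<^sup>+\<eta>'. ennreal ((mix (?z \<eta>) (?z \<eta>'))\<^sup>2) \<partial>?K) = ennreal (c1 * (?z \<eta>)\<^sup>2 * ?D + (c2 * ?z \<eta> * ?A + c3))"
        unfolding m using c z0 by (intro st) auto
      then show "(\<integral>\<^sup>+\<eta>'. ennreal ((mix (?z \<eta>) (?z \<eta>'))\<^sup>2) \<partial>?K) = ennreal ((c1 * ?D) * (?z \<eta>)\<^sup>2 + ((c2 * ?A) * ?z \<eta> + c3))"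
        by (simp add: mult_ac)
    qed
    also have "\<dots> = ennreal ((c1 * ?D) * ?D + ((c2 * ?A) * ?A + c3))" using c by (intro st) auto
    also have "(c1 * ?D) * ?D + ((c2 * ?A) * ?A + c3) = (?D\<^sup>2 + 2 * (B - 1) * ?A\<^sup>2 + (B - 1)\<^sup>2) / B\<^sup>2"
      by (simp add: c1_def c2_def c3_def add_divide_distrib power2_eq_square)
    finally show ?thesis .
  qed
  note A = this
  have "(\<integral>\<^sup>+\<eta>. ennreal ((zz \<beta> (Suc n) h \<eta>)\<^sup>2) \<partial>inner (Suc n))
      = (\<integral>\<^sup>+g. \<integral>\<^sup>+\<eta>. \<integral>\<^sup>+\<eta>'. ennreal ((mix (zz \<beta> n (h + s \<beta> n * g) \<eta>) (zz \<beta> n (h + s \<beta> n * g) \<eta>'))\<^sup>2) \<partial>?K \<partial>?K \<partial>N01)"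
    unfolding zz_glue[symmetric] by (rule inner_Suc_nn) measurable
  also have "\<dots> = ennreal (DD \<beta> (Suc n) h)"
    unfolding A DD.simps by (rule nn_heat[OF expoly_DD_step[OF expoly_DD expoly_AA]])
  finally show ?case .
qed

lemma integrable_zz:
  shows "integrable (inner n) (zz \<beta> n h)" "(\<integral>\<eta>. zz \<beta> n h \<eta> \<partial>inner n) = AA \<beta> n h"
    "integrable (inner n) (\<lambda>\<eta>. (zz \<beta> n h \<eta>)\<^sup>2)" "(\<integral>\<eta>. (zz \<beta> n h \<eta>)\<^sup>2 \<partial>inner n) = DD \<beta> n h"
proof -
  have z0: "0 \<le> zz \<beta> n h \<eta>" for \<eta> by (rule less_imp_le[OF zz_pos])
  show "integrable (inner n) (zz \<beta> n h)" "integrable (inner n) (\<lambda>\<eta>. (zz \<beta> n h \<eta>)\<^sup>2)"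
    using z0 by (auto intro!: integrableI_nonneg simp: nn_zz nn_zz_square)
  show "(\<integral>\<eta>. zz \<beta> n h \<eta> \<partial>inner n) = AA \<beta> n h" "(\<integral>\<eta>. (zz \<beta> n h \<eta>)\<^sup>2 \<partial>inner n) = DD \<beta> n h"
    using z0 by (auto simp: integral_eq_nn_integral nn_zz nn_zz_square)
qed

subsection \<open>Logarithmic moments\<close>

declare inner.simps(2) [simp del]

lemma measure_inner_UNIV [simp]: "measure (inner n) UNIV = 1"
  using prob_space.prob_space[OF prob_inner[of n]] by simp

definition lz :: "real \<Rightarrow> nat \<Rightarrow> real \<Rightarrow> (nat \<Rightarrow> real) \<Rightarrow> real" where
  "lz \<beta> n h w = ln (zz \<beta> n h w)"

lemma lz_measurable [measurable]:
  "H \<in> borel_measurable M \<Longrightarrow> W \<in> measurable M FS \<Longrightarrow> (\<lambda>x. lz \<beta> n (H x) (W x)) \<in> borel_measurable M"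
  unfolding lz_def by (intro borel_measurable_ln zz_measurable)

definition kk :: "real \<Rightarrow> nat \<Rightarrow> real \<Rightarrow> real" where
  "kk \<beta> n h = (\<integral>\<eta>. lz \<beta> n h \<eta> \<partial>inner n)"

text \<open>Satisfies VB (n+1) = 2 VB n + 2^(n+2) \<beta>^2 \<tau>^n: two independent halves double
  the variance and the shared variable adds a summable relative amount. Thus it is of order 2^n, and
  the logarithm per site has variance of order 1 / 2^n.\<close>

definition VB :: "real \<Rightarrow> nat \<Rightarrow> real" where
  "VB \<beta> n = 2 ^ n * (\<beta>\<^sup>2 + (\<Sum>j<n. 2 * \<beta>\<^sup>2 * \<tau> ^ j))"

definition lmix :: "real \<Rightarrow> real" where "lmix u = ln ((exp u + (B - 1)) / B)"

text \<open>The derivative lies between 0 and 1, so passing from the sum of the logarithms of the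
  halves to the logarithm of the block cannot increase deviations.\<close>

lemma lmix_lipschitz: "\<bar>lmix u - lmix v\<bar> \<le> \<bar>u - v\<bar>"
proof -
  have A: "0 \<le> lmix u - lmix v \<and> lmix u - lmix v \<le> u - v" if "v \<le> u" for u v
  proof -
    have p: "0 < (exp u + (B - 1)) / B" "0 < (exp v + (B - 1)) / B" for u v
      using B_gt by (auto intro!: divide_pos_pos add_pos_pos)
    have "(exp u + (B - 1)) / B \<le> exp (u - v) * ((exp v + (B - 1)) / B)"
    proof -
      have "1 * (B - 1) \<le> exp (u - v) * (B - 1)" using that B_gt by (intro mult_right_mono) auto
      moreover have "exp u = exp (u - v) * exp v" by (simp add: exp_add[symmetric])
      ultimately have "exp u + (B - 1) \<le> exp (u - v) * (exp v + (B - 1))" by (simp only: distrib_left mult_1_left)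
      then show ?thesis using B_gt by (simp add: divide_right_mono)
    qed
    then have "lmix u \<le> ln (exp (u - v) * ((exp v + (B - 1)) / B))" unfolding lmix_def using p by (intro ln_mono) auto
    also have "\<dots> = (u - v) + lmix v" unfolding lmix_def using p by (subst ln_mult_pos) auto
    finally have 1: "lmix u - lmix v \<le> u - v" by simp
    have "lmix v \<le> lmix u" unfolding lmix_def using p that B_gt by (intro ln_mono divide_right_mono) auto
    then show ?thesis using 1 by simp
  qed
  show ?thesis using A[of u v] A[of v u] by (cases "u \<le> v") auto
qed

lemma lz_glue:
  "lz \<beta> (Suc n) h (glue n (g, \<eta>, \<eta>')) = lmix (lz \<beta> n (h + s \<beta> n * g) \<eta> + lz \<beta> n (h + s \<beta> n * g) \<eta>')"
  unfolding lz_def zz_glue mix_def lmix_def using zz_pos by (simp add: exp_add add_diff_eq)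

lemma lz_lipschitz: "\<bar>lz \<beta> n (h + t) w - lz \<beta> n h w\<bar> \<le> 2 ^ n * \<bar>t\<bar>"
  unfolding lz_def by (rule ln_zz_lipschitz)

text \<open>Integrability is a hypothesis because the bound is needed inside the induction that
  establishes it.\<close>

lemma kk_lipschitz_of_integrable:
  assumes "\<And>h. integrable (inner n) (lz \<beta> n h)"
  shows "\<bar>kk \<beta> n (h + t) - kk \<beta> n h\<bar> \<le> 2 ^ n * \<bar>t\<bar>"
proof -
  interpret prob_space "inner n" by (rule prob_inner)
  have "kk \<beta> n (h + t) - kk \<beta> n h = (\<integral>\<eta>. lz \<beta> n (h + t) \<eta> - lz \<beta> n h \<eta> \<partial>inner n)"
    unfolding kk_def using assms by simp
  also have "\<bar>\<dots>\<bar> \<le> (\<integral>\<eta>. \<bar>lz \<beta> n (h + t) \<eta> - lz \<beta> n h \<eta>\<bar> \<partial>inner n)" by (rule integral_abs_bound)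
  also have "\<dots> \<le> (\<integral>\<eta>. 2 ^ n * \<bar>t\<bar> \<partial>inner n)"
    using assms lz_lipschitz by (intro integral_mono) auto
  finally show ?thesis by (simp add: prob_space)
qed

lemma pair_variance:
  assumes "prob_space K" "integrable K f" "integrable K (\<lambda>x. (f x)\<^sup>2 :: real)"
  shows "(\<integral>\<^sup>+x. \<integral>\<^sup>+y. ennreal ((f x + f y - c)\<^sup>2) \<partial>K \<partial>K)
     = ennreal (2 * (\<integral>x. (f x - (\<integral>x. f x \<partial>K))\<^sup>2 \<partial>K) + (2 * (\<integral>x. f x \<partial>K) - c)\<^sup>2)"
proof -
  interpret prob_space K by fact
  define \<mu> where "\<mu> = (\<integral>x. f x \<partial>K)"
  define m2 where "m2 = (\<integral>x. (f x)\<^sup>2 \<partial>K)"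
  have i: "integrable K (\<lambda>y. (p + f y)\<^sup>2)" and v: "(\<integral>y. (p + f y)\<^sup>2 \<partial>K) = p\<^sup>2 + 2 * p * \<mu> + m2" for p
  proof -
    have e: "(p + f y)\<^sup>2 = p\<^sup>2 + 2 * p * f y + (f y)\<^sup>2" for y by (simp add: power2_sum)
    show "integrable K (\<lambda>y. (p + f y)\<^sup>2)" unfolding e using assms by auto
    show "(\<integral>y. (p + f y)\<^sup>2 \<partial>K) = p\<^sup>2 + 2 * p * \<mu> + m2" unfolding e using assms by (simp add: prob_space \<mu>_def m2_def)
  qed
  have e0: "f x + f y - c = (f x - c) + f y" for x y by simp
  have "(\<integral>\<^sup>+x. \<integral>\<^sup>+y. ennreal ((f x + f y - c)\<^sup>2) \<partial>K \<partial>K) = (\<integral>\<^sup>+x. ennreal ((f x - c)\<^sup>2 + 2 * (f x - c) * \<mu> + m2) \<partial>K)"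
    unfolding e0 using i by (intro nn_integral_cong) (simp add: nn_integral_eq_integral v)
  also have "\<dots> = ennreal (\<integral>x. (f x - c)\<^sup>2 + 2 * (f x - c) * \<mu> + m2 \<partial>K)"
  proof (rule nn_integral_eq_integral)
    have e1: "(f x - c)\<^sup>2 + 2 * (f x - c) * \<mu> + m2 = (f x)\<^sup>2 + (2 * \<mu> - 2 * c) * f x + (c\<^sup>2 - 2 * c * \<mu> + m2)" for x
      by (simp add: power2_diff algebra_simps)
    show "integrable K (\<lambda>x. (f x - c)\<^sup>2 + 2 * (f x - c) * \<mu> + m2)" unfolding e1 using assms by auto
    have "0 \<le> (\<integral>y. ((f x - c) + f y)\<^sup>2 \<partial>K)" for x by simp
    then show "AE x in K. 0 \<le> (f x - c)\<^sup>2 + 2 * (f x - c) * \<mu> + m2" unfolding v by simp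
  qed
  also have "(\<integral>x. (f x - c)\<^sup>2 + 2 * (f x - c) * \<mu> + m2 \<partial>K) = 2 * m2 + 2 * \<mu>\<^sup>2 - 4 * c * \<mu> + c\<^sup>2"
  proof -
    have e1: "(f x - c)\<^sup>2 + 2 * (f x - c) * \<mu> + m2 = (f x)\<^sup>2 + (2 * \<mu> - 2 * c) * f x + (c\<^sup>2 - 2 * c * \<mu> + m2)" for x
      by (simp add: power2_diff algebra_simps)
    show ?thesis unfolding e1 using assms
      by (simp add: prob_space m2_def[symmetric] \<mu>_def[symmetric]) (simp add: algebra_simps power2_eq_square)
  qed
  also have "\<dots> = 2 * (\<integral>x. (f x - \<mu>)\<^sup>2 \<partial>K) + (2 * \<mu> - c)\<^sup>2"
  proof -
    have e2: "f x - \<mu> = (- \<mu>) + f x" for x by simp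
    show ?thesis unfolding e2 v by (simp add: power2_diff algebra_simps power2_eq_square)
  qed
  finally show ?thesis by (simp add: \<mu>_def)
qed

lemma VB_nonneg: "0 \<le> VB \<beta> n"
  unfolding VB_def by (intro mult_nonneg_nonneg add_nonneg_nonneg sum_nonneg) auto

text \<open>The mean square distance of the new logarithm to a constant is at most that of the sum
  of the two old ones to 2 kk, by the Lipschitz property of \<open>lmix\<close>. Given g this is
  twice the old variance plus a squared bias, and the bias is at most 2^(n+1) s_n times the absolute
  value of g. Taking the bound as an extended integral yields integrability together with the
  estimate.\<close>

lemma log_moments:
  shows "integrable (inner n) (lz \<beta> n h) \<and> integrable (inner n) (\<lambda>\<eta>. (lz \<beta> n h \<eta>)\<^sup>2)
    \<and> (\<integral>\<eta>. (lz \<beta> n h \<eta> - kk \<beta> n h)\<^sup>2 \<partial>inner n) \<le> VB \<beta> n"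
proof (induction n arbitrary: h)
  case 0
  interpret prob_space N01 by (rule prob_space_N01)
  have k: "0 \<le> 1 - \<kappa>" "1 - \<kappa> \<le> 1" using \<kappa>_half \<kappa>_pos by simp_all
  define c where "c = \<beta> * sqrt (1 - \<kappa>)"
  have e: "lz \<beta> 0 h (\<lambda>j. sqrt (1 - \<kappa>) * g) = h + c * g" for g by (simp add: lz_def zz_def c_def)
  have e2: "(h + c * g)\<^sup>2 = h\<^sup>2 + 2 * h * c * g + c\<^sup>2 * g\<^sup>2" for g by (simp add: power2_sum power_mult_distrib algebra_simps)
  have i1: "integrable (inner 0) (lz \<beta> 0 h)"
    unfolding inner.simps by (subst integrable_distr_eq, measurable) (simp add: e std_normal_moments)
  have i2: "integrable (inner 0) (\<lambda>\<eta>. (lz \<beta> 0 h \<eta>)\<^sup>2)"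
    unfolding inner.simps by (subst integrable_distr_eq, measurable) (simp add: e e2 std_normal_moments)
  have kk: "kk \<beta> 0 h = h"
    unfolding kk_def inner.simps by (subst integral_distr, measurable) (simp add: e std_normal_moments prob_space[simplified])
  have "(\<integral>\<eta>. (lz \<beta> 0 h \<eta> - kk \<beta> 0 h)\<^sup>2 \<partial>inner 0) = c\<^sup>2"
    unfolding kk inner.simps by (subst integral_distr, measurable) (simp add: e power_mult_distrib std_normal_moments)
  also have "c\<^sup>2 \<le> VB \<beta> 0" using k by (simp add: c_def power_mult_distrib VB_def mult_left_le)
  finally show ?case using i1 i2 by blast
next
  case (Suc n)
  let ?K = "inner n" and ?K' = "inner (Suc n)"
  interpret K': prob_space ?K' by (rule prob_inner)
  have I: "integrable ?K (lz \<beta> n h)" "integrable ?K (\<lambda>\<eta>. (lz \<beta> n h \<eta>)\<^sup>2)"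
    "(\<integral>\<eta>. (lz \<beta> n h \<eta> - kk \<beta> n h)\<^sup>2 \<partial>?K) \<le> VB \<beta> n" for h using Suc[of h] by auto
  define m where "m = lmix (2 * kk \<beta> n h)"
  define \<sigma> where "\<sigma> = 4 * 4 ^ n * (s \<beta> n)\<^sup>2"
  have "(\<integral>\<^sup>+\<eta>. ennreal ((lz \<beta> (Suc n) h \<eta> - m)\<^sup>2) \<partial>?K')
      = (\<integral>\<^sup>+g. \<integral>\<^sup>+\<eta>. \<integral>\<^sup>+\<eta>'. ennreal ((lmix (lz \<beta> n (h + s \<beta> n * g) \<eta> + lz \<beta> n (h + s \<beta> n * g) \<eta>') - m)\<^sup>2) \<partial>?K \<partial>?K \<partial>N01)"
    unfolding lz_glue[symmetric] by (rule inner_Suc_nn) measurable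
  also have "\<dots> \<le> (\<integral>\<^sup>+g. \<integral>\<^sup>+\<eta>. \<integral>\<^sup>+\<eta>'. ennreal ((lz \<beta> n (h + s \<beta> n * g) \<eta> + lz \<beta> n (h + s \<beta> n * g) \<eta>' - 2 * kk \<beta> n h)\<^sup>2) \<partial>?K \<partial>?K \<partial>N01)"
    unfolding m_def using lmix_lipschitz by (intro nn_integral_mono ennreal_leI) (auto simp: abs_le_square_iff[symmetric])
  also have "\<dots> = (\<integral>\<^sup>+g. ennreal (2 * (\<integral>\<eta>. (lz \<beta> n (h + s \<beta> n * g) \<eta> - kk \<beta> n (h + s \<beta> n * g))\<^sup>2 \<partial>?K)
         + (2 * kk \<beta> n (h + s \<beta> n * g) - 2 * kk \<beta> n h)\<^sup>2) \<partial>N01)"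
    unfolding kk_def[of \<beta> n] by (intro nn_integral_cong pair_variance prob_inner I)
  also have "\<dots> \<le> (\<integral>\<^sup>+g. ennreal (\<sigma> * g\<^sup>2 + 2 * VB \<beta> n) \<partial>N01)"
  proof (intro nn_integral_mono ennreal_leI)
    fix g
    have "\<bar>2 * kk \<beta> n (h + s \<beta> n * g) - 2 * kk \<beta> n h\<bar> \<le> \<bar>2 * (2 ^ n * (s \<beta> n * g))\<bar>"
      using kk_lipschitz_of_integrable[OF I(1), of h "s \<beta> n * g"] by (simp add: abs_mult)
    then have "(2 * kk \<beta> n (h + s \<beta> n * g) - 2 * kk \<beta> n h)\<^sup>2 \<le> (2 * (2 ^ n * (s \<beta> n * g)))\<^sup>2"
      by (simp only: abs_le_square_iff)
    also have "\<dots> = \<sigma> * g\<^sup>2"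
    proof -
      have "((2::real) ^ n)\<^sup>2 = 4 ^ n" by (simp add: power2_eq_square power_mult_distrib[symmetric])
      then show ?thesis by (simp add: \<sigma>_def power_mult_distrib)
    qed
    finally show "2 * (\<integral>\<eta>. (lz \<beta> n (h + s \<beta> n * g) \<eta> - kk \<beta> n (h + s \<beta> n * g))\<^sup>2 \<partial>?K)
         + (2 * kk \<beta> n (h + s \<beta> n * g) - 2 * kk \<beta> n h)\<^sup>2 \<le> \<sigma> * g\<^sup>2 + 2 * VB \<beta> n"
      using I(3)[of "h + s \<beta> n * g"] by linarith
  qed
  also have "\<dots> = ennreal (\<sigma> * 1 + 2 * VB \<beta> n)"
  proof (rule nn_integral_affine_prob[OF prob_space_N01])
    show "(\<integral>\<^sup>+x. ennreal (x\<^sup>2) \<partial>N01) = ennreal 1"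
      using std_normal_moments by (simp add: nn_integral_eq_integral)
  qed (use VB_nonneg[of \<beta> n] in \<open>auto simp: \<sigma>_def\<close>)
  also have "\<dots> \<le> ennreal (VB \<beta> (Suc n))"
  proof (rule ennreal_leI)
    have "(4::real) ^ n = 2 ^ n * 2 ^ n" by (simp add: power_mult_distrib[symmetric])
    then have "\<sigma> = 2 ^ Suc n * (2 * (2 ^ n * (s \<beta> n)\<^sup>2))" by (simp add: \<sigma>_def)
    also have "\<dots> \<le> 2 ^ Suc n * (2 * (\<beta>\<^sup>2 * \<tau> ^ n))"
    proof (intro mult_left_mono)
      have "\<beta>\<^sup>2 * (\<tau> ^ n)\<^sup>2 \<le> \<beta>\<^sup>2 * \<tau> ^ n"
        using \<tau>_pow_le_1[of n] mult_left_mono[of "\<tau> ^ n" 1 "\<tau> ^ n"] by (intro mult_left_mono) (auto simp: power2_eq_square)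
      then show "2 ^ n * (s \<beta> n)\<^sup>2 \<le> \<beta>\<^sup>2 * \<tau> ^ n" using s_\<tau>[of n \<beta>] by linarith
    qed auto
    finally show "\<sigma> * 1 + 2 * VB \<beta> n \<le> VB \<beta> (Suc n)" by (simp add: VB_def algebra_simps)
  qed
  finally have B1: "(\<integral>\<^sup>+\<eta>. ennreal ((lz \<beta> (Suc n) h \<eta> - m)\<^sup>2) \<partial>?K') \<le> ennreal (VB \<beta> (Suc n))" .
  have i2: "integrable ?K' (\<lambda>\<eta>. (lz \<beta> (Suc n) h \<eta> - m)\<^sup>2)"
    using B1 by (intro integrableI_nonneg) (auto intro: le_less_trans)
  have i1: "integrable ?K' (\<lambda>\<eta>. lz \<beta> (Suc n) h \<eta> - m)"
    by (rule K'.square_integrable_imp_integrable[OF _ i2]) measurable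
  have il: "integrable ?K' (lz \<beta> (Suc n) h)" using Bochner_Integration.integrable_add[OF i1, of "\<lambda>_. m"] by simp
  \<comment> \<open>The expectation minimises the mean square distance, so the bound around m
    carries over to the variance.\<close>
  have ep: "(lz \<beta> (Suc n) h \<eta> - p)\<^sup>2 = (lz \<beta> (Suc n) h \<eta> - m)\<^sup>2 + 2 * (m - p) * (lz \<beta> (Suc n) h \<eta> - m) + (m - p)\<^sup>2" for \<eta> p
    by (simp add: power2_eq_square algebra_simps)
  have il2: "integrable ?K' (\<lambda>\<eta>. (lz \<beta> (Suc n) h \<eta> - p)\<^sup>2)" for p unfolding ep[of _ p] using i1 i2 by auto
  have "(\<integral>\<eta>. (lz \<beta> (Suc n) h \<eta> - p)\<^sup>2 \<partial>?K') = (\<integral>\<eta>. (lz \<beta> (Suc n) h \<eta> - m)\<^sup>2 \<partial>?K') + 2 * (m - p) * (kk \<beta> (Suc n) h - m) + (m - p)\<^sup>2" for p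
    unfolding ep[of _ p] using i1 i2 il by (simp add: kk_def K'.prob_space)
  from this[of "kk \<beta> (Suc n) h"] have "(\<integral>\<eta>. (lz \<beta> (Suc n) h \<eta> - kk \<beta> (Suc n) h)\<^sup>2 \<partial>?K') = (\<integral>\<eta>. (lz \<beta> (Suc n) h \<eta> - m)\<^sup>2 \<partial>?K') - (m - kk \<beta> (Suc n) h)\<^sup>2"
    by (simp add: power2_eq_square algebra_simps)
  also have "\<dots> \<le> (\<integral>\<eta>. (lz \<beta> (Suc n) h \<eta> - m)\<^sup>2 \<partial>?K')" by simp
  also have "\<dots> \<le> VB \<beta> (Suc n)"
    using B1 i2 VB_nonneg[of \<beta> "Suc n"] by (simp add: nn_integral_eq_integral)
  finally show ?case using il il2[of 0] by simp
qed

lemma integrable_lz: "integrable (inner n) (lz \<beta> n h)"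
  using log_moments by blast

lemma kk_lipschitz: "\<bar>kk \<beta> n (h + t) - kk \<beta> n h\<bar> \<le> 2 ^ n * \<bar>t\<bar>"
  by (rule kk_lipschitz_of_integrable[OF integrable_lz])

lemma kk_midconvex: "2 * kk \<beta> n h \<le> kk \<beta> n (h + t) + kk \<beta> n (h - t)"
proof -
  have "2 * lz \<beta> n h \<eta> \<le> lz \<beta> n (h + t) \<eta> + lz \<beta> n (h - t) \<eta>" for \<eta>
  proof -
    have "2 * lz \<beta> n h \<eta> = ln ((zz \<beta> n h \<eta>)\<^sup>2)" using zz_pos[of \<beta> n h \<eta>] by (simp add: lz_def ln_realpow)
    also have "\<dots> \<le> ln (zz \<beta> n (h + t) \<eta> * zz \<beta> n (h - t) \<eta>)"
      using zz_pos[of \<beta> n h \<eta>] by (intro ln_mono zz_log_midconvex) auto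
    also have "\<dots> = lz \<beta> n (h + t) \<eta> + lz \<beta> n (h - t) \<eta>" using zz_pos by (simp add: lz_def ln_mult_pos)
    finally show ?thesis .
  qed
  then have "(\<integral>\<eta>. 2 * lz \<beta> n h \<eta> \<partial>inner n) \<le> (\<integral>\<eta>. lz \<beta> n (h + t) \<eta> + lz \<beta> n (h - t) \<eta> \<partial>inner n)"
    using integrable_lz by (intro integral_mono) auto
  then show ?thesis using integrable_lz by (simp add: kk_def)
qed

lemma kk_measurable [measurable]: "kk \<beta> n \<in> borel_measurable borel"
proof (rule borel_measurable_continuous_onI)
  have "(2 ^ n)-lipschitz_on UNIV (kk \<beta> n)"
  proof (rule lipschitz_onI)
    show "dist (kk \<beta> n x) (kk \<beta> n y) \<le> 2 ^ n * dist x y" for x y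
      using kk_lipschitz[of \<beta> n y "x - y"] by (simp add: dist_real_def)
  qed simp
  then show "continuous_on UNIV (kk \<beta> n)" by (rule lipschitz_on_continuous_on)
qed

definition D0 :: real where "D0 = ln (B / (B - 1))"

lemma D0_pos: "0 < D0"
  using B_gt by (simp add: D0_def)

lemma lz_ge: "1 \<le> n \<Longrightarrow> - D0 \<le> lz \<beta> n h w"
proof -
  assume "1 \<le> n"
  have "- D0 = ln ((B - 1) / B)" using B_gt by (simp add: D0_def ln_div)
  also have "\<dots> \<le> lz \<beta> n h w" unfolding lz_def using B_gt zz_ge[OF \<open>1 \<le> n\<close>] by (intro ln_mono) auto
  finally show ?thesis .
qed

lemma kk_ge: "1 \<le> n \<Longrightarrow> - D0 \<le> kk \<beta> n h"
proof -
  assume n: "1 \<le> n"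
  interpret prob_space "inner n" by (rule prob_inner)
  show ?thesis unfolding kk_def using lz_ge[OF n] by (intro integral_ge_const integrable_lz) auto
qed

text \<open>Besides the bound of Z_(n+1) by the product of the halves, the average over g must not
  lower the expected logarithm. Midpoint convexity of \<open>kk\<close> together with the symmetry
  of g under sign change shows that it does not.\<close>

lemma kk_Suc:
  assumes n: "1 \<le> n" shows "2 * kk \<beta> n h - ln B \<le> kk \<beta> (Suc n) h"
proof -
  let ?K = "inner n" and ?s = "s \<beta> n"
  have lnB: "0 < ln B" using B_gt by simp
  \<comment> \<open>From generation 1 on the logarithms are at least -D0. Adding such constants
    makes all integrands non-negative, so that \<open>inner_Suc_nn\<close> applies.\<close>
  define E where "E = ln B + 2 * D0"
  have E0: "0 < E" using lnB D0_pos by (simp add: E_def)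
  have nn: "(\<integral>\<^sup>+\<eta>. ennreal (lz \<beta> m h \<eta> + D) \<partial>inner m) = ennreal (kk \<beta> m h + D)" if "1 \<le> m" "D0 \<le> D" for m h D
  proof -
    interpret prob_space "inner m" by (rule prob_inner)
    have "(\<integral>\<^sup>+\<eta>. ennreal (lz \<beta> m h \<eta> + D) \<partial>inner m) = ennreal (\<integral>\<eta>. lz \<beta> m h \<eta> + D \<partial>inner m)"
    proof (rule nn_integral_eq_integral)
      show "AE \<eta> in inner m. 0 \<le> lz \<beta> m h \<eta> + D"
        using lz_ge[OF that(1), of \<beta> h] that(2) by (intro AE_I2) (metis add.commute add.inverse_inverse diff_ge_0_iff_ge diff_minus_eq_add order_trans neg_le_iff_le)
    qed (use integrable_lz in auto)
    then show ?thesis using integrable_lz by (simp add: kk_def prob_space)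
  qed
  define u where "u h = 2 * (kk \<beta> n h + D0)" for h
  have u0: "0 \<le> u h" for h using kk_ge[OF n, of \<beta> h] by (simp add: u_def)
  have [measurable]: "u \<in> borel_measurable borel" unfolding u_def[abs_def] by measurable
  have low: "(\<integral>\<^sup>+g. ennreal (u (h + ?s * g)) \<partial>N01) \<le> ennreal (kk \<beta> (Suc n) h + E)"
  proof -
    have "(\<integral>\<^sup>+g. ennreal (u (h + ?s * g)) \<partial>N01)
        = (\<integral>\<^sup>+g. \<integral>\<^sup>+\<eta>. \<integral>\<^sup>+\<eta>'. ennreal ((lz \<beta> n (h + ?s * g) \<eta> + D0) + (lz \<beta> n (h + ?s * g) \<eta>' + D0)) \<partial>?K \<partial>?K \<partial>N01)"
    proof (rule nn_integral_cong)
      fix g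
      let ?h = "h + ?s * g"
      interpret K: prob_space ?K by (rule prob_inner)
      have p: "0 \<le> lz \<beta> n ?h \<eta> + D0" for \<eta> using lz_ge[OF n, of \<beta> ?h \<eta>] by simp
      have k: "0 \<le> kk \<beta> n ?h + D0" using kk_ge[OF n, of \<beta> ?h] by simp
      have a: "(\<integral>\<^sup>+x. ennreal (1 * (lz \<beta> n ?h x + D0) + d) \<partial>?K) = ennreal (1 * (kk \<beta> n ?h + D0) + d)" if "0 \<le> d" for d
        by (rule nn_integral_affine_prob[OF prob_inner _ _ nn[OF n order_refl]]) (use p k that in auto)
      have "(\<integral>\<^sup>+\<eta>'. ennreal ((lz \<beta> n ?h \<eta> + D0) + (lz \<beta> n ?h \<eta>' + D0)) \<partial>?K) = ennreal ((kk \<beta> n ?h + D0) + (lz \<beta> n ?h \<eta> + D0))" for \<eta>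
        using a[OF p, of \<eta>] unfolding mult_1_left by (simp only: add.commute[of "lz \<beta> n ?h \<eta> + D0"])
      moreover have "(\<integral>\<^sup>+\<eta>. ennreal ((kk \<beta> n ?h + D0) + (lz \<beta> n ?h \<eta> + D0)) \<partial>?K) = ennreal (u ?h)"
      proof -
        have c: "(kk \<beta> n ?h + D0) + (lz \<beta> n ?h \<eta> + D0) = (lz \<beta> n ?h \<eta> + D0) + (kk \<beta> n ?h + D0)" for \<eta> by simp
        show ?thesis unfolding c u_def mult_2 by (rule a[OF k, unfolded mult_1_left])
      qed
      ultimately show "ennreal (u ?h) = (\<integral>\<^sup>+\<eta>. \<integral>\<^sup>+\<eta>'. ennreal ((lz \<beta> n ?h \<eta> + D0) + (lz \<beta> n ?h \<eta>' + D0)) \<partial>?K \<partial>?K)"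
        by simp
    qed
    also have "\<dots> \<le> (\<integral>\<^sup>+g. \<integral>\<^sup>+\<eta>. \<integral>\<^sup>+\<eta>'. ennreal (lmix (lz \<beta> n (h + ?s * g) \<eta> + lz \<beta> n (h + ?s * g) \<eta>') + E) \<partial>?K \<partial>?K \<partial>N01)"
    proof (intro nn_integral_mono ennreal_leI)
      fix g \<eta> \<eta>'
      have "x - ln B \<le> lmix x" for x
      proof -
        have "x - ln B = ln (exp x / B)" using B_gt by (simp add: ln_div)
        also have "\<dots> \<le> lmix x" unfolding lmix_def using B_gt by (intro ln_mono divide_right_mono) auto
        finally show ?thesis .
      qed
      from this[of "lz \<beta> n (h + ?s * g) \<eta> + lz \<beta> n (h + ?s * g) \<eta>'"]
      show "(lz \<beta> n (h + ?s * g) \<eta> + D0) + (lz \<beta> n (h + ?s * g) \<eta>' + D0) \<le> lmix (lz \<beta> n (h + ?s * g) \<eta> + lz \<beta> n (h + ?s * g) \<eta>') + E"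
        unfolding E_def by linarith
    qed
    also have "\<dots> = (\<integral>\<^sup>+\<eta>. ennreal (lz \<beta> (Suc n) h \<eta> + E) \<partial>inner (Suc n))"
      unfolding lz_glue[symmetric] by (rule inner_Suc_nn[symmetric]) measurable
    also have "\<dots> = ennreal (kk \<beta> (Suc n) h + E)"
      using lnB D0_pos by (intro nn) (auto simp: E_def)
    finally show ?thesis .
  qed
  have "ennreal (2 * u h) = (\<integral>\<^sup>+g. ennreal (2 * u h) \<partial>N01)"
    using prob_space.emeasure_space_1[OF prob_space_N01] by simp
  also have "\<dots> \<le> (\<integral>\<^sup>+g. ennreal (u (h + ?s * g)) + ennreal (u (h + ?s * (- g))) \<partial>N01)"
  proof (intro nn_integral_mono)
    fix g
    have "2 * u h \<le> u (h + ?s * g) + u (h + ?s * (- g))"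
      using kk_midconvex[of \<beta> n h "?s * g"] by (simp add: u_def)
    then show "ennreal (2 * u h) \<le> ennreal (u (h + ?s * g)) + ennreal (u (h + ?s * (- g)))"
      using u0 by (simp add: ennreal_plus[symmetric] ennreal_leI del: ennreal_plus)
  qed
  also have "\<dots> = (\<integral>\<^sup>+g. ennreal (u (h + ?s * g)) \<partial>N01) + (\<integral>\<^sup>+g. ennreal (u (h + ?s * (- g))) \<partial>N01)"
    by (rule nn_integral_add) measurable
  also have "\<dots> \<le> ennreal (kk \<beta> (Suc n) h + E) + ennreal (kk \<beta> (Suc n) h + E)"
    using low std_normal_nn_symmetric[of "\<lambda>g. ennreal (u (h + ?s * g))"] by (intro add_mono) auto
  also have "\<dots> = ennreal (2 * (kk \<beta> (Suc n) h + E))"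
    using kk_ge[of "Suc n" \<beta> h] lnB D0_pos by (subst ennreal_plus[symmetric]) (auto simp: E_def)
  finally have "2 * u h \<le> 2 * (kk \<beta> (Suc n) h + E)"
    using kk_ge[of "Suc n" \<beta> h] lnB D0_pos by (subst (asm) ennreal_le_iff) (auto simp: E_def)
  then show ?thesis by (simp add: u_def E_def)
qed

text \<open>Jensen's inequality, through ln x \<le> x - 1 at the quotient of the partition function
  and its mean.\<close>

lemma kk_le_ln_AA: "kk \<beta> n h \<le> ln (AA \<beta> n h)"
proof -
  interpret prob_space "inner n" by (rule prob_inner)
  let ?A = "AA \<beta> n h"
  have "kk \<beta> n h \<le> (\<integral>\<eta>. zz \<beta> n h \<eta> / ?A - 1 + ln ?A \<partial>inner n)"
    unfolding kk_def
  proof (intro integral_mono integrable_lz)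
    fix \<eta>
    have "ln (zz \<beta> n h \<eta> / ?A) \<le> zz \<beta> n h \<eta> / ?A - 1"
      using zz_pos[of \<beta> n h \<eta>] AA_pos[of \<beta> n h] by (intro ln_le_minus_one divide_pos_pos)
    then show "lz \<beta> n h \<eta> \<le> zz \<beta> n h \<eta> / ?A - 1 + ln ?A"
      using zz_pos[of \<beta> n h \<eta>] AA_pos[of \<beta> n h] by (simp add: lz_def ln_div)
  qed (use integrable_zz in auto)
  also have "\<dots> = ?A / ?A - 1 + ln ?A" using integrable_zz by (simp add: prob_space)
  finally show ?thesis using AA_pos[of \<beta> n h] by (simp del: AA_pos)
qed

definition fq :: "real \<Rightarrow> real \<Rightarrow> real" where
  "fq \<beta> h = lim (\<lambda>n. kk \<beta> n h / 2 ^ n)"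

text \<open>By \<open>kk_Suc\<close> the numbers (kk_n - ln B) / 2^n increase, and the annealed free
  energy bounds them. The sequence starts at generation 1, since at generation 0 the logarithm has
  no lower bound.\<close>

lemma fq_lim_and_ge:
  assumes "0 \<le> \<beta>"
  shows "(\<lambda>n. kk \<beta> n h / 2 ^ n) \<longlonglongrightarrow> fq \<beta> h" and "1 \<le> n \<Longrightarrow> (kk \<beta> n h - ln B) / 2 ^ n \<le> fq \<beta> h"
proof -
  let ?L = "\<lambda>n. (kk \<beta> (Suc n) h - ln B) / 2 ^ Suc n"
  have lnB: "0 < ln B" using B_gt by simp
  have inc: "incseq ?L"
  proof (rule incseq_SucI)
    fix n
    have "?L n = (2 * kk \<beta> (Suc n) h - ln B - ln B) / 2 ^ Suc (Suc n)" by (simp add: field_simps)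
    also have "\<dots> \<le> ?L (Suc n)" using kk_Suc[of "Suc n" \<beta> h] by (intro divide_right_mono) auto
    finally show "?L n \<le> ?L (Suc n)" .
  qed
  have ub: "\<forall>n. ?L n \<le> fa \<beta> h"
  proof
    fix n
    have "?L n \<le> (ln (AA \<beta> (Suc n) h) - ln B) / 2 ^ Suc n"
      using kk_le_ln_AA[of \<beta> "Suc n" h] by (intro divide_right_mono) auto
    also have "\<dots> \<le> fa \<beta> h" by (rule fa_lim_and_ge(2)[OF assms])
    finally show "?L n \<le> fa \<beta> h" .
  qed
  from incseq_convergent[OF inc ub] obtain L where L: "?L \<longlonglongrightarrow> L" "\<forall>i. ?L i \<le> L" .
  have "(\<lambda>n. ln B / 2 * (1 / 2) ^ n) \<longlonglongrightarrow> ln B / 2 * 0" by (intro tendsto_intros LIMSEQ_power_zero) auto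
  from tendsto_add[OF L(1) this] have "(\<lambda>n. ?L n + ln B / 2 * (1 / 2) ^ n) \<longlonglongrightarrow> L" by simp
  moreover have "?L n + ln B / 2 * (1 / 2) ^ n = kk \<beta> (Suc n) h / 2 ^ Suc n" for n
    by (simp add: field_simps power_one_over)
  ultimately have "(\<lambda>n. kk \<beta> (Suc n) h / 2 ^ Suc n) \<longlonglongrightarrow> L" by simp
  then have lim: "(\<lambda>n. kk \<beta> n h / 2 ^ n) \<longlonglongrightarrow> L" by (rule LIMSEQ_imp_Suc)
  then have f: "fq \<beta> h = L" unfolding fq_def by (rule limI)
  show "(\<lambda>n. kk \<beta> n h / 2 ^ n) \<longlonglongrightarrow> fq \<beta> h" using lim f by simp
  show "(kk \<beta> n h - ln B) / 2 ^ n \<le> fq \<beta> h" if "1 \<le> n"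
    using L(2) that f by (cases n) auto
qed

text \<open>Second moment method, with the Chebyshev estimate built into the pointwise inequality.\<close>

lemma fq_ge:
  assumes \<beta>: "0 \<le> \<beta>" and n: "1 \<le> n" and A: "2 \<le> AA \<beta> n h"
  shows "((1 - 4 * V \<beta> n h) * (ln (AA \<beta> n h) - ln 2) - (D0 + ln B)) / 2 ^ n \<le> fq \<beta> h"
proof -
  interpret prob_space "inner n" by (rule prob_inner)
  let ?A = "AA \<beta> n h"
  define l where "l = ln ?A - ln 2"
  have l0: "0 \<le> l" using A by (simp add: l_def)
  \<comment> \<open>Where Z is below A / 2 the deviation exceeds A / 2 \<ge> 1, the square term
    makes the left side at most -D0, and the deterministic lower bound suffices. Because A \<ge> 2,
    the absolute variance serves in place of the relative one.\<close>
  have pt: "l * (1 - 4 * (zz \<beta> n h \<eta> - ?A)\<^sup>2) - D0 \<le> lz \<beta> n h \<eta>" for \<eta>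
  proof (cases "?A / 2 \<le> zz \<beta> n h \<eta>")
    case True
    have "l = ln (?A / 2)" using A by (simp add: l_def ln_div)
    also have "\<dots> \<le> lz \<beta> n h \<eta>" unfolding lz_def using True A by (intro ln_mono) auto
    finally have "l \<le> lz \<beta> n h \<eta>" .
    moreover have "l * (1 - 4 * (zz \<beta> n h \<eta> - ?A)\<^sup>2) \<le> l * 1" using l0 by (intro mult_left_mono) auto
    ultimately show ?thesis using D0_pos by linarith
  next
    case False
    define y where "y = ?A - zz \<beta> n h \<eta>"
    have "1 \<le> 2 * y" using False A by (simp add: y_def)
    then have "(1::real)\<^sup>2 \<le> (2 * y)\<^sup>2" by (intro power_mono) auto
    then have "1 \<le> 4 * (zz \<beta> n h \<eta> - ?A)\<^sup>2"
      unfolding power2_commute[of "zz \<beta> n h \<eta>"] y_def[symmetric] by (simp add: power_mult_distrib)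
    then have "1 - 4 * (zz \<beta> n h \<eta> - ?A)\<^sup>2 \<le> 0" by simp
    then have "l * (1 - 4 * (zz \<beta> n h \<eta> - ?A)\<^sup>2) \<le> 0" using l0 by (simp add: mult_nonneg_nonpos)
    then show ?thesis using lz_ge[OF n, of \<beta> h \<eta>] by linarith
  qed
  have e: "(zz \<beta> n h \<eta> - ?A)\<^sup>2 = (zz \<beta> n h \<eta>)\<^sup>2 - 2 * ?A * zz \<beta> n h \<eta> + ?A\<^sup>2" for \<eta> by (simp add: power2_diff)
  have iV: "integrable (inner n) (\<lambda>\<eta>. (zz \<beta> n h \<eta> - ?A)\<^sup>2)" unfolding e using integrable_zz by auto
  have vV: "(\<integral>\<eta>. (zz \<beta> n h \<eta> - ?A)\<^sup>2 \<partial>inner n) = V \<beta> n h"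
    unfolding e using integrable_zz by (simp add: prob_space V_def power2_eq_square)
  have "(\<integral>\<eta>. l * (1 - 4 * (zz \<beta> n h \<eta> - ?A)\<^sup>2) - D0 \<partial>inner n) \<le> kk \<beta> n h"
    unfolding kk_def using iV by (intro integral_mono integrable_lz pt) auto
  then have "l * (1 - 4 * V \<beta> n h) - D0 \<le> kk \<beta> n h"
    using iV by (simp add: prob_space vV)
  then have "((1 - 4 * V \<beta> n h) * l - (D0 + ln B)) / 2 ^ n \<le> (kk \<beta> n h - ln B) / 2 ^ n"
    by (intro divide_right_mono) (auto simp: mult.commute)
  also have "\<dots> \<le> fq \<beta> h" by (rule fq_lim_and_ge(2)[OF \<beta> n])
  finally show ?thesis by (simp add: l_def)
qed

end

subsection \<open>The law of the environment on a block\<close>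

lemma nat_div_eq_iff:
  fixes m :: nat assumes "0 < m" shows "i div m = k \<longleftrightarrow> k * m \<le> i \<and> i < Suc k * m"
  using assms by (auto intro!: div_nat_eqI simp: mult.commute dividend_less_times_div)

text \<open>Counted from 0, the blocks of length 2^p are the classes of i div 2^p. They are nested,
  so once two indices are joined they remain joined at all higher levels, and the least such level
  is characterised by every single p.\<close>

lemma hier_dist_le_iff: "hier_dist (Suc i) (Suc j) \<le> p \<longleftrightarrow> i div 2 ^ p = j div 2 ^ p"
proof -
  define P where "P p \<longleftrightarrow> i div 2 ^ p = j div 2 ^ p" for p :: nat
  have block: "(\<exists>k\<ge>1. Suc i \<in> {(k - 1) * 2 ^ p + 1 .. k * 2 ^ p} \<and> Suc j \<in> {(k - 1) * 2 ^ p + 1 .. k * 2 ^ p})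
      \<longleftrightarrow> P p" (is "?L p \<longleftrightarrow> _") for p
  proof
    assume "?L p"
    then obtain k where k: "1 \<le> k" "Suc i \<in> {(k - 1) * 2 ^ p + 1 .. k * 2 ^ p}" "Suc j \<in> {(k - 1) * 2 ^ p + 1 .. k * 2 ^ p}" by blast
    obtain l where l: "k = Suc l" using k(1) by (cases k) auto
    have "i div 2 ^ p = l" "j div 2 ^ p = l" using k by (auto simp: nat_div_eq_iff l)
    then show "P p" by (simp add: P_def)
  next
    assume R: "P p"
    define l where "l = i div 2 ^ p"
    have "l * 2 ^ p \<le> i \<and> i < Suc l * 2 ^ p" "l * 2 ^ p \<le> j \<and> j < Suc l * 2 ^ p"
      using R nat_div_eq_iff[of "2 ^ p" i l] nat_div_eq_iff[of "2 ^ p" j l] by (auto simp: l_def P_def)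
    then show "?L p" by (intro exI[of _ "Suc l"]) auto
  qed
  have d: "hier_dist (Suc i) (Suc j) = (LEAST p. P p)"
    unfolding hier_dist_def block ..
  have "i < 2 ^ (i + j)" "j < 2 ^ (i + j)"
    using less_exp[of "i + j"] by linarith+
  then have "P (i + j)" by (simp add: P_def)
  then have PL: "P (LEAST p. P p)" by (rule LeastI)
  have mono: "P q" if P: "P p" and pq: "p \<le> q" for p q
  proof -
    obtain k where q: "q = p + k" using le_Suc_ex[OF pq] by blast
    show ?thesis using P by (simp add: P_def q power_add div_mult2_eq)
  qed
  have "(LEAST p. P p) \<le> p \<longleftrightarrow> P p" using mono[OF PL] Least_le[of P p] by blast
  then show ?thesis unfolding d by (simp only: P_def[of p])
qed

lemma hier_dist_blocks:
  assumes "i < 2 ^ n" "j < 2 ^ n"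
  shows "hier_dist (Suc (i + 2 ^ n)) (Suc (j + 2 ^ n)) = hier_dist (Suc i) (Suc j)"
    and "hier_dist (Suc i) (Suc (j + 2 ^ n)) = Suc n" and "hier_dist (Suc (j + 2 ^ n)) (Suc i) = Suc n"
proof -
  have sh: "(i + 2 ^ n) div 2 ^ p = i div 2 ^ p + 2 ^ (n - p)" if "p \<le> n" for i p :: nat
  proof -
    have "(2::nat) ^ n = 2 ^ (n - p) * 2 ^ p" using that by (simp add: power_add[symmetric])
    then show ?thesis by simp
  qed
  have big: "i < 2 ^ p" "j < 2 ^ p" "i + 2 ^ n < 2 ^ p" "j + 2 ^ n < 2 ^ p" if "n < p" for p
    using power_increasing[of "Suc n" p "2::nat"] that assms by simp_all
  have "(i + 2 ^ n) div 2 ^ p = (j + 2 ^ n) div 2 ^ p \<longleftrightarrow> i div 2 ^ p = j div 2 ^ p" for p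
    using sh[of p] big[of p] by (cases "p \<le> n") auto
  then have "hier_dist (Suc (i + 2 ^ n)) (Suc (j + 2 ^ n)) \<le> p \<longleftrightarrow> hier_dist (Suc i) (Suc j) \<le> p" for p
    by (simp only: hier_dist_le_iff)
  then show "hier_dist (Suc (i + 2 ^ n)) (Suc (j + 2 ^ n)) = hier_dist (Suc i) (Suc j)"
    by (meson order_refl order_antisym)
  have "\<not> i div 2 ^ n = (j + 2 ^ n) div 2 ^ n" "i div 2 ^ Suc n = (j + 2 ^ n) div 2 ^ Suc n"
    using assms by (auto simp: div_add_self2)
  then have "\<not> hier_dist (Suc i) (Suc (j + 2 ^ n)) \<le> n" "hier_dist (Suc i) (Suc (j + 2 ^ n)) \<le> Suc n"
    "\<not> hier_dist (Suc (j + 2 ^ n)) (Suc i) \<le> n" "hier_dist (Suc (j + 2 ^ n)) (Suc i) \<le> Suc n"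
    unfolding hier_dist_le_iff by simp_all
  then show "hier_dist (Suc i) (Suc (j + 2 ^ n)) = Suc n" "hier_dist (Suc (j + 2 ^ n)) (Suc i) = Suc n"
    by linarith+
qed

lemma sum_block_split:
  fixes f :: "nat \<Rightarrow> 'a :: comm_monoid_add"
  shows "(\<Sum>j<2 ^ Suc n. f j) = (\<Sum>j<2 ^ n. f j) + (\<Sum>j<2 ^ n. f (j + 2 ^ n))"
proof -
  have "(\<Sum>j<2 ^ n + 2 ^ n. f j) = (\<Sum>j<2 ^ n. f j) + (\<Sum>j=2 ^ n..<2 ^ n + 2 ^ n. f j)"
    by (metis sum.atLeastLessThan_concat lessThan_atLeast0 le_add1 zero_le)
  also have "(\<Sum>j=2 ^ n..<2 ^ n + 2 ^ n. f j) = (\<Sum>j<2 ^ n. f (j + 2 ^ n))"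
    using sum.shift_bounds_nat_ivl[of f 0 "2 ^ n" "2 ^ n"] by (simp add: lessThan_atLeast0)
  finally show ?thesis by (simp add: mult_2)
qed

lemma pair_integral_mult:
  fixes f :: "'a \<Rightarrow> complex" and g :: "'b \<Rightarrow> complex"
  assumes "prob_space M" "prob_space N" and [measurable]: "f \<in> borel_measurable M" "g \<in> borel_measurable N"
    and "\<And>x. norm (f x) \<le> 1" "\<And>x. norm (g x) \<le> 1"
  shows "(CLINT p|M \<Otimes>\<^sub>M N. f (fst p) * g (snd p)) = (CLINT x|M. f x) * (CLINT y|N. g y)"
proof -
  interpret M: prob_space M by fact
  interpret N: prob_space N by fact
  interpret pair_prob_space M N ..
  have "integrable (M \<Otimes>\<^sub>M N) (\<lambda>p. f (fst p) * g (snd p))"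
    using assms by (intro P.integrable_const_bound[where B = 1]) (auto simp: norm_mult mult_le_one)
  from integral_fst'[OF this] show ?thesis by simp
qed

context hier_pinning
begin

text \<open>The variance of the sum of w j * \<eta> (Suc j) over the block when \<eta> has law
  \<open>inner n\<close>, as \<open>char_inner\<close> shows. Weights are counted from 0, sites from
  1.\<close>

primrec qf :: "nat \<Rightarrow> (nat \<Rightarrow> real) \<Rightarrow> real" where
  "qf 0 w = (1 - \<kappa>) * (w 0)\<^sup>2"
| "qf (Suc n) w = (cn n)\<^sup>2 * (\<Sum>j<2 ^ Suc n. w j)\<^sup>2 + qf n w + qf n (\<lambda>j. w (j + 2 ^ n))"

lemma cn_sq: "(cn n)\<^sup>2 = \<kappa> ^ Suc n * (1 - \<kappa>)"
  using \<kappa>_half \<kappa>_pos by (simp add: cn_def)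

text \<open>The covariance of the environment on a block is that of \<open>inner n\<close> plus one
  common variable of variance \<kappa>^(n+1). In the induction the two halves have the constant
  cross covariance \<kappa>^(n+1), which splits into \<kappa>^(n+2) for the new common variable and
  (cn n)^2 for the glue.\<close>

lemma covariance_qf:
  "(\<Sum>i<2 ^ n. \<Sum>j<2 ^ n. w i * w j * \<kappa> ^ hier_dist (Suc i) (Suc j)) = \<kappa> ^ Suc n * (\<Sum>j<2 ^ n. w j)\<^sup>2 + qf n w"
proof (induction n arbitrary: w)
  case 0
  have "hier_dist (Suc 0) (Suc 0) = 0" using hier_dist_le_iff[of 0 0 0] by simp
  then show ?case by (simp add: power2_eq_square algebra_simps)
next
  case (Suc n)
  let ?w = "\<lambda>j. w (j + 2 ^ n)"
  let ?S = "\<Sum>j<2 ^ n. w j" and ?T = "\<Sum>j<2 ^ n. ?w j"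
  have cross: "(\<Sum>i<2 ^ n. \<Sum>j<2 ^ n. w i * ?w j * \<kappa> ^ hier_dist (Suc i) (Suc (j + 2 ^ n))) = \<kappa> ^ Suc n * (?S * ?T)"
    "(\<Sum>i<2 ^ n. \<Sum>j<2 ^ n. ?w i * w j * \<kappa> ^ hier_dist (Suc (i + 2 ^ n)) (Suc j)) = \<kappa> ^ Suc n * (?S * ?T)"
  proof -
    have "(\<Sum>i<2 ^ n. \<Sum>j<2 ^ n. w i * ?w j * \<kappa> ^ hier_dist (Suc i) (Suc (j + 2 ^ n))) = (\<Sum>i<2 ^ n. \<Sum>j<2 ^ n. \<kappa> ^ Suc n * (w i * ?w j))"
      using hier_dist_blocks(2)[of _ n] by (intro sum.cong) auto
    then show "(\<Sum>i<2 ^ n. \<Sum>j<2 ^ n. w i * ?w j * \<kappa> ^ hier_dist (Suc i) (Suc (j + 2 ^ n))) = \<kappa> ^ Suc n * (?S * ?T)"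
      by (simp only: sum_distrib_left[symmetric] sum_product)
    have "(\<Sum>i<2 ^ n. \<Sum>j<2 ^ n. ?w i * w j * \<kappa> ^ hier_dist (Suc (i + 2 ^ n)) (Suc j)) = (\<Sum>i<2 ^ n. \<Sum>j<2 ^ n. \<kappa> ^ Suc n * (?w i * w j))"
      using hier_dist_blocks(3)[of _ n] by (intro sum.cong) auto
    also have "\<dots> = \<kappa> ^ Suc n * (?T * ?S)" by (simp only: sum_distrib_left[symmetric] sum_product)
    finally show "(\<Sum>i<2 ^ n. \<Sum>j<2 ^ n. ?w i * w j * \<kappa> ^ hier_dist (Suc (i + 2 ^ n)) (Suc j)) = \<kappa> ^ Suc n * (?S * ?T)"
      by (simp only: mult.commute[of ?T])
  qed
  have diag: "(\<Sum>i<2 ^ n. \<Sum>j<2 ^ n. ?w i * ?w j * \<kappa> ^ hier_dist (Suc (i + 2 ^ n)) (Suc (j + 2 ^ n))) = \<kappa> ^ Suc n * ?T\<^sup>2 + qf n ?w"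
    unfolding Suc[symmetric] using hier_dist_blocks(1)[of _ n] by (intro sum.cong) auto
  have "(\<Sum>i<2 ^ Suc n. \<Sum>j<2 ^ Suc n. w i * w j * \<kappa> ^ hier_dist (Suc i) (Suc j))
      = (\<kappa> ^ Suc n * ?S\<^sup>2 + qf n w) + \<kappa> ^ Suc n * (?S * ?T) + (\<kappa> ^ Suc n * (?S * ?T) + (\<kappa> ^ Suc n * ?T\<^sup>2 + qf n ?w))"
    unfolding sum_block_split sum.distrib cross diag Suc ..
  also have "\<dots> = \<kappa> ^ Suc (Suc n) * (?S + ?T)\<^sup>2 + qf (Suc n) w"
    unfolding qf.simps sum_block_split cn_sq by (simp add: power2_eq_square algebra_simps)
  finally show ?case unfolding sum_block_split .
qed

lemma char_std: "(CLINT g|N01. iexp (t * g)) = complex_of_real (exp (- t\<^sup>2 / 2))"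
  using fun_cong[OF char_std_normal_distribution, of t] by (simp add: char_def)

lemma iexp_field_measurable:
  "(\<lambda>\<eta>. iexp (\<Sum>j\<in>J. w j * \<eta> (Suc j))) \<in> borel_measurable FS"
  "(\<lambda>\<eta>. iexp (\<Sum>j\<in>J. w j * \<eta> (Suc j))) \<in> borel_measurable (inner n)"
proof -
  have c: "(\<lambda>\<eta>. \<eta> j) \<in> borel_measurable FS" for j using measurable_component_singleton[of j UNIV "\<lambda>_. borel"] by simp
  have s: "(\<lambda>\<eta>. \<Sum>j\<in>J. w j * \<eta> (Suc j)) \<in> borel_measurable FS"
    by (intro borel_measurable_sum borel_measurable_times borel_measurable_const c)
  have e: "(\<lambda>t::real. iexp t) \<in> borel_measurable borel" by measurable
  show 1: "(\<lambda>\<eta>. iexp (\<Sum>j\<in>J. w j * \<eta> (Suc j))) \<in> borel_measurable FS" by (rule measurable_compose[OF s e])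
  show "(\<lambda>\<eta>. iexp (\<Sum>j\<in>J. w j * \<eta> (Suc j))) \<in> borel_measurable (inner n)"
    using 1 by (simp only: measurable_cong_sets[OF sets_inner refl])
qed

lemma char_inner: "(CLINT \<eta>|inner n. iexp (\<Sum>j<2 ^ n. w j * \<eta> (Suc j))) = complex_of_real (exp (- qf n w / 2))"
proof (induction n arbitrary: w)
  case 0
  have k: "0 \<le> 1 - \<kappa>" using \<kappa>_half \<kappa>_pos by simp
  have "(CLINT \<eta>|inner 0. iexp (\<Sum>j<2 ^ 0. w j * \<eta> (Suc j))) = (CLINT g|N01. iexp ((w 0 * sqrt (1 - \<kappa>)) * g))"
    unfolding inner.simps integral_distr[OF base_measurable iexp_field_measurable(1)] by (simp add: mult.assoc)
  also have "\<dots> = complex_of_real (exp (- qf 0 w / 2))" unfolding char_std using k by (simp add: power_mult_distrib mult.commute)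
  finally show ?case .
next
  case (Suc n)
  let ?K = "inner n"
  let ?w = "\<lambda>j. w (j + 2 ^ n)" and ?S = "\<Sum>j<2 ^ Suc n. w j"
  define f where "f g = iexp ((cn n * ?S) * g)" for g
  define F where "F \<eta> = iexp (\<Sum>j<2 ^ n. w j * \<eta> (Suc j))" for \<eta> :: "nat \<Rightarrow> real"
  define G where "G \<eta> = iexp (\<Sum>j<2 ^ n. ?w j * \<eta> (Suc j))" for \<eta> :: "nat \<Rightarrow> real"
  have "(\<lambda>g. iexp (c * g)) \<in> borel_measurable N01" for c by measurable
  then have [measurable]: "f \<in> borel_measurable N01" unfolding f_def[abs_def] .
  have [measurable]: "F \<in> borel_measurable ?K" "G \<in> borel_measurable ?K"
    unfolding F_def[abs_def] G_def[abs_def] by (rule iexp_field_measurable(2))+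
  have nf: "norm (f x) \<le> 1" "norm (F y) \<le> 1" "norm (G z) \<le> 1" for x y z by (simp_all add: f_def F_def G_def)
  have sp: "iexp (\<Sum>j<2 ^ Suc n. w j * glue n p (Suc j)) = f (fst p) * (F (fst (snd p)) * G (snd (snd p)))" for p
  proof -
    have 1: "(\<Sum>j<2 ^ n. w j * glue n p (Suc j)) = (\<Sum>j<2 ^ n. w j * (cn n * fst p)) + (\<Sum>j<2 ^ n. w j * fst (snd p) (Suc j))"
      unfolding sum.distrib[symmetric] by (intro sum.cong) (auto simp: glue_def algebra_simps)
    have 2: "(\<Sum>j<2 ^ n. ?w j * glue n p (Suc (j + 2 ^ n))) = (\<Sum>j<2 ^ n. ?w j * (cn n * fst p)) + (\<Sum>j<2 ^ n. ?w j * snd (snd p) (Suc j))"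
      unfolding sum.distrib[symmetric] by (intro sum.cong) (auto simp: glue_def algebra_simps Suc_diff_le)
    have "(\<Sum>j<2 ^ Suc n. w j * glue n p (Suc j)) = (cn n * ?S) * fst p + ((\<Sum>j<2 ^ n. w j * fst (snd p) (Suc j)) + (\<Sum>j<2 ^ n. ?w j * snd (snd p) (Suc j)))"
      unfolding sum_block_split 1 2 by (simp add: sum_distrib_left sum_distrib_right algebra_simps)
    then show ?thesis unfolding f_def F_def G_def by (simp add: exp_add distrib_left)
  qed
  have "(CLINT \<eta>|inner (Suc n). iexp (\<Sum>j<2 ^ Suc n. w j * \<eta> (Suc j)))
      = (CLINT p|N01 \<Otimes>\<^sub>M (?K \<Otimes>\<^sub>M ?K). f (fst p) * (\<lambda>q. F (fst q) * G (snd q)) (snd p))"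
    by (simp only: inner.simps(2) integral_distr[OF glue_measurable iexp_field_measurable(1)] sp)
  also have "\<dots> = (CLINT x|N01. f x) * ((CLINT y|?K. F y) * (CLINT y|?K. G y))"
  proof -
    have "(CLINT p|N01 \<Otimes>\<^sub>M (?K \<Otimes>\<^sub>M ?K). f (fst p) * (\<lambda>q. F (fst q) * G (snd q)) (snd p))
        = (CLINT x|N01. f x) * (CLINT q|?K \<Otimes>\<^sub>M ?K. F (fst q) * G (snd q))"
    proof (rule pair_integral_mult)
      show "prob_space (?K \<Otimes>\<^sub>M ?K)" by (intro prob_space_pair prob_inner)
      show "(\<lambda>q. F (fst q) * G (snd q)) \<in> borel_measurable (?K \<Otimes>\<^sub>M ?K)" by measurable
    qed (use nf in \<open>auto simp: norm_mult mult_le_one prob_space_N01\<close>)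
    also have "(CLINT q|?K \<Otimes>\<^sub>M ?K. F (fst q) * G (snd q)) = (CLINT y|?K. F y) * (CLINT y|?K. G y)"
      by (rule pair_integral_mult[OF prob_inner prob_inner]) (use nf in auto)
    finally show ?thesis .
  qed
  also have "\<dots> = complex_of_real (exp (- (cn n * ?S)\<^sup>2 / 2) * (exp (- qf n w / 2) * exp (- qf n ?w / 2)))"
    unfolding f_def char_std F_def G_def Suc by simp
  also have "exp (- (cn n * ?S)\<^sup>2 / 2) * (exp (- qf n w / 2) * exp (- qf n ?w / 2)) = exp (- qf (Suc n) w / 2)"
    unfolding exp_add[symmetric] qf.simps by (simp add: power_mult_distrib add_divide_distrib)
  finally show ?case .
qed

end

section \<open>Transfer to the given environment\<close>

locale hier_model = hier_pinning +
  fixes M :: "'a measure" and \<omega> :: "nat \<Rightarrow> 'a \<Rightarrow> real"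
  assumes prob_M: "prob_space M"
    and gauss: "centered_gaussian_family M {1..} \<omega>"
    and cov: "\<And>i j. i \<ge> 1 \<Longrightarrow> j \<ge> 1 \<Longrightarrow> (\<integral>x. \<omega> i x * \<omega> j x \<partial>M) = \<kappa> ^ hier_dist i j"
begin

lemma \<omega>_measurable [measurable]: "\<omega> (Suc i) \<in> borel_measurable M"
  using gauss unfolding centered_gaussian_family_def by simp

lemma gauss_sum:
  obtains \<sigma> where "0 \<le> \<sigma>" "distr M borel (\<lambda>x. \<Sum>j<m. w j * \<omega> (Suc j) x) = distr N01 borel (\<lambda>y. \<sigma> * y)"
proof -
  have "finite (Suc ` {..<m})" "Suc ` {..<m} \<subseteq> {1..}" by auto
  then obtain \<sigma> where \<sigma>: "0 \<le> \<sigma>" "distr M borel (\<lambda>x. \<Sum>i\<in>Suc ` {..<m}. w (i - 1) * \<omega> i x) = distr N01 borel (\<lambda>y. \<sigma> * y)"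
    using gauss unfolding centered_gaussian_family_def by meson
  have "(\<Sum>i\<in>Suc ` {..<m}. w (i - 1) * \<omega> i x) = (\<Sum>j<m. w j * \<omega> (Suc j) x)" for x
    by (subst sum.reindex) auto
  with \<sigma> show ?thesis using that by simp
qed

lemma \<omega>_square_integrable: "integrable M (\<lambda>x. (\<Sum>j<m. w j * \<omega> (Suc j) x)\<^sup>2)"
proof -
  obtain \<sigma> where \<sigma>: "distr M borel (\<lambda>x. \<Sum>j<m. w j * \<omega> (Suc j) x) = distr N01 borel (\<lambda>y. \<sigma> * y)"
    using gauss_sum by blast
  have "integrable (distr N01 borel (\<lambda>y. \<sigma> * y)) (\<lambda>z. z\<^sup>2)"
    by (subst integrable_distr_eq) (auto simp: power_mult_distrib std_normal_moments)
  then have "integrable (distr M borel (\<lambda>x. \<Sum>j<m. w j * \<omega> (Suc j) x)) (\<lambda>z. z\<^sup>2)" by (simp only: \<sigma>)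
  then show ?thesis by (subst (asm) integrable_distr_eq) auto
qed

text \<open>The covariance hypothesis fixes the values of integrals only. That the products are
  integrable is read off the Gaussian law of the single coordinates.\<close>

lemma \<omega>_mult_integrable: "integrable M (\<lambda>x. \<omega> (Suc i) x * \<omega> (Suc j) x)"
proof -
  have sq: "integrable M (\<lambda>x. (\<omega> (Suc i) x)\<^sup>2)" for i
    using \<omega>_square_integrable[of "\<lambda>k. if k = i then 1 else 0" "Suc i"]
    by (simp add: if_distrib[of "\<lambda>c. c * _"] cong: if_cong)
  have "integrable M (\<lambda>x. (\<omega> (Suc i) x)\<^sup>2 + (\<omega> (Suc j) x)\<^sup>2)" using sq by auto
  then show ?thesis
  proof (rule Bochner_Integration.integrable_bound)
    have "\<bar>u * v\<bar> \<le> u\<^sup>2 + v\<^sup>2" for u v :: real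
    proof -
      have "2 * (\<bar>u\<bar> * \<bar>v\<bar>) \<le> u\<^sup>2 + v\<^sup>2" using sum_squares_bound[of "\<bar>u\<bar>" "\<bar>v\<bar>"] by (simp add: mult.assoc)
      moreover have "0 \<le> \<bar>u\<bar> * \<bar>v\<bar>" by simp
      ultimately show ?thesis unfolding abs_mult by linarith
    qed
    then show "AE x in M. norm (\<omega> (Suc i) x * \<omega> (Suc j) x) \<le> norm ((\<omega> (Suc i) x)\<^sup>2 + (\<omega> (Suc j) x)\<^sup>2)"
      by (intro AE_I2) simp
  qed measurable
qed

text \<open>The number \<sigma> provided by the Gaussian hypothesis is identified through the second
  moment, which the covariances determine.\<close>

lemma char_\<omega>:
  "(CLINT x|M. iexp (\<Sum>j<m. w j * \<omega> (Suc j) x))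
     = complex_of_real (exp (- (\<Sum>i<m. \<Sum>j<m. w i * w j * \<kappa> ^ hier_dist (Suc i) (Suc j)) / 2))"
proof -
  let ?X = "\<lambda>x. \<Sum>j<m. w j * \<omega> (Suc j) x"
  obtain \<sigma> where \<sigma>: "distr M borel ?X = distr N01 borel (\<lambda>y. \<sigma> * y)" using gauss_sum by blast
  have "(CLINT x|M. iexp (?X x)) = (CLINT z|distr M borel ?X. iexp z)" by (subst integral_distr) auto
  also have "\<dots> = (CLINT y|N01. iexp (\<sigma> * y))" unfolding \<sigma> by (subst integral_distr) auto
  also have "\<dots> = complex_of_real (exp (- \<sigma>\<^sup>2 / 2))" by (rule char_std)
  also have "\<sigma>\<^sup>2 = (\<integral>x. (?X x)\<^sup>2 \<partial>M)"
  proof -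
    have "(\<integral>x. (?X x)\<^sup>2 \<partial>M) = (\<integral>z. z\<^sup>2 \<partial>distr M borel ?X)" by (subst integral_distr) auto
    also have "\<dots> = (\<integral>y. (\<sigma> * y)\<^sup>2 \<partial>N01)" unfolding \<sigma> by (subst integral_distr) auto
    also have "\<dots> = \<sigma>\<^sup>2" by (simp add: power_mult_distrib std_normal_moments)
    finally show ?thesis ..
  qed
  also have "\<dots> = (\<integral>x. (\<Sum>i<m. \<Sum>j<m. (w i * w j) * (\<omega> (Suc i) x * \<omega> (Suc j) x)) \<partial>M)"
    by (simp add: power2_eq_square sum_product mult_ac)
  also have "\<dots> = (\<Sum>i<m. \<Sum>j<m. (w i * w j) * (\<integral>x. \<omega> (Suc i) x * \<omega> (Suc j) x \<partial>M))"
    using \<omega>_mult_integrable by (simp add: Bochner_Integration.integral_sum)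
  also have "\<dots> = (\<Sum>i<m. \<Sum>j<m. w i * w j * \<kappa> ^ hier_dist (Suc i) (Suc j))" by (simp add: cov)
  finally show ?thesis .
qed

definition cc :: "nat \<Rightarrow> real" where "cc n = sqrt (\<kappa> ^ Suc n)"

definition wf :: "nat \<Rightarrow> real \<times> (nat \<Rightarrow> real) \<Rightarrow> nat \<Rightarrow> real" where
  "wf n p j = cc n * fst p + snd p j"

lemma char_wf:
  "(CLINT p|N01 \<Otimes>\<^sub>M inner n. iexp (\<Sum>j<2 ^ n. w j * wf n p (Suc j)))
    = complex_of_real (exp (- (\<Sum>i<2 ^ n. \<Sum>j<2 ^ n. w i * w j * \<kappa> ^ hier_dist (Suc i) (Suc j)) / 2))"
proof -
  let ?S = "\<Sum>j<2 ^ n. w j"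
  have cc2: "(cc n)\<^sup>2 = \<kappa> ^ Suc n" using \<kappa>_pos by (simp add: cc_def)
  have sp: "iexp (\<Sum>j<2 ^ n. w j * wf n p (Suc j)) = iexp ((cc n * ?S) * fst p) * iexp (\<Sum>j<2 ^ n. w j * snd p (Suc j))" for p
  proof -
    have "(\<Sum>j<2 ^ n. w j * wf n p (Suc j)) = (cc n * ?S) * fst p + (\<Sum>j<2 ^ n. w j * snd p (Suc j))"
      by (simp add: wf_def distrib_left sum.distrib sum_distrib_left sum_distrib_right mult_ac)
    then show ?thesis by (simp add: exp_add distrib_left)
  qed
  have "(CLINT p|N01 \<Otimes>\<^sub>M inner n. iexp (\<Sum>j<2 ^ n. w j * wf n p (Suc j)))
      = (CLINT x|N01. iexp ((cc n * ?S) * x)) * (CLINT \<eta>|inner n. iexp (\<Sum>j<2 ^ n. w j * \<eta> (Suc j)))"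
    unfolding sp by (rule pair_integral_mult[OF prob_space_N01 prob_inner _ iexp_field_measurable(2)]) auto
  also have "\<dots> = complex_of_real (exp (- (cc n * ?S)\<^sup>2 / 2) * exp (- qf n w / 2))"
    unfolding char_std char_inner by simp
  also have "exp (- (cc n * ?S)\<^sup>2 / 2) * exp (- qf n w / 2) = exp (- (\<kappa> ^ Suc n * ?S\<^sup>2 + qf n w) / 2)"
    unfolding exp_add[symmetric] power_mult_distrib cc2 by (simp add: add_divide_distrib)
  finally show ?thesis unfolding covariance_qf .
qed

text \<open>Both families have the same characteristic function for all weights, by
  \<open>char_\<omega>\<close> and \<open>char_wf\<close>. Weights on a part of the block are
  extended by 0 to the whole block, where these formulas are available.\<close>

lemma block_law:
  "distr M (PiM {..<2 ^ n} (\<lambda>_. borel)) (\<lambda>x. \<lambda>j\<in>{..<2 ^ n}. \<omega> (Suc j) x)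
    = distr (N01 \<Otimes>\<^sub>M inner n) (PiM {..<2 ^ n} (\<lambda>_. borel)) (\<lambda>p. \<lambda>j\<in>{..<2 ^ n}. wf n p (Suc j))"
proof (rule joint_uniqueness[OF prob_M prob_space_pair[OF prob_space_N01 prob_inner]])
  show "(\<lambda>p. wf n p (Suc j)) \<in> borel_measurable (N01 \<Otimes>\<^sub>M inner n)" for j unfolding wf_def by measurable
  fix K and w :: "nat \<Rightarrow> real" assume K: "finite K" "K \<subseteq> {..<(2::nat) ^ n}"
  define b' where "b' j = (if j \<in> K then w j else 0)" for j
  have e: "(\<Sum>k\<in>K. w k * f k) = (\<Sum>j<2 ^ n. b' j * f j)" for f :: "nat \<Rightarrow> real"
    using K by (intro sum.mono_neutral_cong_left) (auto simp: b'_def)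
  show "(CLINT x|M. iexp (\<Sum>k\<in>K. w k * \<omega> (Suc k) x)) = (CLINT p|N01 \<Otimes>\<^sub>M inner n. iexp (\<Sum>k\<in>K. w k * wf n p (Suc k)))"
    by (simp only: e char_\<omega> char_wf)
qed auto

text \<open>Moves every expectation of a function of the partition function to the recursive
  construction. The variable common to the block becomes the outer integral over a shift of
  h.\<close>

lemma nn_transfer:
  assumes [measurable]: "\<Psi> \<in> borel_measurable borel"
  shows "(\<integral>\<^sup>+x. \<Psi> (Z B \<beta> h (\<lambda>i. \<omega> i x) n 1) \<partial>M) = (\<integral>\<^sup>+g. \<integral>\<^sup>+\<eta>. \<Psi> (zz \<beta> n (h + \<beta> * cc n * g) \<eta>) \<partial>inner n \<partial>N01)"
proof -
  let ?I = "{..<(2::nat) ^ n}"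
  interpret K: prob_space "inner n" by (rule prob_inner)
  \<comment> \<open>The law of the block is stated for sites counted from 0; W returns to sites
    counted from 1, with value 0 outside the block, where \<open>Z_local\<close> shows nothing is
    read.\<close>
  define W where "W x j = (if 1 \<le> j \<and> j \<le> 2 ^ n then x (j - 1) else 0)" for x :: "nat \<Rightarrow> real" and j
  define \<Phi> where "\<Phi> x = \<Psi> (Z B \<beta> h (W x) n 1)" for x
  have W: "(\<lambda>x. W x j) \<in> borel_measurable (PiM ?I (\<lambda>_. borel))" for j
  proof (cases "1 \<le> j \<and> j \<le> 2 ^ n")
    case True
    then have "j - 1 \<in> ?I" by auto
    then show ?thesis using True by (simp add: W_def measurable_component_singleton)
  qed (auto simp: W_def)
  have [measurable]: "(\<lambda>x. Z B \<beta> h (W x) n 1) \<in> borel_measurable (PiM ?I (\<lambda>_. borel))"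
    by (rule Z_measurable[OF _ W]) auto
  have [measurable]: "\<Phi> \<in> borel_measurable (PiM ?I (\<lambda>_. borel))" unfolding \<Phi>_def[abs_def] by measurable
  have [measurable]: "(\<lambda>p. wf n p (Suc j)) \<in> borel_measurable (N01 \<Otimes>\<^sub>M inner n)" for j unfolding wf_def by measurable
  have Zr: "Z B \<beta> h (W (\<lambda>j\<in>?I. v (Suc j))) n 1 = Z B \<beta> h v n 1" for v
    by (rule Z_local) (auto simp: W_def)
  have \<Phi>_eq: "\<Phi> (\<lambda>j\<in>?I. \<omega> (Suc j) x) = \<Psi> (Z B \<beta> h (\<lambda>i. \<omega> i x) n 1)" for x
    using Zr[of "\<lambda>i. \<omega> i x"] by (simp only: \<Phi>_def)
  have "(\<integral>\<^sup>+x. \<Psi> (Z B \<beta> h (\<lambda>i. \<omega> i x) n 1) \<partial>M) = (\<integral>\<^sup>+y. \<Phi> y \<partial>distr M (PiM ?I (\<lambda>_. borel)) (\<lambda>x. \<lambda>j\<in>?I. \<omega> (Suc j) x))"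
    using \<Phi>_eq by (subst nn_integral_distr) auto
  also have "\<dots> = (\<integral>\<^sup>+p. \<Phi> (\<lambda>j\<in>?I. wf n p (Suc j)) \<partial>(N01 \<Otimes>\<^sub>M inner n))"
    unfolding block_law by (subst nn_integral_distr) auto
  also have "\<dots> = (\<integral>\<^sup>+p. \<Psi> (zz \<beta> n (h + \<beta> * cc n * fst p) (snd p)) \<partial>(N01 \<Otimes>\<^sub>M inner n))"
  proof (rule nn_integral_cong)
    fix p :: "real \<times> (nat \<Rightarrow> real)"
    have "Z B \<beta> h (wf n p) n 1 = zz \<beta> n (h + \<beta> * cc n * fst p) (snd p)"
      using Z_shift[of B \<beta> h "cc n * fst p" "snd p" n 1] by (simp add: wf_def[abs_def] zz_def mult.assoc)
    then show "\<Phi> (\<lambda>j\<in>?I. wf n p (Suc j)) = \<Psi> (zz \<beta> n (h + \<beta> * cc n * fst p) (snd p))"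
      unfolding \<Phi>_def Zr by simp
  qed
  also have "\<dots> = (\<integral>\<^sup>+g. \<integral>\<^sup>+\<eta>. \<Psi> (zz \<beta> n (h + \<beta> * cc n * g) \<eta>) \<partial>inner n \<partial>N01)"
    by (subst K.nn_integral_fst[symmetric]) auto
  finally show ?thesis .
qed

lemma Z_measurable_M [measurable]: "(\<lambda>x. Z B \<beta> h (\<lambda>i. \<omega> i x) n 1) \<in> borel_measurable M"
proof -
  have "(\<lambda>x. Z B \<beta> h (\<lambda>i. if 1 \<le> i then \<omega> i x else 0) n 1) \<in> borel_measurable M"
  proof (rule Z_measurable)
    show "(\<lambda>x. if 1 \<le> j then \<omega> j x else 0) \<in> borel_measurable M" for j
      using \<omega>_measurable[of "j - 1"] by (cases j) auto
  qed auto
  moreover have "Z B \<beta> h (\<lambda>i. if 1 \<le> i then \<omega> i x else 0) n 1 = Z B \<beta> h (\<lambda>i. \<omega> i x) n 1" for x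
    by (rule Z_local) auto
  ultimately show ?thesis by simp
qed

lemma cc_bounds: "0 \<le> cc n" "(cc n)\<^sup>2 \<le> \<kappa> ^ n" "2 ^ n * (cc n)\<^sup>2 \<le> \<tau> ^ n" "cc n \<le> \<tau> ^ n"
proof -
  show "0 \<le> cc n" using \<kappa>_pos by (simp add: cc_def)
  have "(cc n)\<^sup>2 = \<kappa> ^ Suc n" using \<kappa>_pos by (simp add: cc_def)
  also have "\<dots> \<le> \<kappa> ^ n" using \<kappa>_pos \<kappa>_half by (intro power_decreasing) auto
  finally show 1: "(cc n)\<^sup>2 \<le> \<kappa> ^ n" .
  have "2 ^ n * (cc n)\<^sup>2 \<le> 2 ^ n * \<kappa> ^ n" using 1 by (intro mult_left_mono) auto
  also have "\<dots> = (\<tau> ^ n)\<^sup>2" unfolding \<tau>_sq by (simp add: power_mult_distrib)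
  finally have 2: "2 ^ n * (cc n)\<^sup>2 \<le> (\<tau> ^ n)\<^sup>2" .
  also have "\<dots> \<le> \<tau> ^ n" using \<tau>_pow_le_1[of n] mult_left_mono[of "\<tau> ^ n" 1 "\<tau> ^ n"] by (simp add: power2_eq_square)
  finally show "2 ^ n * (cc n)\<^sup>2 \<le> \<tau> ^ n" .
  have "1 * (cc n)\<^sup>2 \<le> 2 ^ n * (cc n)\<^sup>2" by (intro mult_right_mono) auto
  then have "(cc n)\<^sup>2 \<le> (\<tau> ^ n)\<^sup>2" using 2 by linarith
  then show "cc n \<le> \<tau> ^ n" by (rule power2_le_imp_le) simp
qed

lemma expectation_Z: "(\<integral>x. Z B \<beta> h (\<lambda>i. \<omega> i x) n 1 \<partial>M) = heat (\<beta> * cc n) (AA \<beta> n) h"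
proof -
  have Z0: "0 \<le> Z B \<beta> h w n 1" for w using zz_pos[of \<beta> n h w] by (simp add: zz_def)
  have "(\<integral>\<^sup>+x. ennreal (Z B \<beta> h (\<lambda>i. \<omega> i x) n 1) \<partial>M) = ennreal (heat (\<beta> * cc n) (AA \<beta> n) h)"
    by (subst nn_transfer) (auto simp: nn_zz nn_heat[OF expoly_AA])
  then show ?thesis
    using Z0 expoly_nonneg[OF expoly_heat[OF expoly_AA]]
    by (subst integral_eq_nn_integral) (auto simp del: One_nat_def)
qed

text \<open>The variable common to the block adds one more smoothing, of width \<beta> cc_n. With x
  = 2^n \<beta> cc_n it changes the logarithm by at most 3 x + x^2, which is negligible after
  division by 2^n because 2 \<kappa> < 1.\<close>

lemma annealed_eq_fa:
  assumes "0 \<le> \<beta>" shows "annealed_free_energy M \<omega> B \<beta> h = fa \<beta> h"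
proof -
  let ?H = "\<lambda>n. heat (\<beta> * cc n) (AA \<beta> n) h"
  define e where "e n = 3 * \<beta> * \<tau> ^ n + \<beta>\<^sup>2 * \<tau> ^ n" for n
  have lo: "ln (AA \<beta> n h) / 2 ^ n \<le> ln (?H n) / 2 ^ n" for n
    using heat_ge[OF expoly_AA] AA_pos by (intro divide_right_mono ln_mono) auto
  have hi: "ln (?H n) / 2 ^ n \<le> ln (AA \<beta> n h) / 2 ^ n + e n" for n
  proof -
    define x where "x = 2 ^ n * (\<beta> * cc n)"
    have x0: "0 \<le> x" and c0: "0 \<le> \<beta> * cc n" using assms cc_bounds(1)[of n] by (auto simp: x_def)
    have "?H n \<le> (\<integral>g. AA \<beta> n h * exp (x * \<bar>g\<bar>) \<partial>N01)"
    proof (rule heat_abs_le[OF expoly_AA c0])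
      fix g show "AA \<beta> n (h + \<beta> * cc n * \<bar>g\<bar>) \<le> AA \<beta> n h * exp (x * \<bar>g\<bar>)"
        using AA_growth[OF mult_nonneg_nonneg[OF c0 abs_ge_zero[of g]], of \<beta> n h] by (simp add: x_def mult_ac)
    qed (intro integrable_mult_right std_normal_exp_abs x0)
    also have "\<dots> \<le> AA \<beta> n h * exp (3 * x + x\<^sup>2)" using std_normal_exp_abs(2)[OF x0] by (simp add: mult_left_mono)
    finally have "ln (?H n) \<le> ln (AA \<beta> n h * exp (3 * x + x\<^sup>2))"
      using less_le_trans[OF AA_pos heat_ge[OF expoly_AA]] by (intro ln_mono) auto
    also have "\<dots> = ln (AA \<beta> n h) + (3 * x + x\<^sup>2)" by (simp add: ln_mult_pos)
    finally have "ln (?H n) / 2 ^ n \<le> (ln (AA \<beta> n h) + (3 * x + x\<^sup>2)) / 2 ^ n" by (intro divide_right_mono) auto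
    also have "\<dots> = ln (AA \<beta> n h) / 2 ^ n + (3 * \<beta> * cc n + \<beta>\<^sup>2 * (2 ^ n * (cc n)\<^sup>2))"
      by (simp add: x_def add_divide_distrib power2_eq_square)
    also have "\<dots> \<le> ln (AA \<beta> n h) / 2 ^ n + e n"
      unfolding e_def using assms cc_bounds[of n] by (intro add_left_mono add_mono mult_left_mono) auto
    finally show ?thesis .
  qed
  have "e \<longlonglongrightarrow> 3 * \<beta> * 0 + \<beta>\<^sup>2 * 0"
    unfolding e_def[abs_def] using \<tau>_lt by (intro tendsto_intros LIMSEQ_power_zero) auto
  then have "(\<lambda>n. ln (AA \<beta> n h) / 2 ^ n + e n) \<longlonglongrightarrow> fa \<beta> h"
    using tendsto_add[OF fa_lim_and_ge(1)[OF assms, of h], of e 0] by simp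
  then have "(\<lambda>n. ln (?H n) / 2 ^ n) \<longlonglongrightarrow> fa \<beta> h"
    by (rule tendsto_sandwich[OF always_eventually[OF allI[OF lo]] always_eventually[OF allI[OF hi]] fa_lim_and_ge(1)[OF assms]])
  then show ?thesis unfolding annealed_free_energy_def expectation_Z by (rule limI)
qed

text \<open>The variances of the normalised logarithms are summable: the inner field contributes an
  amount of order 1 / 2^n, the common variable \<beta>^2 \<kappa>^n. Hence the sum of the squared
  deviations is almost surely finite and its terms tend to 0 along the full sequence.\<close>

lemma quenched_AE:
  assumes \<beta>: "0 \<le> \<beta>"
  shows "AE x in M. (\<lambda>n. ln (Z B \<beta> h (\<lambda>i. \<omega> i x) n 1) / 2 ^ n) \<longlonglongrightarrow> fq \<beta> h"
proof -
  let ?Y = "\<lambda>n x. (ln (Z B \<beta> h (\<lambda>i. \<omega> i x) n 1) - kk \<beta> n h) / 2 ^ n"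
  define C where "C = \<beta>\<^sup>2 + 2 * \<beta>\<^sup>2 * (1 / (1 - \<tau>))"
  have C0: "0 \<le> C" using \<tau>_lt by (simp add: C_def)
  define \<epsilon> where "\<epsilon> n = C * (1 / 2) ^ n + \<beta>\<^sup>2 * \<kappa> ^ n" for n
  have bound: "(\<integral>\<^sup>+x. ennreal ((?Y n x)\<^sup>2) \<partial>M) \<le> ennreal (\<epsilon> n)" for n
  proof -
    define p where "p = (2::real) ^ n"
    have p0: "0 < p" by (simp add: p_def)
    have "(\<integral>\<^sup>+x. ennreal ((?Y n x)\<^sup>2) \<partial>M) = (\<integral>\<^sup>+g. \<integral>\<^sup>+\<eta>. ennreal (((lz \<beta> n (h + \<beta> * cc n * g) \<eta> - kk \<beta> n h) / p)\<^sup>2) \<partial>inner n \<partial>N01)"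
      unfolding lz_def p_def by (rule nn_transfer[of "\<lambda>z. ennreal (((ln z - kk \<beta> n h) / 2 ^ n)\<^sup>2)"]) measurable
    also have "\<dots> \<le> (\<integral>\<^sup>+g. ennreal (\<beta>\<^sup>2 * (cc n)\<^sup>2 * g\<^sup>2 + VB \<beta> n / p\<^sup>2) \<partial>N01)"
    proof (rule nn_integral_mono)
      fix g
      interpret K: prob_space "inner n" by (rule prob_inner)
      let ?h = "h + \<beta> * cc n * g"
      let ?m = "kk \<beta> n ?h - kk \<beta> n h"
      have i: "integrable (inner n) (lz \<beta> n ?h)" "integrable (inner n) (\<lambda>\<eta>. (lz \<beta> n ?h \<eta>)\<^sup>2)"
        "(\<integral>\<eta>. (lz \<beta> n ?h \<eta> - kk \<beta> n ?h)\<^sup>2 \<partial>inner n) \<le> VB \<beta> n" using log_moments[of n \<beta> ?h] by auto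
      have e1: "(lz \<beta> n ?h \<eta> - kk \<beta> n ?h)\<^sup>2 = (lz \<beta> n ?h \<eta>)\<^sup>2 - 2 * kk \<beta> n ?h * lz \<beta> n ?h \<eta> + (kk \<beta> n ?h)\<^sup>2" for \<eta>
        by (simp add: power2_diff)
      have iv: "integrable (inner n) (\<lambda>\<eta>. (lz \<beta> n ?h \<eta> - kk \<beta> n ?h)\<^sup>2)" unfolding e1 using i by auto
      have e2: "((lz \<beta> n ?h \<eta> - kk \<beta> n h) / p)\<^sup>2 = ((lz \<beta> n ?h \<eta> - kk \<beta> n ?h)\<^sup>2 + 2 * ?m * (lz \<beta> n ?h \<eta> - kk \<beta> n ?h) + ?m\<^sup>2) / p\<^sup>2" for \<eta>
        by (simp add: power2_eq_square power_divide algebra_simps)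
      have ig: "integrable (inner n) (\<lambda>\<eta>. ((lz \<beta> n ?h \<eta> - kk \<beta> n h) / p)\<^sup>2)" unfolding e2 using i iv by auto
      have "(\<integral>\<^sup>+\<eta>. ennreal (((lz \<beta> n ?h \<eta> - kk \<beta> n h) / p)\<^sup>2) \<partial>inner n) = ennreal (\<integral>\<eta>. ((lz \<beta> n ?h \<eta> - kk \<beta> n h) / p)\<^sup>2 \<partial>inner n)"
        using ig by (rule nn_integral_eq_integral) auto
      also have "(\<integral>\<eta>. ((lz \<beta> n ?h \<eta> - kk \<beta> n h) / p)\<^sup>2 \<partial>inner n) = ((\<integral>\<eta>. (lz \<beta> n ?h \<eta> - kk \<beta> n ?h)\<^sup>2 \<partial>inner n) + ?m\<^sup>2) / p\<^sup>2"
        unfolding e2 using i iv by (simp add: kk_def[symmetric])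
      also have "\<dots> \<le> (VB \<beta> n + (p * (\<beta> * cc n * g))\<^sup>2) / p\<^sup>2"
      proof (intro divide_right_mono add_mono i)
        have "\<bar>?m\<bar> \<le> \<bar>p * (\<beta> * cc n * g)\<bar>" using kk_lipschitz[of \<beta> n h "\<beta> * cc n * g"] by (simp add: p_def abs_mult)
        then show "?m\<^sup>2 \<le> (p * (\<beta> * cc n * g))\<^sup>2" by (simp only: abs_le_square_iff)
      qed auto
      also have "\<dots> = \<beta>\<^sup>2 * (cc n)\<^sup>2 * g\<^sup>2 + VB \<beta> n / p\<^sup>2" using p0 by (simp add: power_mult_distrib add_divide_distrib)
      finally show "(\<integral>\<^sup>+\<eta>. ennreal (((lz \<beta> n ?h \<eta> - kk \<beta> n h) / p)\<^sup>2) \<partial>inner n) \<le> ennreal (\<beta>\<^sup>2 * (cc n)\<^sup>2 * g\<^sup>2 + VB \<beta> n / p\<^sup>2)"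
        by (simp add: ennreal_leI)
    qed
    also have "\<dots> = ennreal (\<beta>\<^sup>2 * (cc n)\<^sup>2 * 1 + VB \<beta> n / p\<^sup>2)"
    proof (rule nn_integral_affine_prob[OF prob_space_N01])
      show "(\<integral>\<^sup>+x. ennreal (x\<^sup>2) \<partial>N01) = ennreal 1" using std_normal_moments by (simp add: nn_integral_eq_integral)
    qed (use VB_nonneg[of \<beta> n] in auto)
    also have "\<dots> \<le> ennreal (\<epsilon> n)"
    proof (rule ennreal_leI)
      have "(\<Sum>j<n. 2 * \<beta>\<^sup>2 * \<tau> ^ j) \<le> 2 * \<beta>\<^sup>2 * (1 / (1 - \<tau>))"
        unfolding sum_distrib_left[symmetric] using sum_geometric_le[of \<tau> n] \<tau>_lt by (intro mult_left_mono) auto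
      then have "VB \<beta> n \<le> p * C" unfolding VB_def C_def p_def by (intro mult_left_mono) auto
      then have "VB \<beta> n / p\<^sup>2 \<le> p * C / p\<^sup>2" by (intro divide_right_mono) auto
      also have "\<dots> = C / p" using p0 by (simp add: power2_eq_square)
      also have "\<dots> = C * (1 / 2) ^ n" by (simp add: p_def power_one_over)
      finally have 1: "VB \<beta> n / p\<^sup>2 \<le> C * (1 / 2) ^ n" .
      have "\<beta>\<^sup>2 * (cc n)\<^sup>2 \<le> \<beta>\<^sup>2 * \<kappa> ^ n" using cc_bounds(2)[of n] by (intro mult_left_mono) auto
      then show "\<beta>\<^sup>2 * (cc n)\<^sup>2 * 1 + VB \<beta> n / p\<^sup>2 \<le> \<epsilon> n" using 1 by (simp add: \<epsilon>_def)
    qed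
    finally show ?thesis .
  qed
  have \<epsilon>0: "0 \<le> \<epsilon> n" for n using C0 \<kappa>_pos by (simp add: \<epsilon>_def)
  have \<epsilon>s: "summable \<epsilon>"
    unfolding \<epsilon>_def[abs_def] using \<kappa>_pos \<kappa>_half by (intro summable_add summable_mult summable_geometric) auto
  have "(\<integral>\<^sup>+x. (\<Sum>n. ennreal ((?Y n x)\<^sup>2)) \<partial>M) = (\<Sum>n. \<integral>\<^sup>+x. ennreal ((?Y n x)\<^sup>2) \<partial>M)"
    by (rule nn_integral_suminf) measurable
  also have "\<dots> \<le> (\<Sum>n. ennreal (\<epsilon> n))" using bound by (intro suminf_le) auto
  also have "\<dots> < \<infinity>" using \<epsilon>s \<epsilon>0 by (simp add: suminf_ennreal2)
  finally have fin: "(\<integral>\<^sup>+x. (\<Sum>n. ennreal ((?Y n x)\<^sup>2)) \<partial>M) \<noteq> \<infinity>" by simp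
  have Ym: "(\<lambda>x. ennreal ((?Y n x)\<^sup>2)) \<in> borel_measurable M" for n by measurable
  have "AE x in M. (\<Sum>n. ennreal ((?Y n x)\<^sup>2)) \<noteq> \<infinity>"
    by (rule nn_integral_PInf_AE[OF borel_measurable_suminf_order[OF Ym] fin])
  then show ?thesis
  proof (rule AE_mp, intro AE_I2 impI)
    fix x assume "(\<Sum>n. ennreal ((?Y n x)\<^sup>2)) \<noteq> \<infinity>"
    then have "summable (\<lambda>n. (?Y n x)\<^sup>2)" by (intro summable_suminf_not_top) auto
    then have "(\<lambda>n. (?Y n x)\<^sup>2) \<longlonglongrightarrow> 0" by (rule summable_LIMSEQ_zero)
    then have "(\<lambda>n. sqrt ((?Y n x)\<^sup>2)) \<longlonglongrightarrow> sqrt 0" by (rule tendsto_real_sqrt)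
    then have "(\<lambda>n. \<bar>?Y n x\<bar>) \<longlonglongrightarrow> 0" by (simp only: real_sqrt_abs real_sqrt_zero)
    then have "(\<lambda>n. ?Y n x) \<longlonglongrightarrow> 0" by (rule tendsto_rabs_zero_cancel)
    from tendsto_add[OF this fq_lim_and_ge(1)[OF \<beta>, of h]]
    show "(\<lambda>n. ln (Z B \<beta> h (\<lambda>i. \<omega> i x) n 1) / 2 ^ n) \<longlonglongrightarrow> fq \<beta> h"
      by (simp add: diff_divide_distrib)
  qed
qed

text \<open>Two constants that are almost sure limits of the same sequence agree, since a
  probability space is not null. So the description operator returns the limit.\<close>

lemma quenched_eq_fq:
  assumes "0 \<le> \<beta>" shows "quenched_free_energy M \<omega> B \<beta> h = fq \<beta> h"
  unfolding quenched_free_energy_def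
proof (rule the_equality)
  interpret prob_space M by (rule prob_M)
  show "AE x in M. (\<lambda>n. ln (Z B \<beta> h (\<lambda>i. \<omega> i x) n 1) / 2 ^ n) \<longlonglongrightarrow> fq \<beta> h" by (rule quenched_AE[OF assms])
  fix L assume "AE x in M. (\<lambda>n. ln (Z B \<beta> h (\<lambda>i. \<omega> i x) n 1) / 2 ^ n) \<longlonglongrightarrow> L"
  with quenched_AE[OF assms, of h] have "AE x in M. L = fq \<beta> h"
    by eventually_elim (rule LIMSEQ_unique)
  then show "L = fq \<beta> h" by (auto dest: AE_E3 simp: AE_const)
qed

lemma critical_eq_hcrit:
  assumes "0 \<le> \<beta>" shows "annealed_critical_point M \<omega> B \<beta> = hcrit \<beta>"
  unfolding annealed_critical_point_def hcrit_def by (simp add: annealed_eq_fa[OF assms])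

end

section \<open>The three regimes\<close>

text \<open>The two upper bounds on \<kappa> say precisely that 1 / \<kappa> exceeds (2 / B)^2 and
  2, which leaves room for b.\<close>

lemma exists_above_max:
  fixes B \<kappa> :: real
  assumes "1 < B" "0 < \<kappa>" "\<kappa> < min (B\<^sup>2 / 4) (1 / 2)"
  obtains b where "2 < b" "(2 / B)\<^sup>2 < b" "b * \<kappa> < 1"
proof -
  have "2 < 1 / \<kappa>" using assms by (simp add: field_simps)
  moreover have "(2 / B)\<^sup>2 < 1 / \<kappa>" using assms by (simp add: field_simps power_divide)
  ultimately have "max 2 ((2 / B)\<^sup>2) < 1 / \<kappa>" by simp
  then obtain b where b: "max 2 ((2 / B)\<^sup>2) < b" "b < 1 / \<kappa>" using dense by blast
  have "b * \<kappa> < 1" using b(2) assms(2) by (simp add: field_simps)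
  then show ?thesis using that[of b] b(1) by simp
qed

context hier_pinning
begin

lemma fq_comparison:
  assumes q: "0 < q" "\<rho> < q" "2 / B\<^sup>2 \<le> q\<^sup>2"
  shows "\<exists>\<delta>>0. \<forall>\<eta>. 0 < \<eta> \<longrightarrow> \<eta> < 1 \<longrightarrow> (\<exists>X\<ge>4. \<exists>\<theta>>0. \<forall>\<beta> n u. 0 < \<beta> \<longrightarrow> \<beta> \<le> \<delta> \<longrightarrow> 1 \<le> n \<longrightarrow>
     \<beta> * (\<Sum>j<n. q ^ j) \<le> \<delta> \<longrightarrow> X \<le> a ^ n * u \<longrightarrow> a ^ n * u \<le> 2 * X \<longrightarrow> \<beta> * q ^ n \<le> \<theta> \<longrightarrow> \<beta> * \<rho> ^ n \<le> \<theta> \<longrightarrow>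
     (1 - \<eta>) * fa \<beta> (hcrit \<beta> + u) \<le> fq \<beta> (hcrit \<beta> + u))"
proof (rule free_energy_comparison[OF q])
  show "0 \<le> D0 + ln B" using D0_pos B_gt by simp
  show "((1 - 4 * V \<beta> n h) * (ln (AA \<beta> n h) - ln 2) - (D0 + ln B)) / 2 ^ n \<le> fq \<beta> h"
    if "0 < \<beta>" "1 \<le> n" "2 \<le> AA \<beta> n h" for \<beta> h n
    using fq_ge[of \<beta> n h] that by simp
qed

text \<open>Some admissible q is below 1, so the sum of the \<beta> q^j is bounded uniformly in the
  number of generations and \<beta> small is enough. The resulting \<beta>0 does not depend on
  \<eta>, because \<delta> in \<open>fq_comparison\<close> is chosen before \<eta>.\<close>

lemma irrelevant_regime:
  assumes "sqrt 2 < B"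
  shows "\<exists>\<beta>0>0. \<forall>\<beta>. 0 < \<beta> \<and> \<beta> \<le> \<beta>0 \<longrightarrow> (\<forall>\<eta>\<in>{0<..<1}. \<exists>\<epsilon>>0. \<forall>u\<in>{0<..<\<epsilon>}.
     (1 - \<eta>) * fa \<beta> (hcrit \<beta> + u) \<le> fq \<beta> (hcrit \<beta> + u))"
proof -
  \<comment> \<open>Must be at least sqrt 2 / B, strictly above \<rho> and still below 1; the
    midpoint of \<rho> and 1 takes care of the second requirement.\<close>
  define q where "q = max ((1 + \<rho>) / 2) (sqrt 2 / B)"
  have r: "sqrt 2 / B < 1" "0 < sqrt 2 / B" using assms B_gt by simp_all
  have "\<rho> < (1 + \<rho>) / 2" "(1 + \<rho>) / 2 < 1" using \<rho>_lt by simp_all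
  then have q: "0 < q" "\<rho> < q" "q < 1" using r by (auto simp: q_def less_max_iff_disj)
  have "(sqrt 2 / B)\<^sup>2 \<le> q\<^sup>2" using r by (intro power_mono) (auto simp: q_def)
  then have q2: "2 / B\<^sup>2 \<le> q\<^sup>2" by (simp add: power_divide)
  obtain \<delta> where \<delta>: "0 < \<delta>" "\<forall>\<eta>. 0 < \<eta> \<longrightarrow> \<eta> < 1 \<longrightarrow> (\<exists>X\<ge>4. \<exists>\<theta>>0. \<forall>\<beta> n u. 0 < \<beta> \<longrightarrow> \<beta> \<le> \<delta> \<longrightarrow> 1 \<le> n \<longrightarrow>
     \<beta> * (\<Sum>j<n. q ^ j) \<le> \<delta> \<longrightarrow> X \<le> a ^ n * u \<longrightarrow> a ^ n * u \<le> 2 * X \<longrightarrow> \<beta> * q ^ n \<le> \<theta> \<longrightarrow> \<beta> * \<rho> ^ n \<le> \<theta> \<longrightarrow>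
     (1 - \<eta>) * fa \<beta> (hcrit \<beta> + u) \<le> fq \<beta> (hcrit \<beta> + u))"
    using fq_comparison[OF q(1,2) q2] by (elim exE conjE) (rule that)
  define \<beta>0 where "\<beta>0 = min \<delta> (\<delta> * (1 - q))"
  have \<beta>0: "0 < \<beta>0" "\<beta>0 \<le> \<delta>" "\<beta>0 \<le> \<delta> * (1 - q)" using \<delta>(1) q(3) by (auto simp: \<beta>0_def)
  have "\<exists>\<epsilon>>0. \<forall>u\<in>{0<..<\<epsilon>}. (1 - \<eta>) * fa \<beta> (hcrit \<beta> + u) \<le> fq \<beta> (hcrit \<beta> + u)"
    if \<beta>: "0 < \<beta>" "\<beta> \<le> \<beta>0" and \<eta>: "0 < \<eta>" "\<eta> < 1" for \<beta> \<eta>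
  proof -
    obtain X \<theta> where X: "4 \<le> X" "0 < \<theta>" "\<forall>\<beta> n u. 0 < \<beta> \<longrightarrow> \<beta> \<le> \<delta> \<longrightarrow> 1 \<le> n \<longrightarrow>
     \<beta> * (\<Sum>j<n. q ^ j) \<le> \<delta> \<longrightarrow> X \<le> a ^ n * u \<longrightarrow> a ^ n * u \<le> 2 * X \<longrightarrow> \<beta> * q ^ n \<le> \<theta> \<longrightarrow> \<beta> * \<rho> ^ n \<le> \<theta> \<longrightarrow>
     (1 - \<eta>) * fa \<beta> (hcrit \<beta> + u) \<le> fq \<beta> (hcrit \<beta> + u)"
      using spec[OF \<delta>(2), of \<eta>, THEN mp, OF \<eta>(1), THEN mp, OF \<eta>(2)] by (elim exE conjE) (rule that)
    \<comment> \<open>Beyond generation m the quantities \<beta> q^n and \<beta> \<rho>^n are at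
      most \<theta>. Taking u below X / a^m forces the scale of u to lie beyond m; this is the
      \<epsilon> of the claim.\<close>
    obtain m where m: "q ^ m < \<theta> / \<beta>" using real_arch_pow_inv[OF _ q(3), of "\<theta> / \<beta>"] X(2) \<beta>(1) by auto
    have pw: "\<beta> * q ^ n \<le> \<theta>" "\<beta> * \<rho> ^ n \<le> \<theta>" if "m < n" for n
    proof -
      have "q ^ n \<le> q ^ m" using that q by (intro power_decreasing) auto
      then have "q ^ n \<le> \<theta> / \<beta>" using m by linarith
      then show 1: "\<beta> * q ^ n \<le> \<theta>" using \<beta>(1) by (simp add: field_simps)
      have "\<rho> ^ n \<le> q ^ n" using q \<rho>_gt by (intro power_mono) auto
      then have "\<beta> * \<rho> ^ n \<le> \<beta> * q ^ n" using \<beta>(1) by (intro mult_left_mono) auto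
      then show "\<beta> * \<rho> ^ n \<le> \<theta>" using 1 by linarith
    qed
    have "(1 - \<eta>) * fa \<beta> (hcrit \<beta> + u) \<le> fq \<beta> (hcrit \<beta> + u)" if u: "0 < u" "u < X / a ^ m" for u
    proof -
      have "a ^ m * u < X" using u(2) a_pos by (simp add: field_simps)
      then obtain n where n: "m < n" "X \<le> a ^ n * u" "a ^ n * u \<le> 2 * X"
        using obtain_scale[OF u(1), of X m] X(1) by auto
      have "(\<Sum>j<n. q ^ j) \<le> 1 / (1 - q)" using sum_geometric_le[of q n] q by simp
      then have "\<beta> * (\<Sum>j<n. q ^ j) \<le> (\<delta> * (1 - q)) * (1 / (1 - q))"
        using \<beta> \<beta>0(3) q by (intro mult_mono sum_nonneg) auto
      then have "\<beta> * (\<Sum>j<n. q ^ j) \<le> \<delta>" using q(3) by simp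
      then show ?thesis using n pw[OF n(1)] \<beta> \<beta>0(2) by (intro X(3)[rule_format, of \<beta> n u]) auto
    qed
    moreover have "0 < X / a ^ m" using X(1) a_pos by simp
    ultimately show ?thesis by (intro exI[of _ "X / a ^ m"]) auto
  qed
  then show ?thesis using \<beta>0(1) by (intro exI[of _ \<beta>0]) auto
qed

lemma powr_window:
  fixes \<beta> u c e :: real
  assumes "0 < \<beta>" "0 < e" "0 < c" "c * \<beta> powr (1 / e) < u"
  shows "\<beta> * (1 / u) powr e \<le> (1 / c) powr e"
proof -
  have "0 < c * \<beta> powr (1 / e)" using assms by simp
  then have "1 / u \<le> 1 / (c * \<beta> powr (1 / e))" using assms(4) by (intro divide_left_mono) auto
  then have "(1 / u) powr e \<le> (1 / (c * \<beta> powr (1 / e))) powr e"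
    using assms less_trans[OF \<open>0 < c * \<beta> powr (1 / e)\<close> assms(4)] by (intro powr_mono2) auto
  also have "\<dots> = (1 / c) powr e / \<beta>"
    using assms by (simp add: powr_divide powr_mult powr_powr)
  finally show ?thesis using assms(1) by (simp add: field_simps)
qed

text \<open>Now q > 1, so the sum of the q^j is of order q^n and everything reduces to \<beta> q^n
  being small at the scale n of u. There a^n is of order 1 / u, whence q^n is of order u^(-e), and
  the lower bound on u is what is required.\<close>

lemma relevant_regime:
  assumes "B < sqrt 2" and \<eta>: "\<eta> \<in> {0<..<1}"
  shows "\<exists>c>0. \<exists>\<beta>0>0. \<exists>\<epsilon>>0. \<forall>\<beta>. 0 < \<beta> \<and> \<beta> \<le> \<beta>0 \<longrightarrow> (\<forall>u\<in>{c * \<beta> powr (2 / (2 - \<nu> B))<..<\<epsilon>}.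
     (1 - \<eta>) * fa \<beta> (hcrit \<beta> + u) \<le> fq \<beta> (hcrit \<beta> + u))"
proof -
  define q where "q = sqrt 2 / B"
  have q: "1 < q" using assms(1) B_gt by (simp add: q_def)
  have q0: "0 < q" "\<rho> < q" using q \<rho>_lt by linarith+
  have q2: "q\<^sup>2 = 2 / B\<^sup>2" by (simp add: q_def power_divide)
  obtain \<delta> where \<delta>: "0 < \<delta>" "\<forall>\<eta>. 0 < \<eta> \<longrightarrow> \<eta> < 1 \<longrightarrow> (\<exists>X\<ge>4. \<exists>\<theta>>0. \<forall>\<beta> n u. 0 < \<beta> \<longrightarrow> \<beta> \<le> \<delta> \<longrightarrow> 1 \<le> n \<longrightarrow>
     \<beta> * (\<Sum>j<n. q ^ j) \<le> \<delta> \<longrightarrow> X \<le> a ^ n * u \<longrightarrow> a ^ n * u \<le> 2 * X \<longrightarrow> \<beta> * q ^ n \<le> \<theta> \<longrightarrow> \<beta> * \<rho> ^ n \<le> \<theta> \<longrightarrow>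
     (1 - \<eta>) * fa \<beta> (hcrit \<beta> + u) \<le> fq \<beta> (hcrit \<beta> + u))"
    using fq_comparison[OF q0 eq_refl[OF q2[symmetric]]] by (elim exE conjE) (rule that)
  have \<eta>: "0 < \<eta>" "\<eta> < 1" using \<eta> by auto
  obtain X \<theta> where X: "4 \<le> X" "0 < \<theta>" "\<forall>\<beta> n u. 0 < \<beta> \<longrightarrow> \<beta> \<le> \<delta> \<longrightarrow> 1 \<le> n \<longrightarrow>
     \<beta> * (\<Sum>j<n. q ^ j) \<le> \<delta> \<longrightarrow> X \<le> a ^ n * u \<longrightarrow> a ^ n * u \<le> 2 * X \<longrightarrow> \<beta> * q ^ n \<le> \<theta> \<longrightarrow> \<beta> * \<rho> ^ n \<le> \<theta> \<longrightarrow>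
     (1 - \<eta>) * fa \<beta> (hcrit \<beta> + u) \<le> fq \<beta> (hcrit \<beta> + u)"
    using spec[OF \<delta>(2), of \<eta>, THEN mp, OF \<eta>(1), THEN mp, OF \<eta>(2)] by (elim exE conjE) (rule that)
  \<comment> \<open>The exponent with \<open>a powr e = q\<close>, and 1 / e is the power of \<beta>
    in the claim.\<close>
  define e where "e = (2 - \<nu> B) / 2"
  have lna: "0 < ln a" using a_gt by simp
  have nu: "\<nu> B = ln 2 / ln a" by (simp add: \<nu>_def a_def)
  have ae: "a powr e = q"
  proof -
    have "q = a / sqrt 2" using B_gt real_sqrt_pow2[of 2] by (simp add: q_def a_def field_simps power2_eq_square)
    moreover have "a powr e = exp (ln a - ln 2 / 2)"
      using a_pos lna by (simp add: powr_def e_def nu field_simps)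
    moreover have "exp (ln a - ln 2 / 2) = a / sqrt 2"
      using a_pos by (simp add: exp_diff ln_sqrt[symmetric])
    ultimately show ?thesis by simp
  qed
  \<comment> \<open>From a > 1 and \<open>a powr e = q\<close> with q > 1. Equivalently, \<nu> <
    2.\<close>
  have e0: "0 < e"
  proof (rule ccontr)
    assume "\<not> 0 < e"
    then have "a powr e \<le> a powr 0" using a_gt by (intro powr_mono) auto
    then show False using ae q a_pos by simp
  qed
  define m where "m = min \<theta> (\<delta> * (q - 1))"
  have m: "0 < m" "m \<le> \<theta>" "m \<le> \<delta> * (q - 1)" using X(2) \<delta>(1) q by (auto simp: m_def)
  \<comment> \<open>Solves (2 X / c)^e = m, the largest value of \<beta> q^n that both the smallness
    at the scale and the sum over generations tolerate.\<close>
  define c where "c = 2 * X * m powr (- 1 / e)"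
  have c0: "0 < c" using X(1) m(1) by (simp add: c_def)
  have cm: "(2 * X) powr e * (1 / c) powr e = m"
  proof -
    have "(2 * X) powr e * (1 / c) powr e = (2 * X * (1 / c)) powr e" by (rule powr_mult[symmetric])
    also have "2 * X * (1 / c) = m powr (1 / e)" using X(1) m(1) by (simp add: c_def powr_minus field_simps)
    also have "(m powr (1 / e)) powr e = m" using m(1) e0 by (simp add: powr_powr)
    finally show ?thesis .
  qed
  define \<beta>0 where "\<beta>0 = min \<delta> \<theta>"
  have \<beta>0: "0 < \<beta>0" "\<beta>0 \<le> \<delta>" "\<beta>0 \<le> \<theta>" using \<delta>(1) X(2) by (auto simp: \<beta>0_def)
  have "(1 - \<eta>) * fa \<beta> (hcrit \<beta> + u) \<le> fq \<beta> (hcrit \<beta> + u)"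
    if \<beta>: "0 < \<beta>" "\<beta> \<le> \<beta>0" and u: "c * \<beta> powr (1 / e) < u" "u < 1" for \<beta> u
  proof -
    have "0 < c * \<beta> powr (1 / e)" using c0 \<beta>(1) by simp
    then have u0: "0 < u" using u(1) by linarith
    have "a ^ 0 * u < X" using u(2) X(1) by simp
    then obtain n where n: "0 < n" "X \<le> a ^ n * u" "a ^ n * u \<le> 2 * X"
      using obtain_scale[OF u0, of X 0] X(1) by auto
    have "a ^ n \<le> 2 * X * (1 / u)" using n(3) u0 by (simp add: field_simps)
    then have "(a ^ n) powr e \<le> (2 * X * (1 / u)) powr e" using e0 a_pos by (intro powr_mono2) auto
    also have "\<dots> = (2 * X) powr e * (1 / u) powr e" by (rule powr_mult)
    also have "(a ^ n) powr e = q ^ n"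
      unfolding ae[symmetric] using a_pos by (simp add: powr_realpow[symmetric] powr_powr mult.commute)
    finally have "\<beta> * q ^ n \<le> \<beta> * ((2 * X) powr e * (1 / u) powr e)" using \<beta>(1) by (intro mult_left_mono) auto
    also have "\<dots> = (2 * X) powr e * (\<beta> * (1 / u) powr e)" by simp
    also have "\<dots> \<le> (2 * X) powr e * (1 / c) powr e"
      using powr_window[OF \<beta>(1) e0 c0 u(1)] by (intro mult_left_mono) auto
    finally have bq: "\<beta> * q ^ n \<le> m" unfolding cm .
    have "(\<Sum>j<n. q ^ j) = (q ^ n - 1) / (q - 1)" using q by (intro geometric_sum) auto
    also have "\<dots> \<le> q ^ n / (q - 1)" using q by (intro divide_right_mono) auto
    finally have "\<beta> * (\<Sum>j<n. q ^ j) \<le> \<beta> * (q ^ n / (q - 1))" using \<beta>(1) by (intro mult_left_mono) auto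
    also have "\<dots> \<le> \<delta>" using bq m(3) q by (simp add: pos_divide_le_eq)
    finally have sum: "\<beta> * (\<Sum>j<n. q ^ j) \<le> \<delta>" .
    have "\<rho> ^ n \<le> 1" using \<rho>_gt \<rho>_lt by (intro power_le_one) auto
    then have "\<beta> * \<rho> ^ n \<le> \<beta> * 1" using \<beta>(1) by (intro mult_left_mono) auto
    then have "\<beta> * \<rho> ^ n \<le> \<theta>" using \<beta>(2) \<beta>0(3) by linarith
    then show ?thesis using n sum bq m(2) \<beta> \<beta>0(2) by (intro X(3)[rule_format, of \<beta> n u]) auto
  qed
  moreover have "1 / e = 2 / (2 - \<nu> B)" by (simp add: e_def)
  ultimately show ?thesis using c0 \<beta>0(1) by (intro exI[of _ c] conjI exI[of _ \<beta>0] exI[of _ "1::real"]) auto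
qed

text \<open>With q = 1 the sum is just n, so \<beta> n must be small. At the scale of u, n ln a is
  at most ln (2 X) - ln u, and the lower bound on u makes this of order \<beta>^(-2/3). Thus \<beta>
  n is of order \<beta>^(1/3), and c = 1 will do.\<close>

lemma marginal_regime:
  assumes "B = sqrt 2" and \<eta>: "\<eta> \<in> {0<..<1}"
  shows "\<exists>\<beta>0>0. \<exists>c>0. \<forall>\<beta>. 0 < \<beta> \<and> \<beta> \<le> \<beta>0 \<longrightarrow> (\<forall>u\<in>{c * exp (- c * \<beta> powr (- 2 / 3))<..<1}.
     (1 - \<eta>) * fa \<beta> (hcrit \<beta> + u) \<le> fq \<beta> (hcrit \<beta> + u))"
proof -
  have q2: "2 / B\<^sup>2 \<le> 1\<^sup>2" by (simp add: assms(1))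
  obtain \<delta> where \<delta>: "0 < \<delta>" "\<forall>\<eta>. 0 < \<eta> \<longrightarrow> \<eta> < 1 \<longrightarrow> (\<exists>X\<ge>4. \<exists>\<theta>>0. \<forall>\<beta> n u. 0 < \<beta> \<longrightarrow> \<beta> \<le> \<delta> \<longrightarrow> 1 \<le> n \<longrightarrow>
     \<beta> * (\<Sum>j<n. 1 ^ j) \<le> \<delta> \<longrightarrow> X \<le> a ^ n * u \<longrightarrow> a ^ n * u \<le> 2 * X \<longrightarrow> \<beta> * 1 ^ n \<le> \<theta> \<longrightarrow> \<beta> * \<rho> ^ n \<le> \<theta> \<longrightarrow>
     (1 - \<eta>) * fa \<beta> (hcrit \<beta> + u) \<le> fq \<beta> (hcrit \<beta> + u))"
    using fq_comparison[OF zero_less_one \<rho>_lt q2] by (elim exE conjE) (rule that)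
  have \<eta>: "0 < \<eta>" "\<eta> < 1" using \<eta> by auto
  obtain X \<theta> where X: "4 \<le> X" "0 < \<theta>" "\<forall>\<beta> n u. 0 < \<beta> \<longrightarrow> \<beta> \<le> \<delta> \<longrightarrow> 1 \<le> n \<longrightarrow>
     \<beta> * (\<Sum>j<n. 1 ^ j) \<le> \<delta> \<longrightarrow> X \<le> a ^ n * u \<longrightarrow> a ^ n * u \<le> 2 * X \<longrightarrow> \<beta> * 1 ^ n \<le> \<theta> \<longrightarrow> \<beta> * \<rho> ^ n \<le> \<theta> \<longrightarrow>
     (1 - \<eta>) * fa \<beta> (hcrit \<beta> + u) \<le> fq \<beta> (hcrit \<beta> + u)"
    using spec[OF \<delta>(2), of \<eta>, THEN mp, OF \<eta>(1), THEN mp, OF \<eta>(2)] by (elim exE conjE) (rule that)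
  have lna: "0 < ln a" using a_gt by simp
  have l2X: "0 < ln (2 * X) + 1" using ln_ge_zero[of "2 * X"] X(1) by linarith
  \<comment> \<open>The bound on \<open>\<beta> powr (1 / 3)\<close> under which \<beta> n \<le>
    \<delta>; it accounts for the entry \<open>t ^ 3\<close> of the minimum below.\<close>
  define t where "t = \<delta> * ln a / (ln (2 * X) + 1)"
  have t0: "0 < t" using \<delta>(1) lna l2X by (simp add: t_def)
  define \<beta>0 where "\<beta>0 = Min {1, \<delta>, \<theta>, t ^ 3}"
  have \<beta>0: "0 < \<beta>0" "\<beta>0 \<le> 1" "\<beta>0 \<le> \<delta>" "\<beta>0 \<le> \<theta>" "\<beta>0 \<le> t ^ 3" using \<delta>(1) X(2) t0 by (auto simp: \<beta>0_def)
  have "(1 - \<eta>) * fa \<beta> (hcrit \<beta> + u) \<le> fq \<beta> (hcrit \<beta> + u)"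
    if \<beta>: "0 < \<beta>" "\<beta> \<le> \<beta>0" and u: "exp (- (\<beta> powr (- 2 / 3))) < u" "u < 1" for \<beta> u
  proof -
    have u0: "0 < u" using u(1) by (rule less_trans[OF exp_gt_zero])
    have "a ^ 0 * u < X" using u(2) X(1) by simp
    then obtain n where n: "0 < n" "X \<le> a ^ n * u" "a ^ n * u \<le> 2 * X"
      using obtain_scale[OF u0, of X 0] X(1) by auto
    have "ln (exp (- (\<beta> powr (- 2 / 3)))) < ln u" using u(1) u0 by (intro ln_less_cancel_iff[THEN iffD2]) auto
    then have lu: "- ln u < \<beta> powr (- 2 / 3)" by simp
    have "ln (a ^ n * u) \<le> ln (2 * X)" using n(3) u0 a_pos by (intro ln_mono) auto
    then have "real n * ln a + ln u \<le> ln (2 * X)" using u0 a_pos by (simp add: ln_mult_pos ln_realpow)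
    then have "real n * ln a \<le> ln (2 * X) + \<beta> powr (- 2 / 3)" using lu by linarith
    then have "\<beta> * (real n * ln a) \<le> \<beta> * (ln (2 * X) + \<beta> powr (- 2 / 3))" using \<beta>(1) by (intro mult_left_mono) auto
    also have "\<dots> = \<beta> * ln (2 * X) + \<beta> powr (1 / 3)"
      using \<beta>(1) powr_add[of \<beta> 1 "- 2 / 3"] by (simp add: distrib_left)
    also have "\<beta> * ln (2 * X) \<le> \<beta> powr (1 / 3) * ln (2 * X)"
      using powr_mono'[of "1 / 3" 1 \<beta>] \<beta> \<beta>0(2) X(1) by (intro mult_right_mono) auto
    also have "\<beta> powr (1 / 3) * ln (2 * X) + \<beta> powr (1 / 3) = \<beta> powr (1 / 3) * (ln (2 * X) + 1)" by (simp add: distrib_left)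
    also have "\<dots> \<le> t * (ln (2 * X) + 1)"
    proof (rule mult_right_mono)
      have "\<beta> powr (1 / 3) \<le> (t ^ 3) powr (1 / 3)" using \<beta> \<beta>0(5) by (intro powr_mono2) auto
      also have "\<dots> = (t powr real 3) powr (1 / 3)" using powr_realpow[OF t0, of 3] by (simp only:)
      also have "\<dots> = t" unfolding powr_powr using t0 by simp
      finally show "\<beta> powr (1 / 3) \<le> t" .
    qed (use l2X in simp)
    also have "\<dots> = \<delta> * ln a" using l2X by (simp add: t_def)
    finally have "(\<beta> * real n) * ln a \<le> \<delta> * ln a" by (simp only: mult.assoc)
    then have bn: "\<beta> * real n \<le> \<delta>" using lna by simp
    have "\<rho> ^ n \<le> 1" using \<rho>_gt \<rho>_lt by (intro power_le_one) auto
    then have "\<beta> * \<rho> ^ n \<le> \<beta> * 1" using \<beta>(1) by (intro mult_left_mono) auto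
    then have "\<beta> * \<rho> ^ n \<le> \<theta>" using \<beta>(2) \<beta>0(4) by linarith
    then show ?thesis using n bn \<beta> \<beta>0 by (intro X(3)[rule_format, of \<beta> n u]) auto
  qed
  then show ?thesis using \<beta>0(1) by (intro exI[of _ \<beta>0] conjI exI[of _ "1::real"]) auto
qed

end

theorem proposition6p1:
  fixes M :: "'a measure" and \<omega> :: "nat \<Rightarrow> 'a \<Rightarrow> real" and B \<kappa> :: real
    and F Fa :: "real \<Rightarrow> real \<Rightarrow> real" and hc :: "real \<Rightarrow> real"
  defines "F \<equiv> quenched_free_energy M \<omega> B"
    and "Fa \<equiv> annealed_free_energy M \<omega> B"
    and "hc \<equiv> annealed_critical_point M \<omega> B"
  assumes "prob_space M"
    and "centered_gaussian_family M {1..} \<omega>"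
    and "\<And>i j. i \<ge> 1 \<Longrightarrow> j \<ge> 1 \<Longrightarrow> (\<integral>x. \<omega> i x * \<omega> j x \<partial>M) = \<kappa> ^ hier_dist i j"
    and "1 < B" "B < 2"
    and "0 < \<kappa>" "\<kappa> < min (B\<^sup>2 / 4) (1 / 2)"
  shows "(B > B_crit \<longrightarrow>
           (\<exists>\<beta>0>0. \<forall>\<beta>. 0 < \<beta> \<and> \<beta> \<le> \<beta>0 \<longrightarrow>
             (\<forall>\<eta>\<in>{0<..<1}. \<exists>\<epsilon>>0. \<forall>u\<in>{0<..<\<epsilon>}.
               F \<beta> (hc \<beta> + u) \<ge> (1 - \<eta>) * Fa \<beta> (hc \<beta> + u))))
       \<and> (B < B_crit \<longrightarrow>
           (\<forall>\<eta>\<in>{0<..<1}. \<exists>c>0. \<exists>\<beta>0>0. \<exists>\<epsilon>>0. \<forall>\<beta>. 0 < \<beta> \<and> \<beta> \<le> \<beta>0 \<longrightarrow>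
             (\<forall>u\<in>{c * \<beta> powr (2 / (2 - \<nu> B))<..<\<epsilon>}.
               F \<beta> (hc \<beta> + u) \<ge> (1 - \<eta>) * Fa \<beta> (hc \<beta> + u))))
       \<and> (B = B_crit \<longrightarrow>
           (\<forall>\<eta>\<in>{0<..<1}. \<exists>\<beta>0>0. \<exists>c>0. \<forall>\<beta>. 0 < \<beta> \<and> \<beta> \<le> \<beta>0 \<longrightarrow>
             (\<forall>u\<in>{c * exp (- c * \<beta> powr (- 2 / 3))<..<1}.
               F \<beta> (hc \<beta> + u) \<ge> (1 - \<eta>) * Fa \<beta> (hc \<beta> + u))))"
proof -
  obtain b where b: "2 < b" "(2 / B)\<^sup>2 < b" "b * \<kappa> < 1"
    using exists_above_max[OF assms(7,9,10)] by blast
  interpret hier_model B \<kappa> b M \<omega>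
    by (intro hier_model.intro hier_model_axioms.intro hier_pinning.intro)
      (assumption | rule assms(4-9) b)+
  have F: "F \<beta> h = fq \<beta> h" if "0 < \<beta>" for \<beta> h unfolding F_def using that by (intro quenched_eq_fq) simp
  have Fa: "Fa \<beta> h = fa \<beta> h" if "0 < \<beta>" for \<beta> h unfolding Fa_def using that by (intro annealed_eq_fa) simp
  have hc: "hc \<beta> = hcrit \<beta>" if "0 < \<beta>" for \<beta> unfolding hc_def using that by (intro critical_eq_hcrit) simp
  show ?thesis
    unfolding B_crit_def
  proof (intro conjI impI ballI, goal_cases)
    case 1
    obtain \<beta>0 where \<beta>0: "0 < \<beta>0" "\<And>\<beta>. 0 < \<beta> \<and> \<beta> \<le> \<beta>0 \<Longrightarrow> \<forall>\<eta>\<in>{0<..<1}. \<exists>\<epsilon>>0. \<forall>u\<in>{0<..<\<epsilon>}.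
        (1 - \<eta>) * fa \<beta> (hcrit \<beta> + u) \<le> fq \<beta> (hcrit \<beta> + u)"
      using irrelevant_regime[OF 1] by (elim exE conjE) (rule that, assumption, elim allE, erule mp)
    show ?case
      by (rule exI[of _ \<beta>0], intro conjI allI impI \<beta>0(1), frule conjunct1)
        (drule \<beta>0(2), simp only: F Fa hc)
  next
    case (2 \<eta>)
    obtain c \<beta>0 \<epsilon> where c: "0 < c" "0 < \<beta>0" "0 < \<epsilon>" "\<And>\<beta>. 0 < \<beta> \<and> \<beta> \<le> \<beta>0 \<Longrightarrow>
        \<forall>u\<in>{c * \<beta> powr (2 / (2 - \<nu> B))<..<\<epsilon>}. (1 - \<eta>) * fa \<beta> (hcrit \<beta> + u) \<le> fq \<beta> (hcrit \<beta> + u)"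
      using relevant_regime[OF 2] by (elim exE conjE) (rule that, assumption, assumption, assumption, elim allE, erule mp)
    show ?case
      by (rule exI[of _ c], intro conjI c(1), rule exI[of _ \<beta>0], intro conjI c(2), rule exI[of _ \<epsilon>],
          intro conjI allI impI c(3), frule conjunct1) (drule c(4), simp only: F Fa hc)
  next
    case (3 \<eta>)
    obtain \<beta>0 c where c: "0 < \<beta>0" "0 < c" "\<And>\<beta>. 0 < \<beta> \<and> \<beta> \<le> \<beta>0 \<Longrightarrow>
        \<forall>u\<in>{c * exp (- c * \<beta> powr (- 2 / 3))<..<1}. (1 - \<eta>) * fa \<beta> (hcrit \<beta> + u) \<le> fq \<beta> (hcrit \<beta> + u)"
      using marginal_regime[OF 3] by (elim exE conjE) (rule that, assumption, assumption, elim allE, erule mp)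
    show ?case
      by (rule exI[of _ \<beta>0], intro conjI c(1), rule exI[of _ c], intro conjI allI impI c(2), frule conjunct1)
        (drule c(3), simp only: F Fa hc)
  qed
qed

end
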